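(* Let $k\ge1$ be an integer and $\beta<\eta<\alpha$. Assume that $F(u)$ is $C^k$ smooth. If $\beta<k\eta<\alpha$ and $$K\,\mathrm{Lip}_uG\,\Big(\frac{1}{i\eta-\beta}+\frac{1}{\alpha-i\eta}\Big)<1\qquad\text{for all }1\le i\le k,$$ then, with $M^s(\omega)=\{u_0\in H\;|\;u(\cdot,\omega,u_0)\in C_\eta^+\}$, $$\tilde M^s(\omega)=T^{-1}(\omega,M^s(\omega)),\qquad\omega\in\Omega,$$ is a $C^k$ invariant stable manifold for the stochastic partial differential equation $$du=Au\,dt+F(u)\,dt+\frac u2\,dt+u\,dW,$$ i.e. for the random dynamical system $\hat u$ generated by it.
   Context: **State space and linear part.** $H$ is an infinite dimensional separable Hilbert space with norm $|\cdot|$. The linear operator $A:D(A)\to H$ generates a strongly continuous semigroup $e^{At}$ on $H$ satisfying an exponential dichotomy with exponents $\alpha>\beta$ and bound $K$: there is a continuous projection $P^+$ on $H$ such that (i) $P^+e^{At}=e^{At}P^+$; (ii) for $t\ge 0$ the restriction $e^{At}|_{R(P^+)}$ is an isomorphism of the range $R(P^+)$ onto itself, and $e^{At}$ for $t<0$ is defined on $R(P^+)$ as the inverse map; (iii) $|e^{At}P^+x|\le Ke^{\alpha t}|x|$ for $t\le 0$ and $|e^{At}P^-x|\le Ke^{\beta t}|x|$ for $t\ge 0$, where $P^-=I-P^+$. Put $H^-=P^-H$ (stable subspace), $H^+=P^+H$ (unstable subspace), so $H=H^+\oplus H^-$. **Nonlinearity.** $F:H\to H$ satisfies $F(0)=0$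 and $|P^\pm(F(x_1)-F(x_2))|\le \mathrm{Lip}F\,|x_1-x_2|$ for all $x_1,x_2\in H$, with Lipschitz constant $\mathrm{Lip}F>0$. **Noise.** Let $C_0(\mathbb R,\mathbb R)$ be the continuous functions $\omega:\mathbb R\to\mathbb R$ with $\omega(0)=0$, with the compact open topology, its Borel $\sigma$-algebra and the (two-sided) Wiener measure $\mathbb P$, and let $\theta_t\omega=\omega(\cdot+t)-\omega(t)$. $\Omega\subset C_0(\mathbb R,\mathbb R)$ is a Borel set of $\mathbb P$-measure one with $\theta_t\Omega=\Omega$ for all $t\in\mathbb R$, such that for $\omega\in\Omega$: $\omega(t)/t\to0$ as $t\to\pm\infty$; $z(\omega)=-\int_{-\infty}^0e^\tau\omega(\tau)\,d\tau$ exists; $t\mapsto z(\theta_t\omega)$ is continuous (it is the stationary solution of $dz+z\,dt=dW$, $W(t)=\omega(t)$); and $|z(\theta_t\omega)|/|t|\to0$, $\frac1t\int_0^tz(\theta_\tau\omega)\,d\tau\to0$ as $t\to\pm\infty$. $\mathcal F$ is the trace on $\Omega$ of the Borel $\sigma$-algebra, and $\mathbb P$ is restricted to $\mathcal F$. **Random PDE.** $G(\omega,u)=e^{-z(\omega)}F(e^{z(\omega)}u)$. For every $\omega$, $G(\omega,\cdot)$ satisfies the same Lipschitz estimate as $F$, and $\mathrm{Lip}_uG$ $(=\mathrm{Lip}F)$ denotes the Lipschitz constant of $G$ with respect to $u$: $|P^\pm(G(\omega,x_1)-G(\omega,x_2))|\le\mathrm{Lip}_uG\,|x_1-x_2|$.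 For each $\omega\in\Omega$ and $u_0\in H$, $u(t,\omega,u_0)$, $t\ge0$, is the unique mild solution of $\frac{du}{dt}=Au+z(\theta_t\omega)u+G(\theta_t\omega,u)$, $u(0)=u_0$, i.e. $$u(t)=e^{At+\int_0^tz(\theta_\tau\omega)d\tau}u_0+\int_0^te^{A(t-s)+\int_s^tz(\theta_r\omega)dr}G(\theta_s\omega,u(s))\,ds.$$ The map $(t,\omega,x)\mapsto u(t,\omega,x)$ is a random dynamical system on $H$ over $\theta$ (measurable, $u(0,\omega,x)=x$, $u(t_1+t_2,\omega,x)=u(t_2,\theta_{t_1}\omega,u(t_1,\omega,x))$). **Stochastic PDE.** The stochastic equation (Ito form; in Stratonovich form $\frac{du}{dt}=Au+F(u)+u\,\dot W$, $W$ the standard real Wiener process $W(t)=\omega(t)$) generates the random dynamical system $$\hat u(t,\omega,x)=T^{-1}(\theta_t\omega,u(t,\omega,T(\omega,x))),\qquad T(\omega,x)=xe^{-z(\omega)},\quad T^{-1}(\omega,x)=xe^{z(\omega)}.$$ **Function space.** For $\beta<\eta<\alpha$ (and given $\omega$), $C_\eta^+$ is the Banach space of continuous $\phi:[0,\infty)\to H$ with $|\phi|_{C_\eta^+}=\sup_{t\ge0}e^{-\eta t-\int_0^tz(\theta_\tau\omega)d\tau}|\phi(t)|<\infty$. **Invariant manifolds.** A random set is a family $M=\{M(\omega)\}_{\omega\in\Omega}$ of nonempty closed subsets of $H$ such that $\omega\mapsto\inf_{y\in M(\omega)}|x-y|$ is a random variable for every $x\in H$. It is invariant for a random dynamical system $\phi$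 if $\phi(t,\omega,M(\omega))\subset M(\theta_t\omega)$ for all $t\ge0$. An invariant random set of the form $M(\omega)=\{\xi+h(\xi,\omega)\,|\,\xi\in H^-\}$ with $h(\cdot,\omega):H^-\to H^+$ of class $C^k$ is called a $C^k$ stable manifold.
   Formalization: When η > 0 and k ≥ 2, the derivatives of F of orders 2 to k are additionally assumed to be bounded on H; with F merely C^k the claim is false, since M^s can fail to be C^2. For η ≤ 0 or k = 1 nothing is added. *)

theory Defs
  imports "HOL-Probability.Probability"
begin

section \<open>Semigroups and exponential dichotomies\<close>

definition C0_semigroup :: "(real \<Rightarrow> 'h::real_normed_vector \<Rightarrow> 'h) \<Rightarrow> bool" where
  "C0_semigroup S \<longleftrightarrow>
     (\<forall>t\<ge>0. bounded_linear (S t)) \<and>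
     (\<forall>x. S 0 x = x) \<and>
     (\<forall>s\<ge>0. \<forall>t\<ge>0. \<forall>x. S (s + t) x = S s (S t x)) \<and>
     (\<forall>x. ((\<lambda>t. S t x) \<longlongrightarrow> x) (at_right 0))"

text \<open>An unbounded operator is given by its domain \<open>DA\<close> and a function \<open>A\<close>, whose values
  outside \<open>DA\<close> are irrelevant.  Only the values \<open>S t\<close> for \<open>t \<ge> 0\<close> are constrained.\<close>

definition generates_semigroup ::
  "'h::real_normed_vector set \<Rightarrow> ('h \<Rightarrow> 'h) \<Rightarrow> (real \<Rightarrow> 'h \<Rightarrow> 'h) \<Rightarrow> bool" where
  "generates_semigroup DA A S \<longleftrightarrow>
     C0_semigroup S \<and>
     DA = {x. \<exists>y. ((\<lambda>t. (1 / t) *\<^sub>R (S t x - x)) \<longlongrightarrow> y) (at_right 0)} \<and>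
     (\<forall>x\<in>DA. ((\<lambda>t. (1 / t) *\<^sub>R (S t x - x)) \<longlongrightarrow> A x) (at_right 0))"

definition minus_proj :: "('h::ab_group_add \<Rightarrow> 'h) \<Rightarrow> 'h \<Rightarrow> 'h" where
  "minus_proj Pp x = x - Pp x"

text \<open>The flow on the unstable subspace: for \<open>t < 0\<close> it is the inverse of the
  restriction of \<open>S (- t)\<close> to \<open>range Pp\<close>.\<close>

definition unstable_flow :: "(real \<Rightarrow> 'h \<Rightarrow> 'h) \<Rightarrow> ('h \<Rightarrow> 'h) \<Rightarrow> real \<Rightarrow> 'h \<Rightarrow> 'h" where
  "unstable_flow S Pp t = (if 0 \<le> t then S t else inv_into (range Pp) (S (- t)))"

text \<open>Boundedness of the inverse of \<open>S t\<close> on \<open>range Pp\<close> is part of the first estimate.\<close>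

definition exponential_dichotomy ::
  "(real \<Rightarrow> 'h::real_normed_vector \<Rightarrow> 'h) \<Rightarrow> ('h \<Rightarrow> 'h) \<Rightarrow> real \<Rightarrow> real \<Rightarrow> real \<Rightarrow> bool" where
  "exponential_dichotomy S Pp \<alpha> \<beta> K \<longleftrightarrow>
     \<beta> < \<alpha> \<and>
     bounded_linear Pp \<and> (\<forall>x. Pp (Pp x) = Pp x) \<and>
     (\<forall>t\<ge>0. \<forall>x. Pp (S t x) = S t (Pp x)) \<and>
     (\<forall>t\<ge>0. bij_betw (S t) (range Pp) (range Pp)) \<and>
     (\<forall>t\<le>0. \<forall>x. norm (unstable_flow S Pp t (Pp x)) \<le> K * exp (\<alpha> * t) * norm x) \<and>
     (\<forall>t\<ge>0. \<forall>x. norm (S t (minus_proj Pp x)) \<le> K * exp (\<beta> * t) * norm x)"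


section \<open>Smoothness of class \<open>C\<^sup>k\<close> in the Frechet sense\<close>

text \<open>The \<open>j\<close>-th Frechet derivative of a map on the normed space \<open>V\<close> (a linear subspace of the
  ambient type) is represented, through the identification of iterated spaces of
  bounded linear maps with bounded multilinear maps, by a function of lists of length \<open>j\<close> of
  elements of \<open>V\<close>.  Continuity and differentiability of derivatives refer to the norm of bounded
  multilinear maps, i.e. they are uniform in the list of directions.\<close>

definition bounded_multilinear_on ::
  "'a::real_normed_vector set \<Rightarrow> nat \<Rightarrow> ('a list \<Rightarrow> 'b::real_normed_vector) \<Rightarrow> bool" where
  "bounded_multilinear_on V j m \<longleftrightarrow>
     (\<forall>vs. length vs = j \<and> set vs \<subseteq> V \<longrightarrow>
        (\<forall>i<j. \<forall>v\<in>V. \<forall>w\<in>V. \<forall>c.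
           m (vs[i := v + w]) = m (vs[i := v]) + m (vs[i := w]) \<and>
           m (vs[i := c *\<^sub>R v]) = c *\<^sub>R m (vs[i := v]))) \<and>
     (\<exists>C. \<forall>vs. length vs = j \<and> set vs \<subseteq> V \<longrightarrow> norm (m vs) \<le> C * prod_list (map norm vs))"

definition frechet_derivs_upto ::
  "nat \<Rightarrow> 'a::real_normed_vector set \<Rightarrow> ('a \<Rightarrow> 'b::real_normed_vector) \<Rightarrow>
     (nat \<Rightarrow> 'a \<Rightarrow> 'a list \<Rightarrow> 'b) \<Rightarrow> bool" where
  "frechet_derivs_upto k V f D \<longleftrightarrow>
     (\<forall>x\<in>V. D 0 x [] = f x) \<and>
     (\<forall>j\<le>k. \<forall>x\<in>V. bounded_multilinear_on V j (D j x)) \<and>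
     (\<forall>j<k. \<forall>x\<in>V. \<forall>e>0. \<exists>d>0. \<forall>y\<in>V. dist y x < d \<longrightarrow>
        (\<forall>vs. length vs = j \<and> set vs \<subseteq> V \<longrightarrow>
           norm (D j y vs - D j x vs - D (Suc j) x ((y - x) # vs))
             \<le> e * norm (y - x) * prod_list (map norm vs))) \<and>
     (\<forall>j\<le>k. \<forall>x\<in>V. \<forall>e>0. \<exists>d>0. \<forall>y\<in>V. dist y x < d \<longrightarrow>
        (\<forall>vs. length vs = j \<and> set vs \<subseteq> V \<longrightarrow>
           norm (D j y vs - D j x vs) \<le> e * prod_list (map norm vs)))"

definition Ck_on :: "nat \<Rightarrow> 'a::real_normed_vector set \<Rightarrow> ('a \<Rightarrow> 'b::real_normed_vector) \<Rightarrow> bool" where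
  "Ck_on k V f \<longleftrightarrow> (\<exists>D. frechet_derivs_upto k V f D)"

text \<open>The derivatives of a \<open>C\<^sup>k\<close> map are unique, so the quantifier over \<open>D\<close> is harmless.
  Order 1 is left out because a globally Lipschitz map has a bounded first derivative.
  Bounds of order at least 2 are what lets the Nemytskii operator of \<open>f\<close> act between
  exponentially weighted spaces of growing functions (\<open>\<eta> > 0\<close>); for decaying functions local
  boundedness near 0 suffices.\<close>

definition bounded_higher_derivs ::
  "nat \<Rightarrow> ('a::real_normed_vector \<Rightarrow> 'b::real_normed_vector) \<Rightarrow> bool" where
  "bounded_higher_derivs k f \<longleftrightarrow>
     (\<forall>D. frechet_derivs_upto k UNIV f D \<longrightarrow>
        (\<forall>j\<in>{2..k}. \<exists>C. \<forall>x vs. length vs = j \<longrightarrow>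
            norm (D j x vs) \<le> C * prod_list (map norm vs)))"


section \<open>The noise\<close>

definition C0_paths :: "(real \<Rightarrow> real) set" where
  "C0_paths = {\<omega>. continuous_on UNIV \<omega> \<and> \<omega> 0 = 0}"

definition compact_open_topology :: "(real \<Rightarrow> real) topology" where
  "compact_open_topology =
     topology_generated_by {{\<omega>\<in>C0_paths. \<omega> ` C \<subseteq> U} | C U. compact C \<and> open U}"

definition C0_borel :: "(real \<Rightarrow> real) measure" where
  "C0_borel = sigma C0_paths {U. openin compact_open_topology U}"

text \<open>Two-sided Wiener measure, characterised by independent increments over the whole real
  line with \<open>\<omega> t - \<omega> s\<close> centred Gaussian of variance \<open>t - s\<close>; recall \<open>\<omega> 0 = 0\<close> on \<open>C0_paths\<close>.\<close>

definition wiener_measure :: "(real \<Rightarrow> real) measure \<Rightarrow> bool" where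
  "wiener_measure W \<longleftrightarrow>
     prob_space W \<and> space W = C0_paths \<and> sets W = sets C0_borel \<and>
     (\<forall>s t. s < t \<longrightarrow>
        distributed W lborel (\<lambda>\<omega>. \<omega> t - \<omega> s) (\<lambda>x. ennreal (normal_density 0 (sqrt (t - s)) x))) \<and>
     (\<forall>(n::nat) \<tau>. strict_mono_on {..n} \<tau> \<longrightarrow>
        prob_space.indep_vars W (\<lambda>_. borel) (\<lambda>i \<omega>. \<omega> (\<tau> (Suc i)) - \<omega> (\<tau> i)) {..<n})"

definition wshift :: "real \<Rightarrow> (real \<Rightarrow> real) \<Rightarrow> (real \<Rightarrow> real)" where
  "wshift t \<omega> = (\<lambda>s. \<omega> (s + t) - \<omega> t)"

definition ou :: "(real \<Rightarrow> real) \<Rightarrow> real" where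
  "ou \<omega> = - (LBINT \<tau>:{..0}. exp \<tau> * \<omega> \<tau>)"

definition int_ou :: "(real \<Rightarrow> real) \<Rightarrow> real \<Rightarrow> real \<Rightarrow> real" where
  "int_ou \<omega> s t = (LBINT \<tau>=ereal s..ereal t. ou (wshift \<tau> \<omega>))"

definition noise_set :: "(real \<Rightarrow> real) measure \<Rightarrow> (real \<Rightarrow> real) set \<Rightarrow> bool" where
  "noise_set W Om \<longleftrightarrow>
     Om \<in> sets W \<and> emeasure W Om = 1 \<and> (\<forall>t. wshift t ` Om = Om) \<and>
     (\<forall>\<omega>\<in>Om.
        ((\<lambda>t. \<omega> t / t) \<longlongrightarrow> 0) at_top \<and> ((\<lambda>t. \<omega> t / t) \<longlongrightarrow> 0) at_bot \<and>
        set_integrable lborel {..0} (\<lambda>\<tau>. exp \<tau> * \<omega> \<tau>) \<and>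
        continuous_on UNIV (\<lambda>t. ou (wshift t \<omega>)) \<and>
        ((\<lambda>t. \<bar>ou (wshift t \<omega>)\<bar> / \<bar>t\<bar>) \<longlongrightarrow> 0) at_top \<and>
        ((\<lambda>t. \<bar>ou (wshift t \<omega>)\<bar> / \<bar>t\<bar>) \<longlongrightarrow> 0) at_bot \<and>
        ((\<lambda>t. (1 / t) * int_ou \<omega> 0 t) \<longlongrightarrow> 0) at_top \<and>
        ((\<lambda>t. (1 / t) * int_ou \<omega> 0 t) \<longlongrightarrow> 0) at_bot)"


section \<open>The random and the stochastic evolution equation\<close>

definition rand_nonlin :: "('h::real_vector \<Rightarrow> 'h) \<Rightarrow> (real \<Rightarrow> real) \<Rightarrow> 'h \<Rightarrow> 'h" where
  "rand_nonlin F \<omega> x = exp (- ou \<omega>) *\<^sub>R F (exp (ou \<omega>) *\<^sub>R x)"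

definition mild_solution ::
  "(real \<Rightarrow> 'h::{real_inner,banach,second_countable_topology} \<Rightarrow> 'h) \<Rightarrow> ('h \<Rightarrow> 'h) \<Rightarrow>
     (real \<Rightarrow> real) \<Rightarrow> 'h \<Rightarrow> (real \<Rightarrow> 'h) \<Rightarrow> bool" where
  "mild_solution S F \<omega> u0 v \<longleftrightarrow>
     continuous_on {0..} v \<and>
     (\<forall>t\<ge>0. v t = exp (int_ou \<omega> 0 t) *\<^sub>R S t u0 +
        (LBINT s=ereal 0..ereal t.
           exp (int_ou \<omega> s t) *\<^sub>R S (t - s) (rand_nonlin F (wshift s \<omega>) (v s))))"

text \<open>Random dynamical systems over the shift; only times \<open>t \<ge> 0\<close> and paths in \<open>Om\<close> matter.\<close>

definition random_dynamical_system ::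
  "(real \<Rightarrow> real) measure \<Rightarrow> (real \<Rightarrow> real) set \<Rightarrow>
     (real \<Rightarrow> (real \<Rightarrow> real) \<Rightarrow> 'h::real_normed_vector \<Rightarrow> 'h) \<Rightarrow> bool" where
  "random_dynamical_system W Om \<phi> \<longleftrightarrow>
     (\<lambda>(t, \<omega>, x). \<phi> t \<omega> x) \<in>
        (restrict_space borel {0..} \<Otimes>\<^sub>M (restrict_space W Om \<Otimes>\<^sub>M borel)) \<rightarrow>\<^sub>M borel \<and>
     (\<forall>\<omega>\<in>Om. \<forall>x. \<phi> 0 \<omega> x = x) \<and>
     (\<forall>t1\<ge>0. \<forall>t2\<ge>0. \<forall>\<omega>\<in>Om. \<forall>x. \<phi> (t1 + t2) \<omega> x = \<phi> t2 (wshift t1 \<omega>) (\<phi> t1 \<omega> x))"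

definition Ttrans :: "(real \<Rightarrow> real) \<Rightarrow> 'h::real_vector \<Rightarrow> 'h" where
  "Ttrans \<omega> x = exp (- ou \<omega>) *\<^sub>R x"

definition Ttrans_inv :: "(real \<Rightarrow> real) \<Rightarrow> 'h::real_vector \<Rightarrow> 'h" where
  "Ttrans_inv \<omega> x = exp (ou \<omega>) *\<^sub>R x"

definition spde_rds ::
  "(real \<Rightarrow> (real \<Rightarrow> real) \<Rightarrow> 'h::real_vector \<Rightarrow> 'h) \<Rightarrow> real \<Rightarrow> (real \<Rightarrow> real) \<Rightarrow> 'h \<Rightarrow> 'h" where
  "spde_rds u t \<omega> x = Ttrans_inv (wshift t \<omega>) (u t \<omega> (Ttrans \<omega> x))"


section \<open>Stable manifolds\<close>

definition C_eta_plus ::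
  "real \<Rightarrow> (real \<Rightarrow> real) \<Rightarrow> (real \<Rightarrow> 'h::real_normed_vector) set" where
  "C_eta_plus \<eta> \<omega> =
     {\<phi>. continuous_on {0..} \<phi> \<and>
         bdd_above ((\<lambda>t. exp (- \<eta> * t - int_ou \<omega> 0 t) * norm (\<phi> t)) ` {0..})}"

definition Ms ::
  "real \<Rightarrow> (real \<Rightarrow> (real \<Rightarrow> real) \<Rightarrow> 'h::real_normed_vector \<Rightarrow> 'h) \<Rightarrow> (real \<Rightarrow> real) \<Rightarrow> 'h set" where
  "Ms \<eta> u \<omega> = {u0. (\<lambda>t. u t \<omega> u0) \<in> C_eta_plus \<eta> \<omega>}"

definition random_set ::
  "(real \<Rightarrow> real) measure \<Rightarrow> (real \<Rightarrow> real) set \<Rightarrow>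
     ((real \<Rightarrow> real) \<Rightarrow> 'h::real_normed_vector set) \<Rightarrow> bool" where
  "random_set W Om M \<longleftrightarrow>
     (\<forall>\<omega>\<in>Om. M \<omega> \<noteq> {} \<and> closed (M \<omega>)) \<and>
     (\<forall>x. (\<lambda>\<omega>. infdist x (M \<omega>)) \<in> borel_measurable (restrict_space W Om))"

definition invariant_random_set ::
  "(real \<Rightarrow> real) measure \<Rightarrow> (real \<Rightarrow> real) set \<Rightarrow>
     (real \<Rightarrow> (real \<Rightarrow> real) \<Rightarrow> 'h::real_normed_vector \<Rightarrow> 'h) \<Rightarrow>
     ((real \<Rightarrow> real) \<Rightarrow> 'h set) \<Rightarrow> bool" where
  "invariant_random_set W Om \<phi> M \<longleftrightarrow>
     random_dynamical_system W Om \<phi> \<and> random_set W Om M \<and>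
     (\<forall>\<omega>\<in>Om. \<forall>t\<ge>0. \<phi> t \<omega> ` M \<omega> \<subseteq> M (wshift t \<omega>))"

definition Ck_stable_manifold ::
  "nat \<Rightarrow> (real \<Rightarrow> real) measure \<Rightarrow> (real \<Rightarrow> real) set \<Rightarrow> ('h::real_normed_vector \<Rightarrow> 'h) \<Rightarrow>
     (real \<Rightarrow> (real \<Rightarrow> real) \<Rightarrow> 'h \<Rightarrow> 'h) \<Rightarrow> ((real \<Rightarrow> real) \<Rightarrow> 'h set) \<Rightarrow> bool" where
  "Ck_stable_manifold k W Om Pp \<phi> M \<longleftrightarrow>
     invariant_random_set W Om \<phi> M \<and>
     (\<exists>h :: 'h \<Rightarrow> (real \<Rightarrow> real) \<Rightarrow> 'h. \<forall>\<omega>\<in>Om.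
        (\<forall>\<xi>\<in>range (minus_proj Pp). h \<xi> \<omega> \<in> range Pp) \<and>
        Ck_on k (range (minus_proj Pp)) (\<lambda>\<xi>. h \<xi> \<omega>) \<and>
        M \<omega> = {\<xi> + h \<xi> \<omega> | \<xi>. \<xi> \<in> range (minus_proj Pp)})"

end

theory Submission
  imports Defs
begin

text \<open>
  Put \<open>c(t) = exp (\<integral>\<^sub>0\<^sup>t z(\<theta>\<^sub>\<tau>\<omega>) d\<tau> + z(\<theta>\<^sub>t\<omega>) - z(\<omega>))\<close>.  A trajectory of the stochastic equation is \<open>c(t) v(t)\<close>,
  where \<open>v\<close> is a mild solution of the deterministic equation with linear part \<open>A\<close> and nonlinearity
  \<open>F(c v) / c\<close>; the factor \<open>c\<close> grows subexponentially.  A mild solution is bounded by a multiple of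
  \<open>e\<^sup>\<eta>\<^sup>t\<close> iff it solves the Lyapunov--Perron equation
  \<open>v(t) = e\<^sup>A\<^sup>t \<xi> + \<integral>\<^sub>0\<^sup>t e\<^sup>A\<^sup>(\<^sup>t\<^sup>-\<^sup>s\<^sup>) P\<^sup>- g(s, v) ds - \<integral>\<^sub>t\<^sup>\<infinity> e\<^sup>A\<^sup>(\<^sup>t\<^sup>-\<^sup>s\<^sup>) P\<^sup>+ g(s, v) ds\<close>, which is a contraction under
  the gap condition, so the stable set is the graph of \<open>\<xi> \<mapsto> P\<^sup>+ v\<^sub>\<xi>(0)\<close>.

  Smoothness comes from a single estimate: a solution of \<open>w = r + LP f\<close> with \<open>|P\<^sup>\<plusminus> f| \<le> L |w| + \<rho> e\<^sup>\<gamma>\<^sup>t\<close> is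
  bounded in the weight \<open>\<gamma>\<close> by \<open>r\<close> and \<open>\<rho>\<close>.  The formal derivatives of \<open>\<xi> \<mapsto> v\<^sub>\<xi>\<close> solve linear
  Lyapunov--Perron equations whose inhomogeneity is a sum over set partitions of the directions; their
  differences and Taylor remainders solve equations of the same kind with a small inhomogeneity.
  The composition with \<open>F\<close> is differentiable only if the weight of the target is enlarged a little, and
  the strict gap condition leaves room for this.

  Measurability in \<open>\<omega>\<close> passes from the Picard iterates to \<open>v\<^sub>\<xi>\<close>, and the distance to the graph is an
  infimum over countably many \<open>\<xi>\<close>.
\<close>


subsection \<open>The dichotomy and the Lyapunov--Perron operator\<close>

text \<open>The derivatives of \<open>F\<close> are only continuous: along two nearby trajectories
  they agree up to a small error on a compact time interval and are merely bounded afterwards. A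
  factor \<open>exp (\<tau> * s)\<close> with \<tau> > 0 absorbs the bounded tail. This is the loss
  of weight, and it is why there are two families of weights: the formal derivatives live in the
  weights \<open>p j\<close>, their differences and Taylor remainders in the larger weights
  \<open>q j\<close>. Every remainder is controlled by remainders of shorter lists in the same
  family \<open>q\<close>, so the loss occurs once and does not accumulate with the order. A product
  over the blocks of a partition adds up weights, and the scaling of \<open>F\<close> contributes
  the power \<open>c s ^ (m - 1)\<close>; the superadditivity
  \<open>q i + q j + \<sigma> \<le> q (i + j)\<close> pays for both. The bounded tail needs bounds
  on the derivatives for all times: for \<eta> > 0 they are assumed, while for \<eta> \<le> 0 a
  weight below 0 makes the trajectories decay to 0, near which the derivatives are bounded by
  continuity.\<close>

locale dichotomy =
  fixes S :: "real \<Rightarrow> 'h::{banach,second_countable_topology} \<Rightarrow> 'h"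
    and Pp :: "'h \<Rightarrow> 'h" and \<alpha> \<beta> K :: real
  assumes semigroup: "C0_semigroup S"
    and dich: "exponential_dichotomy S Pp \<alpha> \<beta> K"
    and K_nonneg: "0 \<le> K"
begin

abbreviation Q :: "'h \<Rightarrow> 'h" where "Q \<equiv> minus_proj Pp"

text \<open>The group on the unstable subspace, precomposed with the projection. It is total in the
  time and in the vector, so the group law \<open>E_E\<close> needs no side conditions.\<close>

definition E :: "real \<Rightarrow> 'h \<Rightarrow> 'h" where
  "E t x = unstable_flow S Pp t (Pp x)"

lemma S_bl: "0 \<le> t \<Longrightarrow> bounded_linear (S t)"
  and S_0 [simp]: "S 0 x = x"
  and S_add: "0 \<le> s \<Longrightarrow> 0 \<le> t \<Longrightarrow> S (s + t) x = S s (S t x)"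
  and S_cont0: "((\<lambda>t. S t x) \<longlongrightarrow> x) (at_right 0)"
  using semigroup by (auto simp: C0_semigroup_def)

lemma Pp_bl: "bounded_linear Pp"
  and Pp_Pp [simp]: "Pp (Pp x) = Pp x"
  and Pp_S: "0 \<le> t \<Longrightarrow> Pp (S t x) = S t (Pp x)"
  and S_bij: "0 \<le> t \<Longrightarrow> bij_betw (S t) (range Pp) (range Pp)"
  and E_bound: "t \<le> 0 \<Longrightarrow> norm (E t x) \<le> K * exp (\<alpha> * t) * norm x"
  and SQ_bound: "0 \<le> t \<Longrightarrow> norm (S t (Q x)) \<le> K * exp (\<beta> * t) * norm x"
  using dich by (auto simp: exponential_dichotomy_def E_def)

lemma Q_bl: "bounded_linear Q"
  unfolding minus_proj_def[abs_def] by (intro bounded_linear_sub bounded_linear_ident Pp_bl)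

lemma Pp_plus_Q: "Pp x + Q x = x"
  by (simp add: minus_proj_def)

lemma Pp_Q [simp]: "Pp (Q x) = 0" and Q_Pp [simp]: "Q (Pp x) = 0" and Q_Q [simp]: "Q (Q x) = Q x"
  by (simp_all add: minus_proj_def linear_diff[OF bounded_linear.linear[OF Pp_bl]])

lemma Q_S: "0 \<le> t \<Longrightarrow> Q (S t x) = S t (Q x)"
  by (simp add: minus_proj_def linear_diff[OF bounded_linear.linear[OF S_bl]] Pp_S)

lemma in_range_Pp: "x \<in> range Pp \<longleftrightarrow> Pp x = x"
  by (metis Pp_Pp rangeE rangeI)

lemma in_range_Q: "x \<in> range Q \<longleftrightarrow> Q x = x"
  by (metis Q_Q rangeE rangeI)

lemma E_nonneg: "0 \<le> t \<Longrightarrow> E t x = S t (Pp x)"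
  by (simp add: E_def unstable_flow_def)

lemma E_neg: "t \<le> 0 \<Longrightarrow> S (- t) (E t x) = Pp x \<and> Pp (E t x) = E t x"
proof (cases "t = 0")
  case False
  assume t: "t \<le> 0"
  with False have *: "E t x = inv_into (range Pp) (S (- t)) (Pp x)"
    by (simp add: E_def unstable_flow_def)
  have "Pp x \<in> S (- t) ` range Pp"
    using S_bij[of "- t"] t by (simp add: bij_betw_def)
  then show ?thesis unfolding *
    using inv_into_into[of "Pp x" "S (- t)" "range Pp"] by (simp add: f_inv_into_f in_range_Pp)
qed (simp add: E_nonneg)

lemma Pp_E [simp]: "Pp (E t x) = E t x"
  by (cases "0 \<le> t") (auto simp: E_nonneg Pp_S E_neg)

lemma Q_E [simp]: "Q (E t x) = 0"
  by (simp add: minus_proj_def)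

lemma E_Pp [simp]: "E t (Pp x) = E t x"
  by (simp add: E_def)

lemma E_Q [simp]: "E t (Q x) = E t 0"
  by (metis E_Pp Pp_Q bounded_linear.linear linear_0 Pp_bl)

text \<open>For negative times \<open>E\<close> is only known as an inverse. Identities there are
  proved by applying \<open>S\<close> to both sides and cancelling it on the unstable
  subspace.\<close>

lemma S_inj: "0 \<le> t \<Longrightarrow> S t x = S t y \<Longrightarrow> Pp x = x \<Longrightarrow> Pp y = y \<Longrightarrow> x = y"
  using S_bij[of t] by (metis bij_betw_def inj_onD in_range_Pp)

lemma E_0 [simp]: "E 0 x = Pp x"
  by (simp add: E_nonneg)

lemma S_E: assumes "0 \<le> s" shows "S s (E t x) = E (s + t) x"
proof -
  consider "0 \<le> t" | "t \<le> 0" "0 \<le> s + t" | "t \<le> 0" "s + t \<le> 0" by linarith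
  then show ?thesis
  proof cases
    case 1 then show ?thesis using assms by (simp add: E_nonneg S_add)
  next
    case 2
    have "S s (E t x) = S (s + t) (S (- t) (E t x))"
      using 2 S_add[of "s + t" "- t" "E t x"] by simp
    then show ?thesis using 2 E_neg[of t x] by (simp add: E_nonneg)
  next
    case 3
    have "S (- (s + t)) (S s (E t x)) = S (- t) (E t x)"
      using 3 assms S_add[of "- (s + t)" s "E t x"] by simp
    also have "\<dots> = S (- (s + t)) (E (s + t) x)"
      using 3 E_neg[of t x] E_neg[of "s + t" x] by simp
    finally have *: "S (- (s + t)) (S s (E t x)) = S (- (s + t)) (E (s + t) x)" .
    show ?thesis
      by (rule S_inj[OF _ *]) (use 3 assms in \<open>auto simp: Pp_S\<close>)
  qed
qed

lemma E_E: "E s (E t x) = E (s + t) x"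
proof (cases "0 \<le> s")
  case True then show ?thesis by (simp add: E_nonneg[of s] S_E)
next
  case False
  then have *: "S (- s) (E s (E t x)) = S (- s) (E (s + t) x)"
    using E_neg[of s "E t x"] S_E[of "- s" "s + t" x] by simp
  show ?thesis by (rule S_inj[OF _ *]) (use False in auto)
qed

lemma E_S: assumes "0 \<le> s" shows "E t (S s x) = E (s + t) x"
  by (metis E_E E_Pp E_nonneg Pp_S add.commute assms)

lemma E_bl: "bounded_linear (E t)"
proof (cases "0 \<le> t")
  case True
  then have "E t = (\<lambda>x. S t (Pp x))" by (auto simp: E_nonneg)
  then show ?thesis using bounded_linear_compose[OF S_bl Pp_bl, of t] True by simp
next
  case False
  then have t: "t \<le> 0" "0 \<le> - t" by auto
  note lS = bounded_linear.linear[OF S_bl[OF t(2)]] and lP = bounded_linear.linear[OF Pp_bl]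
  show ?thesis
  proof (rule bounded_linear_intro[where K = "K * exp (\<alpha> * t)"])
    fix x y r
    show "E t (x + y) = E t x + E t y"
      by (rule S_inj[OF t(2)]) (use t in \<open>auto simp: linear_add[OF lS] linear_add[OF lP] E_neg\<close>)
    show "E t (r *\<^sub>R x) = r *\<^sub>R E t x"
      by (rule S_inj[OF t(2)]) (use t in \<open>auto simp: linear_cmul[OF lS] linear_cmul[OF lP] E_neg\<close>)
    show "norm (E t x) \<le> norm x * (K * exp (\<alpha> * t))"
      using E_bound[OF t(1), of x] by (simp add: mult_ac)
  qed
qed

lemmas E_linear = bounded_linear.linear[OF E_bl]
lemmas Pp_linear = bounded_linear.linear[OF Pp_bl]
lemmas Q_linear = bounded_linear.linear[OF Q_bl]
lemmas S_linear = bounded_linear.linear[OF S_bl]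

lemma E_zero [simp]: "E t 0 = 0" and Pp_zero [simp]: "Pp 0 = 0" and Q_zero [simp]: "Q 0 = 0"
  by (simp_all add: linear_0 E_linear Pp_linear Q_linear)

lemma S_zero [simp]: "0 \<le> t \<Longrightarrow> S t 0 = 0"
  by (simp add: linear_0 S_linear)

text \<open>The absolute value turns one-sided strong continuity at 0 into a two-sided limit, so
  that differences of \<open>SQ\<close> and of \<open>E\<close> can be estimated symmetrically in
  the two times.\<close>

lemma S_abs_tendsto: "((\<lambda>s. S \<bar>s - t\<bar> x) \<longlongrightarrow> x) (at t within A)"
proof -
  have "((\<lambda>h. S \<bar>h\<bar> x) \<longlongrightarrow> x) (at 0)"
  proof (rule filterlim_split_at)
    have "((\<lambda>h. S (- h) x) \<longlongrightarrow> x) (at_left 0)"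
      using S_cont0[of x] unfolding filterlim_at_left_to_right by simp
    then show "((\<lambda>h. S \<bar>h\<bar> x) \<longlongrightarrow> x) (at_left 0)"
      by (rule Lim_transform_eventually) (auto simp: eventually_at_filter)
    show "((\<lambda>h. S \<bar>h\<bar> x) \<longlongrightarrow> x) (at_right 0)"
      using S_cont0[of x] by (rule Lim_transform_eventually) (auto simp: eventually_at_filter)
  qed
  then have "((\<lambda>s. S \<bar>s - t\<bar> x) \<longlongrightarrow> x) (at t)"
    using LIM_offset_zero_iff[of t "\<lambda>s. S \<bar>s - t\<bar> x" x] by simp
  then show ?thesis by (rule tendsto_within_subset) simp
qed

text \<open>The time is cut off at 0 to obtain a map that is jointly continuous on the whole line;
  measurability of the Green kernel rests on this.\<close>

definition SQ :: "real \<Rightarrow> 'h \<Rightarrow> 'h" where "SQ t x = S (max 0 t) (Q x)"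

lemma SQ_bl: "bounded_linear (SQ t)"
  unfolding SQ_def[abs_def] by (rule bounded_linear_compose[OF S_bl Q_bl]) simp

lemma SQ_le: "norm (SQ t x) \<le> K * exp (\<beta> * max 0 t) * norm x"
  by (simp add: SQ_def SQ_bound)

lemma SQ_Q [simp]: "SQ t (Q x) = SQ t x" by (simp add: SQ_def)

text \<open>The semigroup law pulls out the factor at the smaller time; what remains is the
  increment of \<open>S\<close> over the distance of the two times.\<close>

lemma SQ_diff_le:
  "norm (SQ s x - SQ t x) \<le> K * exp (\<beta> * max 0 (min s t)) * norm (S \<bar>max 0 s - max 0 t\<bar> x - x)"
proof -
  have *: "norm (SQ s x - SQ t x) \<le> K * exp (\<beta> * max 0 (min s t)) * norm (S \<bar>max 0 s - max 0 t\<bar> x - x)"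
    if "t \<le> s" for s t
  proof -
    define r where "r = max 0 s - max 0 t"
    have r: "0 \<le> r" "max 0 s = max 0 t + r" using that by (auto simp: r_def)
    have "SQ s x - SQ t x = SQ t (S r x - x)"
      using r(1) unfolding SQ_def r(2) by (simp add: S_add Q_S linear_diff[OF Q_linear] linear_diff[OF S_linear])
    moreover have "min s t = t" "\<bar>max 0 s - max 0 t\<bar> = r" using that r by auto
    ultimately show ?thesis using SQ_le[of t "S r x - x"] by simp
  qed
  show ?thesis
  proof (cases "t \<le> s")
    case True then show ?thesis by (rule *)
  next
    case False
    then show ?thesis using *[of s t] by (simp add: norm_minus_commute abs_minus_commute min.commute)
  qed
qed

text \<open>The dichotomy bounds \<open>E\<close> at nonpositive times only. Hence both times are
  referred to a later time \<open>T\<close>, and \<open>E\<close> at a nonpositive time acts on an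
  increment of the forward orbit of \<open>E T x\<close>.\<close>

lemma E_diff_le:
  assumes "s \<le> T" "t \<le> T"
  shows "norm (E s x - E t x) \<le> K * exp (\<alpha> * (min s t - T)) * norm (S \<bar>s - t\<bar> (E T x) - E T x)"
proof -
  have *: "norm (E s x - E t x) \<le> K * exp (\<alpha> * (min s t - T)) * norm (S \<bar>s - t\<bar> (E T x) - E T x)"
    if "t \<le> s" "s \<le> T" for s t
  proof -
    have "E s x - E t x = E (t - T) (S (s - t) (E T x) - E T x)"
      using that by (simp add: linear_diff[OF E_linear] E_S E_E S_E)
    then show ?thesis using E_bound[of "t - T" "S (s - t) (E T x) - E T x"] that
      by (simp add: min_absorb2)
  qed
  show ?thesis
  proof (cases "t \<le> s")
    case True then show ?thesis using * assms by auto
  next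
    case False
    then show ?thesis using *[of s t] assms by (simp add: norm_minus_commute abs_minus_commute min.commute)
  qed
qed

lemma SQ_cont: "continuous_on UNIV (\<lambda>t. SQ t x)"
proof (clarsimp simp: continuous_on_def)
  fix t :: real
  have "((\<lambda>s. max 0 s) \<longlongrightarrow> max 0 t) (at t)" by (rule tendsto_max[OF tendsto_const tendsto_ident_at])
  then have "((\<lambda>s. S \<bar>max 0 s - max 0 t\<bar> x) \<longlongrightarrow> x) (at t)"
  proof -
    have "isCont (\<lambda>r. S \<bar>r - max 0 t\<bar> x) (max 0 t)"
      using S_abs_tendsto[of "max 0 t" x UNIV] by (simp add: isCont_def)
    from isCont_tendsto_compose[OF this \<open>((\<lambda>s. max 0 s) \<longlongrightarrow> max 0 t) (at t)\<close>]
    show ?thesis by simp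
  qed
  then have "((\<lambda>s. K * exp (\<beta> * max 0 (min s t)) * norm (S \<bar>max 0 s - max 0 t\<bar> x - x)) \<longlongrightarrow>
      K * exp (\<beta> * max 0 (min t t)) * norm (x - x)) (at t)"
    by (intro tendsto_intros tendsto_max tendsto_min)
  then have *: "((\<lambda>s. K * exp (\<beta> * max 0 (min s t)) * norm (S \<bar>max 0 s - max 0 t\<bar> x - x)) \<longlongrightarrow> 0) (at t)"
    by simp
  have "((\<lambda>s. SQ s x - SQ t x) \<longlongrightarrow> 0) (at t)"
    by (rule Lim_null_comparison[OF always_eventually[OF allI[OF SQ_diff_le]] *])
  then show "((\<lambda>s. SQ s x) \<longlongrightarrow> SQ t x) (at t)"
    by (rule LIM_zero_cancel)
qed

lemma E_cont: "continuous_on UNIV (\<lambda>t. E t x)"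
proof (clarsimp simp: continuous_on_def)
  fix t :: real
  have "((\<lambda>s. K * exp (\<alpha> * (min s t - (t + 1))) * norm (S \<bar>s - t\<bar> (E (t + 1) x) - E (t + 1) x)) \<longlongrightarrow>
      K * exp (\<alpha> * (min t t - (t + 1))) * norm (E (t + 1) x - E (t + 1) x)) (at t)"
    by (intro tendsto_intros tendsto_min S_abs_tendsto)
  moreover have "\<forall>\<^sub>F s in at t. norm (E s x - E t x) \<le> K * exp (\<alpha> * (min s t - (t + 1))) * norm (S \<bar>s - t\<bar> (E (t + 1) x) - E (t + 1) x)"
    unfolding eventually_at by (rule exI[of _ 1]) (auto intro!: E_diff_le simp: dist_real_def)
  ultimately have "((\<lambda>s. E s x - E t x) \<longlongrightarrow> 0) (at t)"
    by (simp add: Lim_null_comparison)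
  then show "((\<lambda>s. E s x) \<longlongrightarrow> E t x) (at t)"
    by (rule LIM_zero_cancel)
qed

text \<open>The bound comes from \<open>E t = E (t - T) \<circ> E T\<close> with \<open>t - T \<le> 0\<close>, so no uniform
  boundedness principle is needed.\<close>

lemma E_locally_bounded:
  obtains B where "0 < B" "\<And>t x. \<bar>t\<bar> \<le> T \<Longrightarrow> norm (E t x) \<le> B * norm x"
proof -
  obtain C where C: "0 < C" "\<And>x. norm (E T x) \<le> norm x * C"
    using bounded_linear.pos_bounded[OF E_bl] by blast
  define B where "B = (K + 1) * exp (\<bar>\<alpha>\<bar> * (2 * \<bar>T\<bar>)) * C"
  have "norm (E t x) \<le> B * norm x" if "\<bar>t\<bar> \<le> T" for t x
  proof -
    have "norm (E t x) = norm (E (t - T) (E T x))" by (simp add: E_E)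
    also have "\<dots> \<le> K * exp (\<alpha> * (t - T)) * norm (E T x)"
      using that by (intro E_bound) auto
    also have "\<dots> \<le> (K + 1) * exp (\<bar>\<alpha>\<bar> * (2 * \<bar>T\<bar>)) * (norm x * C)"
    proof (intro mult_mono C(2))
      have "\<alpha> * (t - T) \<le> \<bar>\<alpha>\<bar> * \<bar>t - T\<bar>" by (metis abs_ge_self abs_mult)
      also have "\<dots> \<le> \<bar>\<alpha>\<bar> * (2 * \<bar>T\<bar>)" using that by (intro mult_left_mono) auto
      finally show "exp (\<alpha> * (t - T)) \<le> exp (\<bar>\<alpha>\<bar> * (2 * \<bar>T\<bar>))" by simp
    qed (use K_nonneg C in auto)
    finally show ?thesis by (simp add: B_def mult_ac)
  qed
  moreover have "0 < B" using K_nonneg C by (simp add: B_def add_nonneg_pos)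
  ultimately show ?thesis using that by blast
qed

text \<open>Continuity in the time alone and a norm bound on compact time intervals suffice, because
  \<open>f s y - f t x\<close> splits into \<open>f s (y - x)\<close> and
  \<open>f s x - f t x\<close>.\<close>

lemma joint_continuity:
  fixes f :: "real \<Rightarrow> 'h \<Rightarrow> 'h"
  assumes lin: "\<And>t. linear (f t)" and cont: "\<And>x. continuous_on UNIV (\<lambda>t. f t x)"
    and bd: "\<And>T. \<exists>B. \<forall>t x. \<bar>t\<bar> \<le> T \<longrightarrow> norm (f t x) \<le> B * norm x"
  shows "continuous_on UNIV (\<lambda>(t, x). f t x)"
  unfolding continuous_on_def
proof (intro ballI)
  fix p :: "real \<times> 'h"
  obtain t x where p: "p = (t, x)" by (cases p)
  obtain B where B: "\<And>s y. \<bar>s\<bar> \<le> \<bar>t\<bar> + 1 \<Longrightarrow> norm (f s y) \<le> B * norm y"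
    using bd[of "\<bar>t\<bar> + 1"] by auto
  have 1: "((\<lambda>z. B * norm (snd z - x) + norm (f (fst z) x - f t x)) \<longlongrightarrow> B * norm (x - x) + norm (f t x - f t x)) (at (t, x))"
  proof -
    have "isCont (\<lambda>s. f s x) t" using cont[of x] by (simp add: continuous_on_eq_continuous_at)
    moreover have "(fst \<longlongrightarrow> t) (at (t, x))" "(snd \<longlongrightarrow> x) (at (t, x))"
      using tendsto_fst[OF tendsto_ident_at, of "(t,x)"] tendsto_snd[OF tendsto_ident_at, of "(t,x)"]
      by (simp_all)
    ultimately show ?thesis
      by (intro tendsto_intros isCont_tendsto_compose[where g = "\<lambda>s. f s x"])
  qed
  have "\<forall>\<^sub>F z in at (t, x). norm ((case z of (s, y) \<Rightarrow> f s y) - f t x) \<le> B * norm (snd z - x) + norm (f (fst z) x - f t x)"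
    unfolding eventually_at
  proof (rule exI[of _ 1], intro conjI ballI impI)
    fix z assume z: "z \<noteq> (t, x) \<and> dist z (t, x) < 1"
    obtain s y where zs: "z = (s, y)" by (cases z)
    have s: "\<bar>s\<bar> \<le> \<bar>t\<bar> + 1"
      using z zs dist_fst_le[of "(s, y)" "(t, x)"] by (auto simp: dist_real_def)
    have "f s y - f t x = f s (y - x) + (f s x - f t x)" by (simp add: linear_diff[OF lin])
    then have "norm (f s y - f t x) \<le> norm (f s (y - x)) + norm (f s x - f t x)"
      by (metis norm_triangle_ineq)
    then show "norm ((case z of (s, y) \<Rightarrow> f s y) - f t x) \<le> B * norm (snd z - x) + norm (f (fst z) x - f t x)"
      using B[OF s, of "y - x"] zs by simp
  qed simp
  then have "((\<lambda>z. (case z of (s, y) \<Rightarrow> f s y) - f t x) \<longlongrightarrow> 0) (at (t, x))"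
    by (rule Lim_null_comparison) (use 1 in simp)
  then show "((\<lambda>(t, x). f t x) \<longlongrightarrow> (case p of (t, x) \<Rightarrow> f t x)) (at p)"
    unfolding p by (simp add: LIM_zero_cancel)
qed

lemma SQ_locally_bounded: "\<exists>B. \<forall>t x. \<bar>t\<bar> \<le> T \<longrightarrow> norm (SQ t x) \<le> B * norm x"
proof (intro exI allI impI)
  fix t x assume t: "\<bar>t\<bar> \<le> T"
  have "\<beta> * max 0 t \<le> \<bar>\<beta>\<bar> * T"
  proof -
    have "\<beta> * max 0 t \<le> \<bar>\<beta>\<bar> * max 0 t" by (intro mult_right_mono) auto
    also have "\<dots> \<le> \<bar>\<beta>\<bar> * T" using t by (intro mult_left_mono) auto
    finally show ?thesis .
  qed
  then show "norm (SQ t x) \<le> (K * exp (\<bar>\<beta>\<bar> * T)) * norm x"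
    using K_nonneg by (intro order.trans[OF SQ_le[of t x]] mult_right_mono mult_left_mono) auto
qed

lemma SQ_joint: "continuous_on UNIV (\<lambda>(t, x). SQ t x)"
  by (rule joint_continuity[OF bounded_linear.linear[OF SQ_bl] SQ_cont SQ_locally_bounded])

lemma E_joint: "continuous_on UNIV (\<lambda>(t, x). E t x)"
  by (rule joint_continuity[OF E_linear E_cont]) (metis E_locally_bounded)

section \<open>The Green kernel and the Lyapunov--Perron operator\<close>

definition Gr :: "real \<Rightarrow> real \<Rightarrow> 'h \<Rightarrow> 'h" where
  "Gr t s y = (if s \<le> t then SQ (t - s) y else - E (t - s) y)"

text \<open>One integral over the line covers both integrals of the Lyapunov--Perron equation. The
  cut-off sits inside the kernel, whose argument then vanishes for negative times, where
  \<open>f\<close> is arbitrary.\<close>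

definition LP :: "(real \<Rightarrow> 'h) \<Rightarrow> real \<Rightarrow> 'h" where
  "LP f t = (LINT s|lborel. Gr t s (indicator {0..} s *\<^sub>R f s))"

lemma Gr_linear: "linear (Gr t s)"
  using bounded_linear.linear[OF SQ_bl[of "t - s"]] E_linear[of "t - s"]
  by (cases "s \<le> t") (auto simp: Gr_def[abs_def] linear_compose_neg)

lemma Gr_zero [simp]: "Gr t s 0 = 0" by (rule linear_0[OF Gr_linear])

lemma Gr_measurable [measurable (raw)]:
  assumes [measurable]: "f \<in> borel_measurable M" "g \<in> borel_measurable M" "h \<in> borel_measurable M"
  shows "(\<lambda>x. Gr (f x) (g x) (h x)) \<in> borel_measurable M"
proof -
  have *: "(\<lambda>x. SQ (f x - g x) (h x)) \<in> borel_measurable M"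
    by (rule borel_measurable_continuous_Pair[OF _ _ SQ_joint[unfolded split_beta]]) measurable
  have **: "(\<lambda>x. E (f x - g x) (h x)) \<in> borel_measurable M"
    by (rule borel_measurable_continuous_Pair[OF _ _ E_joint[unfolded split_beta]]) measurable
  show ?thesis unfolding Gr_def using * ** by measurable
qed

text \<open>The mass of the Green kernel in the weight \<gamma>, computed in
  \<open>ker_integral\<close>. The gap condition reads
  \<open>K * L * kap (real i * \<eta>) < 1\<close>.\<close>

definition kap :: "real \<Rightarrow> real" where
  "kap \<gamma> = 1 / (\<gamma> - \<beta>) + 1 / (\<alpha> - \<gamma>)"

text \<open>The exponentials of the dichotomy estimates divided by
  \<open>exp (\<gamma> * (t - s))\<close>: a convolution kernel, so the weighted bound on
  \<open>LP\<close> does not depend on the time.\<close>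

definition ker :: "real \<Rightarrow> real \<Rightarrow> real" where
  "ker \<gamma> r = (if 0 \<le> r then exp (- ((\<gamma> - \<beta>) * r)) else exp ((\<alpha> - \<gamma>) * r))"

lemma ker_measurable [measurable]: "ker \<gamma> \<in> borel_measurable borel"
  unfolding ker_def by measurable

lemma ker_pos: "0 < ker \<gamma> r" by (simp add: ker_def)

lemma has_integral_exp_half_line:
  assumes "0 < (a::real)"
  shows "has_bochner_integral lborel (\<lambda>r. indicator {0..} r * exp (- (a * r))) (1 / a)"
proof (rule has_bochner_integral_nn_integral)
  have "(\<integral>\<^sup>+r. ennreal (exp (- (a * r))) * indicator {0..} r \<partial>lborel) = 0 - (- exp (- (a * 0)) / a)"
  proof (rule nn_integral_FTC_atLeast)
    show "DERIV (\<lambda>r. - exp (- (a * r)) / a) r :> exp (- (a * r))" for r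
      using assms by (auto intro!: derivative_eq_intros)
    have "((\<lambda>r. exp (- (a * r))) \<longlongrightarrow> 0) at_top"
      using assms by (intro filterlim_compose[OF exp_at_bot] filterlim_compose[OF filterlim_uminus_at_bot_at_top] filterlim_tendsto_pos_mult_at_top[OF tendsto_const _ filterlim_ident])
    from tendsto_divide[OF tendsto_minus[OF this] tendsto_const[of a]]
    show "((\<lambda>r. - exp (- (a * r)) / a) \<longlongrightarrow> 0) at_top" using assms by simp
  qed auto
  then show "(\<integral>\<^sup>+r. ennreal (indicator {0..} r * exp (- (a * r))) \<partial>lborel) = ennreal (1 / a)"
    using assms by (simp add: ennreal_mult'' mult.commute ennreal_indicator)
qed (use assms in auto)

lemma ker_integral:
  assumes "\<beta> < \<gamma>" "\<gamma> < \<alpha>"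
  shows "has_bochner_integral lborel (\<lambda>s. ker \<gamma> (t - s)) (kap \<gamma>)"
proof -
  have 1: "has_bochner_integral lborel (\<lambda>s. indicator {0..} (t - s) * exp (- ((\<gamma> - \<beta>) * (t - s)))) (1 / (\<gamma> - \<beta>))"
    using lborel_has_bochner_integral_real_affine_iff[of "-1" "\<lambda>r. indicator {0..} r * exp (- ((\<gamma> - \<beta>) * r))" "1 / (\<gamma> - \<beta>)" t]
      has_integral_exp_half_line[of "\<gamma> - \<beta>"] assms by simp
  have 2: "has_bochner_integral lborel (\<lambda>s. indicator {0..} (s - t) * exp (- ((\<alpha> - \<gamma>) * (s - t)))) (1 / (\<alpha> - \<gamma>))"
    using lborel_has_bochner_integral_real_affine_iff[of "1" "\<lambda>r. indicator {0..} r * exp (- ((\<alpha> - \<gamma>) * r))" "1 / (\<alpha> - \<gamma>)" "- t"]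
      has_integral_exp_half_line[of "\<alpha> - \<gamma>"] assms by simp
  \<comment> \<open>At \<open>s = t\<close> both indicators equal 1, so the sum of the two pieces
    agrees with \<open>ker\<close> only off this point.\<close>
  have "AE s in lborel. s \<noteq> t" by (rule AE_lborel_singleton)
  then have "AE s in lborel. indicator {0..} (t - s) * exp (- ((\<gamma> - \<beta>) * (t - s))) +
      indicator {0..} (s - t) * exp (- ((\<alpha> - \<gamma>) * (s - t))) = ker \<gamma> (t - s)"
    by eventually_elim (auto simp: ker_def indicator_def algebra_simps)
  from has_bochner_integral_cong_AE[OF _ _ this, THEN iffD1, OF _ _ has_bochner_integral_add[OF 1 2]]
  show ?thesis by (simp add: kap_def)
qed

text \<open>The two components are bounded separately because the Lipschitz estimates of the
  nonlinearity are. A bound on the norm of \<open>f\<close> would bring the norms of the projections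
  into the gap condition.\<close>

definition dominated :: "(real \<Rightarrow> 'h) \<Rightarrow> real \<Rightarrow> real \<Rightarrow> bool" where
  "dominated f \<gamma> M \<longleftrightarrow> continuous_on {0..} f \<and>
     (\<forall>s\<ge>0. norm (Q (f s)) \<le> M * exp (\<gamma> * s) \<and> norm (Pp (f s)) \<le> M * exp (\<gamma> * s))"

lemma half_line_measurable:
  "continuous_on {0..} f \<Longrightarrow> (\<lambda>s::real. indicator {0..} s *\<^sub>R (f s :: 'h)) \<in> borel_measurable borel"
  by (rule borel_measurable_continuous_on_indicator) auto

lemma Gr_le:
  assumes "dominated f \<gamma> M" "0 \<le> M"
  shows "norm (Gr t s (indicator {0..} s *\<^sub>R f s)) \<le> K * M * exp (\<gamma> * t) * ker \<gamma> (t - s)"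
proof (cases "0 \<le> s")
  case s: True
  show ?thesis
  proof (cases "s \<le> t")
    case True
    have "norm (SQ (t - s) (Q (f s))) \<le> K * exp (\<beta> * (t - s)) * (M * exp (\<gamma> * s))"
      using True assms s K_nonneg
      by (auto simp: dominated_def simp del: SQ_Q intro!: order.trans[OF SQ_le] mult_left_mono)
    also have "\<dots> = K * M * exp (\<gamma> * t) * ker \<gamma> (t - s)"
      using True by (simp add: ker_def algebra_simps flip: exp_add)
    finally show ?thesis using s True by (simp add: Gr_def)
  next
    case False
    have "norm (E (t - s) (Pp (f s))) \<le> K * exp (\<alpha> * (t - s)) * (M * exp (\<gamma> * s))"
      using False assms s K_nonneg
      by (auto simp: dominated_def simp del: E_Pp intro!: order.trans[OF E_bound] mult_left_mono)
    also have "\<dots> = K * M * exp (\<gamma> * t) * ker \<gamma> (t - s)"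
      using False by (simp add: ker_def algebra_simps flip: exp_add)
    finally show ?thesis using s False by (simp add: Gr_def)
  qed
next
  case False
  then show ?thesis using assms K_nonneg ker_pos[of \<gamma> "t - s"] by simp
qed

lemma LP_meas:
  assumes "continuous_on {0..} f"
  shows "(\<lambda>s. Gr t s (indicator {0..} s *\<^sub>R f s)) \<in> borel_measurable lborel"
  using half_line_measurable[OF assms] by measurable

context
  fixes \<gamma> :: real
  assumes \<gamma>: "\<beta> < \<gamma>" "\<gamma> < \<alpha>"
begin

lemma kap_pos: "0 < kap \<gamma>"
  using \<gamma> by (simp add: kap_def add_pos_pos)

lemma LP_integrable:
  assumes "dominated f \<gamma> M" "0 \<le> M"
  shows "integrable lborel (\<lambda>s. Gr t s (indicator {0..} s *\<^sub>R f s))"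
proof (rule Bochner_Integration.integrable_bound)
  show "integrable lborel (\<lambda>s. K * M * exp (\<gamma> * t) * ker \<gamma> (t - s))"
    using ker_integral[OF \<gamma>, of t] by (auto simp: has_bochner_integral_iff)
  show "AE s in lborel. norm (Gr t s (indicator {0..} s *\<^sub>R f s)) \<le> norm (K * M * exp (\<gamma> * t) * ker \<gamma> (t - s))"
    using Gr_le[OF assms] ker_pos K_nonneg assms(2) by (auto simp: abs_mult less_imp_le)
qed (use assms LP_meas in \<open>auto simp: dominated_def\<close>)

lemma LP_le:
  assumes "dominated f \<gamma> M" "0 \<le> M"
  shows "norm (LP f t) \<le> K * M * kap \<gamma> * exp (\<gamma> * t)"
proof -
  have "norm (LP f t) \<le> (LINT s|lborel. K * M * exp (\<gamma> * t) * ker \<gamma> (t - s))"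
    unfolding LP_def using ker_integral[OF \<gamma>, of t] Gr_le[OF assms]
    by (intro order.trans[OF integral_norm_bound] integral_mono LP_integrable[OF assms] integrable_norm)
      (auto simp: has_bochner_integral_iff)
  also have "\<dots> = K * M * kap \<gamma> * exp (\<gamma> * t)"
    using ker_integral[OF \<gamma>, of t] by (simp add: has_bochner_integral_iff)
  finally show ?thesis .
qed

text \<open>It yields one integrable majorant for all times within distance 1 of \<open>t\<close>. A
  unit shift changes the exponent by at most the sum of the rates \<open>\<gamma> - \<beta>\<close>
  and \<open>\<alpha> - \<gamma>\<close>, which is \<open>\<alpha> - \<beta>\<close>.\<close>

lemma ker_shift: assumes "\<bar>t - t'\<bar> \<le> 1"
  shows "ker \<gamma> (t' - s) \<le> exp (\<alpha> - \<beta>) * ker \<gamma> (t - s)"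
proof -
  define a b where "a = \<gamma> - \<beta>" and "b = \<alpha> - \<gamma>"
  have ab: "0 < a" "0 < b" "\<alpha> - \<beta> = a + b" using \<gamma> by (auto simp: a_def b_def)
  have k: "ker \<gamma> r = exp (- (a * max 0 r) - b * max 0 (- r))" for r
    by (auto simp: ker_def a_def b_def max_def)
  have "a * max 0 (t - s) \<le> a * (max 0 (t' - s) + 1)" "b * max 0 (- (t - s)) \<le> b * (max 0 (- (t' - s)) + 1)"
    using assms ab by (auto intro!: mult_left_mono)
  then show ?thesis
    unfolding k ab(3) exp_add[symmetric] by (auto simp: algebra_simps)
qed

lemma LP_cont:
  assumes f: "dominated f \<gamma> M" "0 \<le> M"
  shows "continuous_on UNIV (LP f)"
proof (rule continuous_on_sequentially[THEN iffD2])
  show "\<forall>x. \<forall>a\<in>UNIV. (\<forall>n. x n \<in> UNIV) \<and> x \<longlonglongrightarrow> a \<longrightarrow> (LP f \<circ> x) \<longlonglongrightarrow> LP f a"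
  proof (intro allI ballI impI)
    fix x :: "nat \<Rightarrow> real" and t :: real assume "(\<forall>n. x n \<in> UNIV) \<and> x \<longlonglongrightarrow> t"
    then have x: "x \<longlonglongrightarrow> t" by simp
    define B where "B = K * M * exp (\<bar>\<gamma>\<bar> * (\<bar>t\<bar> + 1)) * exp (\<alpha> - \<beta>)"
    obtain N where N: "\<And>n. n \<ge> N \<Longrightarrow> \<bar>t - x n\<bar> \<le> 1"
      using LIMSEQ_D[OF x, of 1] by (force simp: abs_minus_commute)
    have "(\<lambda>n. LP f (x (n + N))) \<longlonglongrightarrow> LP f t"
      unfolding LP_def
    proof (rule integral_dominated_convergence)
      show "integrable lborel (\<lambda>s. B * ker \<gamma> (t - s))"
        using ker_integral[OF \<gamma>, of t] by (auto simp: has_bochner_integral_iff)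
      have xN: "(\<lambda>n. x (n + N)) \<longlonglongrightarrow> t" using x by (rule LIMSEQ_ignore_initial_segment)
      \<comment> \<open>The Green kernel jumps at \<open>s = t\<close>, so convergence of the
        integrands is claimed for all other \<open>s\<close>.\<close>
      have "AE s in lborel. s \<noteq> t" by (rule AE_lborel_singleton)
      then show "AE s in lborel. (\<lambda>n. Gr (x (n + N)) s (indicator {0..} s *\<^sub>R f s)) \<longlonglongrightarrow> Gr t s (indicator {0..} s *\<^sub>R f s)"
      proof eventually_elim
        case (elim s)
        let ?y = "indicator {0..} s *\<^sub>R f s"
        have xs: "(\<lambda>n. x (n + N) - s) \<longlonglongrightarrow> t - s" by (intro tendsto_intros xN)
        show ?case
        proof (cases "s < t")
          case True
          then have "\<forall>\<^sub>F n in sequentially. s < x (n + N)" using order_tendstoD(1)[OF xN] by auto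
          then have ev: "\<forall>\<^sub>F n in sequentially. SQ (x (n + N) - s) ?y = Gr (x (n + N)) s ?y"
            by eventually_elim (simp add: Gr_def)
          have "isCont (\<lambda>r. SQ r ?y) (t - s)"
            using SQ_cont[of ?y] by (simp add: continuous_on_eq_continuous_at)
          from isCont_tendsto_compose[OF this xs] have "(\<lambda>n. SQ (x (n + N) - s) ?y) \<longlonglongrightarrow> SQ (t - s) ?y" .
          from Lim_transform_eventually[OF this ev] show ?thesis using True by (simp add: Gr_def)
        next
          case False
          with elim have "t < s" by simp
          then have "\<forall>\<^sub>F n in sequentially. x (n + N) < s" using order_tendstoD(2)[OF xN] by auto
          then have ev: "\<forall>\<^sub>F n in sequentially. - E (x (n + N) - s) ?y = Gr (x (n + N)) s ?y"
            by eventually_elim (simp add: Gr_def)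
          have "isCont (\<lambda>r. E r ?y) (t - s)"
            using E_cont[of ?y] by (simp add: continuous_on_eq_continuous_at)
          from tendsto_minus[OF isCont_tendsto_compose[OF this xs]]
          have "(\<lambda>n. - E (x (n + N) - s) ?y) \<longlonglongrightarrow> - E (t - s) ?y" .
          from Lim_transform_eventually[OF this ev] show ?thesis using \<open>t < s\<close> by (simp add: Gr_def)
        qed
      qed
      show "AE s in lborel. norm (Gr (x (n + N)) s (indicator {0..} s *\<^sub>R f s)) \<le> B * ker \<gamma> (t - s)" for n
      proof (rule AE_I2)
        fix s
        have *: "\<gamma> * x (n + N) \<le> \<bar>\<gamma>\<bar> * (\<bar>t\<bar> + 1)"
        proof -
          have "\<gamma> * x (n + N) \<le> \<bar>\<gamma>\<bar> * \<bar>x (n + N)\<bar>" by (metis abs_ge_self abs_mult)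
          also have "\<dots> \<le> \<bar>\<gamma>\<bar> * (\<bar>t\<bar> + 1)" using N[of "n + N"] by (intro mult_left_mono) auto
          finally show ?thesis .
        qed
        have "norm (Gr (x (n + N)) s (indicator {0..} s *\<^sub>R f s)) \<le> K * M * exp (\<gamma> * x (n + N)) * ker \<gamma> (x (n + N) - s)"
          by (rule Gr_le[OF f])
        also have "\<dots> \<le> K * M * exp (\<bar>\<gamma>\<bar> * (\<bar>t\<bar> + 1)) * (exp (\<alpha> - \<beta>) * ker \<gamma> (t - s))"
          using K_nonneg f(2) * N[of "n + N"] ker_pos
          by (intro mult_mono ker_shift) (auto intro!: mult_nonneg_nonneg simp: less_imp_le)
        finally show "norm (Gr (x (n + N)) s (indicator {0..} s *\<^sub>R f s)) \<le> B * ker \<gamma> (t - s)"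
          by (simp add: B_def mult_ac)
      qed
    qed (use f LP_meas in \<open>auto simp: dominated_def\<close>)
    then show "(LP f \<circ> x) \<longlonglongrightarrow> LP f t"
      unfolding o_def by (rule LIMSEQ_offset)
  qed
qed

lemma LP_diff:
  assumes "dominated f \<gamma> M" "0 \<le> M" "dominated g \<gamma> N" "0 \<le> N"
  shows "LP f t - LP g t = LP (\<lambda>s. f s - g s) t"
  unfolding LP_def Bochner_Integration.integral_diff[OF LP_integrable[OF assms(1,2)] LP_integrable[OF assms(3,4)], symmetric]
  by (simp add: linear_diff[OF Gr_linear] scaleR_diff_right)

end

lemma LP_cong: "(\<And>s. 0 \<le> s \<Longrightarrow> f s = g s) \<Longrightarrow> LP f t = LP g t"
  unfolding LP_def by (intro Bochner_Integration.integral_cong) (auto simp: indicator_def)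

lemma LP_scale: "LP (\<lambda>s. c *\<^sub>R f s) t = c *\<^sub>R LP f t"
proof -
  have "LP (\<lambda>s. c *\<^sub>R f s) t = (LINT s|lborel. c *\<^sub>R Gr t s (indicator {0..} s *\<^sub>R f s))"
    unfolding LP_def linear_cmul[OF Gr_linear, symmetric] by (simp add: mult.commute)
  then show ?thesis by (simp add: LP_def)
qed

section \<open>The a priori estimate and Picard iteration in weighted norms\<close>

primrec picard :: "(real \<Rightarrow> 'h) \<Rightarrow> (real \<Rightarrow> 'h \<Rightarrow> 'h) \<Rightarrow> nat \<Rightarrow> real \<Rightarrow> 'h" where
  "picard r \<Psi> 0 t = 0"
| "picard r \<Psi> (Suc n) t = r t + LP (\<lambda>s. \<Psi> s (picard r \<Psi> n s)) t"

definition expbd :: "real \<Rightarrow> real \<Rightarrow> (real \<Rightarrow> 'h) \<Rightarrow> bool" where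
  "expbd \<gamma> C w \<longleftrightarrow> (\<forall>t\<ge>0. norm (w t) \<le> C * exp (\<gamma> * t))"

lemma expbd_nonneg: "expbd \<gamma> C w \<Longrightarrow> 0 \<le> C"
  unfolding expbd_def by (metis exp_zero mult.right_neutral mult_zero_right norm_ge_zero order.refl order.trans)

lemma expbd_at_0: "expbd \<gamma> C w \<Longrightarrow> norm (w 0) \<le> C"
  unfolding expbd_def by (metis exp_zero mult.right_neutral mult_zero_right order.refl)

lemma expbd_mono: "expbd \<gamma> C w \<Longrightarrow> \<gamma> \<le> \<gamma>' \<Longrightarrow> expbd \<gamma>' C w"
  using expbd_nonneg[of \<gamma> C w] unfolding expbd_def
  by (meson exp_le_cancel_iff mult_left_mono mult_right_mono order.trans)

lemma dominated_mono: "dominated f \<gamma> M \<Longrightarrow> \<gamma> \<le> \<gamma>' \<Longrightarrow> 0 \<le> M \<Longrightarrow> dominated f \<gamma>' M"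
  unfolding dominated_def
  by (meson exp_le_cancel_iff mult_left_mono mult_right_mono order.trans)

context
  fixes \<gamma> L :: real
  assumes \<gamma>: "\<beta> < \<gamma>" "\<gamma> < \<alpha>" and L: "0 \<le> L" and gap: "K * L * kap \<gamma> < 1"
begin

text \<open>The weighted supremum \<open>N\<close> of \<open>w\<close> satisfies
  \<open>N \<le> R + K * (L * N + \<rho>) * kap \<gamma>\<close>, and the gap condition allows
  solving for \<open>N\<close>. This needs \<open>N\<close> to be finite, which is all that
  \<open>fin\<close> provides: its constant is absent from the conclusion. Only bounds on
  \<open>f\<close> are required, so differences and Taylor remainders are covered as well as
  solutions.\<close>

lemma a_priori:
  assumes eq: "\<And>t. 0 \<le> t \<Longrightarrow> w t = r t + LP f t"
    and cont: "continuous_on {0..} f"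
    and fin: "expbd \<gamma> C w" and r: "expbd \<gamma> R r" and \<rho>: "0 \<le> \<rho>"
    and fQ: "\<And>s. 0 \<le> s \<Longrightarrow> norm (Q (f s)) \<le> L * norm (w s) + \<rho> * exp (\<gamma> * s)"
    and fP: "\<And>s. 0 \<le> s \<Longrightarrow> norm (Pp (f s)) \<le> L * norm (w s) + \<rho> * exp (\<gamma> * s)"
  shows "expbd \<gamma> ((R + K * \<rho> * kap \<gamma>) / (1 - K * L * kap \<gamma>)) w"
proof -
  define X where "X = (\<lambda>t. norm (w t) * exp (- (\<gamma> * t))) ` {0..}"
  define N where "N = Sup X"
  have le_iff: "norm (w t) * exp (- (\<gamma> * t)) \<le> c \<longleftrightarrow> norm (w t) \<le> c * exp (\<gamma> * t)" for t c
    by (simp add: exp_minus field_simps)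
  have bdd: "bdd_above X" unfolding X_def bdd_above_def
    using fin by (auto simp: expbd_def le_iff)
  have N: "norm (w t) \<le> N * exp (\<gamma> * t)" if "0 \<le> t" for t
    using cSup_upper[OF _ bdd] that unfolding N_def le_iff[symmetric] by (auto simp: X_def)
  then have N0: "0 \<le> N" using expbd_nonneg[of \<gamma> N w] by (auto simp: expbd_def)
  have "dominated f \<gamma> (L * N + \<rho>)"
    unfolding dominated_def
  proof (intro conjI allI impI cont)
    fix s :: real assume s: "0 \<le> s"
    have "L * norm (w s) + \<rho> * exp (\<gamma> * s) \<le> (L * N + \<rho>) * exp (\<gamma> * s)"
      using mult_left_mono[OF N[OF s] L] by (simp add: algebra_simps)
    with fQ[OF s] fP[OF s] show "norm (Q (f s)) \<le> (L * N + \<rho>) * exp (\<gamma> * s)"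
      "norm (Pp (f s)) \<le> (L * N + \<rho>) * exp (\<gamma> * s)" by linarith+
  qed
  from LP_le[OF \<gamma> this] have *: "norm (LP f t) \<le> K * (L * N + \<rho>) * kap \<gamma> * exp (\<gamma> * t)" for t
    using L N0 \<rho> by simp
  have "norm (w t) * exp (- (\<gamma> * t)) \<le> R + K * (L * N + \<rho>) * kap \<gamma>" if "0 \<le> t" for t
    unfolding le_iff using *[of t] r that norm_triangle_ineq[of "r t" "LP f t"]
    by (auto simp: expbd_def eq algebra_simps intro: order.trans)
  then have "N \<le> R + K * (L * N + \<rho>) * kap \<gamma>"
    unfolding N_def by (intro cSup_least) (auto simp: X_def)
  then have "N \<le> (R + K * \<rho> * kap \<gamma>) / (1 - K * L * kap \<gamma>)"
    using gap by (simp add: field_simps)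
  then show ?thesis unfolding expbd_def
    using N by (meson exp_ge_zero mult_right_mono order.trans)
qed

context
  fixes r :: "real \<Rightarrow> 'h" and \<Psi> :: "real \<Rightarrow> 'h \<Rightarrow> 'h" and R M :: real
  assumes r_cont: "continuous_on {0..} r" and r_bd: "expbd \<gamma> R r"
    and \<Psi>_cont: "\<And>w. continuous_on {0..} w \<Longrightarrow> continuous_on {0..} (\<lambda>s. \<Psi> s (w s))"
    and \<Psi>_lip: "\<And>s a b. 0 \<le> s \<Longrightarrow> norm (Q (\<Psi> s a - \<Psi> s b)) \<le> L * norm (a - b)"
      "\<And>s a b. 0 \<le> s \<Longrightarrow> norm (Pp (\<Psi> s a - \<Psi> s b)) \<le> L * norm (a - b)"
    and \<Psi>_0: "dominated (\<lambda>s. \<Psi> s 0) \<gamma> M" and M: "0 \<le> M"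
begin

lemma \<Psi>_diff_dominated:
  assumes "continuous_on {0..} w" "continuous_on {0..} w'" "expbd \<gamma> C (\<lambda>s. w s - w' s)"
  shows "dominated (\<lambda>s. \<Psi> s (w s) - \<Psi> s (w' s)) \<gamma> (L * C)"
  unfolding dominated_def
proof (intro conjI allI impI)
  show "continuous_on {0..} (\<lambda>s. \<Psi> s (w s) - \<Psi> s (w' s))"
    by (intro continuous_on_diff \<Psi>_cont assms)
  fix s :: real assume s: "0 \<le> s"
  have "L * norm (w s - w' s) \<le> L * C * exp (\<gamma> * s)"
    using mult_left_mono[OF _ L] assms(3) s by (fastforce simp: expbd_def mult.assoc)
  then show "norm (Q (\<Psi> s (w s) - \<Psi> s (w' s))) \<le> L * C * exp (\<gamma> * s)"
    "norm (Pp (\<Psi> s (w s) - \<Psi> s (w' s))) \<le> L * C * exp (\<gamma> * s)"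
    using \<Psi>_lip[OF s, of "w s" "w' s"] by linarith+
qed

lemma \<Psi>_dominated:
  assumes "continuous_on {0..} w" "expbd \<gamma> C w"
  shows "dominated (\<lambda>s. \<Psi> s (w s)) \<gamma> (L * C + M)"
proof -
  have "dominated (\<lambda>s. \<Psi> s (w s) - \<Psi> s 0) \<gamma> (L * C)"
    using \<Psi>_diff_dominated[of w "\<lambda>_. 0" C] assms by simp
  then have *: "norm (Q (\<Psi> s (w s)) - Q (\<Psi> s 0)) \<le> L * C * exp (\<gamma> * s)"
     "norm (Pp (\<Psi> s (w s)) - Pp (\<Psi> s 0)) \<le> L * C * exp (\<gamma> * s)"
     "norm (Q (\<Psi> s 0)) \<le> M * exp (\<gamma> * s)" "norm (Pp (\<Psi> s 0)) \<le> M * exp (\<gamma> * s)" if "0 \<le> s" for s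
    using \<Psi>_0 that by (auto simp: dominated_def linear_diff[OF Q_linear] linear_diff[OF Pp_linear])
  have "norm (Q (\<Psi> s (w s))) \<le> (L * C + M) * exp (\<gamma> * s)" "norm (Pp (\<Psi> s (w s))) \<le> (L * C + M) * exp (\<gamma> * s)"
    if "0 \<le> s" for s
    using *[OF that] norm_triangle_sub[of "Q (\<Psi> s (w s))" "Q (\<Psi> s 0)"] norm_triangle_sub[of "Pp (\<Psi> s (w s))" "Pp (\<Psi> s 0)"]
    by (simp_all add: algebra_simps)
  then show ?thesis using \<Psi>_cont[OF assms(1)] by (simp add: dominated_def)
qed

lemma LP_\<Psi>_diff:
  assumes "continuous_on {0..} w" "continuous_on {0..} w'" "expbd \<gamma> C (\<lambda>s. w s - w' s)"
    "expbd \<gamma> B w" "expbd \<gamma> B' w'"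
  shows "expbd \<gamma> (K * L * kap \<gamma> * C) (\<lambda>t. LP (\<lambda>s. \<Psi> s (w s)) t - LP (\<lambda>s. \<Psi> s (w' s)) t)"
proof -
  have pos: "0 \<le> C" "0 \<le> B" "0 \<le> B'" using assms expbd_nonneg by blast+
  then have "LP (\<lambda>s. \<Psi> s (w s)) t - LP (\<lambda>s. \<Psi> s (w' s)) t = LP (\<lambda>s. \<Psi> s (w s) - \<Psi> s (w' s)) t" for t
    using L M by (intro LP_diff[OF \<gamma> \<Psi>_dominated[OF assms(1,4)] _ \<Psi>_dominated[OF assms(2,5)]]) auto
  then show ?thesis
    using LP_le[OF \<gamma> \<Psi>_diff_dominated[OF assms(1-3)]] L pos by (auto simp: expbd_def mult_ac)
qed

lemma picard_good: "continuous_on {0..} (picard r \<Psi> n) \<and> (\<exists>C. expbd \<gamma> C (picard r \<Psi> n))"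
proof (induction n)
  case 0
  then show ?case by (auto simp: expbd_def intro!: exI[of _ 0])
next
  case (Suc n)
  then obtain C where C: "continuous_on {0..} (picard r \<Psi> n)" "expbd \<gamma> C (picard r \<Psi> n)" by blast
  note d = \<Psi>_dominated[OF C]
  have pos: "0 \<le> L * C + M" using expbd_nonneg[OF C(2)] L M by simp
  have "expbd \<gamma> (R + K * (L * C + M) * kap \<gamma>) (picard r \<Psi> (Suc n))"
    unfolding expbd_def
  proof (intro allI impI)
    fix t :: real assume "0 \<le> t"
    then show "norm (picard r \<Psi> (Suc n) t) \<le> (R + K * (L * C + M) * kap \<gamma>) * exp (\<gamma> * t)"
      using LP_le[OF \<gamma> d pos, of t] r_bd norm_triangle_ineq[of "r t" "LP (\<lambda>s. \<Psi> s (picard r \<Psi> n s)) t"]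
      unfolding expbd_def by (fastforce simp: algebra_simps)
  qed
  moreover have "continuous_on {0..} (picard r \<Psi> (Suc n))"
    using LP_cont[OF \<gamma> d pos] by (auto intro!: continuous_intros r_cont intro: continuous_on_subset)
  ultimately show ?case by blast
qed

lemma picard_diff: "\<exists>N. \<forall>n. expbd \<gamma> (N * (K * L * kap \<gamma>) ^ n) (\<lambda>t. picard r \<Psi> (Suc n) t - picard r \<Psi> n t)"
proof -
  obtain N where "expbd \<gamma> N (picard r \<Psi> (Suc 0))" using picard_good by blast
  then have "expbd \<gamma> (N * (K * L * kap \<gamma>) ^ n) (\<lambda>t. picard r \<Psi> (Suc n) t - picard r \<Psi> n t)" for n
  proof (induction n)
    case 0
    then show ?case by simp
  next
    case (Suc n)
    obtain B B' where B: "expbd \<gamma> B (picard r \<Psi> (Suc n))" "expbd \<gamma> B' (picard r \<Psi> n)" using picard_good by blast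
    have "expbd \<gamma> (K * L * kap \<gamma> * (N * (K * L * kap \<gamma>) ^ n)) (\<lambda>t. LP (\<lambda>s. \<Psi> s (picard r \<Psi> (Suc n) s)) t - LP (\<lambda>s. \<Psi> s (picard r \<Psi> n s)) t)"
      by (intro LP_\<Psi>_diff[OF _ _ Suc.IH[OF Suc.prems] B]) (use picard_good in blast)+
    then show ?case by (simp add: mult_ac)
  qed
  then show ?thesis by blast
qed

lemma picard_convergence:
  obtains w C where "continuous_on {0..} w" "expbd \<gamma> C w"
    "\<And>t. 0 \<le> t \<Longrightarrow> w t = r t + LP (\<lambda>s. \<Psi> s (w s)) t"
    "\<And>t. 0 \<le> t \<Longrightarrow> (\<lambda>n. picard r \<Psi> n t) \<longlonglongrightarrow> w t"
proof -
  define \<theta> where "\<theta> = K * L * kap \<gamma>"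
  have \<theta>: "0 \<le> \<theta>" "\<theta> < 1" using gap K_nonneg L kap_pos[OF \<gamma>] by (auto simp: \<theta>_def)
  obtain N where N: "\<And>n. expbd \<gamma> (N * \<theta> ^ n) (\<lambda>t. picard r \<Psi> (Suc n) t - picard r \<Psi> n t)"
    using picard_diff by (auto simp: \<theta>_def)
  \<comment> \<open>Dividing by the weight makes the increments uniformly summable on the half-line,
    as the Weierstrass test requires.\<close>
  define p where "p n t = exp (- (\<gamma> * t)) *\<^sub>R picard r \<Psi> n t" for n t
  define D where "D n t = p (Suc n) t - p n t" for n t
  have D_le: "norm (D n t) \<le> N * \<theta> ^ n" if "t \<in> {0..}" for n t
  proof -
    have "norm (D n t) = exp (- (\<gamma> * t)) * norm (picard r \<Psi> (Suc n) t - picard r \<Psi> n t)"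
      by (simp add: D_def p_def flip: scaleR_diff_right)
    also have "\<dots> \<le> exp (- (\<gamma> * t)) * (N * \<theta> ^ n * exp (\<gamma> * t))"
      using N[of n] that by (intro mult_left_mono) (auto simp: expbd_def)
    finally show ?thesis by (simp add: exp_minus field_simps)
  qed
  have sum: "summable (\<lambda>n. N * \<theta> ^ n)" using \<theta> by (intro summable_mult summable_geometric) auto
  have tele: "(\<Sum>i<n. D i t) = p n t" for n t
    using sum_lessThan_telescope[of "\<lambda>n. p n t" n] by (simp add: D_def p_def)
  have ul: "uniform_limit {0..} p (\<lambda>t. \<Sum>i. D i t) sequentially"
    using Weierstrass_m_test[of "{0..}" D "\<lambda>n. N * \<theta> ^ n", OF D_le sum] unfolding tele .
  define u where "u t = (\<Sum>i. D i t)" for t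
  define w where "w t = exp (\<gamma> * t) *\<^sub>R u t" for t
  have pc: "continuous_on {0..} (p n)" for n
    unfolding p_def using picard_good[of n] by (intro continuous_intros) auto
  have "continuous_on {0..} u"
    using uniform_limit_theorem[OF _ ul] pc by (auto simp: u_def)
  then have wc: "continuous_on {0..} w" unfolding w_def by (intro continuous_intros)
  have plim: "(\<lambda>n. p n t) \<longlonglongrightarrow> u t" if "0 \<le> t" for t
    using tendsto_uniform_limitI[OF ul, of t] that by (simp add: u_def)
  have lim: "(\<lambda>n. picard r \<Psi> n t) \<longlonglongrightarrow> w t" if "0 \<le> t" for t
    using tendsto_scaleR[OF tendsto_const[of "exp (\<gamma> * t)"] plim[OF that]]
    by (simp add: p_def w_def exp_minus)
  have diff_bd: "\<exists>n0. \<forall>n\<ge>n0. expbd \<gamma> e (\<lambda>s. picard r \<Psi> n s - w s)" if e: "0 < e" for e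
  proof -
    obtain n0 where n0: "\<And>n t. n \<ge> n0 \<Longrightarrow> 0 \<le> t \<Longrightarrow> dist (p n t) (u t) < e"
      using uniform_limitD[OF ul e] by (auto simp: eventually_sequentially u_def)
    have "expbd \<gamma> e (\<lambda>s. picard r \<Psi> n s - w s)" if n: "n \<ge> n0" for n
      unfolding expbd_def
    proof (intro allI impI)
      fix t :: real assume t: "0 \<le> t"
      have "picard r \<Psi> n t - w t = exp (\<gamma> * t) *\<^sub>R (p n t - u t)"
        by (simp add: p_def w_def exp_minus scaleR_diff_right)
      then show "norm (picard r \<Psi> n t - w t) \<le> e * exp (\<gamma> * t)"
        using n0[OF n t] by (simp add: dist_norm mult.commute)
    qed
    then show ?thesis by blast
  qed
  obtain n1 where "expbd \<gamma> 1 (\<lambda>s. picard r \<Psi> n1 s - w s)" using diff_bd[of 1] by auto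
  moreover obtain C1 where "expbd \<gamma> C1 (picard r \<Psi> n1)" using picard_good by blast
  ultimately have wb: "expbd \<gamma> (C1 + 1) w"
    unfolding expbd_def
  proof (intro allI impI)
    fix t :: real assume "\<forall>t\<ge>0. norm (picard r \<Psi> n1 t - w t) \<le> 1 * exp (\<gamma> * t)" "\<forall>t\<ge>0. norm (picard r \<Psi> n1 t) \<le> C1 * exp (\<gamma> * t)" "0 \<le> t"
    then have "norm (picard r \<Psi> n1 t - w t) \<le> exp (\<gamma> * t)" "norm (picard r \<Psi> n1 t) \<le> C1 * exp (\<gamma> * t)" by auto
    then show "norm (w t) \<le> (C1 + 1) * exp (\<gamma> * t)"
      using norm_triangle_sub[of "w t" "picard r \<Psi> n1 t"] by (simp add: algebra_simps norm_minus_commute)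
  qed
  have "w t = r t + LP (\<lambda>s. \<Psi> s (w s)) t" if t: "0 \<le> t" for t
  proof (rule LIMSEQ_unique[OF LIMSEQ_Suc[OF lim[OF t]]])
    have "(\<lambda>n. LP (\<lambda>s. \<Psi> s (picard r \<Psi> n s)) t - LP (\<lambda>s. \<Psi> s (w s)) t) \<longlonglongrightarrow> 0"
    proof (rule LIMSEQ_I)
      fix e :: real assume e: "0 < e"
      \<comment> \<open>The time is fixed here, so the weight at that time can be divided out of the
        tolerance.\<close>
      define e' where "e' = e / 2 * exp (- (\<gamma> * t))"
      obtain n0 where n0: "\<And>n. n \<ge> n0 \<Longrightarrow> expbd \<gamma> e' (\<lambda>s. picard r \<Psi> n s - w s)"
        using diff_bd[of e'] e by (auto simp: e'_def)
      have "norm (LP (\<lambda>s. \<Psi> s (picard r \<Psi> n s)) t - LP (\<lambda>s. \<Psi> s (w s)) t - 0) < e" if n: "n \<ge> n0" for n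
      proof -
        obtain B where B: "expbd \<gamma> B (picard r \<Psi> n)" using picard_good by blast
        have "expbd \<gamma> (K * L * kap \<gamma> * e') (\<lambda>t. LP (\<lambda>s. \<Psi> s (picard r \<Psi> n s)) t - LP (\<lambda>s. \<Psi> s (w s)) t)"
          by (rule LP_\<Psi>_diff[OF _ wc n0[OF n] B wb]) (use picard_good in blast)
        then have "norm (LP (\<lambda>s. \<Psi> s (picard r \<Psi> n s)) t - LP (\<lambda>s. \<Psi> s (w s)) t) \<le> \<theta> * (e' * exp (\<gamma> * t))"
          using t by (auto simp: expbd_def \<theta>_def mult_ac)
        also have "e' * exp (\<gamma> * t) = e / 2" by (simp add: e'_def exp_minus)
        also have "\<theta> * (e / 2) \<le> 1 * (e / 2)" using \<theta> e by (intro mult_right_mono) auto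
        finally show ?thesis using e by simp
      qed
      then show "\<exists>n0. \<forall>n\<ge>n0. norm (LP (\<lambda>s. \<Psi> s (picard r \<Psi> n s)) t - LP (\<lambda>s. \<Psi> s (w s)) t - 0) < e" by blast
    qed
    from tendsto_add[OF tendsto_const[of "r t"] LIM_zero_cancel[OF this]]
    show "(\<lambda>n. picard r \<Psi> (Suc n) t) \<longlonglongrightarrow> r t + LP (\<lambda>s. \<Psi> s (w s)) t" by simp
  qed
  with that wc wb lim show ?thesis by blast
qed

end

end

section \<open>Mild solutions versus solutions of the Lyapunov--Perron equation\<close>

definition conv :: "(real \<Rightarrow> 'h) \<Rightarrow> real \<Rightarrow> 'h" where
  "conv f t = (LINT s|lborel. indicator {0..t} s *\<^sub>R S (t - s) (f s))"

lemma S_split: "0 \<le> t \<Longrightarrow> S t x = SQ t x + E t x"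
  by (simp add: SQ_def E_nonneg flip: linear_add[OF S_linear] add: Pp_plus_Q add.commute)

lemma SQ_zero [simp]: "SQ t 0 = 0"
  by (rule linear_0[OF bounded_linear.linear[OF SQ_bl]])

lemma S_locally_bounded:
  obtains B where "0 < B" "\<And>t x. 0 \<le> t \<Longrightarrow> t \<le> T \<Longrightarrow> norm (S t x) \<le> B * norm x"
proof -
  obtain B1 where B1: "\<And>t x. \<bar>t\<bar> \<le> T \<Longrightarrow> norm (SQ t x) \<le> B1 * norm x"
    using SQ_locally_bounded[of T] by blast
  obtain B2 where B2: "\<And>t x. \<bar>t\<bar> \<le> T \<Longrightarrow> norm (E t x) \<le> B2 * norm x"
    by (metis E_locally_bounded[of T])
  have "norm (S t x) \<le> (\<bar>B1\<bar> + \<bar>B2\<bar> + 1) * norm x" if "0 \<le> t" "t \<le> T" for t x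
  proof -
    have "norm (S t x) \<le> B1 * norm x + B2 * norm x"
      unfolding S_split[OF that(1)] using that B1[of t x] B2[of t x]
      by (intro norm_triangle_le add_mono) auto
    also have "\<dots> \<le> (\<bar>B1\<bar> + \<bar>B2\<bar> + 1) * norm x"
      unfolding distrib_right[symmetric] by (intro mult_right_mono) auto
    finally show ?thesis .
  qed
  then show ?thesis by (rule that[rotated]) auto
qed

text \<open>\<open>S\<close> is meaningful for nonnegative times only. Continuity of the integrand
  up to \<open>s = t\<close> comes from the splitting into \<open>SQ\<close> and \<open>E\<close>,
  which are jointly continuous on the whole line.\<close>

lemma conv_integrable:
  assumes f: "continuous_on {0..} f" and t: "0 \<le> t"
  shows "integrable lborel (\<lambda>s. indicator {0..t} s *\<^sub>R S (t - s) (f s))"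
proof (rule borel_integrable_compact)
  have f': "continuous_on {0..t} f" using f by (rule continuous_on_subset) auto
  have "continuous_on {0..t} (\<lambda>s. SQ (t - s) (f s) + E (t - s) (f s))"
    by (intro continuous_on_add
        continuous_on_compose2[OF SQ_joint, of _ "\<lambda>s. (t - s, f s)", simplified]
        continuous_on_compose2[OF E_joint, of _ "\<lambda>s. (t - s, f s)", simplified]
        continuous_on_Pair continuous_intros f')
  then show "continuous_on {0..t} (\<lambda>s. S (t - s) (f s))"
    by (rule continuous_on_eq) (auto simp: S_split)
qed auto

context
  fixes \<gamma> :: real assumes \<gamma>: "\<beta> < \<gamma>" "\<gamma> < \<alpha>"
begin

text \<open>At time 0 the stable integral runs over a null set and only the unstable one is left.
  Hence the initial value of a Lyapunov--Perron solution has the free parameter as its stable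
  part.\<close>

lemma LP_0_unstable:
  assumes f: "dominated f \<gamma> M" "0 \<le> M"
  shows "Q (LP f 0) = 0" "Pp (LP f 0) = LP f 0"
proof -
  have "Q (LP f 0) = (LINT s|lborel. Q (Gr 0 s (indicator {0..} s *\<^sub>R f s)))"
    unfolding LP_def by (rule integral_bounded_linear[OF Q_bl LP_integrable[OF \<gamma> f], symmetric])
  also have "\<dots> = (LINT s::real|lborel. 0)"
  proof (rule integral_cong_AE)
    have "AE s in lborel. s \<noteq> (0::real)" by (rule AE_lborel_singleton)
    then show "AE s in lborel. Q (Gr 0 s (indicator {0..} s *\<^sub>R f s)) = 0"
      by eventually_elim (auto simp: Gr_def indicator_def linear_neg[OF Q_linear])
    show "(\<lambda>s. Q (Gr 0 s (indicator {0..} s *\<^sub>R f s))) \<in> borel_measurable lborel"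
      using f LP_meas[of f 0] borel_measurable_continuous_onI[OF linear_continuous_on[OF Q_bl]]
      by (intro measurable_compose[where f = "\<lambda>s. Gr 0 s (indicator {0..} s *\<^sub>R f s)" and g = Q]) (auto simp: dominated_def)
  qed simp
  finally show 1: "Q (LP f 0) = 0" by simp
  show "Pp (LP f 0) = LP f 0" using Pp_plus_Q[of "LP f 0"] 1 by simp
qed

text \<open>Transporting \<open>LP f 0\<close> by \<open>E t\<close> gives minus the unstable
  integral over the whole half-line; the unstable part of the Duhamel integral cancels it on
  \<open>{0..t}\<close> and leaves the tail.\<close>

lemma LP_conv:
  assumes f: "dominated f \<gamma> M" "0 \<le> M" and t: "0 \<le> t"
  shows "LP f t = conv f t + E t (LP f 0)"
proof -
  have fc: "continuous_on {0..} f" using f by (simp add: dominated_def)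
  note i0 = LP_integrable[OF \<gamma> f, of 0] and it = LP_integrable[OF \<gamma> f, of t]
  have iE: "integrable lborel (\<lambda>s. E t (Gr 0 s (indicator {0..} s *\<^sub>R f s)))"
    by (rule integrable_bounded_linear[OF E_bl i0])
  have "LP f t = (LINT s|lborel. indicator {0..t} s *\<^sub>R S (t - s) (f s) + E t (Gr 0 s (indicator {0..} s *\<^sub>R f s)))"
    unfolding LP_def
  proof (rule integral_cong_AE)
    have "AE s in lborel. s \<noteq> (0::real)" by (rule AE_lborel_singleton)
    then show "AE s in lborel. Gr t s (indicator {0..} s *\<^sub>R f s) =
        indicator {0..t} s *\<^sub>R S (t - s) (f s) + E t (Gr 0 s (indicator {0..} s *\<^sub>R f s))"
    proof eventually_elim
      case (elim s)
      then show ?case using t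
        by (auto simp: Gr_def indicator_def S_split linear_neg[OF E_linear] E_E)
    qed
  qed (use LP_meas[OF fc] conv_integrable[OF fc t] iE in auto)
  also have "\<dots> = conv f t + E t (LP f 0)"
    using conv_integrable[OF fc t] iE i0
    by (simp add: conv_def LP_def integral_bounded_linear[OF E_bl])
  finally show ?thesis .
qed

text \<open>A mild solution differs from the Lyapunov--Perron formula by \<open>E t D\<close>. This
  difference grows at most like \<open>exp (\<gamma> * t)\<close>, and going back by
  \<open>E (- t)\<close> gains the factor \<open>exp (- \<alpha> * t)\<close>; since \<gamma> <
  \<alpha>, the unstable part of \<open>D\<close> vanishes.\<close>

lemma mild_imp_LP:
  assumes f: "dominated f \<gamma> M" "0 \<le> M" and v: "expbd \<gamma> C v"
    and eq: "\<And>t. 0 \<le> t \<Longrightarrow> v t = S t x + conv f t"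
    and t: "0 \<le> t"
  shows "v t = S t (Q x) + LP f t"
proof -
  define D where "D = x - LP f 0"
  have split: "v t = S t (Q x) + LP f t + E t D" if "0 \<le> t" for t
    using eq[OF that] LP_conv[OF f that] that
    by (simp add: S_split[of t x] SQ_def D_def linear_diff[OF E_linear])
  define C' where "C' = C + K * norm x + K * M * kap \<gamma>"
  have ED: "norm (E t D) \<le> C' * exp (\<gamma> * t)" if t: "0 \<le> t" for t
  proof -
    have "norm (S t (Q x)) \<le> K * exp (\<beta> * t) * norm x" by (rule SQ_bound[OF t])
    also have "\<dots> \<le> K * exp (\<gamma> * t) * norm x"
      using t \<gamma> K_nonneg by (intro mult_right_mono mult_left_mono) (auto intro: mult_right_mono)
    finally have 1: "norm (S t (Q x)) \<le> K * exp (\<gamma> * t) * norm x" .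
    have "E t D = v t - S t (Q x) - LP f t" using split[OF t] by simp
    then have "norm (E t D) \<le> norm (v t) + norm (S t (Q x)) + norm (LP f t)"
      by (metis add_right_mono norm_triangle_ineq4 norm_triangle_le_diff)
    also have "\<dots> \<le> C * exp (\<gamma> * t) + K * exp (\<gamma> * t) * norm x + K * M * kap \<gamma> * exp (\<gamma> * t)"
      using v t by (intro add_mono 1 LP_le[OF \<gamma> f]) (auto simp: expbd_def)
    finally show ?thesis by (simp add: C'_def algebra_simps)
  qed
  have le: "norm (Pp D) \<le> K * C' * exp (- ((\<alpha> - \<gamma>) * t))" if t: "0 \<le> t" for t
  proof -
    have "norm (Pp D) = norm (E (- t) (E t D))" by (simp add: E_E)
    also have "\<dots> \<le> K * exp (\<alpha> * - t) * (C' * exp (\<gamma> * t))"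
      using K_nonneg t by (intro order.trans[OF E_bound] mult_left_mono ED) auto
    also have "\<dots> = K * C' * exp (- ((\<alpha> - \<gamma>) * t))" by (simp add: algebra_simps flip: exp_add)
    finally show ?thesis .
  qed
  have "((\<lambda>t. exp (- ((\<alpha> - \<gamma>) * t))) \<longlongrightarrow> 0) at_top"
    using \<gamma> by (intro filterlim_compose[OF exp_at_bot] filterlim_compose[OF filterlim_uminus_at_bot_at_top] filterlim_tendsto_pos_mult_at_top[OF tendsto_const _ filterlim_ident]) auto
  from tendsto_mult_right_zero[OF this]
  have "((\<lambda>t. K * C' * exp (- ((\<alpha> - \<gamma>) * t))) \<longlongrightarrow> 0) at_top" .
  then have "norm (Pp D) \<le> 0"
    by (rule tendsto_lowerbound) (auto simp: eventually_at_top_linorder intro!: exI[of _ 0] le)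
  then have "E t D = 0" using E_Pp[of t D] by simp
  then show ?thesis using split[OF t] by simp
qed

lemma LP_imp_mild:
  assumes f: "dominated f \<gamma> M" "0 \<le> M"
    and eq: "\<And>t. 0 \<le> t \<Longrightarrow> v t = S t \<xi> + LP f t" and \<xi>: "Q \<xi> = \<xi>"
    and t: "0 \<le> t"
  shows "v t = S t (v 0) + conv f t"
proof -
  have "S t (LP f 0) = E t (LP f 0)" using LP_0_unstable[OF f] t by (simp add: E_nonneg)
  then show ?thesis using eq[OF t] eq[of 0] LP_conv[OF f t] t
    by (simp add: linear_add[OF S_linear])
qed

end

text \<open>Uniqueness without a growth condition: on \<open>{0..T}\<close> the Duhamel operator is
  a contraction in the supremum norm weighted by \<open>exp (- l * t)\<close>.\<close>

lemma mild_unique: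
  assumes v: "continuous_on {0..} v" "continuous_on {0..} (\<lambda>s. g s (v s))"
      "\<And>t. 0 \<le> t \<Longrightarrow> v t = S t x + conv (\<lambda>s. g s (v s)) t"
    and w: "continuous_on {0..} w" "continuous_on {0..} (\<lambda>s. g s (w s))"
      "\<And>t. 0 \<le> t \<Longrightarrow> w t = S t x + conv (\<lambda>s. g s (w s)) t"
    and lip: "\<And>s a b. 0 \<le> s \<Longrightarrow> norm (g s a - g s b) \<le> L * norm (a - b)" and L: "0 \<le> L"
    and T: "0 \<le> T"
  shows "v T = w T"
proof -
  obtain B where B: "0 < B" "\<And>t x. 0 \<le> t \<Longrightarrow> t \<le> T \<Longrightarrow> norm (S t x) \<le> B * norm x"
    using S_locally_bounded[of T] by blast
  \<comment> \<open>With this rate \<open>B * L / l \<le> 1 / 2\<close>, which leads to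
    \<open>N \<le> N / 2\<close> for the weighted supremum of the difference.\<close>
  define l where "l = 2 * B * L + 1"
  have l: "0 < l" using B L by (simp add: l_def add_nonneg_pos)
  define X where "X = (\<lambda>t. norm (v t - w t) * exp (- (l * t))) ` {0..T}"
  define N where "N = Sup X"
  have cont: "continuous_on {0..T} (\<lambda>t. norm (v t - w t) * exp (- (l * t)))"
    by (intro continuous_intros continuous_on_subset[OF v(1)] continuous_on_subset[OF w(1)]) auto
  have bdd: "bdd_above X"
    unfolding X_def by (intro compact_imp_bounded[THEN bounded_imp_bdd_above] compact_continuous_image cont) auto
  have N: "norm (v t - w t) \<le> N * exp (l * t)" if "0 \<le> t" "t \<le> T" for t
  proof -
    have "norm (v t - w t) * exp (- (l * t)) \<le> N"
      unfolding N_def by (rule cSup_upper[OF _ bdd]) (use that in \<open>auto simp: X_def\<close>)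
    then show ?thesis by (simp add: exp_minus field_simps)
  qed
  have N0: "0 \<le> N" using order.trans[OF norm_ge_zero N[of 0]] T by simp
  have "norm (v t - w t) \<le> N / 2 * exp (l * t)" if t: "0 \<le> t" "t \<le> T" for t
  proof -
    note i = conv_integrable[OF v(2) t(1)] conv_integrable[OF w(2) t(1)]
    have eq: "v t - w t = (LINT s|lborel. indicator {0..t} s *\<^sub>R (S (t - s) (g s (v s)) - S (t - s) (g s (w s))))"
      unfolding v(3)[OF t(1)] w(3)[OF t(1)] using i by (simp add: conv_def scaleR_diff_right)
    have 1: "norm (v t - w t) \<le> (LINT s|lborel. B * L * N * (exp (l * s) * indicator {0..t} s))"
      unfolding eq
    proof (intro order.trans[OF integral_norm_bound] integral_mono)
      show "integrable lborel (\<lambda>s. norm (indicator {0..t} s *\<^sub>R (S (t - s) (g s (v s)) - S (t - s) (g s (w s)))))"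
        using Bochner_Integration.integrable_diff[OF i] by (simp add: scaleR_diff_right)
      have "integrable lborel (\<lambda>s. indicator {0..t} s *\<^sub>R exp (l * s))"
        by (intro borel_integrable_compact continuous_intros) auto
      then show "integrable lborel (\<lambda>s. B * L * N * (exp (l * s) * indicator {0..t} s))"
        by (simp add: mult.commute)
      fix s
      show "norm (indicator {0..t} s *\<^sub>R (S (t - s) (g s (v s)) - S (t - s) (g s (w s))))
          \<le> B * L * N * (exp (l * s) * indicator {0..t} s)"
      proof (cases "s \<in> {0..t}")
        case True
        then have s: "0 \<le> s" "s \<le> t" by auto
        have "norm (S (t - s) (g s (v s)) - S (t - s) (g s (w s))) = norm (S (t - s) (g s (v s) - g s (w s)))"
          using s by (simp add: linear_diff[OF S_linear])
        also have "\<dots> \<le> B * (L * (N * exp (l * s)))"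
          using s t B L N[of s] lip[OF s(1), of "v s" "w s"]
          by (intro order.trans[OF B(2)] mult_left_mono order.trans[OF lip]) auto
        finally show ?thesis using True by (simp add: mult_ac)
      qed simp
    qed
    have 2: "(LINT s|lborel. exp (l * s) * indicator {0..t} s) = exp (l * t) / l - exp (l * 0) / l"
      using l t by (intro integral_FTC_Icc_real) (auto intro!: derivative_eq_intros)
    have 3: "B * L * N * (exp (l * t) / l - exp (l * 0) / l) \<le> B * L * N * (exp (l * t) / l)"
      using B L N0 l by (intro mult_left_mono) auto
    have 4: "(B * L / l) * (N * exp (l * t)) \<le> (1 / 2) * (N * exp (l * t))"
      using N0 l B L by (intro mult_right_mono) (auto simp: l_def field_simps)
    show ?thesis using 1 3 4 by (simp add: 2)
  qed
  then have "norm (v t - w t) * exp (- (l * t)) \<le> N / 2" if "0 \<le> t" "t \<le> T" for t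
    using that by (fastforce simp: exp_minus divide_simps)
  then have "N \<le> N / 2"
    unfolding N_def using T by (intro cSup_least) (auto simp: X_def)
  with N0 have "N = 0" by simp
  with N[of T] T show ?thesis by simp
qed

end

subsection \<open>Set partitions of a list of directions and multilinear maps\<close>

primrec insertions :: "'a \<Rightarrow> 'a list list \<Rightarrow> 'a list list list" where
  "insertions a [] = []"
| "insertions a (B # P) = ((a # B) # P) # map ((#) B) (insertions a P)"

text \<open>The partitions into at least two blocks.  The recursion is the product rule: the derivative
  in direction \<open>a\<close> of \<open>D\<^sup>mF(v)[v\<^sub>B\<^sub>1, \<dots>, v\<^sub>B\<^sub>m]\<close> either adds the block \<open>[a]\<close> or puts \<open>a\<close> into one
  of the blocks.\<close>

primrec proper_parts :: "'a list \<Rightarrow> 'a list list list" where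
  "proper_parts [] = []"
| "proper_parts (a # vs) = (if vs = [] then []
     else [[a], vs] # concat (map (\<lambda>P. ([a] # P) # insertions a P) (proper_parts vs)))"

abbreviation norms :: "'a::real_normed_vector list \<Rightarrow> real" where
  "norms vs \<equiv> prod_list (map norm vs)"

lemma norms_nonneg: "0 \<le> norms vs"
  by (rule prod_list_nonneg) auto

lemma insertions_length: "P' \<in> set (insertions a P) \<Longrightarrow> length P' = length P"
  by (induction P arbitrary: P') auto

lemma insertions_sum: "P' \<in> set (insertions a P) \<Longrightarrow> sum_list (map length P') = Suc (sum_list (map length P))"
  by (induction P arbitrary: P') auto

lemma insertions_norms:
  "P' \<in> set (insertions a P) \<Longrightarrow> prod_list (map norms P') = norm a * prod_list (map norms P)"
  by (induction P arbitrary: P') auto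

lemma insertions_block:
  "P' \<in> set (insertions a P) \<Longrightarrow> B \<in> set P' \<Longrightarrow> B \<in> set P \<or> (\<exists>B0\<in>set P. B = a # B0)"
  by (induction P arbitrary: P') (auto, blast)

text \<open>That every block is shorter than the list makes the equation of each order linear in its
  unknown, with an inhomogeneity built from lower orders.\<close>

lemma proper_parts_props:
  assumes "P \<in> set (proper_parts vs)"
  shows "2 \<le> length P" "sum_list (map length P) = length vs"
    "B \<in> set P \<Longrightarrow> B \<noteq> [] \<and> length B < length vs \<and> set B \<subseteq> set vs"
  using assms
proof (induction vs arbitrary: P B)
  case (Cons a vs)
  {
    case 1
    then show ?case using Cons.IH(1) insertions_length by (fastforce split: if_splits)
  next
    case 2
    then show ?case using Cons.IH(2) insertions_sum by (fastforce split: if_splits)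
  next
    case 3
    then have "vs \<noteq> []" by auto
    with 3 consider "P = [[a], vs]" | P0 where "P0 \<in> set (proper_parts vs)" "P = [a] # P0"
      | P0 where "P0 \<in> set (proper_parts vs)" "P \<in> set (insertions a P0)" by auto
    then show ?case
    proof cases
      case 1
      then show ?thesis using 3 \<open>vs \<noteq> []\<close> by auto
    next
      case 2
      then show ?thesis using 3 \<open>vs \<noteq> []\<close> Cons.IH(3)[of B P0] by auto
    next
      case 3
      then show ?thesis using Cons.IH(3)[of _ P0] insertions_block[OF 3(2) \<open>B \<in> set P\<close>] by fastforce
    qed
  }
qed auto

lemma proper_parts_norms:
  "P \<in> set (proper_parts vs) \<Longrightarrow> prod_list (map norms P) = norms vs"
proof (induction vs arbitrary: P)
  case (Cons a vs)
  then show ?case by (auto simp: insertions_norms split: if_splits)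
qed auto

lemma insertions_map: "insertions (f a) (map (map f) P) = map (map (map f)) (insertions a P)"
  by (induction P) auto

lemma proper_parts_map: "proper_parts (map f vs) = map (map (map f)) (proper_parts vs)"
proof (induction vs)
  case (Cons a vs)
  then show ?case by (auto simp: map_concat o_def insertions_map)
qed simp

text \<open>Mapping both lists to the same constant list reduces this to naturality. It provides
  constants that depend on the order but not on the directions.\<close>

lemma length_proper_parts: "length vs = length ws \<Longrightarrow> length (proper_parts vs) = length (proper_parts ws)"
  by (metis length_map map_replicate_const proper_parts_map)

text \<open>The bound is carried as a parameter because it has to be uniform in the base point and
  explicit in the time.\<close>

definition mlin :: "nat \<Rightarrow> ('a::real_normed_vector list \<Rightarrow> 'b::real_normed_vector) \<Rightarrow> real \<Rightarrow> bool" where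
  "mlin m M b \<longleftrightarrow> 0 \<le> b \<and> bounded_multilinear_on UNIV m M \<and>
     (\<forall>vs. length vs = m \<longrightarrow> norm (M vs) \<le> b * norms vs)"

lemma mlin_le: "mlin m M b \<Longrightarrow> length vs = m \<Longrightarrow> norm (M vs) \<le> b * norms vs"
  by (simp add: mlin_def)

lemma mlinI:
  "bounded_multilinear_on UNIV m M \<Longrightarrow> 0 \<le> b \<Longrightarrow> (\<And>vs. length vs = m \<Longrightarrow> norm (M vs) \<le> b * norms vs) \<Longrightarrow> mlin m M b"
  by (simp add: mlin_def)

lemma multilinear_head:
  assumes "bounded_multilinear_on UNIV (Suc m) M" "length vs = m"
  shows "M ((x + y) # vs) = M (x # vs) + M (y # vs)" "M ((c *\<^sub>R x) # vs) = c *\<^sub>R M (x # vs)"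
    "M ((x - y) # vs) = M (x # vs) - M (y # vs)"
proof -
  have *: "M ((v + w) # vs) = M (v # vs) + M (w # vs) \<and> M ((c *\<^sub>R v) # vs) = c *\<^sub>R M (v # vs)" for v w c
    using assms(1)[unfolded bounded_multilinear_on_def, THEN conjunct1, rule_format, of "v # vs" 0 v w c] assms(2)
    by simp
  show "M ((x + y) # vs) = M (x # vs) + M (y # vs)" "M ((c *\<^sub>R x) # vs) = c *\<^sub>R M (x # vs)"
    using * by auto
  have "M (((x - y) + y) # vs) = M ((x - y) # vs) + M (y # vs)" using * by blast
  then show "M ((x - y) # vs) = M (x # vs) - M (y # vs)" by simp
qed

lemma multilinear_Cons:
  assumes "bounded_multilinear_on UNIV (Suc m) M"
  shows "bounded_multilinear_on UNIV m (\<lambda>vs. M (x # vs))"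
proof -
  obtain C where C: "\<And>vs. length vs = Suc m \<Longrightarrow> norm (M vs) \<le> C * norms vs"
    using assms by (auto simp: bounded_multilinear_on_def)
  have "\<exists>C. \<forall>vs. length vs = m \<and> set vs \<subseteq> UNIV \<longrightarrow> norm (M (x # vs)) \<le> C * norms vs"
  proof (intro exI[of _ "C * norm x"] allI impI)
    fix vs :: "'a list" assume "length vs = m \<and> set vs \<subseteq> UNIV"
    then show "norm (M (x # vs)) \<le> C * norm x * norms vs" using C[of "x # vs"] by (simp add: mult_ac)
  qed
  moreover have "M (x # vs[i := v + w]) = M (x # vs[i := v]) + M (x # vs[i := w]) \<and> M (x # vs[i := c *\<^sub>R v]) = c *\<^sub>R M (x # vs[i := v])"
    if "length vs = m" "i < m" for vs i v w c
    using assms[unfolded bounded_multilinear_on_def, THEN conjunct1, rule_format, of "x # vs" "Suc i" v w c] that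
    by simp
  ultimately show ?thesis unfolding bounded_multilinear_on_def by auto
qed

lemma mlin_Cons:
  assumes "mlin (Suc m) M b" shows "mlin m (\<lambda>vs. M (x # vs)) (b * norm x)"
proof (rule mlinI)
  fix vs :: "'a list" assume "length vs = m"
  then show "norm (M (x # vs)) \<le> b * norm x * norms vs"
    using mlin_le[OF assms, of "x # vs"] by (simp add: mult_ac)
qed (use assms multilinear_Cons in \<open>auto simp: mlin_def\<close>)

lemmas mlin_head = multilinear_head[OF conjunct1[OF conjunct2[OF mlin_def[THEN iffD1]]]]

lemma mlin_map_le:
  assumes "mlin (length P) M b" "\<And>B. B \<in> set P \<Longrightarrow> norm (X B) \<le> a B"
  shows "norm (M (map X P)) \<le> b * prod_list (map a P)"
proof -
  have "norms (map X P) \<le> prod_list (map a P)"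
    using assms(2)
  proof (induction P)
    case (Cons B P)
    have "0 \<le> a B" using Cons.prems[of B] norm_ge_zero[of "X B"] by (simp del: norm_ge_zero)
    then show ?case using Cons by (auto intro!: mult_mono prod_list_nonneg)
  qed simp
  moreover have "0 \<le> b" using assms(1) by (simp add: mlin_def)
  ultimately show ?thesis
    using mlin_le[OF assms(1), of "map X P"] by (meson length_map mult_left_mono order.trans)
qed

text \<open>The arguments are exchanged one at a time. The error \<open>e\<close> is relative to the
  bound \<open>a B\<close> of each argument, so every exchange costs the same factor.\<close>

lemma mlin_diff_le:
  assumes "mlin (length P) M b" "0 \<le> e"
    and "\<And>B. B \<in> set P \<Longrightarrow> norm (X B) \<le> a B" "\<And>B. B \<in> set P \<Longrightarrow> norm (Y B) \<le> a B"
    and "\<And>B. B \<in> set P \<Longrightarrow> norm (Y B - X B) \<le> e * a B"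
  shows "norm (M (map Y P) - M (map X P)) \<le> real (length P) * b * e * prod_list (map a P)"
  using assms
proof (induction P arbitrary: M b)
  case (Cons B P)
  have a0: "0 \<le> a C" if "C \<in> set (B # P)" for C
    using Cons.prems(3)[OF that] norm_ge_zero order.trans by blast
  have ap: "0 \<le> prod_list (map a P)" using a0 by (intro prod_list_nonneg) auto
  have b0: "0 \<le> b" using Cons.prems(1) by (simp add: mlin_def)
  have m: "mlin (Suc (length P)) M b" using Cons.prems(1) by simp
  have "M (map Y (B # P)) - M (map X (B # P)) =
      M ((Y B - X B) # map Y P) + (M (X B # map Y P) - M (X B # map X P))"
    using mlin_head(3)[OF m, of "map Y P" "Y B" "X B"] by simp
  then have "norm (M (map Y (B # P)) - M (map X (B # P))) \<le>
      norm (M ((Y B - X B) # map Y P)) + norm (M (X B # map Y P) - M (X B # map X P))"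
    by (metis norm_triangle_ineq)
  also have "norm (M (X B # map Y P) - M (X B # map X P)) \<le> real (length P) * (b * norm (X B)) * e * prod_list (map a P)"
    using Cons.prems by (intro Cons.IH[OF mlin_Cons[OF m]]) auto
  also have "\<dots> \<le> real (length P) * (b * a B) * e * prod_list (map a P)"
    using Cons.prems b0 ap by (intro mult_right_mono mult_left_mono) auto
  also have "norm (M ((Y B - X B) # map Y P)) \<le> b * norm (Y B - X B) * prod_list (map a P)"
    using Cons.prems by (intro mlin_map_le[OF mlin_Cons[OF m]]) auto
  also have "\<dots> \<le> b * (e * a B) * prod_list (map a P)"
    using Cons.prems b0 ap by (intro mult_right_mono mult_left_mono) auto
  finally show ?case by (simp add: algebra_simps)
qed simp

text \<open>The Leibniz rule as a bound: \<open>a\<close> measures a block, \<open>d\<close> the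
  same block with one more direction.\<close>

primrec leibniz_sum :: "('b \<Rightarrow> real) \<Rightarrow> ('b \<Rightarrow> real) \<Rightarrow> 'b list \<Rightarrow> real" where
  "leibniz_sum a d [] = 0"
| "leibniz_sum a d (B # P) = d B * prod_list (map a P) + a B * leibniz_sum a d P"

lemma leibniz_sum_nonneg:
  "(\<And>B. B \<in> set P \<Longrightarrow> 0 \<le> a B) \<Longrightarrow> (\<And>B. 0 \<le> d B) \<Longrightarrow> 0 \<le> leibniz_sum a d P"
proof (induction P)
  case (Cons B P)
  then have "0 \<le> prod_list (map a P)" by (intro prod_list_nonneg) auto
  then show ?case using Cons by simp
qed simp

text \<open>The Taylor remainder of a product. Splitting off the first block leaves the remainder of
  the other blocks (\<open>U1\<close>), a product of two differences (\<open>U2\<close>) and the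
  remainder of the first block (\<open>U3\<close>). The term \<open>U2\<close> is of the order
  \<open>e * h\<close> because a difference is bounded in two ways: one factor is taken as small
  relative to \<open>a\<close>, the other as at most \<open>h * d B\<close>.\<close>

lemma mlin_product_rule:
  assumes "mlin (length P) M b" "0 \<le> e" "0 \<le> h"
    and "\<And>B. B \<in> set P \<Longrightarrow> norm (X B) \<le> a B" "\<And>B. B \<in> set P \<Longrightarrow> norm (Y B) \<le> a B"
    and "\<And>B. B \<in> set P \<Longrightarrow> norm (Y B - X B) \<le> e * a B"
    and "\<And>B. B \<in> set P \<Longrightarrow> norm (Y B - X B) \<le> h * d B"
    and "\<And>B. B \<in> set P \<Longrightarrow> norm (Y B - X B - X (z # B)) \<le> e * h * d B"
    and d0: "\<And>B. 0 \<le> d B"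
  shows "norm (M (map Y P) - M (map X P) - (\<Sum>P'\<leftarrow>insertions z P. M (map X P')))
    \<le> real (length P) * b * e * h * leibniz_sum a d P"
  using assms(1-8)
proof (induction P arbitrary: M b)
  case (Cons B P)
  have a0: "0 \<le> a C" if "C \<in> set (B # P)" for C
    using Cons.prems(4)[OF that] norm_ge_zero order.trans by blast
  have ap: "0 \<le> prod_list (map a P)" using a0 by (intro prod_list_nonneg) auto
  have lp: "0 \<le> leibniz_sum a d P"
    using a0 d0 by (intro leibniz_sum_nonneg) auto
  have b0: "0 \<le> b" using Cons.prems(1) by (simp add: mlin_def)
  have m: "mlin (Suc (length P)) M b" using Cons.prems(1) by simp
  define U1 where "U1 = M (X B # map Y P) - M (X B # map X P) - (\<Sum>P'\<leftarrow>insertions z P. M (X B # map X P'))"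
  define U2 where "U2 = M ((Y B - X B) # map Y P) - M ((Y B - X B) # map X P)"
  define U3 where "U3 = M ((Y B - X B - X (z # B)) # map X P)"
  have U: "M (map Y (B # P)) - M (map X (B # P)) - (\<Sum>P'\<leftarrow>insertions z (B # P). M (map X P')) = U1 + U2 + U3"
    unfolding U1_def U2_def U3_def
    by (simp add: mlin_head(3)[OF m] o_def)
  have 1: "norm U1 \<le> real (length P) * (b * norm (X B)) * e * h * leibniz_sum a d P"
    unfolding U1_def using Cons.prems by (intro Cons.IH[OF mlin_Cons[OF m]]) auto
  have 1: "norm U1 \<le> real (length P) * (b * a B) * e * h * leibniz_sum a d P"
    using Cons.prems b0 lp by (intro order.trans[OF 1] mult_right_mono mult_left_mono) auto
  have 2: "norm U2 \<le> real (length P) * (b * norm (Y B - X B)) * e * prod_list (map a P)"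
    unfolding U2_def using Cons.prems by (intro mlin_diff_le[OF mlin_Cons[OF m]]) auto
  have 2: "norm U2 \<le> real (length P) * (b * (h * d B)) * e * prod_list (map a P)"
    using Cons.prems b0 ap by (intro order.trans[OF 2] mult_right_mono mult_left_mono) auto
  have 3: "norm U3 \<le> b * norm (Y B - X B - X (z # B)) * prod_list (map a P)"
    unfolding U3_def using Cons.prems by (intro mlin_map_le[OF mlin_Cons[OF m]]) auto
  have 3: "norm U3 \<le> b * (e * h * d B) * prod_list (map a P)"
    using Cons.prems b0 ap by (intro order.trans[OF 3] mult_right_mono mult_left_mono) auto
  \<comment> \<open>A nonnegative spare term: it raises the factor \<open>length P\<close> to
    \<open>length P + 1\<close> in the part of the Leibniz sum that comes from
    \<open>U1\<close>.\<close>
  have 4: "0 \<le> b * e * h * (a B * leibniz_sum a d P)"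
    using b0 Cons.prems(2,3) a0[of B] lp by simp
  have "norm (U1 + U2 + U3) \<le> norm U1 + norm U2 + norm U3"
    by (meson add_right_mono norm_triangle_ineq norm_triangle_le)
  also have "\<dots> \<le> real (length P) * (b * a B) * e * h * leibniz_sum a d P + real (length P) * (b * (h * d B)) * e * prod_list (map a P) + b * (e * h * d B) * prod_list (map a P) + b * e * h * (a B * leibniz_sum a d P)"
    using 1 2 3 4 by linarith
  also have "\<dots> = real (length (B # P)) * b * e * h * leibniz_sum a d (B # P)"
    by (simp add: algebra_simps)
  finally show ?case unfolding U .
qed simp

lemma multilinear_continuous:
  fixes M :: "'a::real_normed_vector list \<Rightarrow> 'b::real_normed_vector"
  assumes M: "mlin (length fs) M b" and fs: "\<And>f. f \<in> set fs \<Longrightarrow> (f \<longlongrightarrow> f s) (at s within A)"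
  shows "((\<lambda>t. M (map (\<lambda>f. f t) fs)) \<longlongrightarrow> M (map (\<lambda>f. f s) fs)) (at s within A)"
proof (rule LIM_zero_cancel, rule tendstoI)
  fix e :: real assume e: "0 < e"
  \<comment> \<open>The summand 1 leaves room for the values at nearby \<open>t\<close> and turns
    the absolute error \<open>e'\<close> into a relative one.\<close>
  define a where "a f = norm (f s) + 1" for f :: "'c \<Rightarrow> 'a"
  define C where "C = real (length fs) * b * prod_list (map a fs)"
  have "0 \<le> b" using M by (simp add: mlin_def)
  moreover have "0 \<le> prod_list (map a fs)" by (intro prod_list_nonneg) (auto simp: a_def)
  ultimately have C: "0 \<le> C" by (simp add: C_def)
  define e' where "e' = min 1 (e / (C + 1))"
  have e': "0 < e'" "e' \<le> 1" using e C by (auto simp: e'_def)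
  have "\<forall>\<^sub>F t in at s within A. \<forall>f\<in>set fs. norm (f t - f s) < e'"
    using e' by (intro eventually_ball_finite ballI tendstoD[OF fs, unfolded dist_norm]) auto
  then show "\<forall>\<^sub>F t in at s within A. dist (M (map (\<lambda>f. f t) fs) - M (map (\<lambda>f. f s) fs)) 0 < e"
  proof eventually_elim
    case (elim t)
    have "norm (M (map (\<lambda>f. f t) fs) - M (map (\<lambda>f. f s) fs)) \<le> real (length fs) * b * e' * prod_list (map a fs)"
    proof (rule mlin_diff_le[OF M])
      fix f assume "f \<in> set fs"
      with elim have f: "norm (f t - f s) < e'" by blast
      show "norm (f s) \<le> a f" by (simp add: a_def)
      show "norm (f t) \<le> a f" using f e' norm_triangle_sub[of "f t" "f s"] by (simp add: a_def)
      have "e' * 1 \<le> e' * a f" using e' by (intro mult_left_mono) (auto simp: a_def)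
      then show "norm (f t - f s) \<le> e' * a f" using f by simp
    qed (use e' in auto)
    also have "\<dots> = C * e'" by (simp add: C_def)
    also have "\<dots> < e"
    proof -
      have "C * e' \<le> C * (e / (C + 1))" using C by (intro mult_left_mono) (auto simp: e'_def)
      also have "\<dots> < e" using C e by (simp add: field_simps)
      finally show ?thesis .
    qed
    finally show ?case by simp
  qed
qed

subsection \<open>Weights\<close>

text \<open>\<open>q i\<close> is the exponential rate allotted to derivatives of order
  \<open>i\<close>. The surplus \<sigma> per additional factor pays for the growth of the m-th
  derivative of the scaled nonlinearity, which is at most of rate
  \<open>(m - 1) * \<sigma>\<close>.\<close>

locale weight =
  fixes q :: "nat \<Rightarrow> real" and \<sigma> :: real
  assumes superadd: "\<And>i j. 1 \<le> i \<Longrightarrow> 1 \<le> j \<Longrightarrow> q i + q j + \<sigma> \<le> q (i + j)"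
begin

lemma weight_sum:
  "P \<noteq> [] \<Longrightarrow> (\<And>B. B \<in> set P \<Longrightarrow> B \<noteq> []) \<Longrightarrow>
    (\<Sum>B\<leftarrow>P. q (length B)) + (real (length P) - 1) * \<sigma> \<le> q (sum_list (map length P))"
proof (induction P rule: list_nonempty_induct)
  case (cons B P)
  have "1 \<le> length B" "1 \<le> sum_list (map length P)"
    using cons by (cases P; auto simp: Suc_le_eq)+
  from superadd[OF this] cons show ?case by (simp add: algebra_simps)
qed auto

context
  fixes C s :: real assumes C: "0 \<le> C" and s: "0 \<le> s"
begin

lemma prod_weight: "prod_list (map (\<lambda>B. C * exp (q (length B) * s) * norms B) P) =
    C ^ length P * exp ((\<Sum>B\<leftarrow>P. q (length B)) * s) * prod_list (map norms P)"
  by (induction P) (auto simp: algebra_simps exp_add)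

lemma norms_blocks_nonneg: "0 \<le> prod_list (map norms P)"
  by (rule prod_list_nonneg) (auto simp: norms_nonneg)

lemma prod_weight_le:
  assumes "P \<noteq> []" "\<And>B. B \<in> set P \<Longrightarrow> B \<noteq> []"
  shows "exp ((real (length P) - 1) * \<sigma> * s) * prod_list (map (\<lambda>B. C * exp (q (length B) * s) * norms B) P)
    \<le> C ^ length P * exp (q (sum_list (map length P)) * s) * prod_list (map norms P)"
proof -
  have "exp ((real (length P) - 1) * \<sigma> * s) * exp ((\<Sum>B\<leftarrow>P. q (length B)) * s) \<le> exp (q (sum_list (map length P)) * s)"
    using mult_right_mono[OF weight_sum[OF assms] s] by (simp add: algebra_simps flip: exp_add)
  from mult_left_mono[OF this, of "C ^ length P * prod_list (map norms P)"]
  show ?thesis unfolding prod_weight by (simp add: mult_ac C norms_blocks_nonneg)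
qed

text \<open>In each term of the Leibniz sum exactly one block is longer by one, so superadditivity
  gives all of them the rate of the total length plus one; the factor \<open>length P\<close> counts
  the terms.\<close>

lemma leibniz_weight_le:
  assumes "P \<noteq> []" "\<And>B. B \<in> set P \<Longrightarrow> B \<noteq> []"
  shows "exp ((real (length P) - 1) * \<sigma> * s) *
      leibniz_sum (\<lambda>B. C * exp (q (length B) * s) * norms B) (\<lambda>B. C * exp (q (Suc (length B)) * s) * norms B) P
    \<le> real (length P) * C ^ length P * exp (q (Suc (sum_list (map length P))) * s) * prod_list (map norms P)"
  using assms
proof (induction P rule: list_nonempty_induct)
  case (cons B P)
  define a d where "a = (\<lambda>B::'a list. C * exp (q (length B) * s) * norms B)"
    and "d = (\<lambda>B::'a list. C * exp (q (Suc (length B)) * s) * norms B)"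
  define m n where "m = length P" and "n = sum_list (map length P)"
  have B: "1 \<le> length B" "1 \<le> n"
    using cons.prems[of B] cons.hyps cons.prems by (cases P; auto simp: Suc_le_eq n_def)+
  define R where "R = C ^ m * prod_list (map norms P)"
  have R: "0 \<le> R" using C norms_blocks_nonneg[of P] by (simp add: R_def)
  have ih: "exp ((real m - 1) * \<sigma> * s) * leibniz_sum a d P \<le> m * exp (q (Suc n) * s) * R"
    using cons by (simp add: a_def d_def m_def n_def R_def mult_ac)
  have pw: "exp ((real m - 1) * \<sigma> * s) * prod_list (map a P) \<le> exp (q n * s) * R"
    using prod_weight_le[of P] cons by (simp add: a_def m_def n_def R_def mult_ac)
  have e: "exp (real m * \<sigma> * s) = exp (\<sigma> * s) * exp ((real m - 1) * \<sigma> * s)"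
    by (simp add: algebra_simps flip: exp_add)
  have sup: "exp (\<sigma> * s) * (exp (q i * s) * exp (q j * s)) \<le> exp (q (i + j) * s)" if "1 \<le> i" "1 \<le> j" for i j
    using mult_right_mono[OF superadd[OF that] s] by (simp add: algebra_simps flip: exp_add)
  have "exp (real m * \<sigma> * s) * leibniz_sum a d (B # P) =
      exp (\<sigma> * s) * d B * (exp ((real m - 1) * \<sigma> * s) * prod_list (map a P)) +
      exp (\<sigma> * s) * a B * (exp ((real m - 1) * \<sigma> * s) * leibniz_sum a d P)"
    unfolding e leibniz_sum.simps by (simp add: distrib_left mult_ac)
  also have "\<dots> \<le> exp (\<sigma> * s) * d B * (exp (q n * s) * R) + exp (\<sigma> * s) * a B * (m * exp (q (Suc n) * s) * R)"
    using C norms_nonneg[of B] by (intro add_mono mult_left_mono pw ih) (auto simp: a_def d_def)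
  also have "\<dots> = (C * norms B * R) * (exp (\<sigma> * s) * (exp (q (Suc (length B)) * s) * exp (q n * s)) +
      m * (exp (\<sigma> * s) * (exp (q (length B) * s) * exp (q (Suc n) * s))))"
    by (simp add: a_def d_def algebra_simps)
  also have "\<dots> \<le> (C * norms B * R) * (exp (q (Suc (length B) + n) * s) + m * exp (q (length B + Suc n) * s))"
    using C norms_nonneg[of B] R B by (intro mult_left_mono add_mono sup) auto
  also have "\<dots> = real (length (B # P)) * C ^ length (B # P) * exp (q (Suc (sum_list (map length (B # P)))) * s) * prod_list (map norms (B # P))"
    by (simp add: m_def n_def R_def algebra_simps)
  finally show ?case by (simp add: a_def d_def m_def)
qed auto

end

end

subsection \<open>A criterion for smoothness\<close>

text \<open>Linearity in the directions other than the first is inherited from the derivative of lower order.\<close>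

lemma frechet_derivs_uptoI:
  fixes f :: "'a::real_normed_vector \<Rightarrow> 'b::real_normed_vector"
  assumes V: "subspace V"
    and D0: "\<And>x. x \<in> V \<Longrightarrow> D 0 x [] = f x"
    and head: "\<And>j x vs v w. j < k \<Longrightarrow> x \<in> V \<Longrightarrow> length vs = j \<Longrightarrow> set vs \<subseteq> V \<Longrightarrow> v \<in> V \<Longrightarrow> w \<in> V \<Longrightarrow>
        D (Suc j) x ((v + w) # vs) = D (Suc j) x (v # vs) + D (Suc j) x (w # vs)"
      "\<And>j x vs v c. j < k \<Longrightarrow> x \<in> V \<Longrightarrow> length vs = j \<Longrightarrow> set vs \<subseteq> V \<Longrightarrow> v \<in> V \<Longrightarrow>
        D (Suc j) x ((c *\<^sub>R v) # vs) = c *\<^sub>R D (Suc j) x (v # vs)"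
    and bd: "\<And>j x. j \<le> k \<Longrightarrow> x \<in> V \<Longrightarrow> \<exists>C. \<forall>vs. length vs = j \<and> set vs \<subseteq> V \<longrightarrow> norm (D j x vs) \<le> C * norms vs"
    and diff: "\<And>j x e. j < k \<Longrightarrow> x \<in> V \<Longrightarrow> 0 < e \<Longrightarrow> \<exists>d>0. \<forall>y\<in>V. dist y x < d \<longrightarrow>
        (\<forall>vs. length vs = j \<and> set vs \<subseteq> V \<longrightarrow>
           norm (D j y vs - D j x vs - D (Suc j) x ((y - x) # vs)) \<le> e * norm (y - x) * norms vs)"
    and cont: "\<And>j x e. j \<le> k \<Longrightarrow> x \<in> V \<Longrightarrow> 0 < e \<Longrightarrow> \<exists>d>0. \<forall>y\<in>V. dist y x < d \<longrightarrow>
        (\<forall>vs. length vs = j \<and> set vs \<subseteq> V \<longrightarrow> norm (D j y vs - D j x vs) \<le> e * norms vs)"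
  shows "frechet_derivs_upto k V f D"
proof -
  \<comment> \<open>A linear relation valid for \<open>D j\<close> at every base point holds for
    difference quotients in the direction \<open>a\<close>, hence for their limit. \<open>G\<close>
    is the defect of the relation for \<open>D (Suc j)\<close>; it is independent of
    \<open>e\<close> and bounded by \<open>e * N\<close>.\<close>
  have comb: "D (Suc j) x (a # u1) = p *\<^sub>R D (Suc j) x (a # u2) + c *\<^sub>R D (Suc j) x (a # u3)"
    if j: "j < k" and x: "x \<in> V" and a: "a \<in> V"
      and u: "length u1 = j" "set u1 \<subseteq> V" "length u2 = j" "set u2 \<subseteq> V" "length u3 = j" "set u3 \<subseteq> V"
      and eq: "\<And>y. y \<in> V \<Longrightarrow> D j y u1 = p *\<^sub>R D j y u2 + c *\<^sub>R D j y u3"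
    for j x a u1 u2 u3 p c
  proof -
    define G where "G = D (Suc j) x (a # u1) - (p *\<^sub>R D (Suc j) x (a # u2) + c *\<^sub>R D (Suc j) x (a # u3))"
    define N where "N = norm a * (norms u1 + \<bar>p\<bar> * norms u2 + \<bar>c\<bar> * norms u3)"
    have N: "0 \<le> N" unfolding N_def by (intro mult_nonneg_nonneg add_nonneg_nonneg norms_nonneg) auto
    have *: "norm G \<le> e * N" if e: "0 < e" for e
    proof -
      obtain d where d: "0 < d" "\<And>y vs. y \<in> V \<Longrightarrow> dist y x < d \<Longrightarrow> length vs = j \<Longrightarrow> set vs \<subseteq> V \<Longrightarrow>
          norm (D j y vs - D j x vs - D (Suc j) x ((y - x) # vs)) \<le> e * norm (y - x) * norms vs"
        using diff[OF j x e] by blast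
      define t where "t = d / (2 * (norm a + 1))"
      have t: "0 < t" using d by (simp add: t_def add_nonneg_pos)
      have ta: "t * norm a < d"
      proof -
        have "t * norm a \<le> t * (norm a + 1)" using t by (intro mult_left_mono) auto
        also have "\<dots> = d / 2"
          using norm_ge_zero[of a] unfolding t_def by (simp add: field_simps del: norm_ge_zero)
        finally show ?thesis using d by simp
      qed
      define y where "y = x + t *\<^sub>R a"
      have y: "y \<in> V" "dist y x < d" "y - x = t *\<^sub>R a"
        using x a V ta t by (auto simp: y_def subspace_add subspace_scale dist_norm)
      define r where "r u = D j y u - D j x u - t *\<^sub>R D (Suc j) x (a # u)" for u
      have r: "norm (r u) \<le> e * (t * norm a) * norms u" if "length u = j" "set u \<subseteq> V" for u
        using d(2)[OF y(1,2) that] that head(2)[OF j x that a, of t] t by (simp add: y(3) r_def)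
      have tG: "t *\<^sub>R G = - (r u1 - (p *\<^sub>R r u2 + c *\<^sub>R r u3))"
        using eq[OF x] eq[OF y(1)] by (simp add: r_def G_def algebra_simps)
      have "norm (t *\<^sub>R G) \<le> norm (r u1) + (\<bar>p\<bar> * norm (r u2) + \<bar>c\<bar> * norm (r u3))"
        unfolding tG norm_minus_cancel
        using norm_triangle_ineq4[of "r u1" "p *\<^sub>R r u2 + c *\<^sub>R r u3"] norm_triangle_ineq[of "p *\<^sub>R r u2" "c *\<^sub>R r u3"]
        by simp
      then have "t * norm G \<le> norm (r u1) + (\<bar>p\<bar> * norm (r u2) + \<bar>c\<bar> * norm (r u3))"
        using t by simp
      also have "\<dots> \<le> e * (t * norm a) * norms u1 + (\<bar>p\<bar> * (e * (t * norm a) * norms u2) + \<bar>c\<bar> * (e * (t * norm a) * norms u3))"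
        using u by (intro add_mono mult_left_mono r) auto
      also have "\<dots> = t * (e * N)" by (simp add: N_def algebra_simps)
      finally show ?thesis using t by simp
    qed
    have "norm G \<le> 0"
    proof (rule field_le_epsilon)
      fix e :: real assume e: "0 < e"
      have "norm G \<le> e / (N + 1) * N" using e N by (intro *) auto
      also have "\<dots> \<le> e" using e N by (simp add: field_simps)
      finally show "norm G \<le> 0 + e" by simp
    qed
    then show ?thesis by (simp add: G_def)
  qed
  have ml: "bounded_multilinear_on V j (D j x)" if "j \<le> k" "x \<in> V" for j x
    using that
  proof (induction j arbitrary: x)
    case 0
    then show ?case using bd[of 0 x] by (auto simp: bounded_multilinear_on_def)
  next
    case (Suc j)
    then have j: "j < k" by simp
    have "D (Suc j) x (vs[i := v + w]) = D (Suc j) x (vs[i := v]) + D (Suc j) x (vs[i := w]) \<and>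
        D (Suc j) x (vs[i := c *\<^sub>R v]) = c *\<^sub>R D (Suc j) x (vs[i := v])"
      if vs: "length vs = Suc j" "set vs \<subseteq> V" and i: "i < Suc j" and vw: "v \<in> V" "w \<in> V" for vs i v w c
    proof -
      obtain a us where us: "vs = a # us" "length us = j" "a \<in> V" "set us \<subseteq> V"
        using vs by (cases vs) auto
      show ?thesis
      proof (cases i)
        case 0
        then show ?thesis using us head[OF j Suc.prems(2) us(2,4)] vw by simp
      next
        case (Suc n)
        then have n: "n < j" using i by simp
        have sub: "set (us[n := z]) \<subseteq> V" if "z \<in> V" for z
          using that us(4) set_update_subset_insert[of us n z] by blast
        have m: "D j y (us[n := v + w]) = D j y (us[n := v]) + D j y (us[n := w]) \<and>
            D j y (us[n := c *\<^sub>R v]) = c *\<^sub>R D j y (us[n := v])" if "y \<in> V" for y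
          using Suc.IH[of y] that j n us vw unfolding bounded_multilinear_on_def by auto
        have "v + w \<in> V" "c *\<^sub>R v \<in> V" using V vw by (auto simp: subspace_add subspace_scale)
        then show ?thesis
          using comb[OF j Suc.prems(2) us(3), of "us[n := v + w]" "us[n := v]" "us[n := w]" 1 1]
            comb[OF j Suc.prems(2) us(3), of "us[n := c *\<^sub>R v]" "us[n := v]" "us[n := v]" c 0]
            us vw sub m Suc by simp
      qed
    qed
    then show ?case using bd[OF Suc.prems] by (auto simp: bounded_multilinear_on_def)
  qed
  show ?thesis
    unfolding frechet_derivs_upto_def using D0 ml diff cont by auto
qed

lemma norm_sum_list_le:
  fixes f :: "'a \<Rightarrow> 'b::real_normed_vector"
  shows "(\<And>x. x \<in> set xs \<Longrightarrow> norm (f x) \<le> c) \<Longrightarrow> norm (\<Sum>x\<leftarrow>xs. f x) \<le> real (length xs) * c"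
proof (induction xs)
  case (Cons x xs)
  then have "norm (f x) \<le> c" "norm (\<Sum>x\<leftarrow>xs. f x) \<le> real (length xs) * c" by auto
  then show ?case by (auto simp: algebra_simps intro: norm_triangle_le)
qed simp

lemma continuous_on_sum_list:
  fixes f :: "'a \<Rightarrow> 'c::topological_space \<Rightarrow> 'b::real_normed_vector"
  shows "(\<And>x. x \<in> set xs \<Longrightarrow> continuous_on A (f x)) \<Longrightarrow> continuous_on A (\<lambda>s. \<Sum>x\<leftarrow>xs. f x s)"
  by (induction xs) (auto intro!: continuous_intros)

lemma blocks_count: "(\<And>B. B \<in> set P \<Longrightarrow> B \<noteq> []) \<Longrightarrow> length P \<le> sum_list (map length P)"
proof (induction P)
  case (Cons B P)
  then have "1 \<le> length B" "length P \<le> sum_list (map length P)" by (auto simp: Suc_le_eq)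
  then show ?case by simp
qed simp

section \<open>Formal derivatives of the solution map: existence and uniform bounds\<close>

context dichotomy
begin

lemma dominated_diff:
  "dominated f \<gamma> M \<Longrightarrow> dominated g \<gamma> N \<Longrightarrow> dominated (\<lambda>s. f s - g s) \<gamma> (M + N)"
  unfolding dominated_def
  by (auto simp: linear_diff[OF Q_linear] linear_diff[OF Pp_linear] distrib_right
      intro!: continuous_on_diff norm_triangle_le_diff add_mono)

text \<open>A common bound for both projections. It is applied to inhomogeneous terms only, whose
  constants do not enter the gap condition.\<close>

definition NP :: real where "NP = onorm Pp + onorm Q"

lemma NP_nonneg: "0 \<le> NP" and NP_Pp: "norm (Pp x) \<le> NP * norm x" and NP_Q: "norm (Q x) \<le> NP * norm x"
proof -
  have 0: "0 \<le> onorm Pp" "0 \<le> onorm Q" using onorm_pos_le Pp_bl Q_bl by blast+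
  then show "0 \<le> NP" by (simp add: NP_def)
  show "norm (Pp x) \<le> NP * norm x"
    using onorm[OF Pp_bl, of x] 0 mult_right_mono[of "onorm Pp" NP "norm x"] by (simp add: NP_def)
  show "norm (Q x) \<le> NP * norm x"
    using onorm[OF Q_bl, of x] 0 mult_right_mono[of "onorm Q" NP "norm x"] by (simp add: NP_def)
qed

definition V :: "'h set" where "V = range Q"

lemma in_V: "x \<in> V \<longleftrightarrow> Q x = x"
  by (simp add: V_def in_range_Q)

lemma V_subspace: "subspace V"
  unfolding V_def by (rule linear_subspace_image[OF Q_linear subspace_UNIV])

text \<open>Built on \<open>nhds\<close> rather than on \<open>at\<close>, so that the centre shares
  every eventual property; \<open>near_self\<close> uses this to specialise bounds to
  \<open>x\<close> itself.\<close>

definition near :: "'h \<Rightarrow> 'h filter" where "near x = inf (nhds x) (principal V)"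

lemma eventually_near: "eventually P (near x) \<longleftrightarrow> (\<exists>d>0. \<forall>y\<in>V. dist y x < d \<longrightarrow> P y)"
  unfolding near_def eventually_inf_principal eventually_nhds_metric by auto

lemma near_self: "eventually P (near x) \<Longrightarrow> x \<in> V \<Longrightarrow> P x"
  unfolding eventually_near by (metis dist_self)

lemma near_V: "eventually (\<lambda>y. y \<in> V) (near x)"
  unfolding eventually_near by (auto intro: exI[of _ 1])

lemma S_V: "0 \<le> t \<Longrightarrow> a \<in> V \<Longrightarrow> S t a = SQ t a"
  by (simp add: SQ_def in_V)

lemma S_V_expbd: "\<beta> \<le> \<gamma> \<Longrightarrow> a \<in> V \<Longrightarrow> expbd \<gamma> (K * norm a) (\<lambda>t. S t a)"
  unfolding expbd_def
proof (intro allI impI)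
  fix t :: real assume "\<beta> \<le> \<gamma>" "a \<in> V" and t: "0 \<le> t"
  then have "norm (S t a) \<le> K * exp (\<beta> * t) * norm a"
    using SQ_le[of t a] by (simp add: S_V)
  also have "\<dots> \<le> K * exp (\<gamma> * t) * norm a"
    using t \<open>\<beta> \<le> \<gamma>\<close> K_nonneg by (intro mult_right_mono mult_left_mono) (auto intro: mult_right_mono)
  finally show "norm (S t a) \<le> K * norm a * exp (\<gamma> * t)" by (simp add: mult_ac)
qed

lemma S_V_cont: "a \<in> V \<Longrightarrow> continuous_on {0..} (\<lambda>t. S t a)"
  by (rule continuous_on_eq[of _ "\<lambda>t. SQ t a"]) (auto simp: S_V intro: continuous_on_subset[OF SQ_cont])

definition good :: "real \<Rightarrow> real \<Rightarrow> bool" where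
  "good L \<gamma> \<longleftrightarrow> \<beta> < \<gamma> \<and> \<gamma> < \<alpha> \<and> K * L * kap \<gamma> < 1"

end

text \<open>\<open>Dg m s\<close> plays the role of the m-th derivative of the nonlinearity at time
  \<open>s\<close>. Smallness and Taylor estimates are asked only along trajectories near a given
  one and only up to a factor \<open>exp (\<tau> * s)\<close>, which \<open>p_\<tau>_q\<close> moves
  into the weight. By \<open>p_q_Suc\<close>, all terms of a Taylor remainder are finite in the
  weight of the longer list.\<close>

locale smooth_LP = dichotomy S Pp \<alpha> \<beta> K + p: weight p \<sigma> + q: weight q \<sigma>
  for S :: "real \<Rightarrow> 'h::{banach,second_countable_topology} \<Rightarrow> 'h" and Pp \<alpha> \<beta> K p q \<sigma> +
  fixes L \<tau> :: real and k :: nat and v :: "'h \<Rightarrow> real \<Rightarrow> 'h"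
    and Dg :: "nat \<Rightarrow> real \<Rightarrow> 'h \<Rightarrow> 'h list \<Rightarrow> 'h"
  assumes L: "0 \<le> L" and \<sigma>: "0 \<le> \<sigma>" and \<tau>: "0 \<le> \<tau>" and k: "1 \<le> k"
    and p_\<tau>_q: "\<And>j. 1 \<le> j \<Longrightarrow> p j + \<tau> \<le> q j" and p_q_Suc: "\<And>j. 1 \<le> j \<Longrightarrow> p j \<le> q (Suc j)"
    and gap_p: "\<And>j. 1 \<le> j \<Longrightarrow> j \<le> k \<Longrightarrow> good L (p j)"
    and gap_q: "\<And>j. 1 \<le> j \<Longrightarrow> j \<le> k \<Longrightarrow> good L (q j)"
    and v_cont: "\<And>x. x \<in> V \<Longrightarrow> continuous_on {0..} (v x)"
    and v_bd: "\<And>x. x \<in> V \<Longrightarrow> \<exists>C. expbd (p 1) C (v x)"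
    and v_eq: "\<And>x t. x \<in> V \<Longrightarrow> 0 \<le> t \<Longrightarrow> v x t = S t x + LP (\<lambda>s. Dg 0 s (v x s) []) t"
    and Dg_ml: "\<And>m s X. m \<le> k \<Longrightarrow> 0 \<le> s \<Longrightarrow> bounded_multilinear_on UNIV m (Dg m s X)"
    and Dg_lip_Q: "\<And>s X Y. 0 \<le> s \<Longrightarrow> norm (Q (Dg 0 s X [] - Dg 0 s Y [])) \<le> L * norm (X - Y)"
    and Dg_lip_P: "\<And>s X Y. 0 \<le> s \<Longrightarrow> norm (Pp (Dg 0 s X [] - Dg 0 s Y [])) \<le> L * norm (X - Y)"
    and Dg_zero: "\<And>s. 0 \<le> s \<Longrightarrow> Dg 0 s 0 [] = 0"
    and Dg_1_Q: "\<And>s X w. 0 \<le> s \<Longrightarrow> norm (Q (Dg 1 s X [w])) \<le> L * norm w"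
    and Dg_1_P: "\<And>s X w. 0 \<le> s \<Longrightarrow> norm (Pp (Dg 1 s X [w])) \<le> L * norm w"
    and Dg_cont: "\<And>x fs. x \<in> V \<Longrightarrow> length fs \<le> k \<Longrightarrow> (\<And>f. f \<in> set fs \<Longrightarrow> continuous_on {0..} f) \<Longrightarrow>
        continuous_on {0..} (\<lambda>s. Dg (length fs) s (v x s) (map (\<lambda>f. f s) fs))"
    and Dg_bd: "\<And>x. x \<in> V \<Longrightarrow> \<exists>B\<ge>0. \<forall>\<^sub>F y in near x. \<forall>m s vs. 1 \<le> m \<and> m \<le> k \<and> 0 \<le> s \<and> length vs = m \<longrightarrow>
        norm (Dg m s (v y s) vs) \<le> B * exp ((real m - 1) * \<sigma> * s) * norms vs"
    and Dg_near: "\<And>x e. x \<in> V \<Longrightarrow> 0 < e \<Longrightarrow> \<forall>\<^sub>F y in near x. \<forall>m s vs. 1 \<le> m \<and> m \<le> k \<and> 0 \<le> s \<and> length vs = m \<longrightarrow>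
        norm (Dg m s (v y s) vs - Dg m s (v x s) vs) \<le> e * exp (((real m - 1) * \<sigma> + \<tau>) * s) * norms vs"
    and Dg_deriv: "\<And>x e. x \<in> V \<Longrightarrow> 0 < e \<Longrightarrow> \<forall>\<^sub>F y in near x. \<forall>m s vs. m < k \<and> 0 \<le> s \<and> length vs = m \<longrightarrow>
        norm (Dg m s (v y s) vs - Dg m s (v x s) vs - Dg (Suc m) s (v x s) ((v y s - v x s) # vs))
          \<le> e * exp ((real m * \<sigma> + \<tau>) * s) * norm (v y s - v x s) * norms vs"
begin

lemma goodD: "good L \<gamma> \<Longrightarrow> \<beta> < \<gamma>" "good L \<gamma> \<Longrightarrow> \<gamma> < \<alpha>" "good L \<gamma> \<Longrightarrow> K * L * kap \<gamma> < 1"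
  by (auto simp: good_def)

text \<open>The part of the Faa di Bruno formula that involves lower orders only. The partition with
  a single block is the linear term in the unknown itself and is added in
  \<open>total\<close>.\<close>

definition rhs :: "('h \<Rightarrow> 'h list \<Rightarrow> real \<Rightarrow> 'h) \<Rightarrow> 'h \<Rightarrow> 'h list \<Rightarrow> real \<Rightarrow> 'h" where
  "rhs W x vs s = (\<Sum>P\<leftarrow>proper_parts vs. Dg (length P) s (v x s) (map (\<lambda>B. W x B s) P))"

definition total :: "('h \<Rightarrow> 'h list \<Rightarrow> real \<Rightarrow> 'h) \<Rightarrow> 'h \<Rightarrow> 'h list \<Rightarrow> real \<Rightarrow> 'h" where
  "total W x vs s = Dg 1 s (v x s) [W x vs s] + rhs W x vs s"

text \<open>The derivatives of the linear map that sends \<xi> to \<open>S t \<xi>\<close>: only the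
  first one is nonzero.\<close>

definition free :: "'h list \<Rightarrow> real \<Rightarrow> 'h" where
  "free vs t = (if length vs = 1 then S t (hd vs) else 0)"

definition sol :: "('h \<Rightarrow> 'h list \<Rightarrow> real \<Rightarrow> 'h) \<Rightarrow> 'h \<Rightarrow> 'h list \<Rightarrow> bool" where
  "sol W x vs \<longleftrightarrow> continuous_on {0..} (W x vs) \<and> (\<exists>C. expbd (p (length vs)) C (W x vs)) \<and>
     (\<forall>t\<ge>0. W x vs t = free vs t + LP (total W x vs) t)"

definition dirs :: "nat \<Rightarrow> 'h list set" where
  "dirs n = {vs. vs \<noteq> [] \<and> length vs \<le> n \<and> set vs \<subseteq> V}"

text \<open>The convention for the empty list lets one definition of the Taylor remainder serve the
  solution and all its derivatives. It is stated apart because the equation at order 0 is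
  nonlinear.\<close>

definition sols :: "nat \<Rightarrow> ('h \<Rightarrow> 'h list \<Rightarrow> real \<Rightarrow> 'h) \<Rightarrow> bool" where
  "sols n W \<longleftrightarrow> (\<forall>x\<in>V. W x [] = v x) \<and> (\<forall>x\<in>V. \<forall>vs\<in>dirs n. sol W x vs)"

lemma part_blocks:
  assumes "vs \<in> dirs n" "P \<in> set (proper_parts vs)"
  shows "P \<noteq> []" "length P \<le> length vs" "\<And>B. B \<in> set P \<Longrightarrow> B \<in> dirs (length vs - 1)"
    "\<And>B. B \<in> set P \<Longrightarrow> B \<noteq> []" "sum_list (map length P) = length vs"
    "prod_list (map norms P) = norms vs"
proof -
  note pr = proper_parts_props[OF assms(2)]
  show "P \<noteq> []" "sum_list (map length P) = length vs" "\<And>B. B \<in> set P \<Longrightarrow> B \<noteq> []"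
    using pr by auto
  then show "length P \<le> length vs" using blocks_count[of P] by simp
  show "B \<in> dirs (length vs - 1)" if "B \<in> set P" for B
    using pr(3)[OF that] assms(1) by (auto simp: dirs_def)
  show "prod_list (map norms P) = norms vs" by (rule proper_parts_norms[OF assms(2)])
qed

definition Dbound :: "real \<Rightarrow> 'h \<Rightarrow> bool" where
  "Dbound B y \<longleftrightarrow> 0 \<le> B \<and> (\<forall>m s vs. 1 \<le> m \<and> m \<le> k \<and> 0 \<le> s \<and> length vs = m \<longrightarrow>
        norm (Dg m s (v y s) vs) \<le> B * exp ((real m - 1) * \<sigma> * s) * norms vs)"

text \<open>\<open>1 \<le> C\<close> makes the powers of \<open>C\<close> monotone, so that
  \<open>C ^ k\<close> bounds the contribution of partitions with any number of blocks up to
  \<open>k\<close>.\<close>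

definition Wbound :: "real \<Rightarrow> ('h \<Rightarrow> 'h list \<Rightarrow> real \<Rightarrow> 'h) \<Rightarrow> nat \<Rightarrow> 'h \<Rightarrow> bool" where
  "Wbound C W n y \<longleftrightarrow> 1 \<le> C \<and> (\<forall>vs\<in>dirs n. expbd (p (length vs)) (C * norms vs) (W y vs))"

lemma Dbound_mlin:
  assumes "Dbound B y" "1 \<le> m" "m \<le> k" "0 \<le> s"
  shows "mlin m (Dg m s (v y s)) (B * exp ((real m - 1) * \<sigma> * s))"
  using assms Dg_ml by (intro mlinI) (auto simp: Dbound_def)

lemma Wbound_mono: "Wbound C W n y \<Longrightarrow> C \<le> C' \<Longrightarrow> m \<le> n \<Longrightarrow> Wbound C' W m y"
  unfolding Wbound_def
proof (intro conjI ballI)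
  fix vs assume *: "1 \<le> C \<and> (\<forall>vs\<in>dirs n. expbd (p (length vs)) (C * norms vs) (W y vs))" "C \<le> C'" "m \<le> n" "vs \<in> dirs m"
  then have "vs \<in> dirs n" by (auto simp: dirs_def)
  with * have "expbd (p (length vs)) (C * norms vs) (W y vs)" by blast
  then show "expbd (p (length vs)) (C' * norms vs) (W y vs)"
    using * norms_nonneg[of vs] unfolding expbd_def
    by (meson exp_ge_zero mult_right_mono order.trans)
qed auto

lemma WboundD:
  assumes "Wbound C W n y" "B \<in> dirs n" "0 \<le> s"
  shows "norm (W y B s) \<le> C * exp (p (length B) * s) * norms B"
  using assms unfolding Wbound_def expbd_def by (auto simp: mult_ac)

lemma Wbound_q:
  assumes "Wbound C W n y" "B \<in> dirs n" "0 \<le> s"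
  shows "norm (W y B s) \<le> C * exp (q (length B) * s) * norms B"
proof -
  have "1 \<le> length B" using assms(2) by (auto simp: dirs_def Suc_le_eq)
  then have "p (length B) \<le> q (length B)" using p_\<tau>_q \<tau> by (metis add_increasing2 order.trans order.refl)
  then have "exp (p (length B) * s) \<le> exp (q (length B) * s)" using assms(3) by (simp add: mult_right_mono)
  then have "C * exp (p (length B) * s) * norms B \<le> C * exp (q (length B) * s) * norms B"
    using assms(1) norms_nonneg[of B] by (intro mult_right_mono mult_left_mono) (auto simp: Wbound_def)
  with WboundD[OF assms] show ?thesis by linarith
qed

lemma Dg_blocks_le:
  assumes D: "Dbound B0 y" and C: "1 \<le> C" and s: "0 \<le> s" and P: "P \<noteq> []" "\<And>B. B \<in> set P \<Longrightarrow> B \<noteq> []" "length P \<le> k"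
    and w: "weight w \<sigma>"
    and X: "\<And>B. B \<in> set P \<Longrightarrow> norm (X B) \<le> C * exp (w (length B) * s) * norms B"
  shows "norm (Dg (length P) s (v y s) (map X P))
    \<le> B0 * C ^ k * exp (w (sum_list (map length P)) * s) * prod_list (map norms P)"
proof -
  let ?a = "\<lambda>B. C * exp (w (length B) * s) * norms B"
  have m: "1 \<le> length P" using P(1) by (simp add: Suc_le_eq)
  have "norm (Dg (length P) s (v y s) (map X P)) \<le> B0 * exp ((real (length P) - 1) * \<sigma> * s) * prod_list (map ?a P)"
    by (rule mlin_map_le[OF Dbound_mlin[OF D m P(3) s] X])
  also have "\<dots> = B0 * (exp ((real (length P) - 1) * \<sigma> * s) * prod_list (map ?a P))" by simp
  also have "\<dots> \<le> B0 * (C ^ length P * exp (w (sum_list (map length P)) * s) * prod_list (map norms P))"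
    using D C by (intro mult_left_mono weight.prod_weight_le[OF w _ s P(1,2)]) (auto simp: Dbound_def)
  also have "\<dots> \<le> B0 * (C ^ k * exp (w (sum_list (map length P)) * s) * prod_list (map norms P))"
    using D C P(3)
    by (intro mult_left_mono mult_right_mono power_increasing prod_list_nonneg) (auto simp: Dbound_def norms_nonneg)
  finally show ?thesis by (simp add: mult_ac)
qed

lemma rhs_le:
  assumes D: "Dbound B0 y" and W: "Wbound C W (length vs - 1) y" and vs: "vs \<in> dirs k" and s: "0 \<le> s"
  shows "norm (rhs W y vs s) \<le> real (length (proper_parts vs)) * (B0 * C ^ k * exp (p (length vs) * s) * norms vs)"
  unfolding rhs_def
proof (rule norm_sum_list_le)
  fix P assume P: "P \<in> set (proper_parts vs)"
  note pb = part_blocks[OF vs P]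
  have "length P \<le> k" using pb(2) vs by (auto simp: dirs_def)
  from Dg_blocks_le[OF D _ s pb(1,4) this p.weight_axioms, of C "\<lambda>B. W y B s"] pb WboundD[OF W _ s] W
  show "norm (Dg (length P) s (v y s) (map (\<lambda>B. W y B s) P)) \<le> B0 * C ^ k * exp (p (length vs) * s) * norms vs"
    by (simp add: Wbound_def)
qed

lemma rhs_cont:
  assumes x: "x \<in> V" and vs: "vs \<in> dirs k" and W: "\<And>B. B \<in> dirs (length vs - 1) \<Longrightarrow> continuous_on {0..} (W x B)"
  shows "continuous_on {0..} (rhs W x vs)"
  unfolding rhs_def
proof (rule continuous_on_sum_list)
  fix P assume P: "P \<in> set (proper_parts vs)"
  note pb = part_blocks[OF vs P]
  have "length P \<le> k" using pb(2) vs by (auto simp: dirs_def)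
  then show "continuous_on {0..} (\<lambda>s. Dg (length P) s (v x s) (map (\<lambda>B. W x B s) P))"
    using Dg_cont[OF x, of "map (W x) P"] W pb(3) by (auto simp: o_def)
qed

lemma Dg_1_cont: "x \<in> V \<Longrightarrow> continuous_on {0..} w \<Longrightarrow> continuous_on {0..} (\<lambda>s. Dg 1 s (v x s) [w s])"
  using Dg_cont[of x "[w]"] k by simp

lemma Dg_1_linear:
  assumes "0 \<le> s"
  shows "Dg 1 s X [a - b] = Dg 1 s X [a] - Dg 1 s X [b]" "Dg 1 s X [a + b] = Dg 1 s X [a] + Dg 1 s X [b]"
    "Dg 1 s X [c *\<^sub>R a] = c *\<^sub>R Dg 1 s X [a]"
  using multilinear_head[of 0 "Dg 1 s X" "[]"] Dg_ml[of 1 s X] k assms by auto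

lemma free_cont: "vs \<in> dirs n \<Longrightarrow> continuous_on {0..} (free vs)"
proof (cases "length vs = 1")
  case True
  moreover assume "vs \<in> dirs n"
  ultimately show ?thesis unfolding free_def[abs_def] by (cases vs) (auto simp: dirs_def S_V_cont)
qed (simp add: free_def[abs_def])

lemma free_expbd: "vs \<in> dirs n \<Longrightarrow> \<beta> \<le> \<gamma> \<Longrightarrow> expbd \<gamma> (K * norms vs) (free vs)"
proof -
  assume vs: "vs \<in> dirs n" and \<gamma>: "\<beta> \<le> \<gamma>"
  show ?thesis
  proof (cases "length vs = 1")
    case True
    then obtain a where "vs = [a]" by (cases vs) auto
    then show ?thesis using S_V_expbd[OF \<gamma>, of a] vs by (simp add: free_def[abs_def] dirs_def)
  next
    case False
    then show ?thesis using K_nonneg norms_nonneg[of vs] by (simp add: free_def expbd_def)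
  qed
qed

text \<open>The linear term keeps the constant \<open>L\<close> of the gap condition; only the known
  part pays the factor \<open>NP\<close>.\<close>

lemma total_bounds:
  assumes "0 \<le> s" "norm (rhs W x vs s) \<le> \<rho>"
  shows "norm (Q (total W x vs s)) \<le> L * norm (W x vs s) + NP * \<rho>"
    "norm (Pp (total W x vs s)) \<le> L * norm (W x vs s) + NP * \<rho>"
proof -
  have "norm (Q (rhs W x vs s)) \<le> NP * \<rho>" "norm (Pp (rhs W x vs s)) \<le> NP * \<rho>"
    using NP_Q[of "rhs W x vs s"] NP_Pp[of "rhs W x vs s"] mult_left_mono[OF assms(2) NP_nonneg] by linarith+
  then show "norm (Q (total W x vs s)) \<le> L * norm (W x vs s) + NP * \<rho>"
    "norm (Pp (total W x vs s)) \<le> L * norm (W x vs s) + NP * \<rho>"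
    using Dg_1_Q[OF assms(1)] Dg_1_P[OF assms(1)]
    by (auto simp: total_def linear_add[OF Q_linear] linear_add[OF Pp_linear] intro!: norm_triangle_le add_mono)
qed

text \<open>\<open>a_priori\<close> bounds each order by the lower ones with constants that involve
  only \<open>C\<close>, \<open>B0\<close> and the order. The bound is therefore uniform on a
  neighbourhood of \<open>x\<close> and in the directions.\<close>

lemma W_bounded:
  assumes "sols n W" "n \<le> k" "x \<in> V"
  shows "\<exists>C. \<forall>\<^sub>F y in near x. Wbound C W n y"
  using assms(1,2)
proof (induction n)
  case 0
  then show ?case by (auto simp: Wbound_def dirs_def intro!: exI[of _ 1] always_eventually)
next
  case (Suc n)
  have "sols n W" using Suc.prems by (auto simp: sols_def dirs_def)
  then obtain C where C: "\<forall>\<^sub>F y in near x. Wbound C W n y" using Suc by auto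
  obtain B0 where B0: "0 \<le> B0" "\<forall>\<^sub>F y in near x. Dbound B0 y"
    using Dg_bd[OF assms(3)] by (auto simp: Dbound_def)
  define j where "j = Suc n"
  have j: "1 \<le> j" "j \<le> k" using Suc.prems by (auto simp: j_def)
  note g = goodD[OF gap_p[OF j]]
  \<comment> \<open>The number of partitions depends only on the length, so any list of length
    \<open>j\<close> may stand in.\<close>
  define N where "N = real (length (proper_parts (replicate j (0::'h))))"
  define \<theta> where "\<theta> = 1 - K * L * kap (p j)"
  have \<theta>: "0 < \<theta>" using g by (simp add: \<theta>_def)
  define C' where "C' = (K + K * (NP * (N * (B0 * C ^ k))) * kap (p j)) / \<theta>"
  have "\<forall>\<^sub>F y in near x. Wbound (max C C') W (Suc n) y"
    using C B0(2) near_V[of x]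
  proof eventually_elim
    case (elim y)
    have C1: "1 \<le> C" using elim by (simp add: Wbound_def)
    have "expbd (p (length vs)) (max C C' * norms vs) (W y vs)" if vs: "vs \<in> dirs (Suc n)" for vs
    proof (cases "length vs \<le> n")
      case True
      then have "vs \<in> dirs n" using vs by (auto simp: dirs_def)
      then show ?thesis using Wbound_mono[OF elim(1), of "max C C'" n] by (auto simp: Wbound_def)
    next
      case False
      then have len: "length vs = j" using vs by (auto simp: dirs_def j_def)
      have vk: "vs \<in> dirs k" using vs j by (auto simp: dirs_def j_def)
      have so: "sol W y vs" using Suc.prems elim(3) vs by (auto simp: sols_def)
      have "N = real (length (proper_parts vs))" using length_proper_parts[of vs "replicate j (0::'h)"] len by (simp add: N_def)
      then have r: "norm (rhs W y vs s) \<le> N * (B0 * C ^ k * exp (p j * s) * norms vs)" if "0 \<le> s" for s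
        using rhs_le[OF elim(2) _ vk that, of C W] elim(1) len by (simp add: j_def)
      define \<rho> where "\<rho> = NP * (N * (B0 * C ^ k)) * norms vs"
      have \<rho>: "0 \<le> \<rho>" using NP_nonneg B0 C1 norms_nonneg[of vs] by (simp add: \<rho>_def N_def)
      obtain Cv where Cv: "expbd (p j) Cv (W y vs)" using so len by (auto simp: sol_def)
      have "expbd (p j) ((K * norms vs + K * \<rho> * kap (p j)) / (1 - K * L * kap (p j))) (W y vs)"
      proof (rule a_priori[OF g(1,2) L g(3)])
        show "W y vs t = free vs t + LP (total W y vs) t" if "0 \<le> t" for t
          using so that by (auto simp: sol_def)
        show "continuous_on {0..} (total W y vs)"
          unfolding total_def
        proof (intro continuous_on_add rhs_cont[OF elim(3) vk] Dg_1_cont[OF elim(3)])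
          show "continuous_on {0..} (W y vs)" using so by (simp add: sol_def)
          fix B assume "B \<in> dirs (length vs - 1)"
          then have "B \<in> dirs (Suc n)" using len by (auto simp: dirs_def j_def)
          then show "continuous_on {0..} (W y B)" using Suc.prems elim(3) by (auto simp: sols_def sol_def)
        qed
        show "expbd (p j) (K * norms vs) (free vs)" using free_expbd[OF vs, of "p j"] g by simp
        show "norm (Q (total W y vs s)) \<le> L * norm (W y vs s) + \<rho> * exp (p j * s)"
          "norm (Pp (total W y vs s)) \<le> L * norm (W y vs s) + \<rho> * exp (p j * s)" if "0 \<le> s" for s
          using total_bounds[OF that r[OF that]] by (simp_all add: \<rho>_def mult_ac)
      qed (use Cv \<rho> in auto)
      also have "(K * norms vs + K * \<rho> * kap (p j)) / (1 - K * L * kap (p j)) = C' * norms vs"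
        by (simp add: C'_def \<rho>_def \<theta>_def algebra_simps add_divide_distrib)
      finally have "expbd (p j) (C' * norms vs) (W y vs)" .
      moreover have "C' * norms vs \<le> max C C' * norms vs" using norms_nonneg[of vs] by (intro mult_right_mono) auto
      ultimately show ?thesis unfolding len expbd_def by (meson exp_ge_zero mult_right_mono order.trans)
    qed
    then show ?case using C1 by (auto simp: Wbound_def)
  qed
  then show ?case by blast
qed

lemma Dbound_near: "x \<in> V \<Longrightarrow> \<exists>B. \<forall>\<^sub>F y in near x. Dbound B y"
proof -
  assume "x \<in> V"
  from Dg_bd[OF this] obtain B where "0 \<le> B" "\<forall>\<^sub>F y in near x. \<forall>m s vs. 1 \<le> m \<and> m \<le> k \<and> 0 \<le> s \<and> length vs = m \<longrightarrow>
      norm (Dg m s (v y s) vs) \<le> B * exp ((real m - 1) * \<sigma> * s) * norms vs" by blast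
  then have "\<forall>\<^sub>F y in near x. Dbound B y" by (simp add: Dbound_def)
  then show ?thesis by blast
qed

text \<open>The linear equation is solved for each base point and each list separately. Linearity in
  the directions is recovered afterwards from uniqueness, in \<open>W_head\<close>.\<close>

lemma sols_exist: "n \<le> k \<Longrightarrow> \<exists>W. sols n W"
proof (induction n)
  case 0
  show ?case by (rule exI[of _ "\<lambda>x vs. v x"]) (auto simp: sols_def dirs_def)
next
  case (Suc n)
  then obtain W where W: "sols n W" by auto
  have ex: "\<exists>w. continuous_on {0..} w \<and> (\<exists>C. expbd (p (length vs)) C w) \<and>
      (\<forall>t\<ge>0. w t = free vs t + LP (\<lambda>s. Dg 1 s (v x s) [w s] + rhs W x vs s) t)"
    if x: "x \<in> V" and vs: "vs \<in> dirs (Suc n)" and len: "length vs = Suc n" for x vs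
  proof -
    have vk: "vs \<in> dirs k" and j: "1 \<le> length vs" "length vs \<le> k" using vs Suc.prems len by (auto simp: dirs_def)
    note g = goodD[OF gap_p[OF j]]
    obtain C where C: "Wbound C W n x"
      using W_bounded[OF W _ x] Suc.prems near_self[OF _ x] by fastforce
    obtain B0 where B0: "Dbound B0 x" using Dbound_near[OF x] near_self[OF _ x] by fastforce
    define \<rho> where "\<rho> = NP * (real (length (proper_parts vs)) * (B0 * C ^ k * norms vs))"
    have \<rho>: "0 \<le> \<rho>" using NP_nonneg B0 C norms_nonneg[of vs] by (simp add: \<rho>_def Dbound_def Wbound_def)
    have rc: "continuous_on {0..} (rhs W x vs)"
      using W x len by (intro rhs_cont vk) (auto simp: sols_def sol_def)
    have r: "norm (rhs W x vs s) \<le> real (length (proper_parts vs)) * (B0 * C ^ k * exp (p (length vs) * s) * norms vs)" if "0 \<le> s" for s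
      using rhs_le[OF B0 _ vk that, of C W] C len by simp
    let ?\<Psi> = "\<lambda>s w. Dg 1 s (v x s) [w] + rhs W x vs s"
    have "\<exists>w C. continuous_on {0..} w \<and> expbd (p (length vs)) C w \<and> (\<forall>t\<ge>0. w t = free vs t + LP (\<lambda>s. ?\<Psi> s (w s)) t)"
    proof (rule picard_convergence[OF g(1,2) L g(3) free_cont[OF vs] free_expbd[OF vs]])
      show "\<beta> \<le> p (length vs)" using g by simp
      show "continuous_on {0..} (\<lambda>s. ?\<Psi> s (w s))" if "continuous_on {0..} w" for w
        using that by (intro continuous_on_add rc Dg_1_cont[OF x])
      show "norm (Q (?\<Psi> s a - ?\<Psi> s b)) \<le> L * norm (a - b)" "norm (Pp (?\<Psi> s a - ?\<Psi> s b)) \<le> L * norm (a - b)"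
        if "0 \<le> s" for s a b
        using Dg_1_Q[OF that, of "v x s" "a - b"] Dg_1_P[OF that, of "v x s" "a - b"] that
        by (simp_all add: Dg_1_linear del: One_nat_def)
      show "dominated (\<lambda>s. ?\<Psi> s 0) (p (length vs)) \<rho>"
        unfolding dominated_def
      proof (intro conjI allI impI)
        show "continuous_on {0..} (\<lambda>s. ?\<Psi> s 0)" by (intro continuous_on_add rc Dg_1_cont[OF x] continuous_on_const)
        fix s :: real assume s: "0 \<le> s"
        have "Dg 1 s (v x s) [0] = 0" using Dg_1_linear(1)[OF s, of "v x s" 0 0] by simp
        then show "norm (Q (?\<Psi> s 0)) \<le> \<rho> * exp (p (length vs) * s)" "norm (Pp (?\<Psi> s 0)) \<le> \<rho> * exp (p (length vs) * s)"
          using order.trans[OF NP_Q mult_left_mono[OF r[OF s] NP_nonneg]] order.trans[OF NP_Pp mult_left_mono[OF r[OF s] NP_nonneg]]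
          by (simp_all add: \<rho>_def mult_ac del: One_nat_def)
      qed
    qed (use \<rho> in blast)+
    then show ?thesis by blast
  qed
  \<comment> \<open>Only lists of the new length are redefined. Blocks of partitions are shorter, so
    \<open>rhs\<close> is the same for \<open>W\<close> and \<open>W'\<close>.\<close>
  define W' where "W' x vs = (if length vs = Suc n then SOME w. continuous_on {0..} w \<and> (\<exists>C. expbd (p (length vs)) C w) \<and>
      (\<forall>t\<ge>0. w t = free vs t + LP (\<lambda>s. Dg 1 s (v x s) [w s] + rhs W x vs s) t) else W x vs)" for x vs
  have rhs_eq: "rhs W' x vs = rhs W x vs" if "vs \<in> dirs (Suc n)" for x vs
  proof -
    have *: "map (\<lambda>B. W' x B s) P = map (\<lambda>B. W x B s) P" if P: "P \<in> set (proper_parts vs)" for P s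
    proof (rule map_cong[OF refl])
      fix B assume "B \<in> set P"
      then have "length B < length vs" using proper_parts_props(3)[OF P] by blast
      then show "W' x B s = W x B s" using \<open>vs \<in> dirs (Suc n)\<close> by (simp add: W'_def dirs_def)
    qed
    show ?thesis
      unfolding rhs_def by (intro ext arg_cong[of _ _ sum_list] map_cong refl) (simp only: *)
  qed
  have "sol W' x vs" if x: "x \<in> V" and vs: "vs \<in> dirs (Suc n)" for x vs
  proof (cases "length vs = Suc n")
    case True
    then have *: "W' x vs = (SOME w. continuous_on {0..} w \<and> (\<exists>C. expbd (p (length vs)) C w) \<and>
      (\<forall>t\<ge>0. w t = free vs t + LP (\<lambda>s. Dg 1 s (v x s) [w s] + rhs W x vs s) t))"
      by (simp add: W'_def del: One_nat_def)
    show ?thesis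
      unfolding sol_def total_def[abs_def] rhs_eq[OF vs] by (rule someI_ex[OF ex[OF x vs True], folded *])
  next
    case False
    then have "vs \<in> dirs n" using vs by (auto simp: dirs_def)
    then have "sol W x vs" using W x by (auto simp: sols_def)
    moreover have "W' x vs = W x vs" using False by (auto simp: W'_def)
    ultimately show ?thesis unfolding sol_def total_def[abs_def] rhs_eq[OF vs] by simp
  qed
  moreover have "W' x [] = v x" if "x \<in> V" for x using W that by (simp add: W'_def sols_def)
  ultimately show ?case by (auto simp: sols_def)
qed

end

lemma exp_add_mult: "exp ((a + b) * s) = exp (a * s) * exp (b * s :: real)"
  by (simp add: distrib_right exp_add)

lemma norms_map_le:
  "(\<And>B. B \<in> set P \<Longrightarrow> norm (X B) \<le> a B) \<Longrightarrow> norms (map X P) \<le> prod_list (map a P)"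
proof (induction P)
  case (Cons B P)
  have "0 \<le> a B" using Cons.prems[of B] norm_ge_zero[of "X B"] by (simp del: norm_ge_zero)
  then show ?case using Cons by (auto intro!: mult_mono prod_list_nonneg)
qed simp

text \<open>Each summand contains exactly one block extended by the new direction and is linear in
  that block.\<close>

lemma insertions_linear:
  assumes "bounded_multilinear_on UNIV (length P) M"
    and "\<And>B. B \<in> set P \<Longrightarrow> X (z # B) = X (a # B) + c *\<^sub>R X (b # B)"
  shows "(\<Sum>P'\<leftarrow>insertions z P. M (map X P')) =
    (\<Sum>P'\<leftarrow>insertions a P. M (map X P')) + c *\<^sub>R (\<Sum>P'\<leftarrow>insertions b P. M (map X P'))"
  using assms
proof (induction P arbitrary: M)
  case (Cons B P)
  have m: "bounded_multilinear_on UNIV (Suc (length P)) M" using Cons.prems(1) by simp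
  have "(\<Sum>P'\<leftarrow>insertions z P. M (X B # map X P')) =
    (\<Sum>P'\<leftarrow>insertions a P. M (X B # map X P')) + c *\<^sub>R (\<Sum>P'\<leftarrow>insertions b P. M (X B # map X P'))"
    using Cons.prems(2) by (intro Cons.IH[OF multilinear_Cons[OF m]]) auto
  moreover have "M (X (z # B) # map X P) = M (X (a # B) # map X P) + c *\<^sub>R M (X (b # B) # map X P)"
    using Cons.prems(2)[of B] multilinear_head[OF m, of "map X P"] by simp
  ultimately show ?case by (simp add: o_def scaleR_add_right)
qed simp

context dichotomy
begin

lemma dominated_scale: "dominated f \<gamma> M \<Longrightarrow> dominated (\<lambda>s. c *\<^sub>R f s) \<gamma> (\<bar>c\<bar> * M)"
  unfolding dominated_def
  by (auto simp: linear_cmul[OF Q_linear] linear_cmul[OF Pp_linear] mult.assoc intro!: continuous_intros mult_left_mono)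

lemma LP_solution_lipschitz:
  assumes g: "good L \<gamma>" and L: "0 \<le> L"
    and \<Psi>_lip: "\<And>s a b. 0 \<le> s \<Longrightarrow> norm (Q (\<Psi> s a - \<Psi> s b)) \<le> L * norm (a - b)"
      "\<And>s a b. 0 \<le> s \<Longrightarrow> norm (Pp (\<Psi> s a - \<Psi> s b)) \<le> L * norm (a - b)"
    and w: "dominated (\<lambda>s. \<Psi> s (w s)) \<gamma> M" "expbd \<gamma> C w" "\<And>t. 0 \<le> t \<Longrightarrow> w t = r t + LP (\<lambda>s. \<Psi> s (w s)) t"
    and w': "dominated (\<lambda>s. \<Psi> s (w' s)) \<gamma> M'" "expbd \<gamma> C' w'" "\<And>t. 0 \<le> t \<Longrightarrow> w' t = r' t + LP (\<lambda>s. \<Psi> s (w' s)) t"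
    and M: "0 \<le> M" "0 \<le> M'" and R: "expbd \<gamma> R (\<lambda>t. r t - r' t)"
  shows "expbd \<gamma> (R / (1 - K * L * kap \<gamma>)) (\<lambda>t. w t - w' t)"
proof -
  from g have g': "\<beta> < \<gamma>" "\<gamma> < \<alpha>" "K * L * kap \<gamma> < 1" by (auto simp: good_def)
  have "expbd \<gamma> ((R + K * 0 * kap \<gamma>) / (1 - K * L * kap \<gamma>)) (\<lambda>t. w t - w' t)"
  proof (rule a_priori[OF g'(1,2) L g'(3)])
    show "w t - w' t = (r t - r' t) + LP (\<lambda>s. \<Psi> s (w s) - \<Psi> s (w' s)) t" if "0 \<le> t" for t
      using that w(3) w'(3) LP_diff[OF g'(1,2) w(1) M(1) w'(1) M(2), of t] by simp
    show "continuous_on {0..} (\<lambda>s. \<Psi> s (w s) - \<Psi> s (w' s))"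
      using w(1) w'(1) by (auto simp: dominated_def intro: continuous_on_diff)
    show "expbd \<gamma> (C + C') (\<lambda>t. w t - w' t)"
      unfolding expbd_def
    proof (intro allI impI)
      fix t :: real assume "0 \<le> t"
      with w(2) w'(2) show "norm (w t - w' t) \<le> (C + C') * exp (\<gamma> * t)"
        unfolding expbd_def by (metis distrib_right norm_triangle_le_diff add_mono)
    qed
  qed (use \<Psi>_lip R in auto)
  then show ?thesis by simp
qed

end

section \<open>Continuity and differentiability of the formal derivatives\<close>

context smooth_LP
begin

lemma v_dominated:
  assumes x: "x \<in> V"
  shows "\<exists>M\<ge>0. dominated (\<lambda>s. Dg 0 s (v x s) []) (p 1) M"
proof -
  obtain C where C: "expbd (p 1) C (v x)" using v_bd[OF x] by blast
  have "dominated (\<lambda>s. Dg 0 s (v x s) []) (p 1) (L * C)"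
    unfolding dominated_def
  proof (intro conjI allI impI)
    show "continuous_on {0..} (\<lambda>s. Dg 0 s (v x s) [])" using Dg_cont[OF x, of "[]"] by simp
    fix s :: real assume s: "0 \<le> s"
    have "L * norm (v x s) \<le> L * C * exp (p 1 * s)"
      using C s mult_left_mono[OF _ L, of "norm (v x s)" "C * exp (p 1 * s)"] by (simp add: expbd_def mult.assoc)
    then show "norm (Q (Dg 0 s (v x s) [])) \<le> L * C * exp (p 1 * s)" "norm (Pp (Dg 0 s (v x s) [])) \<le> L * C * exp (p 1 * s)"
      using Dg_lip_Q[OF s, of "v x s" 0] Dg_lip_P[OF s, of "v x s" 0] Dg_zero[OF s] by auto
  qed
  moreover have "0 \<le> L * C" using L expbd_nonneg[OF C] by simp
  ultimately show ?thesis by blast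
qed

definition Lv :: real where "Lv = K / (1 - K * L * kap (p 1))"

lemma v_lip:
  assumes x: "x \<in> V" and y: "y \<in> V"
  shows "expbd (p 1) (Lv * norm (y - x)) (\<lambda>t. v y t - v x t)"
proof -
  obtain C C' where C: "expbd (p 1) C (v y)" "expbd (p 1) C' (v x)" using v_bd x y by metis
  obtain M M' where M: "0 \<le> M" "0 \<le> M'" "dominated (\<lambda>s. Dg 0 s (v y s) []) (p 1) M" "dominated (\<lambda>s. Dg 0 s (v x s) []) (p 1) M'"
    using v_dominated x y by metis
  note g = gap_p[OF order.refl k]
  have "y - x \<in> V" using x y V_subspace by (simp add: subspace_diff)
  moreover have "\<beta> \<le> p 1" using g by (simp add: good_def)
  ultimately have "expbd (p 1) (K * norm (y - x)) (\<lambda>t. S t (y - x))" by (intro S_V_expbd)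
  then have "expbd (p 1) (K * norm (y - x)) (\<lambda>t. S t y - S t x)"
    by (simp add: expbd_def linear_diff[OF S_linear])
  from LP_solution_lipschitz[OF g L Dg_lip_Q Dg_lip_P M(3) C(1) v_eq[OF y] M(4) C(2) v_eq[OF x] M(1,2) this]
  show ?thesis by (simp add: Lv_def)
qed

lemma dirs_len: "vs \<in> dirs n \<Longrightarrow> 1 \<le> length vs \<and> length vs \<le> n"
  by (auto simp: dirs_def Suc_le_eq)

lemma dirs_mono: "vs \<in> dirs m \<Longrightarrow> m \<le> n \<Longrightarrow> vs \<in> dirs n"
  by (auto simp: dirs_def)

lemma exp_mono_weight: "0 \<le> s \<Longrightarrow> a \<le> b \<Longrightarrow> exp (a * s) \<le> exp ((b::real) * s)"
  by (simp add: mult_right_mono)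

definition Dnear :: "real \<Rightarrow> 'h \<Rightarrow> 'h \<Rightarrow> bool" where
  "Dnear e x y \<longleftrightarrow> (\<forall>m s vs. 1 \<le> m \<and> m \<le> k \<and> 0 \<le> s \<and> length vs = m \<longrightarrow>
        norm (Dg m s (v y s) vs - Dg m s (v x s) vs) \<le> e * exp (((real m - 1) * \<sigma> + \<tau>) * s) * norms vs)"

definition N_parts :: "nat \<Rightarrow> real" where
  "N_parts j = real (length (proper_parts (replicate j (0::'h))))"

lemma N_parts: "real (length (proper_parts (vs :: 'h list))) = N_parts (length vs)"
  using length_proper_parts[of vs "replicate (length vs) 0"] by (simp add: N_parts_def)

text \<open>The constant that \<open>a_priori\<close> yields in \<open>diff_step\<close>. Inside,
  \<open>C\<close> stems from moving the base point in the linear term, \<open>C ^ k\<close> from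
  moving it in a partition term, and the term with \<open>B0\<close> from exchanging the
  blocks.\<close>

definition ZB :: "real \<Rightarrow> real \<Rightarrow> nat \<Rightarrow> real" where
  "ZB C B0 j = K * (NP * (C + N_parts j * (C ^ k + real k * B0 * C ^ k))) * kap (q j) / (1 - K * L * kap (q j))"

lemma ZB_nonneg:
  assumes "0 \<le> C" "0 \<le> B0" "1 \<le> j" "j \<le> k" shows "0 \<le> ZB C B0 j"
proof -
  note g = goodD[OF gap_q[OF assms(3,4)]]
  show ?thesis unfolding ZB_def
    using assms g K_nonneg NP_nonneg kap_pos[OF g(1,2)]
    by (intro divide_nonneg_nonneg mult_nonneg_nonneg add_nonneg_nonneg zero_le_power) (auto simp: N_parts_def)
qed

lemma Dnear_near: "x \<in> V \<Longrightarrow> 0 < e \<Longrightarrow> \<forall>\<^sub>F y in near x. Dnear e x y"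
  unfolding Dnear_def by (rule Dg_near)

text \<open>The first product is the constant of \<open>outer_derivative\<close>, the second that of
  \<open>inner_derivative\<close>.\<close>

definition GC :: "real \<Rightarrow> real \<Rightarrow> real" where
  "GC C B0 = C ^ k * (C + B0 + real k * B0 * C) + real k * real k * B0 * (C + 1) ^ k"

context
  fixes W :: "'h \<Rightarrow> 'h list \<Rightarrow> real \<Rightarrow> 'h"
  assumes W: "sols k W"
begin

lemma W_Nil: "x \<in> V \<Longrightarrow> W x [] = v x"
  using W by (simp add: sols_def)

lemma W_sol: "x \<in> V \<Longrightarrow> vs \<in> dirs k \<Longrightarrow> sol W x vs"
  using W by (simp add: sols_def)

lemma W_eq: "x \<in> V \<Longrightarrow> vs \<in> dirs k \<Longrightarrow> 0 \<le> t \<Longrightarrow> W x vs t = free vs t + LP (total W x vs) t"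
  using W_sol by (simp add: sol_def)

lemma total_cont: "x \<in> V \<Longrightarrow> vs \<in> dirs k \<Longrightarrow> continuous_on {0..} (total W x vs)"
  unfolding total_def[abs_def]
proof (intro continuous_on_add Dg_1_cont rhs_cont)
  assume x: "x \<in> V" and vs: "vs \<in> dirs k"
  then show "continuous_on {0..} (W x vs)" using W_sol by (simp add: sol_def)
  fix B assume "B \<in> dirs (length vs - 1)"
  then have "B \<in> dirs k" using vs by (auto simp: dirs_def)
  then show "continuous_on {0..} (W x B)" using W_sol x by (simp add: sol_def)
qed auto

lemma W_bounded_at: "x \<in> V \<Longrightarrow> \<exists>C. Wbound C W k x"
  using W_bounded[OF W order.refl] near_self by fastforce

lemma total_dominated:
  assumes x: "x \<in> V" and vs: "vs \<in> dirs k"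
  shows "\<exists>M\<ge>0. dominated (total W x vs) (p (length vs)) M"
proof -
  obtain C where C: "Wbound C W k x" using W_bounded_at[OF x] by blast
  obtain B0 where B0: "Dbound B0 x" using Dbound_near[OF x] near_self[OF _ x] by fastforce
  define N where "N = real (length (proper_parts vs))"
  define M where "M = L * (C * norms vs) + NP * (N * (B0 * C ^ k * norms vs))"
  have "dominated (total W x vs) (p (length vs)) M"
    unfolding dominated_def
  proof (intro conjI allI impI total_cont x vs)
    fix s :: real assume s: "0 \<le> s"
    have r: "norm (rhs W x vs s) \<le> N * (B0 * C ^ k * exp (p (length vs) * s) * norms vs)"
      unfolding N_def using vs by (intro rhs_le[OF B0 Wbound_mono[OF C] vs s]) (auto simp: dirs_def)
    have w: "L * norm (W x vs s) \<le> L * (C * exp (p (length vs) * s) * norms vs)"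
      by (intro mult_left_mono WboundD[OF C vs s] L)
    show "norm (Q (total W x vs s)) \<le> M * exp (p (length vs) * s)"
      "norm (Pp (total W x vs s)) \<le> M * exp (p (length vs) * s)"
      using total_bounds[OF s r] w by (simp_all add: M_def algebra_simps)
  qed
  moreover have "0 \<le> M" unfolding M_def
    using B0 C NP_nonneg norms_nonneg[of vs] L
    by (intro add_nonneg_nonneg mult_nonneg_nonneg) (auto simp: Dbound_def Wbound_def N_def)
  ultimately show ?thesis by blast
qed

text \<open>The difference solves a linear equation with coefficient at \<open>x\<close>;
  \<open>X1\<close> and \<open>X2\<close> collect what is left of the linear term and of
  \<open>rhs\<close>. In each partition term the base point is moved first, at the cost of \<tau>
  and hence from the weight \<open>p\<close> to \<open>q\<close>; then the blocks are exchanged,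
  whose differences are already measured in \<open>q\<close>.\<close>

lemma diff_step:
  assumes x: "x \<in> V" and y: "y \<in> V" and vs: "vs \<in> dirs k"
    and B0: "Dbound B0 x" and Cx: "Wbound C W k x" and Cy: "Wbound C W k y"
    and e: "0 \<le> e" and nr: "Dnear e x y"
    and blocks: "\<And>B. B \<in> dirs (length vs - 1) \<Longrightarrow> expbd (q (length B)) (e * norms B) (\<lambda>t. W y B t - W x B t)"
  shows "expbd (q (length vs)) (ZB C B0 (length vs) * e * norms vs) (\<lambda>t. W y vs t - W x vs t)"
proof -
  define j where "j = length vs"
  have j: "1 \<le> j" "j \<le> k" using vs dirs_len by (auto simp: j_def)
  note g = goodD[OF gap_q[OF j]]
  have pq: "p j + \<tau> \<le> q j" "p j \<le> q j" using p_\<tau>_q[OF j(1)] \<tau> by auto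
  have C1: "1 \<le> C" and B00: "0 \<le> B0" using Cx B0 by (auto simp: Wbound_def Dbound_def)
  define N where "N = N_parts j"
  define \<rho> where "\<rho> = NP * (e * C + N * (e * C ^ k + real k * B0 * e * C ^ k)) * norms vs"
  have \<rho>: "0 \<le> \<rho>" unfolding \<rho>_def N_def N_parts_def
    using NP_nonneg e C1 B00 norms_nonneg[of vs] by (intro mult_nonneg_nonneg add_nonneg_nonneg) auto
  obtain My Mx where M: "0 \<le> My" "0 \<le> Mx" "dominated (total W y vs) (p j) My" "dominated (total W x vs) (p j) Mx"
    using total_dominated[OF y vs] total_dominated[OF x vs] by (auto simp: j_def)
  note Mq = dominated_mono[OF M(3) pq(2) M(1)] dominated_mono[OF M(4) pq(2) M(2)]
  define X1 where "X1 s = Dg 1 s (v y s) [W y vs s] - Dg 1 s (v x s) [W y vs s]" for s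
  define X2 where "X2 s = rhs W y vs s - rhs W x vs s" for s
  have X1: "norm (X1 s) \<le> e * C * exp (q j * s) * norms vs" if s: "0 \<le> s" for s
  proof -
    have "norm (X1 s) \<le> e * exp (\<tau> * s) * norm (W y vs s)"
      using nr[unfolded Dnear_def, rule_format, of 1 s "[W y vs s]"] k s by (simp add: X1_def)
    also have "\<dots> \<le> e * exp (\<tau> * s) * (C * exp (p j * s) * norms vs)"
      using e WboundD[OF Cy vs s] by (intro mult_left_mono) (auto simp: j_def)
    also have "\<dots> = (e * C * norms vs) * exp ((p j + \<tau>) * s)"
      unfolding exp_add_mult by (simp add: mult_ac)
    also have "\<dots> \<le> (e * C * norms vs) * exp (q j * s)"
      using e C1 norms_nonneg[of vs] pq s by (intro mult_left_mono exp_mono_weight) auto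
    finally show ?thesis by (simp add: mult_ac)
  qed
  have X2: "norm (X2 s) \<le> N * ((e * C ^ k + real k * B0 * e * C ^ k) * exp (q j * s) * norms vs)" if s: "0 \<le> s" for s
  proof -
    have "norm (X2 s) \<le> real (length (proper_parts vs)) * ((e * C ^ k + real k * B0 * e * C ^ k) * exp (q j * s) * norms vs)"
      unfolding X2_def rhs_def sum_list_subtractf[symmetric]
    proof (rule norm_sum_list_le)
      fix P assume P: "P \<in> set (proper_parts vs)"
      note pb = part_blocks[OF vs P]
      define m where "m = length P"
      have m: "1 \<le> m" "m \<le> k" using pb(1,2) j by (auto simp: Suc_le_eq m_def j_def)
      have Bk: "B \<in> dirs k" if "B \<in> set P" for B
        using pb(3)[OF that] j by (auto intro: dirs_mono simp: j_def)
      let ?a = "\<lambda>B. C * exp (p (length B) * s) * norms B"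
      let ?b = "\<lambda>B. C * exp (q (length B) * s) * norms B"
      have "norm (Dg m s (v y s) (map (\<lambda>B. W y B s) P) - Dg m s (v x s) (map (\<lambda>B. W y B s) P))
          \<le> e * exp (((real m - 1) * \<sigma> + \<tau>) * s) * norms (map (\<lambda>B. W y B s) P)"
        using nr[unfolded Dnear_def, rule_format, of m s "map (\<lambda>B. W y B s) P"] m s by (simp add: m_def)
      also have "\<dots> \<le> e * exp (((real m - 1) * \<sigma> + \<tau>) * s) * prod_list (map ?a P)"
        using e WboundD[OF Cy Bk s] by (intro mult_left_mono norms_map_le) auto
      also have "\<dots> = e * exp (\<tau> * s) * (exp ((real m - 1) * \<sigma> * s) * prod_list (map ?a P))"
        unfolding exp_add_mult by (simp add: mult_ac)
      also have "\<dots> \<le> e * exp (\<tau> * s) * (C ^ m * exp (p j * s) * norms vs)"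
        using p.prod_weight_le[of C s P] C1 s pb(1,4) e
        by (intro mult_left_mono) (auto simp: m_def j_def pb(5,6))
      also have "\<dots> = (e * norms vs) * (C ^ m * exp ((p j + \<tau>) * s))"
        unfolding exp_add_mult by (simp add: mult_ac)
      also have "\<dots> \<le> (e * norms vs) * (C ^ k * exp (q j * s))"
        using e C1 norms_nonneg[of vs] pq s m by (intro mult_left_mono mult_mono exp_mono_weight power_increasing) auto
      finally have 1: "norm (Dg m s (v y s) (map (\<lambda>B. W y B s) P) - Dg m s (v x s) (map (\<lambda>B. W y B s) P))
        \<le> e * C ^ k * exp (q j * s) * norms vs" by (simp add: mult_ac)
      have "norm (Dg m s (v x s) (map (\<lambda>B. W y B s) P) - Dg m s (v x s) (map (\<lambda>B. W x B s) P))
        \<le> real (length P) * (B0 * exp ((real m - 1) * \<sigma> * s)) * e * prod_list (map ?b P)"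
      proof (rule mlin_diff_le)
        show "mlin (length P) (Dg m s (v x s)) (B0 * exp ((real m - 1) * \<sigma> * s))"
          using Dbound_mlin[OF B0 m s] by (simp add: m_def)
        fix B assume B: "B \<in> set P"
        show "norm (W x B s) \<le> ?b B" "norm (W y B s) \<le> ?b B"
          using Wbound_q[OF Cx Bk[OF B] s] Wbound_q[OF Cy Bk[OF B] s] by auto
        have "norm (W y B s - W x B s) \<le> e * norms B * exp (q (length B) * s)"
          using blocks[OF pb(3)[OF B]] s by (simp add: expbd_def)
        \<comment> \<open>\<open>1 \<le> C\<close> makes the error small relative to the bound of
          the block, the form that \<open>mlin_diff_le\<close> expects.\<close>
        also have "\<dots> \<le> (e * norms B * exp (q (length B) * s)) * C"
          using mult_left_mono[OF C1, of "e * norms B * exp (q (length B) * s)"] e norms_nonneg[of B] by simp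
        finally show "norm (W y B s - W x B s) \<le> e * ?b B" by (simp add: mult_ac)
      qed (rule e)
      also have "\<dots> = real m * B0 * e * (exp ((real m - 1) * \<sigma> * s) * prod_list (map ?b P))" by (simp add: m_def)
      also have "\<dots> \<le> real m * B0 * e * (C ^ m * exp (q j * s) * norms vs)"
        using q.prod_weight_le[of C s P] C1 s pb(1,4) e B00
        by (intro mult_left_mono) (auto simp: m_def j_def pb(5,6))
      also have "\<dots> \<le> real k * B0 * e * (C ^ k * exp (q j * s) * norms vs)"
        using m B00 e C1 norms_nonneg[of vs]
        by (intro mult_mono power_increasing) auto
      finally have 2: "norm (Dg m s (v x s) (map (\<lambda>B. W y B s) P) - Dg m s (v x s) (map (\<lambda>B. W x B s) P))
        \<le> real k * B0 * e * C ^ k * exp (q j * s) * norms vs" by (simp add: mult_ac)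
      have "norm (Dg m s (v y s) (map (\<lambda>B. W y B s) P) - Dg m s (v x s) (map (\<lambda>B. W x B s) P)) \<le>
         e * C ^ k * exp (q j * s) * norms vs + real k * B0 * e * C ^ k * exp (q j * s) * norms vs"
        using norm_triangle_le[OF add_mono[OF 1 2]] by simp
      then show "norm (Dg (length P) s (v y s) (map (\<lambda>B. W y B s) P) - Dg (length P) s (v x s) (map (\<lambda>B. W x B s) P))
          \<le> (e * C ^ k + real k * B0 * e * C ^ k) * exp (q j * s) * norms vs"
        by (simp add: m_def distrib_right)
    qed
    then show ?thesis by (simp add: N_parts N_def j_def)
  qed
  have X: "norm (X1 s + X2 s) \<le> (e * C + N * (e * C ^ k + real k * B0 * e * C ^ k)) * norms vs * exp (q j * s)" if "0 \<le> s" for s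
    using norm_triangle_le[OF add_mono[OF X1[OF that] X2[OF that]]] by (simp add: algebra_simps)
  have split: "total W y vs s - total W x vs s = Dg 1 s (v x s) [W y vs s - W x vs s] + (X1 s + X2 s)" if "0 \<le> s" for s
    by (simp add: total_def X1_def X2_def Dg_1_linear[OF that] del: One_nat_def)
  have "expbd (q j) ((0 + K * \<rho> * kap (q j)) / (1 - K * L * kap (q j))) (\<lambda>t. W y vs t - W x vs t)"
  proof (rule a_priori[OF g(1,2) L g(3)])
    show "W y vs t - W x vs t = 0 + LP (\<lambda>s. total W y vs s - total W x vs s) t" if "0 \<le> t" for t
      using W_eq[OF x vs that] W_eq[OF y vs that] LP_diff[OF g(1,2) Mq(1) M(1) Mq(2) M(2), of t] by simp
    show "continuous_on {0..} (\<lambda>s. total W y vs s - total W x vs s)"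
      by (intro continuous_on_diff total_cont x y vs)
    show "expbd (q j) (C * norms vs + C * norms vs) (\<lambda>t. W y vs t - W x vs t)"
      unfolding expbd_def
    proof (intro allI impI)
      fix t :: real assume t: "0 \<le> t"
      show "norm (W y vs t - W x vs t) \<le> (C * norms vs + C * norms vs) * exp (q j * t)"
        using norm_triangle_le_diff[OF add_mono[OF Wbound_q[OF Cy vs t] Wbound_q[OF Cx vs t]]]
        by (simp add: j_def algebra_simps)
    qed
    fix s :: real assume s: "0 \<le> s"
    have "norm (Q (X1 s + X2 s)) \<le> \<rho> * exp (q j * s)" "norm (Pp (X1 s + X2 s)) \<le> \<rho> * exp (q j * s)"
      using order.trans[OF NP_Q mult_left_mono[OF X[OF s] NP_nonneg]] order.trans[OF NP_Pp mult_left_mono[OF X[OF s] NP_nonneg]]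
      by (simp_all add: \<rho>_def mult_ac)
    then show "norm (Q (total W y vs s - total W x vs s)) \<le> L * norm (W y vs s - W x vs s) + \<rho> * exp (q j * s)"
      "norm (Pp (total W y vs s - total W x vs s)) \<le> L * norm (W y vs s - W x vs s) + \<rho> * exp (q j * s)"
      unfolding split[OF s] linear_add[OF Q_linear, of _ "X1 s + X2 s"] linear_add[OF Pp_linear, of _ "X1 s + X2 s"]
      by (auto intro!: norm_triangle_le add_mono Dg_1_Q Dg_1_P s simp del: One_nat_def)
  qed (auto simp: expbd_def \<rho>)
  also have "(0 + K * \<rho> * kap (q j)) / (1 - K * L * kap (q j)) = ZB C B0 j * e * norms vs"
    by (simp add: ZB_def \<rho>_def N_def algebra_simps add_divide_distrib)
  finally show ?thesis by (simp add: j_def)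
qed

lemma near_facts:
  assumes x: "x \<in> V"
  obtains C B0 where "1 \<le> C" "0 \<le> B0" "Dbound B0 x" "Wbound C W k x" "\<forall>\<^sub>F y in near x. Wbound C W k y"
proof -
  obtain C where C: "\<forall>\<^sub>F y in near x. Wbound C W k y" using W_bounded[OF W order.refl x] by blast
  obtain B0 where B0: "Dbound B0 x" using Dbound_near[OF x] near_self[OF _ x] by fastforce
  show ?thesis by (rule that[OF _ _ B0 near_self[OF C x] C]) (use near_self[OF C x] B0 in \<open>auto simp: Wbound_def Dbound_def\<close>)
qed

lemma W_continuous:
  assumes x: "x \<in> V" and n: "n \<le> k"
  shows "0 < e \<Longrightarrow> \<forall>\<^sub>F y in near x. \<forall>vs\<in>dirs n. expbd (q (length vs)) (e * norms vs) (\<lambda>t. W y vs t - W x vs t)"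
  using n
proof (induction n arbitrary: e)
  case 0
  then show ?case by (simp add: dirs_def)
next
  case (Suc n)
  obtain C B0 where C: "1 \<le> C" "0 \<le> B0" "Dbound B0 x" "Wbound C W k x" "\<forall>\<^sub>F y in near x. Wbound C W k y"
    by (rule near_facts[OF x])
  define Z where "Z = ZB C B0 (Suc n)"
  have Z: "0 \<le> Z" using ZB_nonneg[of C B0 "Suc n"] C Suc.prems by (simp add: Z_def)
  \<comment> \<open>Two demands on the tolerance: \<open>e' \<le> e\<close> for the shorter lists,
    and \<open>Z * e' \<le> e\<close> for the new length, whose estimate loses the factor
    \<open>Z\<close>.\<close>
  define e' where "e' = min e (e / (Z + 1))"
  have e': "0 < e'" "e' \<le> e" using Suc.prems Z by (auto simp: e'_def)
  have Ze: "Z * e' \<le> e"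
  proof -
    have "Z * e' \<le> Z * (e / (Z + 1))" using Z by (intro mult_left_mono) (auto simp: e'_def)
    also have "\<dots> \<le> e" using Z Suc.prems by (simp add: field_simps)
    finally show ?thesis .
  qed
  have "\<forall>\<^sub>F y in near x. \<forall>vs\<in>dirs n. expbd (q (length vs)) (e' * norms vs) (\<lambda>t. W y vs t - W x vs t)"
    using Suc e' by auto
  then show ?case using C(5) Dnear_near[OF x e'(1)] near_V[of x]
  proof eventually_elim
    case (elim y)
    show ?case
    proof
      fix vs assume vs: "vs \<in> dirs (Suc n)"
      have mono: "expbd \<gamma> (a * norms vs) f \<Longrightarrow> a \<le> e \<Longrightarrow> expbd \<gamma> (e * norms vs) f" for a \<gamma> f
        unfolding expbd_def by (meson exp_ge_zero mult_right_mono norms_nonneg order.trans)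
      show "expbd (q (length vs)) (e * norms vs) (\<lambda>t. W y vs t - W x vs t)"
      proof (cases "length vs = Suc n")
        case True
        then have "expbd (q (length vs)) (Z * e' * norms vs) (\<lambda>t. W y vs t - W x vs t)"
          using diff_step[OF x elim(4) dirs_mono[OF vs Suc.prems(2)] C(3,4) elim(2) _ elim(3)] elim(1) e'
          by (simp add: Z_def)
        then show ?thesis using mono Ze by blast
      next
        case False
        then have "vs \<in> dirs n" using vs by (auto simp: dirs_def)
        then show ?thesis using elim(1) mono e' by blast
      qed
    qed
  qed
qed

text \<open>The product rule at the level of \<open>rhs\<close>: the \<open>Dg 2\<close> term comes
  from the base point of the linear term, and each partition of \<open>vs\<close> contributes one
  term with the new block \<open>[a]\<close> and one for every block that \<open>a\<close>
  joins.\<close>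

lemma rhs_Cons:
  assumes "vs \<noteq> []"
  shows "rhs W x (a # vs) s = Dg 2 s (v x s) [W x [a] s, W x vs s] +
    (\<Sum>P\<leftarrow>proper_parts vs. Dg (Suc (length P)) s (v x s) (W x [a] s # map (\<lambda>B. W x B s) P) +
       (\<Sum>P'\<leftarrow>insertions a P. Dg (length P) s (v x s) (map (\<lambda>B. W x B s) P')))"
proof -
  let ?T = "\<lambda>P. Dg (length P) s (v x s) (map (\<lambda>B. W x B s) P)"
  have *: "(\<Sum>P'\<leftarrow>concat (map (\<lambda>P. ([a] # P) # insertions a P) Ps). ?T P') =
    (\<Sum>P\<leftarrow>Ps. Dg (Suc (length P)) s (v x s) (W x [a] s # map (\<lambda>B. W x B s) P) +
       (\<Sum>P'\<leftarrow>insertions a P. Dg (length P) s (v x s) (map (\<lambda>B. W x B s) P')))" for Ps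
  proof (induction Ps)
    case (Cons P Ps)
    have "(\<Sum>P'\<leftarrow>insertions a P. ?T P') = (\<Sum>P'\<leftarrow>insertions a P. Dg (length P) s (v x s) (map (\<lambda>B. W x B s) P'))"
      by (intro arg_cong[of _ _ sum_list] map_cong) (auto simp: insertions_length)
    then show ?case using Cons by simp
  qed simp
  show ?thesis using assms * by (simp add: rhs_def numeral_2_eq_2)
qed

text \<open>By the induction hypothesis the defect of linearity solves the homogeneous linear
  equation. It is exponentially bounded, so \<open>a_priori\<close> with zero data makes it
  vanish.\<close>

lemma W_head:
  assumes x: "x \<in> V" and a: "a \<in> V" and b: "b \<in> V"
  shows "set vs \<subseteq> V \<Longrightarrow> length vs < k \<Longrightarrow> 0 \<le> t \<Longrightarrow>
    W x ((a + c *\<^sub>R b) # vs) t = W x (a # vs) t + c *\<^sub>R W x (b # vs) t"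
proof (induction "length vs" arbitrary: vs t rule: less_induct)
  case less
  define z where "z = a + c *\<^sub>R b"
  have z: "z \<in> V" unfolding z_def using a b V_subspace by (simp add: subspace_add subspace_scale)
  have d: "z # vs \<in> dirs k" "a # vs \<in> dirs k" "b # vs \<in> dirs k"
    using z a b less.prems by (auto simp: dirs_def)
  define j where "j = Suc (length vs)"
  have j: "1 \<le> j" "j \<le> k" using less.prems by (auto simp: j_def)
  note g = goodD[OF gap_p[OF j]]
  have IH: "W x (z # B) s = W x (a # B) s + c *\<^sub>R W x (b # B) s"
    if "length B < length vs" "set B \<subseteq> set vs" "0 \<le> s" for B s
    using less.hyps[OF that(1) _ _ that(3)] that less.prems by (auto simp: z_def)
  have rhs0: "rhs W x (z # vs) s = rhs W x (a # vs) s + c *\<^sub>R rhs W x (b # vs) s" if s: "0 \<le> s" for s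
  proof (cases "vs = []")
    case True
    then show ?thesis by (simp add: rhs_def)
  next
    case False
    then have "1 \<le> length vs" by (simp add: Suc_le_eq)
    then have vk: "vs \<in> dirs k" "2 \<le> k" using less.prems False by (auto simp: dirs_def)
    have z1: "W x [z] s = W x [a] s + c *\<^sub>R W x [b] s" using IH[of "[]"] False s by simp
    have 2: "bounded_multilinear_on UNIV (Suc 1) (Dg 2 s (v x s))"
      using Dg_ml[OF vk(2) s] by (simp add: numeral_2_eq_2)
    let ?F = "\<lambda>a P. Dg (Suc (length P)) s (v x s) (W x [a] s # map (\<lambda>B. W x B s) P) +
       (\<Sum>P'\<leftarrow>insertions a P. Dg (length P) s (v x s) (map (\<lambda>B. W x B s) P'))"
    have F: "?F z P = ?F a P + c *\<^sub>R ?F b P" if P: "P \<in> set (proper_parts vs)" for P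
    proof -
      note pb = part_blocks[OF vk(1) P]
      have m: "Suc (length P) \<le> k" using pb(2) less.prems by simp
      have "Dg (Suc (length P)) s (v x s) (W x [z] s # map (\<lambda>B. W x B s) P) =
          Dg (Suc (length P)) s (v x s) (W x [a] s # map (\<lambda>B. W x B s) P) +
          c *\<^sub>R Dg (Suc (length P)) s (v x s) (W x [b] s # map (\<lambda>B. W x B s) P)"
        unfolding z1 using multilinear_head[OF Dg_ml[OF m s], of "map (\<lambda>B. W x B s) P" "v x s"] by simp
      moreover have "(\<Sum>P'\<leftarrow>insertions z P. Dg (length P) s (v x s) (map (\<lambda>B. W x B s) P')) =
          (\<Sum>P'\<leftarrow>insertions a P. Dg (length P) s (v x s) (map (\<lambda>B. W x B s) P')) +
          c *\<^sub>R (\<Sum>P'\<leftarrow>insertions b P. Dg (length P) s (v x s) (map (\<lambda>B. W x B s) P'))"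
        using m s proper_parts_props(3)[OF P] IH by (intro insertions_linear Dg_ml) auto
      ultimately show ?thesis by (simp add: algebra_simps)
    qed
    have "(\<Sum>P\<leftarrow>Ps. ?F z P) = (\<Sum>P\<leftarrow>Ps. ?F a P) + c *\<^sub>R (\<Sum>P\<leftarrow>Ps. ?F b P)"
      if "set Ps \<subseteq> set (proper_parts vs)" for Ps
      using that
    proof (induction Ps)
      case (Cons P Ps)
      then have "?F z P = ?F a P + c *\<^sub>R ?F b P" using F[of P] by simp
      moreover have "(\<Sum>P\<leftarrow>Ps. ?F z P) = (\<Sum>P\<leftarrow>Ps. ?F a P) + c *\<^sub>R (\<Sum>P\<leftarrow>Ps. ?F b P)"
        using Cons by simp
      ultimately show ?case unfolding list.map sum_list.Cons by (simp only: scaleR_add_right add_ac)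
    qed simp
    from this[of "proper_parts vs"]
    show ?thesis
      unfolding rhs_Cons[OF False] z1
      using multilinear_head[OF 2, of "[W x vs s]"] by (simp add: algebra_simps)
  qed
  obtain Mz Ma Mb where M: "0 \<le> Mz" "0 \<le> Ma" "0 \<le> Mb" "dominated (total W x (z # vs)) (p j) Mz"
      "dominated (total W x (a # vs)) (p j) Ma" "dominated (total W x (b # vs)) (p j) Mb"
    using total_dominated[OF x d(1)] total_dominated[OF x d(2)] total_dominated[OF x d(3)] by (auto simp: j_def)
  obtain Cz Ca Cb where C: "expbd (p j) Cz (W x (z # vs))" "expbd (p j) Ca (W x (a # vs))" "expbd (p j) Cb (W x (b # vs))"
    using W_sol[OF x d(1)] W_sol[OF x d(2)] W_sol[OF x d(3)] by (auto simp: sol_def j_def)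
  let ?d = "\<lambda>t. W x (z # vs) t - W x (a # vs) t - c *\<^sub>R W x (b # vs) t"
  let ?f = "\<lambda>s. total W x (z # vs) s - total W x (a # vs) s - c *\<^sub>R total W x (b # vs) s"
  have "expbd (p j) ((0 + K * 0 * kap (p j)) / (1 - K * L * kap (p j))) ?d"
  proof (rule a_priori[OF g(1,2) L g(3)])
    show "?d t = 0 + LP ?f t" if t: "0 \<le> t" for t
    proof -
      have "free (z # vs) t = free (a # vs) t + c *\<^sub>R free (b # vs) t"
        using t by (simp add: free_def z_def linear_add[OF S_linear] linear_cmul[OF S_linear])
      moreover have "LP ?f t = LP (total W x (z # vs)) t - LP (total W x (a # vs)) t - c *\<^sub>R LP (total W x (b # vs)) t"
        using LP_diff[OF g(1,2) dominated_diff[OF M(4,5)] _ dominated_scale[OF M(6)], of c t]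
          LP_diff[OF g(1,2) M(4,1,5,2), of t] M by (simp add: LP_scale)
      ultimately show ?thesis using W_eq[OF x d(1) t] W_eq[OF x d(2) t] W_eq[OF x d(3) t] by (simp add: algebra_simps)
    qed
    show "continuous_on {0..} ?f"
      by (intro continuous_intros total_cont x d)
    show "expbd (p j) (Cz + Ca + \<bar>c\<bar> * Cb) ?d"
      unfolding expbd_def
    proof (intro allI impI)
      fix t :: real assume t: "0 \<le> t"
      have "norm (W x (z # vs) t) \<le> Cz * exp (p j * t)" "norm (W x (a # vs) t) \<le> Ca * exp (p j * t)"
        "\<bar>c\<bar> * norm (W x (b # vs) t) \<le> \<bar>c\<bar> * (Cb * exp (p j * t))"
        using C t by (auto simp: expbd_def intro: mult_left_mono)
      moreover have "norm (?d t) \<le> norm (W x (z # vs) t) + norm (W x (a # vs) t) + \<bar>c\<bar> * norm (W x (b # vs) t)"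
        by (intro order.trans[OF norm_triangle_ineq4] add_mono norm_triangle_ineq4) simp
      ultimately show "norm (?d t) \<le> (Cz + Ca + \<bar>c\<bar> * Cb) * exp (p j * t)" by (simp add: algebra_simps)
    qed
    fix s :: real assume s: "0 \<le> s"
    have "?f s = Dg 1 s (v x s) [?d s]"
      using s by (simp add: total_def rhs0 Dg_1_linear scaleR_add_right del: One_nat_def)
    then show "norm (Q (?f s)) \<le> L * norm (?d s) + 0 * exp (p j * s)" "norm (Pp (?f s)) \<le> L * norm (?d s) + 0 * exp (p j * s)"
      using Dg_1_Q[OF s, of "v x s" "?d s"] Dg_1_P[OF s, of "v x s" "?d s"] by (simp_all del: One_nat_def)
  qed (auto simp: expbd_def)
  then have "?d t = 0" using less.prems(3) by (simp add: expbd_def)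
  then show ?case by (simp add: z_def algebra_simps)
qed

lemma W_zero_direction:
  assumes "x \<in> V" "set vs \<subseteq> V" "length vs < k" "0 \<le> t"
  shows "W x (0 # vs) t = 0"
  using W_head[OF assms(1) subspace_0[OF V_subspace] subspace_0[OF V_subspace] assms(2-4), of 1] by simp

text \<open>All that is known about a point \<open>y\<close> near \<open>x\<close>, gathered so that
  the estimates below concern a single \<open>y\<close> without filters. The condition
  \<open>e \<le> 1\<close> serves to bound first-order increments by a multiple of
  \<open>norm (y - x)\<close>.\<close>

definition close :: "real \<Rightarrow> real \<Rightarrow> real \<Rightarrow> 'h \<Rightarrow> 'h \<Rightarrow> bool" where
  "close e C B0 x y \<longleftrightarrow> x \<in> V \<and> y \<in> V \<and> 0 \<le> e \<and> e \<le> 1 \<and> Dbound B0 x \<and> Wbound C W k x \<and> Wbound C W k y \<and> Lv \<le> C \<and>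
     (\<forall>m s vs. m < k \<and> 0 \<le> s \<and> length vs = m \<longrightarrow>
        norm (Dg m s (v y s) vs - Dg m s (v x s) vs - Dg (Suc m) s (v x s) ((v y s - v x s) # vs))
          \<le> e * exp ((real m * \<sigma> + \<tau>) * s) * norm (v y s - v x s) * norms vs) \<and>
     (\<forall>vs\<in>dirs k. expbd (q (length vs)) (e * norms vs) (\<lambda>t. W y vs t - W x vs t))"

definition remainder :: "'h \<Rightarrow> 'h \<Rightarrow> 'h list \<Rightarrow> real \<Rightarrow> 'h" where
  "remainder x y vs t = W y vs t - W x vs t - W x ((y - x) # vs) t"

lemma close_near:
  assumes x: "x \<in> V"
  obtains C B0 where "1 \<le> C" "0 \<le> B0" "\<forall>e. 0 < e \<and> e \<le> 1 \<longrightarrow> (\<forall>\<^sub>F y in near x. close e C B0 x y)"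
proof -
  obtain C B0 where C: "1 \<le> C" "0 \<le> B0" "Dbound B0 x" "Wbound C W k x" "\<forall>\<^sub>F y in near x. Wbound C W k y"
    by (rule near_facts[OF x])
  define C' where "C' = max C Lv"
  have "\<forall>\<^sub>F y in near x. close e C' B0 x y" if e: "0 < e" "e \<le> 1" for e
    using C(5) near_V Dg_deriv[OF x e(1)] W_continuous[OF x order.refl e(1)]
  proof eventually_elim
    case (elim y)
    show ?case unfolding close_def
      using Wbound_mono[OF C(4), of C' k] Wbound_mono[OF elim(1), of C' k] C(3) x e elim
      by (auto simp: C'_def)
  qed
  then show ?thesis using C by (intro that[of C' B0]) (auto simp: C'_def)
qed

context
  fixes e C B0 x y
  assumes cl: "close e C B0 x y"
begin

lemma close_facts:
  shows xV: "x \<in> V" and yV: "y \<in> V" and hV: "y - x \<in> V" and e0: "0 \<le> e" and e1: "e \<le> 1" and C1: "1 \<le> C" and B00: "0 \<le> B0"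
    and DB: "Dbound B0 x" and Wx: "Wbound C W k x" and Wy: "Wbound C W k y"
  using cl V_subspace by (auto simp: close_def Wbound_def Dbound_def subspace_diff)

lemma close_v: assumes s: "0 \<le> s" shows "norm (v y s - v x s) \<le> C * norm (y - x) * exp (p 1 * s)"
proof -
  have "norm (v y s - v x s) \<le> Lv * norm (y - x) * exp (p 1 * s)"
    using v_lip[OF xV yV] s by (simp add: expbd_def)
  also have "\<dots> \<le> C * norm (y - x) * exp (p 1 * s)"
    using cl by (intro mult_right_mono) (auto simp: close_def)
  finally show ?thesis .
qed

lemma q1_le: "0 \<le> s \<Longrightarrow> exp (\<tau> * s) * exp (p 1 * s) \<le> exp (q 1 * s)" "0 \<le> s \<Longrightarrow> exp (p 1 * s) \<le> exp (q 1 * s)"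
proof -
  assume s: "0 \<le> s"
  have *: "p 1 + \<tau> \<le> q 1" "p 1 \<le> q 1" using p_\<tau>_q[OF order.refl] \<tau> by auto
  show "exp (\<tau> * s) * exp (p 1 * s) \<le> exp (q 1 * s)"
    using exp_mono_weight[OF s *(1)] unfolding exp_add_mult by (simp add: mult_ac)
  show "exp (p 1 * s) \<le> exp (q 1 * s)" by (rule exp_mono_weight[OF s *(2)])
qed

text \<open>The increment of the trajectory counts as one more block of length 1. The derivative
  then has one more argument than \<open>P\<close> has blocks, hence the exponent with
  \<open>length P\<close> in place of \<open>length P - 1\<close>.\<close>

lemma extra_block:
  assumes s: "0 \<le> s" and P: "P \<noteq> []" "\<And>B. B \<in> set P \<Longrightarrow> B \<noteq> []" "length P \<le> k"
  shows "exp (real (length P) * \<sigma> * s) * exp (q 1 * s) * prod_list (map (\<lambda>B. C * exp (q (length B) * s) * norms B) P)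
    \<le> C ^ k * exp (q (Suc (sum_list (map length P))) * s) * prod_list (map norms P)"
proof -
  define m n where "m = length P" and "n = sum_list (map length P)"
  define A where "A = prod_list (map (\<lambda>B. C * exp (q (length B) * s) * norms B) P)"
  have "1 \<le> length P" using P(1) by (simp add: Suc_le_eq)
  then have n: "1 \<le> n" using blocks_count[of P, OF P(2)] by (simp add: n_def)
  have nn: "0 \<le> prod_list (map norms P)" by (intro prod_list_nonneg) (auto simp: norms_nonneg)
  have e: "exp (real m * \<sigma> * s) = exp (\<sigma> * s) * exp ((real m - 1) * \<sigma> * s)"
    by (simp add: algebra_simps flip: exp_add)
  have 1: "exp ((real m - 1) * \<sigma> * s) * A \<le> C ^ m * exp (q n * s) * prod_list (map norms P)"
    using q.prod_weight_le[of C s P] C1 s P by (simp add: m_def n_def A_def)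
  have 2: "exp (\<sigma> * s) * (exp (q 1 * s) * exp (q n * s)) \<le> exp (q (Suc n) * s)"
    using exp_mono_weight[OF s q.superadd[OF order.refl n]] unfolding exp_add_mult by (simp add: mult_ac)
  have "exp (real m * \<sigma> * s) * exp (q 1 * s) * A = exp (\<sigma> * s) * exp (q 1 * s) * (exp ((real m - 1) * \<sigma> * s) * A)"
    unfolding e by simp
  also have "\<dots> \<le> exp (\<sigma> * s) * exp (q 1 * s) * (C ^ m * exp (q n * s) * prod_list (map norms P))"
    by (intro mult_left_mono 1) auto
  also have "\<dots> = C ^ m * prod_list (map norms P) * (exp (\<sigma> * s) * (exp (q 1 * s) * exp (q n * s)))" by simp
  also have "\<dots> \<le> C ^ k * prod_list (map norms P) * exp (q (Suc n) * s)"
    using C1 P(3) nn by (intro mult_mono 2 power_increasing) (auto simp: m_def)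
  finally show ?thesis by (simp add: m_def n_def A_def mult_ac)
qed

text \<open>Differentiation in the base point. \<open>R1\<close> is the Taylor remainder of the
  nonlinearity, \<open>R2\<close> replaces \<open>v y s - v x s\<close> by the formal derivative
  \<open>W x [y - x] s\<close>, and \<open>R3\<close> moves the blocks in the derivative term from
  \<open>y\<close> to \<open>x\<close>.\<close>

lemma outer_derivative:
  assumes s: "0 \<le> s" and P: "P \<noteq> []" "\<And>B. B \<in> set P \<Longrightarrow> B \<in> dirs k" "length P < k"
    and r0: "expbd (q 1) (e * norm (y - x)) (remainder x y [])"
  shows "norm (Dg (length P) s (v y s) (map (\<lambda>B. W y B s) P) - Dg (length P) s (v x s) (map (\<lambda>B. W y B s) P)
       - Dg (Suc (length P)) s (v x s) (W x [y - x] s # map (\<lambda>B. W x B s) P))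
    \<le> e * norm (y - x) * (C ^ k * (C + B0 + real k * B0 * C)) * exp (q (Suc (sum_list (map length P))) * s) * prod_list (map norms P)"
proof -
  define m where "m = length P"
  define h where "h = norm (y - x)"
  define Y X where "Y = map (\<lambda>B. W y B s) P" and "X = map (\<lambda>B. W x B s) P"
  define a where "a = (\<lambda>B::'h list. C * exp (q (length B) * s) * norms B)"
  define G where "G = C ^ k * exp (q (Suc (sum_list (map length P))) * s) * prod_list (map norms P)"
  have B: "B \<noteq> []" if "B \<in> set P" for B using P(2)[OF that] by (auto simp: dirs_def)
  have eb: "exp (real m * \<sigma> * s) * exp (q 1 * s) * prod_list (map a P) \<le> G"
    using extra_block[OF s P(1) B] P(3) by (simp add: G_def a_def m_def)
  have m: "1 \<le> Suc m" "Suc m \<le> k" using P(3) by (auto simp: m_def)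
  have lin: "mlin (Suc m) (Dg (Suc m) s (v x s)) (B0 * exp (real m * \<sigma> * s))"
    using Dbound_mlin[OF DB m s] by simp
  have len: "length Y = m" "length X = m" by (auto simp: Y_def X_def m_def)
  have aY: "norm (W y B s) \<le> a B" "norm (W x B s) \<le> a B" if "B \<in> set P" for B
    using Wbound_q[OF Wy P(2)[OF that] s] Wbound_q[OF Wx P(2)[OF that] s] by (auto simp: a_def)
  have a0: "0 \<le> prod_list (map a P)"
    using C1 by (intro prod_list_nonneg) (auto simp: a_def norms_nonneg)
  have h0: "0 \<le> h" by (simp add: h_def)
  have nY: "norms Y \<le> prod_list (map a P)" unfolding Y_def by (rule norms_map_le) (rule aY)
  define R1 where "R1 = Dg m s (v y s) Y - Dg m s (v x s) Y - Dg (Suc m) s (v x s) ((v y s - v x s) # Y)"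
  define R2 where "R2 = Dg (Suc m) s (v x s) (remainder x y [] s # Y)"
  define R3 where "R3 = Dg (Suc m) s (v x s) (W x [y - x] s # Y) - Dg (Suc m) s (v x s) (W x [y - x] s # X)"
  have "v y s - v x s = remainder x y [] s + W x [y - x] s"
    by (simp add: remainder_def W_Nil xV yV)
  then have split: "Dg m s (v y s) Y - Dg m s (v x s) Y - Dg (Suc m) s (v x s) (W x [y - x] s # X) = R1 + R2 + R3"
    unfolding R1_def R2_def R3_def using mlin_head(1)[OF lin, of Y] len by simp
  have R1: "norm R1 \<le> (e * h * C) * G"
  proof -
    have "norm R1 \<le> e * exp ((real m * \<sigma> + \<tau>) * s) * norm (v y s - v x s) * norms Y"
      using cl P(3) s len unfolding close_def R1_def m_def by blast
    also have "\<dots> \<le> e * exp ((real m * \<sigma> + \<tau>) * s) * (C * h * exp (p 1 * s)) * prod_list (map a P)"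
      using e0 C1 h0 by (intro mult_mono mult_left_mono nY close_v[OF s, folded h_def] norms_nonneg mult_nonneg_nonneg) auto
    also have "\<dots> = (e * h * C) * (exp (real m * \<sigma> * s) * (exp (\<tau> * s) * exp (p 1 * s)) * prod_list (map a P))"
      unfolding exp_add_mult by (simp add: mult_ac)
    also have "\<dots> \<le> (e * h * C) * (exp (real m * \<sigma> * s) * exp (q 1 * s) * prod_list (map a P))"
      using e0 C1 h0 a0 by (intro mult_left_mono mult_right_mono q1_le s) auto
    also have "\<dots> \<le> (e * h * C) * G" using e0 C1 h0 by (intro mult_left_mono eb) auto
    finally show ?thesis .
  qed
  have R2: "norm R2 \<le> (e * h * B0) * G"
  proof -
    have "norm R2 \<le> B0 * exp (real m * \<sigma> * s) * norm (remainder x y [] s) * prod_list (map a P)"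
      unfolding R2_def Y_def by (rule mlin_map_le[OF mlin_Cons[OF lin, unfolded m_def], folded m_def]) (rule aY)
    also have "\<dots> \<le> B0 * exp (real m * \<sigma> * s) * (e * h * exp (q 1 * s)) * prod_list (map a P)"
      using r0 s B00 a0 by (intro mult_right_mono mult_left_mono) (auto simp: expbd_def h_def)
    also have "\<dots> = (e * h * B0) * (exp (real m * \<sigma> * s) * exp (q 1 * s) * prod_list (map a P))" by simp
    also have "\<dots> \<le> (e * h * B0) * G" using e0 B00 h0 by (intro mult_left_mono eb) auto
    finally show ?thesis .
  qed
  have R3: "norm R3 \<le> (e * h * (real k * B0 * C)) * G"
  proof -
    have "norm R3 \<le> real (length P) * (B0 * exp (real m * \<sigma> * s) * norm (W x [y - x] s)) * e * prod_list (map a P)"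
      unfolding R3_def Y_def X_def
    proof (rule mlin_diff_le[where M = "\<lambda>vs. Dg (Suc m) s (v x s) (W x [y - x] s # vs)"])
      show "mlin (length P) (\<lambda>vs. Dg (Suc m) s (v x s) (W x [y - x] s # vs)) (B0 * exp (real m * \<sigma> * s) * norm (W x [y - x] s))"
        using mlin_Cons[OF lin] by (simp add: m_def)
      fix B assume B: "B \<in> set P"
      have "norm (W y B s - W x B s) \<le> e * norms B * exp (q (length B) * s)"
        using cl P(2)[OF B] s by (auto simp: close_def expbd_def)
      also have "\<dots> \<le> (e * norms B * exp (q (length B) * s)) * C"
        using mult_left_mono[OF C1, of "e * norms B * exp (q (length B) * s)"] e0 norms_nonneg[of B] by simp
      finally show "norm (W y B s - W x B s) \<le> e * a B" by (simp add: a_def mult_ac)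
    qed (use aY e0 in auto)
    also have "\<dots> \<le> real k * (B0 * exp (real m * \<sigma> * s) * (C * exp (q 1 * s) * h)) * e * prod_list (map a P)"
    proof -
      have "[y - x] \<in> dirs k" using hV k by (simp add: dirs_def)
      from Wbound_q[OF Wx this s] have "norm (W x [y - x] s) \<le> C * exp (q 1 * s) * h" by (simp add: h_def)
      then show ?thesis
        using P(3) B00 C1 h0 e0 a0 by (intro mult_right_mono mult_mono mult_left_mono) auto
    qed
    also have "\<dots> = (e * h * (real k * B0 * C)) * (exp (real m * \<sigma> * s) * exp (q 1 * s) * prod_list (map a P))" by simp
    also have "\<dots> \<le> (e * h * (real k * B0 * C)) * G" using e0 B00 C1 h0 by (intro mult_left_mono eb) auto
    finally show ?thesis .
  qed
  have "norm (R1 + R2 + R3) \<le> norm R1 + norm R2 + norm R3"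
    by (meson add_right_mono norm_triangle_ineq norm_triangle_le)
  also have "\<dots> \<le> (e * h * C) * G + (e * h * B0) * G + (e * h * (real k * B0 * C)) * G"
    by (intro add_mono R1 R2 R3)
  also have "\<dots> = e * h * (C ^ k * (C + B0 + real k * B0 * C)) * exp (q (Suc (sum_list (map length P))) * s) * prod_list (map norms P)"
    by (simp add: G_def algebra_simps)
  finally show ?thesis unfolding split[symmetric] by (simp add: m_def h_def Y_def X_def)
qed

text \<open>Differentiation in the blocks at a fixed base point: the product rule for multilinear
  maps, with the weights collected by \<open>leibniz_weight_le\<close>.\<close>

lemma inner_derivative:
  assumes s: "0 \<le> s" and P: "P \<noteq> []" "\<And>B. B \<in> set P \<Longrightarrow> B \<in> dirs (k - 1)" "length P \<le> k"
    and r: "\<And>B. B \<in> set P \<Longrightarrow> expbd (q (Suc (length B))) (e * norm (y - x) * norms B) (remainder x y B)"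
  shows "norm (Dg (length P) s (v x s) (map (\<lambda>B. W y B s) P) - Dg (length P) s (v x s) (map (\<lambda>B. W x B s) P)
       - (\<Sum>P'\<leftarrow>insertions (y - x) P. Dg (length P) s (v x s) (map (\<lambda>B. W x B s) P')))
    \<le> e * norm (y - x) * (real k * real k * B0 * (C + 1) ^ k) * exp (q (Suc (sum_list (map length P))) * s) * prod_list (map norms P)"
proof -
  define m where "m = length P"
  define h where "h = norm (y - x)"
  \<comment> \<open>The increment of a block is its formal derivative, with constant
    \<open>C\<close>, plus its remainder, with constant \<open>e \<le> 1\<close>.\<close>
  define D where "D = C + 1"
  define a where "a = (\<lambda>B::'h list. D * exp (q (length B) * s) * norms B)"
  define d where "d = (\<lambda>B::'h list. D * exp (q (Suc (length B)) * s) * norms B)"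
  have D: "C \<le> D" "1 \<le> D" "0 \<le> D" using C1 by (auto simp: D_def)
  have m: "1 \<le> m" "m \<le> k" using P by (auto simp: m_def Suc_le_eq)
  have Bk: "B \<in> dirs k" "B \<noteq> []" if "B \<in> set P" for B using P(2)[OF that] by (auto simp: dirs_def)
  have up: "u \<le> C * w \<Longrightarrow> 0 \<le> w \<Longrightarrow> u \<le> D * w" for u w :: real
    using mult_right_mono[OF D(1), of w] by linarith
  have nn: "0 \<le> prod_list (map norms P)" by (intro prod_list_nonneg) (auto simp: norms_nonneg)
  have "norm (Dg m s (v x s) (map (\<lambda>B. W y B s) P) - Dg m s (v x s) (map (\<lambda>B. W x B s) P)
       - (\<Sum>P'\<leftarrow>insertions (y - x) P. Dg m s (v x s) (map (\<lambda>B. W x B s) P')))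
    \<le> real (length P) * (B0 * exp ((real m - 1) * \<sigma> * s)) * e * h * leibniz_sum a d P"
  proof (rule mlin_product_rule)
    show "mlin (length P) (Dg m s (v x s)) (B0 * exp ((real m - 1) * \<sigma> * s))"
      using Dbound_mlin[OF DB m s] by (simp add: m_def)
    show "0 \<le> d B" for B using D norms_nonneg[of B] by (simp add: d_def)
    fix B assume B: "B \<in> set P"
    show "norm (W x B s) \<le> a B" "norm (W y B s) \<le> a B"
      using Wbound_q[OF Wx Bk(1)[OF B] s] Wbound_q[OF Wy Bk(1)[OF B] s] up[of _ "exp (q (length B) * s) * norms B"] norms_nonneg[of B]
      by (auto simp: a_def mult.assoc)
    have "norm (W y B s - W x B s) \<le> e * norms B * exp (q (length B) * s)"
      using cl Bk(1)[OF B] s by (auto simp: close_def expbd_def)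
    also have "\<dots> \<le> (e * norms B * exp (q (length B) * s)) * D"
      using mult_left_mono[OF D(2), of "e * norms B * exp (q (length B) * s)"] e0 norms_nonneg[of B] by simp
    finally show "norm (W y B s - W x B s) \<le> e * a B" by (simp add: a_def mult_ac)
    have rB: "norm (remainder x y B s) \<le> e * h * norms B * exp (q (Suc (length B)) * s)"
      using r[OF B] s by (simp add: expbd_def h_def)
    also have "\<dots> \<le> (e * h * norms B * exp (q (Suc (length B)) * s)) * D"
      using mult_left_mono[OF D(2), of "e * h * norms B * exp (q (Suc (length B)) * s)"] e0 norms_nonneg[of B] by (simp add: h_def)
    finally show "norm (W y B s - W x B s - W x ((y - x) # B) s) \<le> e * h * d B" by (simp add: d_def mult_ac remainder_def)
    have "(y - x) # B \<in> dirs k" using P(2)[OF B] hV k by (auto simp: dirs_def)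
    from Wbound_q[OF Wx this s] have w: "norm (W x ((y - x) # B) s) \<le> C * exp (q (Suc (length B)) * s) * (h * norms B)"
      by (simp add: h_def)
    have "e * h * norms B * exp (q (Suc (length B)) * s) \<le> 1 * h * norms B * exp (q (Suc (length B)) * s)"
      using e1 norms_nonneg[of B] by (intro mult_right_mono) (auto simp: h_def)
    then have "norm (remainder x y B s) \<le> 1 * h * norms B * exp (q (Suc (length B)) * s)" using rB by linarith
    moreover have "W y B s - W x B s = remainder x y B s + W x ((y - x) # B) s" by (simp add: remainder_def)
    ultimately show "norm (W y B s - W x B s) \<le> h * d B"
      using norm_triangle_le[OF add_mono[OF _ w], of "remainder x y B s" "1 * h * norms B * exp (q (Suc (length B)) * s)"]
      by (simp add: d_def D_def algebra_simps)
  qed (auto simp: e0 h_def)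
  also have "\<dots> = (e * h * real m * B0) * (exp ((real m - 1) * \<sigma> * s) * leibniz_sum a d P)"
    by (simp add: m_def)
  also have "\<dots> \<le> (e * h * real m * B0) * (real m * D ^ m * exp (q (Suc (sum_list (map length P))) * s) * prod_list (map norms P))"
    using q.leibniz_weight_le[OF D(3) s P(1) Bk(2)] e0 B00
    by (intro mult_left_mono) (auto simp: a_def d_def m_def h_def)
  also have "\<dots> \<le> (e * h * real k * B0) * (real k * D ^ k * exp (q (Suc (sum_list (map length P))) * s) * prod_list (map norms P))"
    using e0 B00 D m nn by (intro mult_mono mult_left_mono mult_right_mono power_increasing mult_nonneg_nonneg) (auto simp: h_def)
  finally show ?thesis by (simp add: m_def h_def D_def mult_ac)
qed

text \<open>Qualitative finiteness in the weight \<open>q (Suc (length vs))\<close>, as demanded by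
  the hypothesis \<open>fin\<close> of \<open>a_priori\<close>; the constant is not uniform.\<close>

lemma remainder_expbd:
  assumes vs: "vs = [] \<or> vs \<in> dirs k" "length vs < k"
  shows "\<exists>M. expbd (q (Suc (length vs))) M (remainder x y vs)"
proof -
  define j where "j = length vs"
  have d: "(y - x) # vs \<in> dirs k" using vs hV by (auto simp: dirs_def)
  have pq: "p (Suc j) \<le> q (Suc j)" using p_\<tau>_q[of "Suc j"] \<tau> by simp
  have "\<exists>Cy Cx. expbd (q (Suc j)) Cy (W y vs) \<and> expbd (q (Suc j)) Cx (W x vs)"
  proof (cases "vs = []")
    case True
    obtain Cy Cx where "expbd (p 1) Cy (v y)" "expbd (p 1) Cx (v x)" using v_bd xV yV by metis
    then show ?thesis using True pq W_Nil[OF xV] W_Nil[OF yV] by (auto simp: j_def intro: expbd_mono)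
  next
    case False
    then have vk: "vs \<in> dirs k" using vs by blast
    obtain Cy Cx where "expbd (p j) Cy (W y vs)" "expbd (p j) Cx (W x vs)"
      using W_sol[OF xV vk] W_sol[OF yV vk] by (auto simp: sol_def j_def)
    moreover have "p j \<le> q (Suc j)" using p_q_Suc[of j] dirs_len[OF vk] by (simp add: j_def)
    ultimately show ?thesis by (auto intro: expbd_mono)
  qed
  moreover obtain Ca where "expbd (q (Suc j)) Ca (W x ((y - x) # vs))"
    using W_sol[OF xV d] pq by (auto simp: sol_def j_def intro: expbd_mono)
  ultimately obtain Cy Cx Ca where C: "expbd (q (Suc j)) Cy (W y vs)" "expbd (q (Suc j)) Cx (W x vs)" "expbd (q (Suc j)) Ca (W x ((y - x) # vs))"
    by blast
  have "expbd (q (Suc j)) (Cy + Cx + Ca) (remainder x y vs)"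
    unfolding expbd_def remainder_def
  proof (intro allI impI)
    fix t :: real assume t: "0 \<le> t"
    have "norm (W y vs t - W x vs t - W x ((y - x) # vs) t) \<le> norm (W y vs t) + norm (W x vs t) + norm (W x ((y - x) # vs) t)"
      by (intro order.trans[OF norm_triangle_ineq4] add_mono norm_triangle_ineq4) simp
    then show "norm (W y vs t - W x vs t - W x ((y - x) # vs) t) \<le> (Cy + Cx + Ca) * exp (q (Suc j) * t)"
      using C t by (fastforce simp: expbd_def algebra_simps)
  qed
  then show ?thesis by (auto simp: j_def)
qed

text \<open>At order 0 the inhomogeneity is the Taylor remainder of the nonlinearity itself. Its
  smallness costs \<tau>, and the increment of the trajectory is Lipschitz in the weight
  \<open>p 1\<close>, so it fits into \<open>q 1\<close>.\<close>

lemma deriv_step_Nil: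
  "expbd (q 1) (K * (NP * C) * kap (q 1) / (1 - K * L * kap (q 1)) * e * norm (y - x)) (remainder x y [])"
proof -
  define h where "h = norm (y - x)"
  note g = goodD[OF gap_q[OF order.refl k]]
  have d: "[y - x] \<in> dirs k" using k hV by (auto simp: dirs_def)
  have pq: "p 1 \<le> q 1" using p_\<tau>_q[of 1] \<tau> by simp
  obtain My Mx Ma where M0: "0 \<le> My" "0 \<le> Mx" "0 \<le> Ma" "dominated (\<lambda>s. Dg 0 s (v y s) []) (p 1) My"
      "dominated (\<lambda>s. Dg 0 s (v x s) []) (p 1) Mx" "dominated (total W x [y - x]) (p 1) Ma"
    using v_dominated[OF yV] v_dominated[OF xV] total_dominated[OF xV d] by auto
  note M = dominated_mono[OF M0(4) pq M0(1)] dominated_mono[OF M0(5) pq M0(2)] dominated_mono[OF M0(6) pq M0(3)]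
  let ?f = "\<lambda>s. Dg 0 s (v y s) [] - Dg 0 s (v x s) [] - total W x [y - x] s"
  define R where "R s = Dg 0 s (v y s) [] - Dg 0 s (v x s) [] - Dg 1 s (v x s) [v y s - v x s]" for s
  have R: "norm (R s) \<le> (e * h * C) * exp (q 1 * s)" if s: "0 \<le> s" for s
  proof -
    have "norm (R s) \<le> e * exp ((real 0 * \<sigma> + \<tau>) * s) * norm (v y s - v x s) * norms ([]::'h list)"
    proof -
      have "\<forall>m s vs. m < k \<and> 0 \<le> s \<and> length vs = m \<longrightarrow>
        norm (Dg m s (v y s) vs - Dg m s (v x s) vs - Dg (Suc m) s (v x s) ((v y s - v x s) # vs))
          \<le> e * exp ((real m * \<sigma> + \<tau>) * s) * norm (v y s - v x s) * norms vs"
        using cl unfolding close_def by blast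
      from this[rule_format, of 0 s "[]"] show ?thesis using k s by (simp add: R_def)
    qed
    also have "\<dots> \<le> e * exp (\<tau> * s) * (C * h * exp (p 1 * s))"
      using e0 close_v[OF s] by (auto simp: h_def intro!: mult_left_mono)
    also have "\<dots> = (e * h * C) * (exp (\<tau> * s) * exp (p 1 * s))" by simp
    also have "\<dots> \<le> (e * h * C) * exp (q 1 * s)"
      using e0 C1 by (intro mult_left_mono q1_le s) (auto simp: h_def)
    finally show ?thesis .
  qed
  have split: "?f s = Dg 1 s (v x s) [remainder x y [] s] + R s" if s: "0 \<le> s" for s
    using s by (simp add: total_def rhs_def remainder_def W_Nil xV yV R_def Dg_1_linear del: One_nat_def)
  define \<rho> where "\<rho> = NP * (e * h * C)"
  obtain Cr where Cr: "expbd (q 1) Cr (remainder x y [])" using remainder_expbd[of "[]"] k by auto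
  have \<rho>: "0 \<le> \<rho>" using NP_nonneg e0 C1 by (simp add: \<rho>_def h_def)
  have "expbd (q 1) ((0 + K * \<rho> * kap (q 1)) / (1 - K * L * kap (q 1))) (remainder x y [])"
  proof (rule a_priori[OF g(1,2) L g(3) _ _ Cr _ \<rho>])
    show "remainder x y [] t = 0 + LP ?f t" if t: "0 \<le> t" for t
    proof -
      have "LP ?f t = LP (\<lambda>s. Dg 0 s (v y s) []) t - LP (\<lambda>s. Dg 0 s (v x s) []) t - LP (total W x [y - x]) t"
        using LP_diff[OF g(1,2) dominated_diff[OF M(1,2)] _ M(3) M0(3), of t]
          LP_diff[OF g(1,2) M(1) M0(1) M(2) M0(2), of t] M0 by simp
      then show ?thesis
        using W_eq[OF xV d t] v_eq[OF xV t] v_eq[OF yV t] t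
        by (simp add: remainder_def W_Nil xV yV free_def linear_diff[OF S_linear])
    qed
    show "continuous_on {0..} ?f"
      using M0 by (intro continuous_on_diff) (auto simp: dominated_def)
    fix s :: real assume s: "0 \<le> s"
    have "norm (Q (R s)) \<le> \<rho> * exp (q 1 * s)" "norm (Pp (R s)) \<le> \<rho> * exp (q 1 * s)"
      using order.trans[OF NP_Q mult_left_mono[OF R[OF s] NP_nonneg]] order.trans[OF NP_Pp mult_left_mono[OF R[OF s] NP_nonneg]]
      by (simp_all add: \<rho>_def mult_ac)
    then show "norm (Q (?f s)) \<le> L * norm (remainder x y [] s) + \<rho> * exp (q 1 * s)"
      "norm (Pp (?f s)) \<le> L * norm (remainder x y [] s) + \<rho> * exp (q 1 * s)"
      unfolding split[OF s] linear_add[OF Q_linear, of _ "R s"] linear_add[OF Pp_linear, of _ "R s"]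
      by (auto intro!: norm_triangle_le add_mono Dg_1_Q Dg_1_P s simp del: One_nat_def)
  qed (auto simp: expbd_def)
  also have "(0 + K * \<rho> * kap (q 1)) / (1 - K * L * kap (q 1)) = K * (NP * C) * kap (q 1) / (1 - K * L * kap (q 1)) * e * h"
    by (simp add: \<rho>_def)
  finally show ?thesis by (simp add: h_def)
qed

text \<open>With \<open>rhs_Cons\<close> the formal derivative is matched term by term:
  \<open>U\<close> varies the base point and \<open>I\<close> the blocks of a partition term. What
  stays is \<open>Dg 1\<close> applied to the remainder, with the constant \<open>L\<close> of the
  gap condition.\<close>

lemma deriv_step:
  assumes vs: "vs \<in> dirs k" "length vs < k"
    and r0: "expbd (q 1) (e * norm (y - x)) (remainder x y [])"
    and r: "\<And>B. B \<in> dirs (length vs - 1) \<Longrightarrow> expbd (q (Suc (length B))) (e * norm (y - x) * norms B) (remainder x y B)"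
  shows "expbd (q (Suc (length vs))) (K * (NP * (GC C B0 + N_parts (length vs) * GC C B0)) * kap (q (Suc (length vs))) / (1 - K * L * kap (q (Suc (length vs)))) * e * norm (y - x) * norms vs) (remainder x y vs)"
proof -
  define h where "h = norm (y - x)"
  define a where "a = y - x"
  define j where "j = length vs"
  define G1 G2 where "G1 = C ^ k * (C + B0 + real k * B0 * C)" and "G2 = real k * real k * B0 * (C + 1) ^ k"
  have G: "GC C B0 = G1 + G2" "0 \<le> G2" "0 \<le> G1" using C1 B00 by (auto simp: GC_def G1_def G2_def)
  have j: "1 \<le> j" "1 \<le> Suc j" "Suc j \<le> k" using vs dirs_len[OF vs(1)] by (auto simp: j_def)
  note g = goodD[OF gap_q[OF j(2,3)]]
  have ne: "vs \<noteq> []" using vs by (auto simp: dirs_def)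
  have d: "a # vs \<in> dirs k" using vs hV by (auto simp: dirs_def a_def)
  have pq: "p j \<le> q (Suc j)" "p (Suc j) \<le> q (Suc j)" using p_q_Suc[OF j(1)] p_\<tau>_q[OF j(2)] \<tau> by auto
  obtain My Mx Ma where M0: "0 \<le> My" "0 \<le> Mx" "0 \<le> Ma" "dominated (total W y vs) (p j) My"
      "dominated (total W x vs) (p j) Mx" "dominated (total W x (a # vs)) (p (Suc j)) Ma"
    using total_dominated[OF yV vs(1)] total_dominated[OF xV vs(1)] total_dominated[OF xV d] by (auto simp: j_def)
  note M = dominated_mono[OF M0(4) pq(1) M0(1)] dominated_mono[OF M0(5) pq(1) M0(2)] dominated_mono[OF M0(6) pq(2) M0(3)]
  let ?f = "\<lambda>s. total W y vs s - total W x vs s - total W x (a # vs) s"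
  let ?ex = "\<lambda>s. exp (q (Suc j) * s) * norms vs"
  define X1 where "X1 s = Dg 1 s (v y s) [W y vs s] - Dg 1 s (v x s) [W y vs s] - Dg 2 s (v x s) [W x [a] s, W x vs s]" for s
  define U where "U P s = Dg (length P) s (v y s) (map (\<lambda>B. W y B s) P) - Dg (length P) s (v x s) (map (\<lambda>B. W y B s) P)
       - Dg (Suc (length P)) s (v x s) (W x [a] s # map (\<lambda>B. W x B s) P)" for P s
  define I where "I P s = Dg (length P) s (v x s) (map (\<lambda>B. W y B s) P) - Dg (length P) s (v x s) (map (\<lambda>B. W x B s) P)
       - (\<Sum>P'\<leftarrow>insertions a P. Dg (length P) s (v x s) (map (\<lambda>B. W x B s) P'))" for P s
  define X2 where "X2 s = (\<Sum>P\<leftarrow>proper_parts vs. U P s + I P s)" for s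
  \<comment> \<open>The linear term is treated as a partition with the single block
    \<open>vs\<close>; its derivative in the base point is the \<open>Dg 2\<close> term of
    \<open>rhs_Cons\<close>.\<close>
  have X1: "norm (X1 s) \<le> e * h * G1 * ?ex s" if s: "0 \<le> s" for s
    using outer_derivative[OF s _ _ _ r0, of "[vs]"] vs j
    by (simp add: X1_def h_def G1_def j_def a_def numeral_2_eq_2 mult.assoc)
  have X2: "norm (X2 s) \<le> real (length (proper_parts vs)) * (e * h * GC C B0 * ?ex s)" if s: "0 \<le> s" for s
    unfolding X2_def
  proof (rule norm_sum_list_le)
    fix P assume P: "P \<in> set (proper_parts vs)"
    note pb = part_blocks[OF vs(1) P]
    have dk: "B \<in> dirs k" "B \<in> dirs (k - 1)" if "B \<in> set P" for B
      using pb(3)[OF that] vs(2) by (auto intro: dirs_mono)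
    have 1: "norm (U P s) \<le> e * h * G1 * ?ex s"
      using outer_derivative[OF s pb(1) dk(1) _ r0] pb(2) vs(2)
      by (simp add: U_def h_def G1_def j_def a_def pb(5,6) mult.assoc)
    have 2: "norm (I P s) \<le> e * h * G2 * ?ex s"
      using inner_derivative[OF s pb(1) dk(2) _ r[OF pb(3)]] pb(2) vs(2)
      by (simp add: I_def h_def G2_def j_def a_def pb(5,6) mult.assoc)
    show "norm (U P s + I P s) \<le> e * h * GC C B0 * ?ex s"
      using norm_triangle_le[OF add_mono[OF 1 2]] by (simp add: G algebra_simps)
  qed
  have X: "norm (X1 s + X2 s) \<le> (e * h * (GC C B0 + N_parts j * GC C B0) * norms vs) * exp (q (Suc j) * s)" if s: "0 \<le> s" for s
  proof -
    have "e * h * G1 * ?ex s \<le> e * h * GC C B0 * ?ex s"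
      using e0 G norms_nonneg[of vs] by (intro mult_right_mono mult_left_mono) (auto simp: h_def)
    then have "norm (X1 s + X2 s) \<le> e * h * GC C B0 * ?ex s + N_parts j * (e * h * GC C B0 * ?ex s)"
      using X1[OF s] X2[OF s] N_parts[of vs] by (intro norm_triangle_le add_mono) (auto simp: j_def)
    then show ?thesis by (simp add: algebra_simps)
  qed
  have split: "?f s = Dg 1 s (v x s) [remainder x y vs s] + (X1 s + X2 s)" if s: "0 \<le> s" for s
  proof -
    have "X2 s = rhs W y vs s - rhs W x vs s - (\<Sum>P\<leftarrow>proper_parts vs. Dg (Suc (length P)) s (v x s) (W x [a] s # map (\<lambda>B. W x B s) P) +
       (\<Sum>P'\<leftarrow>insertions a P. Dg (length P) s (v x s) (map (\<lambda>B. W x B s) P')))"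
      unfolding X2_def rhs_def sum_list_subtractf[symmetric] U_def I_def
      by (intro arg_cong[of _ _ sum_list] map_cong refl) simp
    then show ?thesis
      unfolding total_def rhs_Cons[OF ne] remainder_def Dg_1_linear[OF s] X1_def a_def by (simp del: One_nat_def)
  qed
  define \<rho> where "\<rho> = NP * (e * h * (GC C B0 + N_parts j * GC C B0) * norms vs)"
  have \<rho>: "0 \<le> \<rho>" using NP_nonneg e0 G norms_nonneg[of vs]
    unfolding \<rho>_def by (intro mult_nonneg_nonneg add_nonneg_nonneg) (auto simp: h_def N_parts_def)
  obtain Cr where Cr: "expbd (q (Suc j)) Cr (remainder x y vs)" using remainder_expbd[of vs] vs by (auto simp: j_def)
  have "expbd (q (Suc j)) ((0 + K * \<rho> * kap (q (Suc j))) / (1 - K * L * kap (q (Suc j)))) (remainder x y vs)"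
  proof (rule a_priori[OF g(1,2) L g(3) _ _ Cr _ \<rho>])
    show "remainder x y vs t = 0 + LP ?f t" if t: "0 \<le> t" for t
    proof -
      have "LP ?f t = LP (total W y vs) t - LP (total W x vs) t - LP (total W x (a # vs)) t"
        using LP_diff[OF g(1,2) dominated_diff[OF M(1,2)] _ M(3) M0(3), of t]
          LP_diff[OF g(1,2) M(1) M0(1) M(2) M0(2), of t] M0 by simp
      moreover have "free (a # vs) t = 0" using ne by (simp add: free_def)
      ultimately show ?thesis
        using W_eq[OF xV d t] W_eq[OF xV vs(1) t] W_eq[OF yV vs(1) t]
        by (simp add: remainder_def a_def)
    qed
    show "continuous_on {0..} ?f"
      using M0 by (intro continuous_on_diff) (auto simp: dominated_def)
    fix s :: real assume s: "0 \<le> s"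
    have "norm (Q (X1 s + X2 s)) \<le> \<rho> * exp (q (Suc j) * s)" "norm (Pp (X1 s + X2 s)) \<le> \<rho> * exp (q (Suc j) * s)"
      using order.trans[OF NP_Q mult_left_mono[OF X[OF s] NP_nonneg]] order.trans[OF NP_Pp mult_left_mono[OF X[OF s] NP_nonneg]]
      by (simp_all add: \<rho>_def mult_ac)
    then show "norm (Q (?f s)) \<le> L * norm (remainder x y vs s) + \<rho> * exp (q (Suc j) * s)"
      "norm (Pp (?f s)) \<le> L * norm (remainder x y vs s) + \<rho> * exp (q (Suc j) * s)"
      unfolding split[OF s] linear_add[OF Q_linear, of _ "X1 s + X2 s"] linear_add[OF Pp_linear, of _ "X1 s + X2 s"]
      by (auto intro!: norm_triangle_le add_mono Dg_1_Q Dg_1_P s simp del: One_nat_def)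
  qed (auto simp: expbd_def)
  also have "(0 + K * \<rho> * kap (q (Suc j))) / (1 - K * L * kap (q (Suc j))) = K * (NP * (GC C B0 + N_parts j * GC C B0)) * kap (q (Suc j)) / (1 - K * L * kap (q (Suc j))) * e * h * norms vs"
    by (simp add: \<rho>_def mult_ac)
  finally show ?thesis by (simp add: j_def h_def)
qed

end

lemma rescale:
  assumes "0 < e" shows "\<exists>e'>0. e' \<le> e \<and> e' \<le> 1 \<and> Z * e' \<le> (e::real)"
proof (intro exI conjI)
  define e' where "e' = min 1 (e / (\<bar>Z\<bar> + 1))"
  show "0 < e'" "e' \<le> 1" using assms by (auto simp: e'_def)
  have 1: "e' \<le> e / (\<bar>Z\<bar> + 1)" by (simp add: e'_def)
  also have "\<dots> \<le> e" using assms by (simp add: field_simps)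
  finally show "e' \<le> e" .
  have "Z * e' \<le> \<bar>Z\<bar> * e'" using \<open>0 < e'\<close> by (intro mult_right_mono) auto
  also have "\<dots> \<le> \<bar>Z\<bar> * (e / (\<bar>Z\<bar> + 1))" using 1 by (intro mult_left_mono) auto
  also have "\<dots> \<le> e" using assms by (simp add: field_simps)
  finally show "Z * e' \<le> e" .
qed

lemma W_differentiable:
  assumes x: "x \<in> V"
  shows "n \<le> k \<Longrightarrow> 0 < e \<Longrightarrow> \<forall>\<^sub>F y in near x. \<forall>vs. set vs \<subseteq> V \<and> length vs < n \<longrightarrow>
    expbd (q (Suc (length vs))) (e * norm (y - x) * norms vs) (remainder x y vs)"
proof (induction n arbitrary: e)
  case (Suc n)
  obtain C B0 where C: "1 \<le> C" "0 \<le> B0" "\<forall>e. 0 < e \<and> e \<le> 1 \<longrightarrow> (\<forall>\<^sub>F y in near x. close e C B0 x y)"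
    by (rule close_near[OF x])
  have mono: "expbd \<gamma> (a * norm (y - x) * norms vs) f \<Longrightarrow> a \<le> b \<Longrightarrow> expbd \<gamma> (b * norm (y - x) * norms vs) f" for a b \<gamma> f vs y
    unfolding expbd_def by (meson exp_ge_zero mult_right_mono norms_nonneg norm_ge_zero order.trans)
  show ?case
  proof (cases "n = 0")
    case True
    obtain e' where e': "0 < e'" "e' \<le> 1" "K * (NP * C) * kap (q 1) / (1 - K * L * kap (q 1)) * e' \<le> e"
      using rescale[OF Suc.prems(2)] by blast
    from C(3)[rule_format, OF conjI[OF e'(1,2)]] show ?thesis
    proof eventually_elim
      case (elim y)
      from mono[of _ _ y "[]", OF _ e'(3)] deriv_step_Nil[OF elim]
      show ?case using True by simp
    qed
  next
    case False
    define GG where "GG = GC C B0"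
    define Z where "Z = K * (NP * (GG + N_parts n * GG)) * kap (q (Suc n)) / (1 - K * L * kap (q (Suc n)))"
    obtain e' where e': "0 < e'" "e' \<le> e" "e' \<le> 1" "Z * e' \<le> e" using rescale[OF Suc.prems(2)] by blast
    have IH: "\<forall>\<^sub>F y in near x. \<forall>vs. set vs \<subseteq> V \<and> length vs < n \<longrightarrow>
        expbd (q (Suc (length vs))) (e' * norm (y - x) * norms vs) (remainder x y vs)"
      using Suc e' by auto
    from IH C(3)[rule_format, OF conjI[OF e'(1,3)]] show ?thesis
    proof eventually_elim
      case (elim y)
      show ?case
      proof (intro allI impI)
        fix vs assume vs: "set vs \<subseteq> V \<and> length vs < Suc n"
        show "expbd (q (Suc (length vs))) (e * norm (y - x) * norms vs) (remainder x y vs)"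
        proof (cases "length vs = n")
          case True
          have vk: "vs \<in> dirs k" "length vs < k" using True False vs Suc.prems(1) by (auto simp: dirs_def)
          have "expbd (q (Suc (length vs))) (K * (NP * (GG + N_parts (length vs) * GG)) * kap (q (Suc (length vs))) / (1 - K * L * kap (q (Suc (length vs)))) * e' * norm (y - x) * norms vs) (remainder x y vs)"
            unfolding GG_def
          proof (rule deriv_step[OF elim(2) vk])
            show "expbd (q 1) (e' * norm (y - x)) (remainder x y [])"
              using elim(1)[rule_format, of "[]"] False by simp
            show "expbd (q (Suc (length B))) (e' * norm (y - x) * norms B) (remainder x y B)" if "B \<in> dirs (length vs - 1)" for B
            proof -
              have "length B < n" "set B \<subseteq> V" using that True \<open>n \<noteq> 0\<close> unfolding dirs_def by (cases vs; force)+
              then show ?thesis using elim(1) by blast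
            qed
          qed
          from mono[OF this[unfolded True, folded Z_def] e'(4)] show ?thesis unfolding True .
        next
          case False
          then have "expbd (q (Suc (length vs))) (e' * norm (y - x) * norms vs) (remainder x y vs)"
            using elim(1) vs by auto
          from mono[OF this e'(2)] show ?thesis .
        qed
      qed
    qed
  qed
qed simp

end

text \<open>At time 0 all weights equal 1, so the loss of weight along the half-line is invisible in
  the derivatives of the graph.\<close>

theorem stable_graph_Ck: "Ck_on k V (\<lambda>x. Pp (v x 0))"
proof -
  obtain W where W: "sols k W" using sols_exist by blast
  define D where "D j x vs = Pp (W x vs 0)" for j :: nat and x vs
  have NP1: "0 < NP + 1" using NP_nonneg by simp
  have NPP: "norm (Pp z) \<le> (NP + 1) * c" if "norm z \<le> c" for z :: 'h and c
  proof -
    have "norm (Pp z) \<le> (NP + 1) * norm z" using NP_Pp[of z] norm_ge_zero[of z] by (simp add: algebra_simps del: norm_ge_zero)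
    also have "\<dots> \<le> (NP + 1) * c" using NP1 that by (intro mult_left_mono) auto
    finally show ?thesis .
  qed
  have d0: "x \<in> V \<Longrightarrow> vs \<noteq> [] \<Longrightarrow> set vs \<subseteq> V \<Longrightarrow> length vs \<le> k \<Longrightarrow> vs \<in> dirs k" for x vs by (simp add: dirs_def)
  have "frechet_derivs_upto k V (\<lambda>x. Pp (v x 0)) D"
  proof (rule frechet_derivs_uptoI[OF V_subspace])
    show "D 0 x [] = Pp (v x 0)" if "x \<in> V" for x using W_Nil[OF W that] by (simp add: D_def)
  next
    fix j x vs a b assume A: "j < k" "x \<in> V" "length vs = j" "set vs \<subseteq> V" "a \<in> V" "b \<in> V"
    show "D (Suc j) x ((a + b) # vs) = D (Suc j) x (a # vs) + D (Suc j) x (b # vs)"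
      using W_head[OF W A(2,5,6,4), of 0 1] A by (simp add: D_def linear_add[OF Pp_linear])
  next
    fix j x vs a c assume A: "j < k" "x \<in> V" "length vs = j" "set vs \<subseteq> V" "a \<in> V"
    show "D (Suc j) x ((c *\<^sub>R a) # vs) = c *\<^sub>R D (Suc j) x (a # vs)"
      using W_head[OF W A(2) subspace_0[OF V_subspace] A(5,4), of 0 c] W_zero_direction[OF W A(2,4), of 0] A
      by (simp add: D_def linear_cmul[OF Pp_linear])
  next
    fix j x assume A: "j \<le> k" "x \<in> V"
    obtain C where C: "Wbound C W k x" using W_bounded_at[OF W A(2)] by blast
    show "\<exists>C. \<forall>vs. length vs = j \<and> set vs \<subseteq> V \<longrightarrow> norm (D j x vs) \<le> C * norms vs"
    proof (cases "j = 0")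
      case True
      then show ?thesis by (intro exI[of _ "norm (D j x [])"]) auto
    next
      case False
      then have "norm (W x vs 0) \<le> C * norms vs" if "length vs = j" "set vs \<subseteq> V" for vs
        using WboundD[OF C, of vs 0] that A by (auto simp: dirs_def)
      then show ?thesis using NPP unfolding D_def by (intro exI[of _ "(NP + 1) * C"]) (auto simp: mult.assoc)
    qed
  next
    fix j x and e :: real assume A: "j < k" "x \<in> V" "0 < e"
    define e' where "e' = e / (NP + 1)"
    have e': "0 < e'" "(NP + 1) * e' = e" using A NP1 by (auto simp: e'_def)
    from W_differentiable[OF W A(2) order.refl e'(1)]
    have "\<forall>\<^sub>F y in near x. \<forall>vs. length vs = j \<and> set vs \<subseteq> V \<longrightarrow>
           norm (D j y vs - D j x vs - D (Suc j) x ((y - x) # vs)) \<le> e * norm (y - x) * norms vs"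
    proof eventually_elim
      case (elim y)
      show ?case
      proof (intro allI impI)
        fix vs assume vs: "length vs = j \<and> set vs \<subseteq> V"
        then have "expbd (q (Suc j)) (e' * norm (y - x) * norms vs) (remainder W x y vs)" using elim A(1) by auto
        then have "norm (W y vs 0 - W x vs 0 - W x ((y - x) # vs) 0) \<le> e' * norm (y - x) * norms vs"
          using expbd_at_0 by (fastforce simp: remainder_def[OF W])
        from NPP[OF this] show "norm (D j y vs - D j x vs - D (Suc j) x ((y - x) # vs)) \<le> e * norm (y - x) * norms vs"
          by (simp add: D_def linear_diff[OF Pp_linear] e'(2)[symmetric] mult.assoc)
      qed
    qed
    then show "\<exists>d>0. \<forall>y\<in>V. dist y x < d \<longrightarrow> (\<forall>vs. length vs = j \<and> set vs \<subseteq> V \<longrightarrow>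
           norm (D j y vs - D j x vs - D (Suc j) x ((y - x) # vs)) \<le> e * norm (y - x) * norms vs)"
      unfolding eventually_near .
  next
    fix j x and e :: real assume A: "j \<le> k" "x \<in> V" "0 < e"
    define e' where "e' = e / (NP + 1)"
    have e': "0 < e'" "(NP + 1) * e' = e" using A NP1 by (auto simp: e'_def)
    have "\<forall>\<^sub>F y in near x. \<forall>vs. length vs = j \<and> set vs \<subseteq> V \<longrightarrow> norm (D j y vs - D j x vs) \<le> e * norms vs"
    proof (cases "j = 0")
      case True
      have "\<forall>\<^sub>F y in near x. Lv * norm (y - x) \<le> e'"
      proof -
        have "((\<lambda>y. Lv * norm (y - x)) \<longlongrightarrow> Lv * norm (x - x)) (nhds x)"
          by (intro tendsto_intros filterlim_ident)
        then have "\<forall>\<^sub>F y in nhds x. Lv * norm (y - x) < e'" using e' by (intro order_tendstoD(2)) auto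
        then show ?thesis unfolding near_def eventually_inf_principal by eventually_elim auto
      qed
      then show ?thesis using near_V[of x]
      proof eventually_elim
        case (elim y)
        have "norm (v y 0 - v x 0) \<le> Lv * norm (y - x)" by (rule expbd_at_0[OF v_lip[OF A(2) elim(2)]])
        then have "norm (v y 0 - v x 0) \<le> e'" using elim by simp
        from NPP[OF this] show ?case using True W_Nil[OF W] A(2) elim(2) e'(2)
          by (simp add: D_def linear_diff[OF Pp_linear])
      qed
    next
      case False
      from W_continuous[OF W A(2) order.refl e'(1)] show ?thesis
      proof eventually_elim
        case (elim y)
        show ?case
        proof (intro allI impI)
          fix vs assume vs: "length vs = j \<and> set vs \<subseteq> V"
          then have "vs \<in> dirs k" using False A by (auto simp: dirs_def)
          then have "norm (W y vs 0 - W x vs 0) \<le> e' * norms vs" using elim expbd_at_0 by fastforce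
          from NPP[OF this] show "norm (D j y vs - D j x vs) \<le> e * norms vs"
            by (simp add: D_def linear_diff[OF Pp_linear] e'(2)[symmetric] mult.assoc)
        qed
      qed
    qed
    then show "\<exists>d>0. \<forall>y\<in>V. dist y x < d \<longrightarrow> (\<forall>vs. length vs = j \<and> set vs \<subseteq> V \<longrightarrow> norm (D j y vs - D j x vs) \<le> e * norms vs)"
      unfolding eventually_near .
  qed
  then show ?thesis unfolding Ck_on_def by blast
qed

end

subsection \<open>The equation with a scaled nonlinearity\<close>

locale scaled_equation = dichotomy S Pp \<alpha> \<beta> K
  for S :: "real \<Rightarrow> 'h::{banach,second_countable_topology} \<Rightarrow> 'h" and Pp \<alpha> \<beta> K +
  fixes F :: "'h \<Rightarrow> 'h" and c :: "real \<Rightarrow> real" and L :: real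
  assumes F_zero: "F 0 = 0" and L: "0 \<le> L"
    and F_lip_P: "\<And>x y. norm (Pp (F x - F y)) \<le> L * norm (x - y)"
    and F_lip_Q: "\<And>x y. norm (Q (F x - F y)) \<le> L * norm (x - y)"
    and c_cont: "continuous_on {0..} c" and c_pos: "\<And>s. 0 \<le> s \<Longrightarrow> 0 < c s"
    and c_subexp: "\<And>\<sigma>. 0 < \<sigma> \<Longrightarrow> \<exists>C. \<forall>s\<ge>0. c s \<le> C * exp (\<sigma> * s)"
begin

definition g :: "real \<Rightarrow> 'h \<Rightarrow> 'h" where
  "g s X = (1 / c s) *\<^sub>R F (c s *\<^sub>R X)"

lemma g_zero [simp]: "g s 0 = 0" by (simp add: g_def F_zero)

lemma F_lip: "norm (F x - F y) \<le> 2 * L * norm (x - y)"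
  using F_lip_P[of x y] F_lip_Q[of x y] norm_triangle_ineq[of "Pp (F x - F y)" "Q (F x - F y)"]
  by (simp add: Pp_plus_Q)

lemma F_cont: "continuous_on A F"
proof (rule continuous_on_subset[of UNIV])
  have "(2 * L)-lipschitz_on UNIV F"
    using F_lip L by (intro lipschitz_onI) (auto simp: dist_norm)
  then show "continuous_on UNIV F" by (rule lipschitz_on_continuous_on)
qed simp

text \<open>Conjugation with a positive scalar preserves Lipschitz constants, so the gap condition
  is not affected by the noise. \<open>T\<close> stands for either projection or the
  identity.\<close>

lemma g_diff: "0 \<le> s \<Longrightarrow> norm (T (g s a - g s b)) \<le> l * norm (a - b)"
  if T: "linear T" and TF: "\<And>x y. norm (T (F x - F y)) \<le> l * norm (x - y)" for T :: "'h \<Rightarrow> 'h"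
proof -
  assume s: "0 \<le> s"
  have "g s a - g s b = (1 / c s) *\<^sub>R (F (c s *\<^sub>R a) - F (c s *\<^sub>R b))" by (simp add: g_def scaleR_diff_right)
  then have "norm (T (g s a - g s b)) = 1 / c s * norm (T (F (c s *\<^sub>R a) - F (c s *\<^sub>R b)))"
    using c_pos[OF s] by (simp add: linear_cmul[OF T])
  also have "\<dots> \<le> 1 / c s * (l * norm (c s *\<^sub>R a - c s *\<^sub>R b))"
    using c_pos[OF s] by (intro mult_left_mono TF) auto
  also have "\<dots> = l * norm (a - b)"
    using c_pos[OF s] by (simp flip: scaleR_diff_right)
  finally show ?thesis .
qed

lemmas g_lip_Q = g_diff[OF Q_linear F_lip_Q] and g_lip_P = g_diff[OF Pp_linear F_lip_P]
  and g_lip = g_diff[OF linear_ident F_lip]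

lemma g_cont: "continuous_on {0..} w \<Longrightarrow> continuous_on {0..} (\<lambda>s. g s (w s))"
  unfolding g_def
  by (intro continuous_intros continuous_on_compose2[OF F_cont[of UNIV]] c_cont) (auto dest: c_pos)

lemma g_dominated:
  assumes "continuous_on {0..} w" "expbd \<gamma> C w"
  shows "dominated (\<lambda>s. g s (w s)) \<gamma> (L * C)"
  unfolding dominated_def
proof (intro conjI allI impI g_cont assms)
  fix s :: real assume s: "0 \<le> s"
  have "L * norm (w s) \<le> L * (C * exp (\<gamma> * s))" using assms(2) s L by (intro mult_left_mono) (auto simp: expbd_def)
  then show "norm (Q (g s (w s))) \<le> L * C * exp (\<gamma> * s)" "norm (Pp (g s (w s))) \<le> L * C * exp (\<gamma> * s)"
    using g_lip_Q[OF s, of "w s" 0] g_lip_P[OF s, of "w s" 0] by simp_all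
qed

text \<open>The iteration starts from 0 and mentions no weight. The same function is therefore the
  solution for every good \<gamma>: the graph is characterised in the weight \<eta>, while its
  smoothness is proved in nearby weights.\<close>

definition vsol :: "'h \<Rightarrow> real \<Rightarrow> 'h" where
  "vsol \<xi> t = lim (\<lambda>n. picard (\<lambda>t. S t \<xi>) g n t)"

lemma vsol:
  assumes gd: "good L \<gamma>" and \<xi>: "\<xi> \<in> V"
  shows vsol_cont: "continuous_on {0..} (vsol \<xi>)"
    and vsol_expbd: "\<exists>C. expbd \<gamma> C (vsol \<xi>)"
    and vsol_eq: "0 \<le> t \<Longrightarrow> vsol \<xi> t = S t \<xi> + LP (\<lambda>s. g s (vsol \<xi> s)) t"
    and vsol_lim: "0 \<le> t \<Longrightarrow> (\<lambda>n. picard (\<lambda>t. S t \<xi>) g n t) \<longlonglongrightarrow> vsol \<xi> t"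
proof -
  have b: "\<beta> < \<gamma>" "\<gamma> < \<alpha>" "K * L * kap \<gamma> < 1" using gd by (auto simp: good_def)
  have d0: "dominated (\<lambda>s. g s 0) \<gamma> 0" by (simp add: dominated_def)
  have "\<exists>w C. continuous_on {0..} w \<and> expbd \<gamma> C w \<and>
      (\<forall>t\<ge>0. w t = S t \<xi> + LP (\<lambda>s. g s (w s)) t) \<and>
      (\<forall>t\<ge>0. (\<lambda>n. picard (\<lambda>t. S t \<xi>) g n t) \<longlonglongrightarrow> w t)"
  proof (rule picard_convergence[OF b(1,2) L b(3) S_V_cont[OF \<xi>] S_V_expbd[OF less_imp_le[OF b(1)] \<xi>] g_cont g_lip_Q g_lip_P d0 order.refl])
    fix w C assume w: "continuous_on {0..} w" "expbd \<gamma> C w"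
      "\<And>t. 0 \<le> t \<Longrightarrow> w t = S t \<xi> + LP (\<lambda>s. g s (w s)) t"
      "\<And>t. 0 \<le> t \<Longrightarrow> (\<lambda>n. picard (\<lambda>t. S t \<xi>) g n t) \<longlonglongrightarrow> w t"
    show "\<exists>w C. continuous_on {0..} w \<and> expbd \<gamma> C w \<and>
      (\<forall>t\<ge>0. w t = S t \<xi> + LP (\<lambda>s. g s (w s)) t) \<and>
      (\<forall>t\<ge>0. (\<lambda>n. picard (\<lambda>t. S t \<xi>) g n t) \<longlonglongrightarrow> w t)" by (intro exI[of _ w] exI[of _ C] conjI allI impI w)
  qed
  then obtain w C where w: "continuous_on {0..} w" "expbd \<gamma> C w"
    "\<And>t. 0 \<le> t \<Longrightarrow> w t = S t \<xi> + LP (\<lambda>s. g s (w s)) t"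
    "\<And>t. 0 \<le> t \<Longrightarrow> (\<lambda>n. picard (\<lambda>t. S t \<xi>) g n t) \<longlonglongrightarrow> w t"
    by blast
  have eq: "vsol \<xi> t = w t" if "0 \<le> t" for t
    unfolding vsol_def by (rule limI[OF w(4)[OF that]])
  show "continuous_on {0..} (vsol \<xi>)" by (rule continuous_on_eq[OF w(1)]) (simp add: eq)
  show "\<exists>C. expbd \<gamma> C (vsol \<xi>)" using w(2) by (auto simp: expbd_def eq)
  show "vsol \<xi> t = S t \<xi> + LP (\<lambda>s. g s (vsol \<xi> s)) t" if t: "0 \<le> t"
    using w(3)[OF t] LP_cong[of "\<lambda>s. g s (vsol \<xi> s)" "\<lambda>s. g s (w s)" t] by (simp add: eq t)
  show "(\<lambda>n. picard (\<lambda>t. S t \<xi>) g n t) \<longlonglongrightarrow> vsol \<xi> t" if "0 \<le> t"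
    using w(4)[OF that] by (simp add: eq that)
qed

lemma vsol_lipschitz:
  assumes gd: "good L \<gamma>" and x: "x \<in> V" and y: "y \<in> V"
  shows "expbd \<gamma> (K / (1 - K * L * kap \<gamma>) * norm (y - x)) (\<lambda>t. vsol y t - vsol x t)"
proof -
  obtain C C' where C: "expbd \<gamma> C (vsol y)" "expbd \<gamma> C' (vsol x)" using vsol_expbd[OF gd] x y by metis
  note dm = g_dominated[OF vsol_cont[OF gd y] C(1)] g_dominated[OF vsol_cont[OF gd x] C(2)]
  have "y - x \<in> V" using x y V_subspace by (simp add: subspace_diff)
  moreover have "\<beta> \<le> \<gamma>" using gd by (simp add: good_def)
  ultimately have "expbd \<gamma> (K * norm (y - x)) (\<lambda>t. S t (y - x))" by (intro S_V_expbd)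
  then have "expbd \<gamma> (K * norm (y - x)) (\<lambda>t. S t y - S t x)"
    by (simp add: expbd_def linear_diff[OF S_linear])
  from LP_solution_lipschitz[OF gd L g_lip_Q g_lip_P dm(1) C(1) vsol_eq[OF gd y] dm(2) C(2) vsol_eq[OF gd x] _ _ this]
  show ?thesis using L C expbd_nonneg by fastforce
qed

definition mild :: "'h \<Rightarrow> (real \<Rightarrow> 'h) \<Rightarrow> bool" where
  "mild x w \<longleftrightarrow> continuous_on {0..} w \<and> (\<forall>t\<ge>0. w t = S t x + conv (\<lambda>s. g s (w s)) t)"

lemma mild_unique': "mild x w \<Longrightarrow> mild x w' \<Longrightarrow> 0 \<le> t \<Longrightarrow> w t = w' t"
  by (rule mild_unique[where g = g and L = "2 * L" and x = x])
    (use g_cont g_lip L in \<open>auto simp: mild_def\<close>)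

lemma conv_0: "conv f 0 = 0"
proof -
  have "AE s in lborel. s \<noteq> (0::real)" by (rule AE_lborel_singleton)
  then have "AE s in lborel. indicator {0..0} s *\<^sub>R S (0 - s) (f s) = 0"
    by eventually_elim (auto simp: indicator_def)
  then show ?thesis unfolding conv_def by (rule integral_eq_zero_AE)
qed

text \<open>The parameter has to be \<open>Q x\<close>, because the Lyapunov--Perron integral at
  time 0 lies in the unstable subspace.\<close>

lemma stable_set_graph:
  assumes gd: "good L \<gamma>"
  shows "(\<exists>w C. mild x w \<and> expbd \<gamma> C w) \<longleftrightarrow> (\<exists>\<xi>\<in>V. x = \<xi> + Pp (vsol \<xi> 0))"
proof
  have b: "\<beta> < \<gamma>" "\<gamma> < \<alpha>" "K * L * kap \<gamma> < 1" using gd by (auto simp: good_def)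
  {
    assume "\<exists>w C. mild x w \<and> expbd \<gamma> C w"
    then obtain w C where w: "mild x w" "expbd \<gamma> C w" by blast
    then have wc: "continuous_on {0..} w" and we: "\<And>t. 0 \<le> t \<Longrightarrow> w t = S t x + conv (\<lambda>s. g s (w s)) t"
      by (auto simp: mild_def)
    note d = g_dominated[OF wc w(2)]
    have LC: "0 \<le> L * C" using L expbd_nonneg[OF w(2)] by simp
    have \<xi>: "Q x \<in> V" by (simp add: in_V)
    obtain C' where C': "expbd \<gamma> C' (vsol (Q x))" using vsol_expbd[OF gd \<xi>] by blast
    have LC': "0 \<le> L * C'" using L expbd_nonneg[OF C'] by simp
    \<comment> \<open>Both solutions have the same free term, so the Lipschitz estimate with
      \<open>R = 0\<close> identifies them.\<close>
    have "expbd \<gamma> 0 (\<lambda>t. S t (Q x) - S t (Q x))" by (simp add: expbd_def)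
    from expbd_at_0[OF LP_solution_lipschitz[OF gd L g_lip_Q g_lip_P d w(2) mild_imp_LP[OF b(1,2) d LC w(2) we]
          g_dominated[OF vsol_cont[OF gd \<xi>] C'] C' vsol_eq[OF gd \<xi>] LC LC' this]]
    have "w 0 = vsol (Q x) 0" by simp
    then have "x = vsol (Q x) 0" using we[of 0] by (simp add: conv_0)
    then have "x = Q x + Pp (vsol (Q x) 0)" using Pp_plus_Q[of x] by (simp add: add.commute)
    then show "\<exists>\<xi>\<in>V. x = \<xi> + Pp (vsol \<xi> 0)" using \<xi> by blast
  next
    assume "\<exists>\<xi>\<in>V. x = \<xi> + Pp (vsol \<xi> 0)"
    then obtain \<xi> where \<xi>: "\<xi> \<in> V" "x = \<xi> + Pp (vsol \<xi> 0)" by blast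
    obtain C where C: "expbd \<gamma> C (vsol \<xi>)" using vsol_expbd[OF gd \<xi>(1)] by blast
    note d = g_dominated[OF vsol_cont[OF gd \<xi>(1)] C]
    have LC: "0 \<le> L * C" using L expbd_nonneg[OF C] by simp
    have Q\<xi>: "Q \<xi> = \<xi>" using \<xi> by (simp add: in_V)
    then have P\<xi>: "Pp \<xi> = 0" using Pp_Q[of \<xi>] by simp
    have v0: "vsol \<xi> 0 = x"
      using vsol_eq[OF gd \<xi>(1), of 0] LP_0_unstable[OF b(1,2) d LC] \<xi>(2) P\<xi> by (simp add: linear_add[OF Pp_linear])
    have "vsol \<xi> t = S t x + conv (\<lambda>s. g s (vsol \<xi> s)) t" if "0 \<le> t" for t
      using LP_imp_mild[OF b(1,2) d LC vsol_eq[OF gd \<xi>(1)] Q\<xi> that] unfolding v0 .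
    then have "mild x (vsol \<xi>)"
      using vsol_cont[OF gd \<xi>(1)] unfolding mild_def by blast
    then show "\<exists>w C. mild x w \<and> expbd \<gamma> C w" using C by blast
  }
qed

end

subsection \<open>Derivatives of the nonlinearity along a trajectory\<close>

context
  fixes k :: nat and F :: "'a::real_normed_vector \<Rightarrow> 'b::real_normed_vector" and D
  assumes D: "frechet_derivs_upto k UNIV F D"
begin

lemma D_multilinear: "m \<le> k \<Longrightarrow> bounded_multilinear_on UNIV m (D m X)"
  using D by (simp add: frechet_derivs_upto_def)

lemma D_continuous: "m \<le> k \<Longrightarrow> 0 < e \<Longrightarrow> \<exists>d>0. \<forall>Y. dist Y X < d \<longrightarrow>
    (\<forall>vs. length vs = m \<longrightarrow> norm (D m Y vs - D m X vs) \<le> e * norms vs)"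
  using D by (simp add: frechet_derivs_upto_def)

lemma D_derivative: "m < k \<Longrightarrow> 0 < e \<Longrightarrow> \<exists>d>0. \<forall>Y. dist Y X < d \<longrightarrow>
    (\<forall>vs. length vs = m \<longrightarrow> norm (D m Y vs - D m X vs - D (Suc m) X ((Y - X) # vs)) \<le> e * norm (Y - X) * norms vs)"
  using D by (simp add: frechet_derivs_upto_def)

lemma D_bound_at: "m \<le> k \<Longrightarrow> \<exists>B\<ge>0. \<forall>vs. length vs = m \<longrightarrow> norm (D m X vs) \<le> B * norms vs"
proof -
  assume "m \<le> k"
  from D_multilinear[OF this, of X] obtain B where B: "\<And>vs. length vs = m \<Longrightarrow> norm (D m X vs) \<le> B * norms vs"
    by (auto simp: bounded_multilinear_on_def)
  have "norm (D m X vs) \<le> max 0 B * norms vs" if "length vs = m" for vs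
    using B[OF that] mult_right_mono[of B "max 0 B" "norms vs"] norms_nonneg[of vs] by simp
  then show ?thesis by (intro exI[of _ "max 0 B"]) auto
qed

text \<open>A Lebesgue number argument. Only \<open>X\<close> is confined to the compact set;
  \<open>Z\<close> ranges over a full neighbourhood in the space, as needed for perturbed
  trajectories.\<close>

lemma D_uniform_compact:
  assumes Kc: "compact Kc" and m: "m \<le> k" and e: "0 < e"
  shows "\<exists>d>0. \<forall>X\<in>Kc. \<forall>Z. dist Z X < d \<longrightarrow> (\<forall>vs. length vs = m \<longrightarrow> norm (D m Z vs - D m X vs) \<le> e * norms vs)"
proof -
  have "\<forall>X. \<exists>d>0. \<forall>Y. dist Y X < d \<longrightarrow> (\<forall>vs. length vs = m \<longrightarrow> norm (D m Y vs - D m X vs) \<le> e / 2 * norms vs)"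
    using D_continuous[OF m, of "e / 2"] e by auto
  then obtain d where d: "\<And>X. 0 < d X" "\<And>X Y vs. dist Y X < d X \<Longrightarrow> length vs = m \<Longrightarrow> norm (D m Y vs - D m X vs) \<le> e / 2 * norms vs"
    by metis
  obtain r where r: "0 < r" "\<And>X. X \<in> Kc \<Longrightarrow> \<exists>G\<in>(\<lambda>X. ball X (d X)) ` Kc. ball X r \<subseteq> G"
    by (rule Heine_Borel_lemma[OF Kc, of "(\<lambda>X. ball X (d X)) ` Kc"]) (use d in auto)
  have "norm (D m Z vs - D m X vs) \<le> e * norms vs" if X: "X \<in> Kc" "dist Z X < r" "length vs = m" for X Z vs
  proof -
    obtain X0 where X0: "ball X r \<subseteq> ball X0 (d X0)" using r(2)[OF X(1)] by auto
    have "X \<in> ball X r" "Z \<in> ball X r" using r X by (auto simp: dist_commute)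
    then have "X \<in> ball X0 (d X0)" "Z \<in> ball X0 (d X0)" using X0 by blast+
    then have "dist X X0 < d X0" "dist Z X0 < d X0" by (simp_all add: dist_commute)
    then have 1: "norm (D m Z vs - D m X0 vs) \<le> e / 2 * norms vs" and 2: "norm (D m X vs - D m X0 vs) \<le> e / 2 * norms vs"
      using d(2) X(3) by auto
    have "norm ((D m Z vs - D m X0 vs) - (D m X vs - D m X0 vs)) \<le> e / 2 * norms vs + e / 2 * norms vs"
      by (rule norm_triangle_le_diff[OF add_mono[OF 1 2]])
    then show ?thesis by simp
  qed
  then show ?thesis using r(1) by blast
qed

lemma D_bounded_compact:
  assumes Kc: "compact Kc" and m: "m \<le> k"
  shows "\<exists>d>0. \<exists>B. \<forall>X\<in>Kc. \<forall>Z. dist Z X < d \<longrightarrow> (\<forall>vs. length vs = m \<longrightarrow> norm (D m Z vs) \<le> B * norms vs)"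
proof -
  obtain d where d: "0 < d" "\<And>X Z vs. X \<in> Kc \<Longrightarrow> dist Z X < d \<Longrightarrow> length vs = m \<Longrightarrow> norm (D m Z vs - D m X vs) \<le> 1 * norms vs"
    using D_uniform_compact[OF Kc m, of 1] by auto
  obtain T where T: "finite T" "T \<subseteq> Kc" "Kc \<subseteq> (\<Union>x\<in>T. ball x d)"
    using compactE_image[OF Kc, of Kc "\<lambda>x. ball x d"] d(1) by (metis UN_I centre_in_ball open_ball subsetI)
  obtain b where b: "\<And>X. 0 \<le> b X" "\<And>X vs. length vs = m \<Longrightarrow> norm (D m X vs) \<le> b X * norms vs"
    using D_bound_at[OF m] by metis
  \<comment> \<open>One unit for the step from \<open>Z\<close> to \<open>X\<close>, one from
    \<open>X\<close> to the centre of a ball of the finite cover; the sum dominates the bound at any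
    centre.\<close>
  define B where "B = 2 + (\<Sum>x\<in>T. b x)"
  have "norm (D m Z vs) \<le> B * norms vs" if X: "X \<in> Kc" "dist Z X < d" "length vs = m" for X Z vs
  proof -
    obtain x where x: "x \<in> T" "dist x X < d" using T(3) X(1) by auto
    have "norm (D m Z vs - D m X vs) \<le> norms vs" "norm (D m X vs - D m x vs) \<le> norms vs" "norm (D m x vs) \<le> b x * norms vs"
      using d(2)[of X Z vs] d(2)[of x X vs] T(2) X x b(2) by (auto simp: dist_commute)
    moreover have "b x * norms vs \<le> (\<Sum>x\<in>T. b x) * norms vs"
      using x T(1) b(1) by (intro mult_right_mono member_le_sum norms_nonneg) auto
    moreover have "norm (D m Z vs) \<le> norm (D m Z vs - D m X vs) + norm (D m X vs - D m x vs) + norm (D m x vs)"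
      using norm_triangle_sub[of "D m Z vs" "D m X vs"] norm_triangle_sub[of "D m X vs" "D m x vs"] by linarith
    ultimately show ?thesis by (simp add: B_def algebra_simps)
  qed
  then show ?thesis using d(1) by blast
qed

text \<open>Differentiability at a point gives no rate that is uniform along a trajectory. Closeness
  of the next derivative on the segment does: the mean value inequality is applied after subtracting
  the linear part.\<close>

lemma D_mean_value:
  assumes m: "m < k" and vs: "length vs = m"
    and bd: "\<And>\<theta> us. 0 \<le> \<theta> \<Longrightarrow> \<theta> \<le> 1 \<Longrightarrow> length us = Suc m \<Longrightarrow> norm (D (Suc m) (X + \<theta> *\<^sub>R h) us - D (Suc m) X us) \<le> e * norms us"
  shows "norm (D m (X + h) vs - D m X vs - D (Suc m) X (h # vs)) \<le> e * norm h * norms vs"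
proof -
  define f where "f \<theta> = D m (X + \<theta> *\<^sub>R h) vs - \<theta> *\<^sub>R D (Suc m) X (h # vs)" for \<theta> :: real
  define f' where "f' \<theta> t = t *\<^sub>R (D (Suc m) (X + \<theta> *\<^sub>R h) (h # vs) - D (Suc m) X (h # vs))" for \<theta> t :: real
  have der: "(f has_derivative f' \<theta>) (at \<theta> within {0..1})" for \<theta>
  proof -
    have "((\<lambda>\<theta>. D m (X + \<theta> *\<^sub>R h) vs) has_derivative (\<lambda>t. t *\<^sub>R D (Suc m) (X + \<theta> *\<^sub>R h) (h # vs))) (at \<theta>)"
      unfolding has_derivative_at_alt
    proof (intro conjI allI impI bounded_linear_scaleR_left)
      fix \<epsilon> :: real assume \<epsilon>: "0 < \<epsilon>"
      define N where "N = norm h * norms vs + 1"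
      have N: "0 < N" using norms_nonneg[of vs] by (simp add: N_def add_nonneg_pos)
      obtain d where d: "0 < d" "\<And>Y. dist Y (X + \<theta> *\<^sub>R h) < d \<Longrightarrow>
          norm (D m Y vs - D m (X + \<theta> *\<^sub>R h) vs - D (Suc m) (X + \<theta> *\<^sub>R h) ((Y - (X + \<theta> *\<^sub>R h)) # vs)) \<le> \<epsilon> / N * norm (Y - (X + \<theta> *\<^sub>R h)) * norms vs"
        using D_derivative[OF m, of "\<epsilon> / N" "X + \<theta> *\<^sub>R h"] \<epsilon> N vs by auto
      show "\<exists>d>0. \<forall>y. norm (y - \<theta>) < d \<longrightarrow> norm (D m (X + y *\<^sub>R h) vs - D m (X + \<theta> *\<^sub>R h) vs - (y - \<theta>) *\<^sub>R D (Suc m) (X + \<theta> *\<^sub>R h) (h # vs)) \<le> \<epsilon> * norm (y - \<theta>)"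
      proof (intro exI[of _ "d / (norm h + 1)"] conjI allI impI)
        show "0 < d / (norm h + 1)" using d by (simp add: add_nonneg_pos)
        fix y :: real assume y: "norm (y - \<theta>) < d / (norm h + 1)"
        have eq: "X + y *\<^sub>R h - (X + \<theta> *\<^sub>R h) = (y - \<theta>) *\<^sub>R h" by (simp add: algebra_simps)
        have hp: "0 < norm h + 1" by (simp add: add_nonneg_pos)
        have "norm (y - \<theta>) * norm h \<le> norm (y - \<theta>) * (norm h + 1)" by (intro mult_left_mono) auto
        also have "\<dots> < d" using y hp by (simp add: pos_less_divide_eq)
        finally have "dist (X + y *\<^sub>R h) (X + \<theta> *\<^sub>R h) < d" unfolding dist_norm eq by simp
        from d(2)[OF this, unfolded eq] have "norm (D m (X + y *\<^sub>R h) vs - D m (X + \<theta> *\<^sub>R h) vs - (y - \<theta>) *\<^sub>R D (Suc m) (X + \<theta> *\<^sub>R h) (h # vs))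
            \<le> \<epsilon> / N * (\<bar>y - \<theta>\<bar> * norm h) * norms vs"
          using multilinear_head(2)[OF D_multilinear vs, of "X + \<theta> *\<^sub>R h" "y - \<theta>" h] m by simp
        also have "\<dots> = \<epsilon> * \<bar>y - \<theta>\<bar> * (norm h * norms vs / N)" by simp
        also have "\<dots> \<le> \<epsilon> * \<bar>y - \<theta>\<bar> * 1"
          using \<epsilon> N by (intro mult_left_mono) (auto simp: N_def)
        finally show "norm (D m (X + y *\<^sub>R h) vs - D m (X + \<theta> *\<^sub>R h) vs - (y - \<theta>) *\<^sub>R D (Suc m) (X + \<theta> *\<^sub>R h) (h # vs)) \<le> \<epsilon> * norm (y - \<theta>)"
          by simp
      qed
    qed
    from has_derivative_diff[OF this has_derivative_scaleR_left[OF has_derivative_ident]]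
    have "(f has_derivative f' \<theta>) (at \<theta>)"
      unfolding f_def f'_def by (simp add: scaleR_diff_right)
    then show ?thesis by (rule has_derivative_at_withinI)
  qed
  have "norm (f 1 - f 0) \<le> (e * norm h * norms vs) * norm (1 - 0 :: real)"
  proof (rule differentiable_bound[OF _ der])
    fix \<theta> :: real assume \<theta>: "\<theta> \<in> {0..1}"
    show "onorm (f' \<theta>) \<le> e * norm h * norms vs"
    proof (rule onorm_le)
      fix t :: real
      have "norm (D (Suc m) (X + \<theta> *\<^sub>R h) (h # vs) - D (Suc m) X (h # vs)) \<le> e * norms (h # vs)"
        using \<theta> vs by (intro bd) auto
      from mult_left_mono[OF this, of "\<bar>t\<bar>"]
      show "norm (f' \<theta> t) \<le> e * norm h * norms vs * norm t" by (simp add: f'_def mult_ac)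
    qed
  qed auto
  then show ?thesis by (simp add: f_def algebra_simps)
qed

end

lemma uniform_radius:
  assumes "\<And>m. m \<le> (k::nat) \<Longrightarrow> \<exists>d>0. P m d" and "\<And>m d d'. P m d \<Longrightarrow> d' \<le> d \<Longrightarrow> P m d'"
  shows "\<exists>d>(0::real). \<forall>m\<le>k. P m d"
proof -
  obtain d where d: "\<And>m. m \<le> k \<Longrightarrow> 0 < d m \<and> P m (d m)" using assms(1) by metis
  have "P m (Min (d ` {..k}))" if "m \<le> k" for m
    using assms(2)[OF conjunct2[OF d[OF that]], of "Min (d ` {..k})"] that by simp
  moreover have "0 < Min (d ` {..k})" using d by (subst Min_gr_iff) auto
  ultimately show ?thesis by blast
qed

context scaled_equation
begin

text \<open>The segment between the scaled trajectories at time \<open>s\<close>, on which the mean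
  value inequality needs the derivatives. Its end point recovers the trajectory of \<open>y\<close>,
  so one family of estimates serves both purposes.\<close>

definition seg :: "'h \<Rightarrow> 'h \<Rightarrow> real \<Rightarrow> real \<Rightarrow> 'h" where
  "seg x y \<theta> s = c s *\<^sub>R vsol x s + \<theta> *\<^sub>R (c s *\<^sub>R (vsol y s - vsol x s))"

lemma seg_0 [simp]: "seg x y 0 s = c s *\<^sub>R vsol x s" and seg_1 [simp]: "seg x y 1 s = c s *\<^sub>R vsol y s"
  by (simp_all add: seg_def scaleR_diff_right)

context
  fixes k :: nat and D :: "nat \<Rightarrow> 'h \<Rightarrow> 'h list \<Rightarrow> 'h"
  assumes D: "frechet_derivs_upto k UNIV F D" and k: "1 \<le> k"
begin

lemma D_0: "D 0 X [] = F X"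
  using D by (simp add: frechet_derivs_upto_def)

text \<open>The derivative inherits the Lipschitz constant of each component, so the linearised
  equations satisfy the same gap condition. A difference quotient along \<open>w\<close> with
  arbitrarily small relative error shows it.\<close>

lemma D_1_bound:
  assumes T: "bounded_linear T" and TF: "\<And>x y. norm (T (F x - F y)) \<le> L * norm (x - y)"
  shows "norm ((T :: 'h \<Rightarrow> 'h) (D 1 X [w])) \<le> L * norm w"
proof (rule field_le_epsilon)
  fix e :: real assume e: "0 < e"
  obtain N where N: "0 < N" "\<And>x. norm (T x) \<le> norm x * N" using bounded_linear.pos_bounded[OF T] by blast
  note lin = bounded_linear.linear[OF T]
  define e' where "e' = e / (N * (norm w + 1))"
  have w: "0 < norm w + 1" by (simp add: add_nonneg_pos)
  have e': "0 < e'" using e N w by (simp add: e'_def)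
  obtain d where d: "0 < d" "\<And>Y. dist Y X < d \<Longrightarrow> norm (F Y - F X - D 1 X [Y - X]) \<le> e' * norm (Y - X)"
    using D_derivative[OF D, of 0 e' X] k e' by (auto simp: D_0)
  define t where "t = d / (2 * (norm w + 1))"
  have t: "0 < t" using d w by (simp add: t_def)
  have tw: "t * norm w < d"
  proof -
    have "t * norm w \<le> t * (norm w + 1)" using t by (intro mult_left_mono) auto
    also have "\<dots> = d / 2" using w by (simp add: t_def field_simps)
    finally show ?thesis using d by simp
  qed
  define Y where "Y = X + t *\<^sub>R w"
  have Y: "Y - X = t *\<^sub>R w" "dist Y X < d" using tw t by (auto simp: Y_def dist_norm)
  have Dt: "D 1 X [t *\<^sub>R w] = t *\<^sub>R D 1 X [w]"
    using multilinear_head(2)[of 0 "D 1 X" "[]"] D_multilinear[OF D k] by simp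
  have "t * norm (T (D 1 X [w])) = norm (T (D 1 X [Y - X]))"
    unfolding Y(1) Dt using t by (simp add: linear_cmul[OF lin])
  also have "D 1 X [Y - X] = (F Y - F X) - (F Y - F X - D 1 X [Y - X])" by simp
  also have "norm (T \<dots>) \<le> norm (T (F Y - F X)) + norm (T (F Y - F X - D 1 X [Y - X]))"
    unfolding linear_diff[OF lin, of "F Y - F X" "F Y - F X - D 1 X [Y - X]"] by (rule norm_triangle_ineq4)
  also have "\<dots> \<le> L * (t * norm w) + e' * (t * norm w) * N"
    using TF[of Y X] order.trans[OF N(2) mult_right_mono[OF d(2)[OF Y(2)]]] N t by (intro add_mono) (auto simp: Y(1))
  finally have "t * norm (T (D 1 X [w])) \<le> t * (L * norm w + e' * norm w * N)" by (simp add: algebra_simps)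
  then have "norm (T (D 1 X [w])) \<le> L * norm w + e' * norm w * N" using t by simp
  also have "e' * norm w * N \<le> e' * (norm w + 1) * N" using e' N by (intro mult_right_mono mult_left_mono) auto
  also have "\<dots> = e" using N w by (simp add: e'_def)
  finally show "norm (T (D 1 X [w])) \<le> L * norm w + e" by simp
qed

text \<open>Bounds uniform over all times. They are the only property of the derivatives whose proof
  depends on the sign of \<eta>.\<close>

definition locally_bounded_derivs :: bool where
  "locally_bounded_derivs \<longleftrightarrow> (\<forall>x\<in>V. \<exists>B\<ge>0. \<forall>\<^sub>F y in near x. \<forall>s \<theta> m us. 0 \<le> s \<and> 0 \<le> \<theta> \<and> \<theta> \<le> 1 \<and> 1 \<le> m \<and> m \<le> k \<and> length us = m \<longrightarrow>
     norm (D m (seg x y \<theta> s) us) \<le> B * norms us)"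

text \<open>\<open>J\<close> is a bounded time range in general. For negative \<gamma> it may be all
  times, since then \<open>c s * exp (\<gamma> * s)\<close> is bounded on the half-line.\<close>

lemma seg_close:
  assumes gd: "good L \<gamma>" and x: "x \<in> V" and r: "0 < r" and M: "\<And>s. 0 \<le> s \<Longrightarrow> s \<in> J \<Longrightarrow> c s * exp (\<gamma> * s) \<le> M"
  shows "\<forall>\<^sub>F y in near x. \<forall>s \<theta>. 0 \<le> s \<and> s \<in> J \<and> 0 \<le> \<theta> \<and> \<theta> \<le> 1 \<longrightarrow> dist (seg x y \<theta> s) (c s *\<^sub>R vsol x s) < r"
proof -
  define l where "l = K / (1 - K * L * kap \<gamma>)"
  have l: "0 \<le> l" using gd K_nonneg by (simp add: l_def good_def)
  have "((\<lambda>y. \<bar>M\<bar> * (l * norm (y - x))) \<longlongrightarrow> \<bar>M\<bar> * (l * norm (x - x))) (nhds x)"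
    by (intro tendsto_intros filterlim_ident)
  then have "\<forall>\<^sub>F y in nhds x. \<bar>M\<bar> * (l * norm (y - x)) < r" using r by (intro order_tendstoD(2)) auto
  then have "\<forall>\<^sub>F y in near x. \<bar>M\<bar> * (l * norm (y - x)) < r"
    unfolding near_def eventually_inf_principal by eventually_elim auto
  then show ?thesis using near_V[of x]
  proof eventually_elim
    case (elim y)
    show ?case
    proof (intro allI impI)
      fix s \<theta> :: real assume A: "0 \<le> s \<and> s \<in> J \<and> 0 \<le> \<theta> \<and> \<theta> \<le> 1"
      then have s: "0 \<le> s" by simp
      have "dist (seg x y \<theta> s) (c s *\<^sub>R vsol x s) = \<theta> * (c s * norm (vsol y s - vsol x s))"
        using A c_pos[OF s] by (simp add: dist_norm seg_def)
      also have "\<dots> \<le> 1 * (c s * (l * norm (y - x) * exp (\<gamma> * s)))"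
        using A c_pos[OF s] vsol_lipschitz[OF gd x elim(2)] by (intro mult_mono mult_left_mono) (auto simp: expbd_def l_def)
      also have "\<dots> = (c s * exp (\<gamma> * s)) * (l * norm (y - x))" by simp
      also have "\<dots> \<le> \<bar>M\<bar> * (l * norm (y - x))"
        using M[of s] A l by (intro mult_right_mono) auto
      finally show "dist (seg x y \<theta> s) (c s *\<^sub>R vsol x s) < r" using elim(1) by simp
    qed
  qed
qed

lemma compact_trajectory:
  assumes gd: "good L \<gamma>" and x: "x \<in> V"
  shows "compact ((\<lambda>s. c s *\<^sub>R vsol x s) ` {0..T})" "\<exists>M. \<forall>s. 0 \<le> s \<and> s \<le> T \<longrightarrow> c s * exp (\<gamma> * s) \<le> M"
proof -
  show "compact ((\<lambda>s. c s *\<^sub>R vsol x s) ` {0..T})"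
    by (intro compact_continuous_image continuous_intros continuous_on_subset[OF c_cont] continuous_on_subset[OF vsol_cont[OF gd x]]) auto
  have "compact ((\<lambda>s. c s * exp (\<gamma> * s)) ` {0..T})"
    by (intro compact_continuous_image continuous_intros continuous_on_subset[OF c_cont]) auto
  then have "bdd_above ((\<lambda>s. c s * exp (\<gamma> * s)) ` {0..T})" by (intro bounded_imp_bdd_above compact_imp_bounded)
  then show "\<exists>M. \<forall>s. 0 \<le> s \<and> s \<le> T \<longrightarrow> c s * exp (\<gamma> * s) \<le> M" unfolding bdd_above_def by fastforce
qed

lemma derivs_uniformly_close:
  assumes gd: "good L \<gamma>" and lb: locally_bounded_derivs and x: "x \<in> V" and \<tau>: "0 < \<tau>" and e: "0 < e"
  shows "\<forall>\<^sub>F y in near x. \<forall>s \<theta> m us. 0 \<le> s \<and> 0 \<le> \<theta> \<and> \<theta> \<le> 1 \<and> 1 \<le> m \<and> m \<le> k \<and> length us = m \<longrightarrow>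
     norm (D m (seg x y \<theta> s) us - D m (c s *\<^sub>R vsol x s) us) \<le> e * exp (\<tau> * s) * norms us"
proof -
  obtain B where B: "0 \<le> B" "\<forall>\<^sub>F y in near x. \<forall>s \<theta> m us. 0 \<le> s \<and> 0 \<le> \<theta> \<and> \<theta> \<le> 1 \<and> 1 \<le> m \<and> m \<le> k \<and> length us = m \<longrightarrow>
     norm (D m (seg x y \<theta> s) us) \<le> B * norms us"
    using lb x unfolding locally_bounded_derivs_def by blast
  \<comment> \<open>From \<open>T\<close> on, \<open>e * exp (\<tau> * s)\<close> exceeds
    \<open>2 * B\<close>, the trivial bound on the difference of two derivatives. Before
    \<open>T\<close>, compactness of the trajectory applies.\<close>
  define T where "T = 2 * B / (e * \<tau>)"
  have T: "2 * B \<le> e * exp (\<tau> * s)" if "T \<le> s" for s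
  proof -
    have "2 * B = e * (\<tau> * T)" using e \<tau> by (simp add: T_def)
    also have "\<dots> \<le> e * exp (\<tau> * s)"
    proof -
      have "\<tau> * T \<le> \<tau> * s" using \<tau> that by (intro mult_left_mono) auto
      then have "\<tau> * T \<le> exp (\<tau> * s)" using exp_ge_add_one_self[of "\<tau> * s"] by linarith
      then show ?thesis using e by (intro mult_left_mono) auto
    qed
    finally show ?thesis .
  qed
  let ?Kc = "(\<lambda>s. c s *\<^sub>R vsol x s) ` {0..T}"
  obtain M where M: "\<And>s. 0 \<le> s \<Longrightarrow> s \<le> T \<Longrightarrow> c s * exp (\<gamma> * s) \<le> M" using compact_trajectory(2)[OF gd x] by blast
  obtain d where d: "0 < d" "\<And>m X Z vs. m \<le> k \<Longrightarrow> X \<in> ?Kc \<Longrightarrow> dist Z X < d \<Longrightarrow> length vs = m \<Longrightarrow> norm (D m Z vs - D m X vs) \<le> e * norms vs"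
  proof -
    have "\<exists>d>0. \<forall>m\<le>k. \<forall>X\<in>?Kc. \<forall>Z. dist Z X < d \<longrightarrow> (\<forall>vs. length vs = m \<longrightarrow> norm (D m Z vs - D m X vs) \<le> e * norms vs)"
      by (rule uniform_radius) (use D_uniform_compact[OF D compact_trajectory(1)[OF gd x] _ e] in \<open>auto dest: order.strict_trans2\<close>)
    then show ?thesis using that by blast
  qed
  have "\<forall>\<^sub>F y in near x. \<forall>s \<theta>. 0 \<le> s \<and> s \<le> T \<and> 0 \<le> \<theta> \<and> \<theta> \<le> 1 \<longrightarrow> dist (seg x y \<theta> s) (c s *\<^sub>R vsol x s) < d"
    using seg_close[OF gd x d(1), of "{..T}" M] M by simp
  then show ?thesis using B(2)
  proof eventually_elim
    case (elim y)
    show ?case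
    proof (intro allI impI)
      fix s \<theta> :: real and m us assume A: "0 \<le> s \<and> 0 \<le> \<theta> \<and> \<theta> \<le> 1 \<and> 1 \<le> m \<and> m \<le> k \<and> length (us :: 'h list) = m"
      show "norm (D m (seg x y \<theta> s) us - D m (c s *\<^sub>R vsol x s) us) \<le> e * exp (\<tau> * s) * norms us"
      proof (cases "s \<le> T")
        case True
        have "norm (D m (seg x y \<theta> s) us - D m (c s *\<^sub>R vsol x s) us) \<le> e * norms us"
          using A True elim(1) by (intro d(2)) auto
        also have "\<dots> \<le> e * exp (\<tau> * s) * norms us"
        proof -
          have "1 \<le> exp (\<tau> * s)" using A \<tau> by simp
          from mult_left_mono[OF this, of e] e show ?thesis by (intro mult_right_mono norms_nonneg) auto
        qed
        finally show ?thesis .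
      next
        case False
        have 1: "norm (D m (seg x y \<theta> s) us) \<le> B * norms us" using elim(2) A by blast
        have "0 \<le> s \<and> 0 \<le> (0::real) \<and> (0::real) \<le> 1 \<and> 1 \<le> m \<and> m \<le> k \<and> length us = m" using A by simp
        with elim(2) have "norm (D m (seg x y 0 s) us) \<le> B * norms us" by blast
        then have 2: "norm (D m (c s *\<^sub>R vsol x s) us) \<le> B * norms us" by simp
        have "norm (D m (seg x y \<theta> s) us - D m (c s *\<^sub>R vsol x s) us) \<le> B * norms us + B * norms us"
          by (rule norm_triangle_le_diff[OF add_mono[OF 1 2]])
        also have "\<dots> = (2 * B) * norms us" by simp
        also have "\<dots> \<le> e * exp (\<tau> * s) * norms us" using T[of s] False by (intro mult_right_mono norms_nonneg) auto
        finally show ?thesis .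
      qed
    qed
  qed
qed

text \<open>The chain rule for \<open>g\<close>: a factor \<open>c s\<close> for each direction and
  the division by \<open>c s\<close> in front. The quotient form includes order 0.\<close>

definition Dg :: "nat \<Rightarrow> real \<Rightarrow> 'h \<Rightarrow> 'h list \<Rightarrow> 'h" where
  "Dg m s X vs = (c s ^ m / c s) *\<^sub>R D m (c s *\<^sub>R X) vs"

lemma Dg_0: "Dg 0 s X [] = g s X"
  by (simp add: Dg_def g_def D_0)

lemma Dg_1: "0 \<le> s \<Longrightarrow> Dg 1 s X [w] = D 1 (c s *\<^sub>R X) [w]"
  using c_pos[of s] by (simp add: Dg_def)

lemma norm_scale_c: "0 \<le> s \<Longrightarrow> norm ((c s ^ m / c s) *\<^sub>R (z::'h)) = (c s ^ m / c s) * norm z"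
  using c_pos[of s] by (simp add: abs_of_pos)

lemma c_power_le:
  assumes "0 < \<sigma>"
  shows "\<exists>C\<ge>1. \<forall>m s. m \<le> k \<and> 0 \<le> s \<longrightarrow> c s ^ m \<le> C * exp (real m * \<sigma> * s)"
proof -
  obtain C where C: "\<And>s. 0 \<le> s \<Longrightarrow> c s \<le> C * exp (\<sigma> * s)" using c_subexp[OF assms] by blast
  have "c s ^ m \<le> max 1 C ^ k * exp (real m * \<sigma> * s)" if "m \<le> k" "0 \<le> s" for m s
  proof -
    have "c s \<le> max 1 C * exp (\<sigma> * s)"
    proof -
      have "C * exp (\<sigma> * s) \<le> max 1 C * exp (\<sigma> * s)" by (intro mult_right_mono) auto
      then show ?thesis using C[OF that(2)] by linarith
    qed
    then have "c s ^ m \<le> (max 1 C * exp (\<sigma> * s)) ^ m" using c_pos[OF that(2)] by (intro power_mono) auto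
    also have "\<dots> = max 1 C ^ m * exp (real m * \<sigma> * s)"
      by (simp add: power_mult_distrib exp_of_nat_mult[symmetric] mult_ac)
    also have "\<dots> \<le> max 1 C ^ k * exp (real m * \<sigma> * s)"
      using that by (intro mult_right_mono power_increasing) auto
    finally show ?thesis .
  qed
  moreover have "1 \<le> max 1 C ^ k" by (rule one_le_power) simp
  ultimately show ?thesis by blast
qed

lemma smooth_LP_vsol:
  assumes w: "weight p \<sigma>" "weight q \<sigma>" and \<sigma>: "0 < \<sigma>" and \<tau>: "0 < \<tau>"
    and p_\<tau>_q: "\<And>j. 1 \<le> j \<Longrightarrow> p j + \<tau> \<le> q j" and p_q_Suc: "\<And>j. 1 \<le> j \<Longrightarrow> p j \<le> q (Suc j)"
    and gap_p: "\<And>j. 1 \<le> j \<Longrightarrow> j \<le> k \<Longrightarrow> good L (p j)"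
    and gap_q: "\<And>j. 1 \<le> j \<Longrightarrow> j \<le> k \<Longrightarrow> good L (q j)"
    and lb: locally_bounded_derivs
  shows "smooth_LP S Pp \<alpha> \<beta> K p q \<sigma> L \<tau> k vsol Dg"
proof -
  interpret p: weight p \<sigma> by (rule w)
  interpret q: weight q \<sigma> by (rule w)
  note gd = gap_p[OF order.refl k]
  obtain Cc where Cc: "1 \<le> Cc" "\<And>m s. m \<le> k \<Longrightarrow> 0 \<le> s \<Longrightarrow> c s ^ m \<le> Cc * exp (real m * \<sigma> * s)"
    using c_power_le[OF \<sigma>] by blast
  have factor: "c s ^ m / c s \<le> Cc * exp ((real m - 1) * \<sigma> * s)" "0 \<le> c s ^ m / c s" if "1 \<le> m" "m \<le> k" "0 \<le> s" for m s
  proof -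
    from that obtain n where n: "m = Suc n" by (cases m) auto
    show "c s ^ m / c s \<le> Cc * exp ((real m - 1) * \<sigma> * s)" "0 \<le> c s ^ m / c s"
      using Cc(2)[of n s] c_pos[OF that(3)] that by (auto simp: n)
  qed
  show ?thesis
  proof (unfold_locales)
    show "0 \<le> L" by (rule L)
    show "0 \<le> \<sigma>" "0 \<le> \<tau>" using \<sigma> \<tau> by auto
    show "1 \<le> k" by (rule k)
    show "p j + \<tau> \<le> q j" if "1 \<le> j" for j by (rule p_\<tau>_q[OF that])
    show "p j \<le> q (Suc j)" if "1 \<le> j" for j by (rule p_q_Suc[OF that])
    show "good L (p j)" "good L (q j)" if "1 \<le> j" "j \<le> k" for j using gap_p gap_q that by auto
    show "continuous_on {0..} (vsol x)" if "x \<in> V" for x by (rule vsol_cont[OF gd that])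
    show "\<exists>C. expbd (p 1) C (vsol x)" if "x \<in> V" for x by (rule vsol_expbd[OF gd that])
    show "vsol x t = S t x + LP (\<lambda>s. Dg 0 s (vsol x s) []) t" if "x \<in> V" "0 \<le> t" for x t
      unfolding Dg_0 by (rule vsol_eq[OF gd that])
    show "bounded_multilinear_on UNIV m (Dg m s X)" if m: "m \<le> k" and "0 \<le> s" for m s X
    proof -
      obtain B where B: "\<And>vs. length vs = m \<Longrightarrow> norm (D m (c s *\<^sub>R X) vs) \<le> B * norms vs"
        using D_bound_at[OF D m] by blast
      have "norm (Dg m s X vs) \<le> (\<bar>c s ^ m / c s\<bar> * B) * norms vs" if "length vs = m" for vs
        using mult_left_mono[OF B[OF that], of "\<bar>c s ^ m / c s\<bar>"] by (simp add: Dg_def mult_ac)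
      then have "\<exists>C. \<forall>vs. length vs = m \<and> set vs \<subseteq> UNIV \<longrightarrow> norm (Dg m s X vs) \<le> C * norms vs" by blast
      then show ?thesis
        using D_multilinear[OF D m, of "c s *\<^sub>R X"] unfolding bounded_multilinear_on_def
        by (auto simp: Dg_def scaleR_add_right)
    qed
    fix s :: real and X Y w :: 'h assume s: "0 \<le> s"
    show "norm (Q (Dg 0 s X [] - Dg 0 s Y [])) \<le> L * norm (X - Y)" "norm (Pp (Dg 0 s X [] - Dg 0 s Y [])) \<le> L * norm (X - Y)"
      unfolding Dg_0 by (rule g_lip_Q[OF s] g_lip_P[OF s])+
    show "Dg 0 s 0 [] = 0" by (simp add: Dg_0)
    show "norm (Q (Dg 1 s X [w])) \<le> L * norm w" "norm (Pp (Dg 1 s X [w])) \<le> L * norm w"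
      unfolding Dg_1[OF s] using D_1_bound[OF Q_bl F_lip_Q] D_1_bound[OF Pp_bl F_lip_P] by blast+
  next
    fix x and fs :: "(real \<Rightarrow> 'h) list"
    assume x: "x \<in> V" and fs: "length fs \<le> k" "\<And>f. f \<in> set fs \<Longrightarrow> continuous_on {0..} f"
    let ?m = "length fs"
    have X: "continuous_on {0..} (\<lambda>s. c s *\<^sub>R vsol x s)" by (intro continuous_intros c_cont vsol_cont[OF gd x])
    \<comment> \<open>Base point and directions move together: \<open>1\<close> moves the directions
      at the fixed base point, and \<open>2\<close> moves the base point while the directions stay
      bounded near \<open>s0\<close>.\<close>
    have "continuous_on {0..} (\<lambda>s. D ?m (c s *\<^sub>R vsol x s) (map (\<lambda>f. f s) fs))"
      unfolding continuous_on_def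
    proof
      fix s0 :: real assume s0: "s0 \<in> {0..}"
      let ?F = "at s0 within {0..}"
      let ?X0 = "c s0 *\<^sub>R vsol x s0"
      have fs0: "(f \<longlongrightarrow> f s0) ?F" if "f \<in> set fs" for f using fs(2)[OF that] s0 by (simp add: continuous_on_def)
      obtain b where b: "0 \<le> b" "\<And>vs. length vs = ?m \<Longrightarrow> norm (D ?m ?X0 vs) \<le> b * norms vs" using D_bound_at[OF D fs(1)] by blast
      have ml: "mlin ?m (D ?m ?X0) b" using b D_multilinear[OF D fs(1)] by (intro mlinI) auto
      have 1: "((\<lambda>s. D ?m ?X0 (map (\<lambda>f. f s) fs)) \<longlongrightarrow> D ?m ?X0 (map (\<lambda>f. f s0) fs)) ?F"
        by (rule multilinear_continuous[OF ml fs0])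
      define N where "N = (\<Prod>f\<leftarrow>fs. norm (f s0)) + 1"
      have N: "0 < N" unfolding N_def by (intro add_nonneg_pos prod_list_nonneg) auto
      have nt: "((\<lambda>s. \<Prod>f\<leftarrow>gs. norm (f s)) \<longlongrightarrow> (\<Prod>f\<leftarrow>gs. norm (f s0))) ?F" if "set gs \<subseteq> set fs" for gs
        using that fs0 by (induction gs) (auto intro!: tendsto_intros)
      have nev: "\<forall>\<^sub>F s in ?F. (\<Prod>f\<leftarrow>fs. norm (f s)) < N"
        using nt[OF order.refl] by (intro order_tendstoD(2)) (auto simp: N_def)
      have 2: "((\<lambda>s. D ?m (c s *\<^sub>R vsol x s) (map (\<lambda>f. f s) fs) - D ?m ?X0 (map (\<lambda>f. f s) fs)) \<longlongrightarrow> 0) ?F"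
      proof (rule tendstoI)
        fix e :: real assume e: "0 < e"
        obtain d where d: "0 < d" "\<And>Y vs. dist Y ?X0 < d \<Longrightarrow> length vs = ?m \<Longrightarrow> norm (D ?m Y vs - D ?m ?X0 vs) \<le> e / (2 * N) * norms vs"
          using D_continuous[OF D fs(1), of "e / (2 * N)" ?X0] e N by auto
        have "((\<lambda>s. c s *\<^sub>R vsol x s) \<longlongrightarrow> ?X0) ?F" using X s0 by (simp add: continuous_on_def)
        then have "\<forall>\<^sub>F s in ?F. dist (c s *\<^sub>R vsol x s) ?X0 < d" using d(1) by (rule tendstoD)
        then show "\<forall>\<^sub>F s in ?F. dist (D ?m (c s *\<^sub>R vsol x s) (map (\<lambda>f. f s) fs) - D ?m ?X0 (map (\<lambda>f. f s) fs)) 0 < e"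
          using nev
        proof eventually_elim
          case (elim s)
          have "norms (map (\<lambda>f. f s) fs) < N" using elim(2) by (simp add: o_def)
          then have "e / (2 * N) * norms (map (\<lambda>f. f s) fs) \<le> e / (2 * N) * N" using e N by (intro mult_left_mono) auto
          moreover have "e / (2 * N) * N < e" using e N by simp
          ultimately show ?case using d(2)[OF elim(1), of "map (\<lambda>f. f s) fs"] by simp
        qed
      qed
      from tendsto_add[OF 2 1]
      show "((\<lambda>s. D ?m (c s *\<^sub>R vsol x s) (map (\<lambda>f. f s) fs)) \<longlongrightarrow> D ?m ?X0 (map (\<lambda>f. f s0) fs)) ?F" by simp
    qed
    then show "continuous_on {0..} (\<lambda>s. Dg (length fs) s (vsol x s) (map (\<lambda>f. f s) fs))"
      unfolding Dg_def using c_pos by (intro continuous_intros c_cont) (auto simp: less_imp_neq[symmetric])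
  next
    fix x assume x: "x \<in> V"
    obtain B where B: "0 \<le> B" "\<forall>\<^sub>F y in near x. \<forall>s \<theta> m us. 0 \<le> s \<and> 0 \<le> \<theta> \<and> \<theta> \<le> 1 \<and> 1 \<le> m \<and> m \<le> k \<and> length us = m \<longrightarrow>
       norm (D m (seg x y \<theta> s) us) \<le> B * norms us"
      using lb x unfolding locally_bounded_derivs_def by blast
    show "\<exists>B\<ge>0. \<forall>\<^sub>F y in near x. \<forall>m s vs. 1 \<le> m \<and> m \<le> k \<and> 0 \<le> s \<and> length vs = m \<longrightarrow>
        norm (Dg m s (vsol y s) vs) \<le> B * exp ((real m - 1) * \<sigma> * s) * norms vs"
    proof (intro exI[of _ "Cc * B"] conjI)
      show "0 \<le> Cc * B" using Cc B by simp
      show "\<forall>\<^sub>F y in near x. \<forall>m s vs. 1 \<le> m \<and> m \<le> k \<and> 0 \<le> s \<and> length vs = m \<longrightarrow>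
        norm (Dg m s (vsol y s) vs) \<le> Cc * B * exp ((real m - 1) * \<sigma> * s) * norms vs"
        using B(2)
      proof eventually_elim
        case (elim y)
        show ?case
        proof (intro allI impI)
          fix m :: nat and s :: real and vs :: "'h list" assume A: "1 \<le> m \<and> m \<le> k \<and> 0 \<le> s \<and> length vs = m"
          then have "0 \<le> s \<and> 0 \<le> (1::real) \<and> (1::real) \<le> 1 \<and> 1 \<le> m \<and> m \<le> k \<and> length vs = m" by simp
          with elim have "norm (D m (seg x y 1 s) vs) \<le> B * norms vs" by blast
          then have "(c s ^ m / c s) * norm (D m (c s *\<^sub>R vsol y s) vs) \<le> (Cc * exp ((real m - 1) * \<sigma> * s)) * (B * norms vs)"
            using A Cc factor by (intro mult_mono) auto
          then show "norm (Dg m s (vsol y s) vs) \<le> Cc * B * exp ((real m - 1) * \<sigma> * s) * norms vs"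
            using A unfolding Dg_def by (simp only: norm_scale_c mult_ac)
        qed
      qed
    qed
  next
    fix x and e :: real assume x: "x \<in> V" and e: "0 < e"
    define e' where "e' = e / Cc"
    have e': "0 < e'" "Cc * e' = e" using e Cc by (auto simp: e'_def)
    from derivs_uniformly_close[OF gd lb x \<tau> e'(1)]
    show "\<forall>\<^sub>F y in near x. \<forall>m s vs. 1 \<le> m \<and> m \<le> k \<and> 0 \<le> s \<and> length vs = m \<longrightarrow>
        norm (Dg m s (vsol y s) vs - Dg m s (vsol x s) vs) \<le> e * exp (((real m - 1) * \<sigma> + \<tau>) * s) * norms vs"
    proof eventually_elim
      case (elim y)
      show ?case
      proof (intro allI impI)
        fix m :: nat and s :: real and vs :: "'h list" assume A: "1 \<le> m \<and> m \<le> k \<and> 0 \<le> s \<and> length vs = m"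
        then have "0 \<le> s \<and> 0 \<le> (1::real) \<and> (1::real) \<le> 1 \<and> 1 \<le> m \<and> m \<le> k \<and> length vs = m" by simp
        with elim have "norm (D m (seg x y 1 s) vs - D m (c s *\<^sub>R vsol x s) vs) \<le> e' * exp (\<tau> * s) * norms vs" by blast
        then have "(c s ^ m / c s) * norm (D m (c s *\<^sub>R vsol y s) vs - D m (c s *\<^sub>R vsol x s) vs) \<le> (Cc * exp ((real m - 1) * \<sigma> * s)) * (e' * exp (\<tau> * s) * norms vs)"
          using A Cc factor by (intro mult_mono) auto
        also have "\<dots> = (Cc * e') * exp (((real m - 1) * \<sigma> + \<tau>) * s) * norms vs" unfolding exp_add_mult by (simp add: mult_ac)
        finally show "norm (Dg m s (vsol y s) vs - Dg m s (vsol x s) vs) \<le> e * exp (((real m - 1) * \<sigma> + \<tau>) * s) * norms vs"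
          unfolding e'(2) Dg_def scaleR_diff_right[symmetric] using A by (simp only: norm_scale_c)
      qed
    qed
    from derivs_uniformly_close[OF gd lb x \<tau> e'(1)]
    show "\<forall>\<^sub>F y in near x. \<forall>m s vs. m < k \<and> 0 \<le> s \<and> length vs = m \<longrightarrow>
        norm (Dg m s (vsol y s) vs - Dg m s (vsol x s) vs - Dg (Suc m) s (vsol x s) ((vsol y s - vsol x s) # vs))
          \<le> e * exp ((real m * \<sigma> + \<tau>) * s) * norm (vsol y s - vsol x s) * norms vs"
    proof eventually_elim
      case (elim y)
      show ?case
      proof (intro allI impI)
        fix m :: nat and s :: real and vs :: "'h list" assume A: "m < k \<and> 0 \<le> s \<and> length vs = m"
        define h where "h = vsol y s - vsol x s"
        have cs: "0 < c s" using A c_pos by simp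
        \<comment> \<open>The mean value inequality at one time, with increment
          \<open>c s *\<^sub>R h\<close>; the bound on the whole segment has a constant independent
          of \<open>s\<close>.\<close>
        have "norm (D m (c s *\<^sub>R vsol x s + c s *\<^sub>R h) vs - D m (c s *\<^sub>R vsol x s) vs - D (Suc m) (c s *\<^sub>R vsol x s) ((c s *\<^sub>R h) # vs))
          \<le> e' * exp (\<tau> * s) * norm (c s *\<^sub>R h) * norms vs"
        proof (rule D_mean_value[OF D])
          fix \<theta> :: real and us :: "'h list" assume "0 \<le> \<theta>" "\<theta> \<le> 1" "length us = Suc m"
          then have "0 \<le> s \<and> 0 \<le> \<theta> \<and> \<theta> \<le> 1 \<and> 1 \<le> Suc m \<and> Suc m \<le> k \<and> length us = Suc m" using A by simp
          with elim have "norm (D (Suc m) (seg x y \<theta> s) us - D (Suc m) (c s *\<^sub>R vsol x s) us) \<le> e' * exp (\<tau> * s) * norms us" by blast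
          then show "norm (D (Suc m) (c s *\<^sub>R vsol x s + \<theta> *\<^sub>R c s *\<^sub>R h) us - D (Suc m) (c s *\<^sub>R vsol x s) us) \<le> e' * exp (\<tau> * s) * norms us"
            by (simp add: seg_def h_def)
        qed (use A in auto)
        then have 1: "(c s ^ m / c s) * norm (D m (c s *\<^sub>R vsol y s) vs - D m (c s *\<^sub>R vsol x s) vs - D (Suc m) (c s *\<^sub>R vsol x s) ((c s *\<^sub>R h) # vs))
          \<le> (c s ^ m / c s) * (e' * exp (\<tau> * s) * norm (c s *\<^sub>R h) * norms vs)"
          using cs by (intro mult_left_mono) (auto simp: h_def scaleR_diff_right)
        have "D (Suc m) (c s *\<^sub>R vsol x s) ((c s *\<^sub>R h) # vs) = c s *\<^sub>R D (Suc m) (c s *\<^sub>R vsol x s) (h # vs)"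
          using A by (intro multilinear_head(2)[OF D_multilinear[OF D]]) auto
        then have "Dg m s (vsol y s) vs - Dg m s (vsol x s) vs - Dg (Suc m) s (vsol x s) (h # vs) =
          (c s ^ m / c s) *\<^sub>R (D m (c s *\<^sub>R vsol y s) vs - D m (c s *\<^sub>R vsol x s) vs - D (Suc m) (c s *\<^sub>R vsol x s) ((c s *\<^sub>R h) # vs))"
          using cs by (simp add: Dg_def scaleR_diff_right)
        then have "norm (Dg m s (vsol y s) vs - Dg m s (vsol x s) vs - Dg (Suc m) s (vsol x s) (h # vs))
          \<le> (c s ^ m / c s) * (e' * exp (\<tau> * s) * norm (c s *\<^sub>R h) * norms vs)" using 1 cs by simp
        also have "\<dots> = c s ^ m * (e' * exp (\<tau> * s) * norm h * norms vs)" using cs by simp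
        also have "\<dots> \<le> (Cc * exp (real m * \<sigma> * s)) * (e' * exp (\<tau> * s) * norm h * norms vs)"
          using A Cc(2)[of m s] e' norms_nonneg[of vs] by (intro mult_right_mono) auto
        also have "\<dots> = (Cc * e') * exp ((real m * \<sigma> + \<tau>) * s) * norm h * norms vs" unfolding exp_add_mult by (simp add: mult_ac)
        finally show "norm (Dg m s (vsol y s) vs - Dg m s (vsol x s) vs - Dg (Suc m) s (vsol x s) ((vsol y s - vsol x s) # vs))
          \<le> e * exp ((real m * \<sigma> + \<tau>) * s) * norm (vsol y s - vsol x s) * norms vs"
          unfolding e'(2) h_def .
      qed
    qed
  qed
qed

end

text \<open>The gap condition is open in the weight; this is the room from which \<tau>, \<sigma>
  and the two families of weights are taken.\<close>

lemma good_eventually: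
  assumes gd: "good L \<gamma>" and f: "(f \<longlongrightarrow> \<gamma>) Fi"
  shows "\<forall>\<^sub>F z in Fi. good L (f z)"
proof -
  have b: "\<beta> < \<gamma>" "\<gamma> < \<alpha>" "K * L * kap \<gamma> < 1" using gd by (auto simp: good_def)
  have "((\<lambda>z. K * L * kap (f z)) \<longlongrightarrow> K * L * kap \<gamma>) Fi"
    unfolding kap_def using b by (intro tendsto_intros f) auto
  from order_tendstoD(2)[OF this b(3)] order_tendstoD(1)[OF f b(1)] order_tendstoD(2)[OF f b(2)]
  show ?thesis by eventually_elim (simp add: good_def)
qed

context
  fixes k :: nat and D :: "nat \<Rightarrow> 'h \<Rightarrow> 'h list \<Rightarrow> 'h"
  assumes D: "frechet_derivs_upto k UNIV F D" and k: "1 \<le> k"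
begin

lemma locally_bounded_derivsI:
  assumes "\<And>x m. x \<in> V \<Longrightarrow> 1 \<le> m \<Longrightarrow> m \<le> k \<Longrightarrow> \<exists>B. \<forall>\<^sub>F y in near x. \<forall>s \<theta> us. 0 \<le> s \<and> 0 \<le> \<theta> \<and> \<theta> \<le> 1 \<and> length us = m \<longrightarrow>
     norm (D m (seg x y \<theta> s) us) \<le> B * norms us"
  shows "locally_bounded_derivs k D"
  unfolding locally_bounded_derivs_def[OF D k]
proof
  fix x assume x: "x \<in> V"
  have "\<forall>m\<in>{1..k}. \<exists>B. \<forall>\<^sub>F y in near x. \<forall>s \<theta> us. 0 \<le> s \<and> 0 \<le> \<theta> \<and> \<theta> \<le> 1 \<and> length us = m \<longrightarrow>
     norm (D m (seg x y \<theta> s) us) \<le> B * norms us"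
    using assms[OF x] by simp
  from bchoice[OF this] obtain B where B: "\<forall>m\<in>{1..k}. \<forall>\<^sub>F y in near x. \<forall>s \<theta> us. 0 \<le> s \<and> 0 \<le> \<theta> \<and> \<theta> \<le> 1 \<and> length us = m \<longrightarrow>
     norm (D m (seg x y \<theta> s) us) \<le> B m * norms us" ..
  define BB where "BB = (\<Sum>m\<in>{1..k}. \<bar>B m\<bar>)"
  have BB: "B m \<le> BB" if "m \<in> {1..k}" for m
    unfolding BB_def using member_le_sum[OF that, of "\<lambda>m. \<bar>B m\<bar>"] by simp
  have "\<forall>\<^sub>F y in near x. \<forall>m\<in>{1..k}. \<forall>s \<theta> us. 0 \<le> s \<and> 0 \<le> \<theta> \<and> \<theta> \<le> 1 \<and> length us = m \<longrightarrow>
     norm (D m (seg x y \<theta> s) us) \<le> B m * norms us"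
    by (rule eventually_ball_finite[OF finite_atLeastAtMost B])
  then have "\<forall>\<^sub>F y in near x. \<forall>s \<theta> m us. 0 \<le> s \<and> 0 \<le> \<theta> \<and> \<theta> \<le> 1 \<and> 1 \<le> m \<and> m \<le> k \<and> length us = m \<longrightarrow>
       norm (D m (seg x y \<theta> s) us) \<le> BB * norms us"
  proof eventually_elim
    case (elim y)
    show ?case
    proof (intro allI impI)
      fix s \<theta> :: real and m :: nat and us :: "'h list" assume A: "0 \<le> s \<and> 0 \<le> \<theta> \<and> \<theta> \<le> 1 \<and> 1 \<le> m \<and> m \<le> k \<and> length us = m"
      then have m: "m \<in> {1..k}" by simp
      with elim A have "norm (D m (seg x y \<theta> s) us) \<le> B m * norms us" by blast
      also have "\<dots> \<le> BB * norms us" by (intro mult_right_mono BB[OF m] norms_nonneg)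
      finally show "norm (D m (seg x y \<theta> s) us) \<le> BB * norms us" .
    qed
  qed
  moreover have "0 \<le> BB" unfolding BB_def by (intro sum_nonneg) auto
  ultimately show "\<exists>B\<ge>0. \<forall>\<^sub>F y in near x. \<forall>s \<theta> m us. 0 \<le> s \<and> 0 \<le> \<theta> \<and> \<theta> \<le> 1 \<and> 1 \<le> m \<and> m \<le> k \<and> length us = m \<longrightarrow>
       norm (D m (seg x y \<theta> s) us) \<le> B * norms us" by blast
qed

lemma locally_bounded_derivs_global:
  assumes "\<And>j. j \<in> {2..k} \<Longrightarrow> \<exists>C. \<forall>x vs. length vs = j \<longrightarrow> norm (D j x vs) \<le> C * norms vs"
  shows "locally_bounded_derivs k D"
proof (rule locally_bounded_derivsI)
  fix x and m :: nat assume m: "1 \<le> m" "m \<le> k"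
  have "\<exists>C. \<forall>x vs. length vs = m \<longrightarrow> norm (D m x vs) \<le> C * norms vs"
  proof (cases "m = 1")
    case True
    have "norm (D 1 X [w]) \<le> 2 * L * norm w" for X w
      using D_1_bound[OF D k Pp_bl F_lip_P, of X w] D_1_bound[OF D k Q_bl F_lip_Q, of X w]
        norm_triangle_ineq[of "Pp (D 1 X [w])" "Q (D 1 X [w])"] unfolding Pp_plus_Q by linarith
    then have "norm (D 1 X vs) \<le> 2 * L * norms vs" if "length vs = 1" for X vs
      using that by (cases vs) auto
    then show ?thesis using True by blast
  next
    case False
    then show ?thesis using assms[of m] m by simp
  qed
  then show "\<exists>B. \<forall>\<^sub>F y in near x. \<forall>s \<theta> us. 0 \<le> s \<and> 0 \<le> \<theta> \<and> \<theta> \<le> 1 \<and> length us = m \<longrightarrow>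
     norm (D m (seg x y \<theta> s) us) \<le> B * norms us"
    by (auto intro!: always_eventually)
qed

text \<open>Up to some time \<open>T\<close> the trajectory is compact. After it the scaled
  trajectory is close to 0, where continuity of the derivatives gives a bound.\<close>

lemma locally_bounded_derivs_decay:
  assumes gd: "good L \<gamma>" and neg: "\<gamma> < 0"
  shows "locally_bounded_derivs k D"
proof (rule locally_bounded_derivsI)
  fix x and m :: nat assume x: "x \<in> V" and m: "1 \<le> m" "m \<le> k"
  obtain C where C: "expbd \<gamma> C (vsol x)" using vsol_expbd[OF gd x] by blast
  \<comment> \<open>Half of the decay rate is spent on the growth of \<open>c\<close>; the other
    half still makes the scaled trajectory decay.\<close>
  obtain Cc where Cc: "\<And>s. 0 \<le> s \<Longrightarrow> c s \<le> Cc * exp (- \<gamma> / 2 * s)" using c_subexp[of "- \<gamma> / 2"] neg by auto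
  have Cc0: "0 \<le> Cc" using Cc[of 0] c_pos[of 0] by simp
  have cexp: "c s * exp (\<gamma> * s) \<le> Cc * exp (\<gamma> / 2 * s)" if "0 \<le> s" for s
  proof -
    have "c s * exp (\<gamma> * s) \<le> (Cc * exp (- \<gamma> / 2 * s)) * exp (\<gamma> * s)" by (intro mult_right_mono Cc that) auto
    also have "\<dots> = Cc * exp (\<gamma> / 2 * s)" by (simp add: mult.assoc flip: exp_add)
    finally show ?thesis .
  qed
  have cM: "c s * exp (\<gamma> * s) \<le> Cc" if "0 \<le> s" for s
  proof -
    have "exp (\<gamma> / 2 * s) \<le> 1" using neg that by (simp add: mult_nonpos_nonneg)
    then have "Cc * exp (\<gamma> / 2 * s) \<le> Cc * 1" using Cc0 by (intro mult_left_mono)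
    then show ?thesis using cexp[OF that] by simp
  qed
  obtain d0 B0 where d0: "0 < d0" "\<And>Z us. dist Z 0 < d0 \<Longrightarrow> length us = m \<Longrightarrow> norm (D m Z us) \<le> B0 * norms us"
    using D_bounded_compact[OF D compact_insert[OF compact_empty], of m 0] m by auto
  have "((\<lambda>s. exp (- ((- \<gamma> / 2) * s))) \<longlongrightarrow> 0) at_top"
    using neg by (intro filterlim_compose[OF exp_at_bot] filterlim_compose[OF filterlim_uminus_at_bot_at_top] filterlim_tendsto_pos_mult_at_top[OF tendsto_const _ filterlim_ident]) auto
  from tendsto_mult_right_zero[OF this, of "C * Cc"] have "((\<lambda>s. C * Cc * exp (\<gamma> / 2 * s)) \<longlongrightarrow> 0) at_top" by simp
  then have "\<forall>\<^sub>F s in at_top. C * Cc * exp (\<gamma> / 2 * s) < d0 / 2" using d0(1) by (intro order_tendstoD(2)) auto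
  then obtain T where T: "\<And>s. T \<le> s \<Longrightarrow> C * Cc * exp (\<gamma> / 2 * s) < d0 / 2" by (auto simp: eventually_at_top_linorder)
  let ?Kc = "(\<lambda>s. c s *\<^sub>R vsol x s) ` {0..T}"
  obtain d1 B1 where d1: "0 < d1" "\<And>X Z us. X \<in> ?Kc \<Longrightarrow> dist Z X < d1 \<Longrightarrow> length us = m \<Longrightarrow> norm (D m Z us) \<le> B1 * norms us"
    using D_bounded_compact[OF D compact_trajectory(1)[OF D k gd x] m(2), of T] by blast
  \<comment> \<open>One half of the radius \<open>d0\<close> is reserved for the trajectory of
    \<open>x\<close>, the other for its distance to the segment.\<close>
  define r where "r = min d1 (d0 / 2)"
  have r: "0 < r" using d0 d1 by (simp add: r_def)
  have "\<forall>\<^sub>F y in near x. \<forall>s \<theta>. 0 \<le> s \<and> s \<in> UNIV \<and> 0 \<le> \<theta> \<and> \<theta> \<le> 1 \<longrightarrow> dist (seg x y \<theta> s) (c s *\<^sub>R vsol x s) < r"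
    by (rule seg_close[OF D k gd x r]) (rule cM)
  then have "\<forall>\<^sub>F y in near x. \<forall>s \<theta> us. 0 \<le> s \<and> 0 \<le> \<theta> \<and> \<theta> \<le> 1 \<and> length us = m \<longrightarrow>
     norm (D m (seg x y \<theta> s) us) \<le> max B0 B1 * norms us"
  proof eventually_elim
    case (elim y)
    show ?case
    proof (intro allI impI)
      fix s \<theta> :: real and us :: "'h list" assume A: "0 \<le> s \<and> 0 \<le> \<theta> \<and> \<theta> \<le> 1 \<and> length us = m"
      then have dist: "dist (seg x y \<theta> s) (c s *\<^sub>R vsol x s) < r" using elim by simp
      have "norm (D m (seg x y \<theta> s) us) \<le> B0 * norms us \<or> norm (D m (seg x y \<theta> s) us) \<le> B1 * norms us"
      proof (cases "s \<le> T")
        case True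
        then show ?thesis using d1(2)[of "c s *\<^sub>R vsol x s" "seg x y \<theta> s" us] dist A by (auto simp: r_def)
      next
        case False
        have s: "0 \<le> s" using A by simp
        have "norm (c s *\<^sub>R vsol x s) \<le> c s * (C * exp (\<gamma> * s))"
          using C s c_pos[OF s] by (auto simp: expbd_def intro: mult_left_mono)
        also have "\<dots> = C * (c s * exp (\<gamma> * s))" by simp
        also have "\<dots> \<le> C * (Cc * exp (\<gamma> / 2 * s))" using expbd_nonneg[OF C] by (intro mult_left_mono cexp s)
        also have "\<dots> < d0 / 2" using T[of s] False by (simp add: mult_ac)
        finally have "dist (c s *\<^sub>R vsol x s) 0 < d0 / 2" by simp
        then have "dist (seg x y \<theta> s) 0 < d0"
          using dist dist_triangle[of "seg x y \<theta> s" 0 "c s *\<^sub>R vsol x s"] by (simp add: r_def)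
        then show ?thesis using d0(2) A by blast
      qed
      then show "norm (D m (seg x y \<theta> s) us) \<le> max B0 B1 * norms us"
        using mult_right_mono[OF max.cobounded1[of B0 B1] norms_nonneg[of us]] mult_right_mono[OF max.cobounded2[of B1 B0] norms_nonneg[of us]] by linarith
    qed
  qed
  then show "\<exists>B. \<forall>\<^sub>F y in near x. \<forall>s \<theta> us. 0 \<le> s \<and> 0 \<le> \<theta> \<and> \<theta> \<le> 1 \<and> length us = m \<longrightarrow>
     norm (D m (seg x y \<theta> s) us) \<le> B * norms us" by blast
qed

text \<open>For \<open>\<eta> > 0\<close> the \<open>j\<close>-th derivative is estimated in weights close to \<open>j \<eta>\<close>.  For \<open>\<eta> \<le> 0\<close> products
  of decaying functions decay faster, so one weight slightly below \<open>\<eta>\<close> serves all orders.\<close>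

theorem vsol_Ck:
  assumes gd: "\<And>j. 1 \<le> j \<Longrightarrow> j \<le> k \<Longrightarrow> good L (real j * \<eta>)"
    and bd: "\<And>j. 0 < \<eta> \<Longrightarrow> j \<in> {2..k} \<Longrightarrow> \<exists>C. \<forall>x vs. length vs = j \<longrightarrow> norm (D j x vs) \<le> C * norms vs"
  shows "Ck_on k V (\<lambda>x. Pp (vsol x 0))"
proof (cases "0 < \<eta>")
  case True
  have "\<forall>\<^sub>F \<delta> in at_right 0. \<forall>j\<in>{1..k}. good L (real j * \<eta> - \<delta>) \<and> good L (real j * \<eta> + (real j - 1) * \<delta>)"
  proof (intro eventually_ball_finite ballI eventually_conj)
    fix j assume j: "j \<in> {1..k}"
    have 1: "((\<lambda>\<delta>. real j * \<eta> - \<delta>) \<longlongrightarrow> real j * \<eta> - 0) (at_right 0)"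
      by (intro tendsto_intros)
    have 2: "((\<lambda>\<delta>. real j * \<eta> + (real j - 1) * \<delta>) \<longlongrightarrow> real j * \<eta> + (real j - 1) * 0) (at_right 0)"
      by (intro tendsto_intros)
    show "\<forall>\<^sub>F \<delta> in at_right 0. good L (real j * \<eta> - \<delta>)" "\<forall>\<^sub>F \<delta> in at_right 0. good L (real j * \<eta> + (real j - 1) * \<delta>)"
      using good_eventually[OF _ 1] good_eventually[OF _ 2] gd[of j] j by auto
  qed simp
  then have "\<forall>\<^sub>F \<delta> in at_right 0. 0 < \<delta> \<and> (\<forall>j\<in>{1..k}. good L (real j * \<eta> - \<delta>) \<and> good L (real j * \<eta> + (real j - 1) * \<delta>))"
    using eventually_at_right_less by (rule eventually_conj[rotated])
  then obtain \<delta> where \<delta>: "0 < \<delta>" "\<And>j. j \<in> {1..k} \<Longrightarrow> good L (real j * \<eta> - \<delta>) \<and> good L (real j * \<eta> + (real j - 1) * \<delta>)"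
    using eventually_happens'[of "at_right (0::real)"] by (metis (no_types, lifting) trivial_limit_at_right_real)
  \<comment> \<open>Both families satisfy superadditivity with surplus \<delta> as an equality, and
    \<open>p j + \<delta> \<le> q j\<close> is an equality at \<open>j = 1\<close>.\<close>
  define p q where "p j = real j * \<eta> - \<delta>" and "q j = real j * \<eta> + (real j - 1) * \<delta>" for j
  have "smooth_LP S Pp \<alpha> \<beta> K p q \<delta> L \<delta> k vsol (Dg D)"
  proof (rule smooth_LP_vsol[OF D k _ _ \<delta>(1) \<delta>(1)])
    show "weight p \<delta>" "weight q \<delta>" using \<delta>(1) by unfold_locales (auto simp: p_def q_def algebra_simps)
    show "p j + \<delta> \<le> q j" if "1 \<le> j" for j
      using that \<delta>(1) by (simp add: p_def q_def)
    show "p j \<le> q (Suc j)" if "1 \<le> j" for j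
    proof -
      have "0 \<le> real j * \<delta>" using \<delta>(1) by simp
      then show ?thesis using \<delta>(1) True by (simp add: p_def q_def algebra_simps)
    qed
    show "good L (p j)" "good L (q j)" if "1 \<le> j" "j \<le> k" for j using \<delta>(2)[of j] that by (auto simp: p_def q_def)
    show "locally_bounded_derivs k D" by (rule locally_bounded_derivs_global) (rule bd[OF True])
  qed
  then show ?thesis by (rule smooth_LP.stable_graph_Ck)
next
  case False
  have g1: "good L \<eta>" using gd[OF order.refl k] by simp
  have "\<forall>\<^sub>F \<delta> in at_right 0. good L (\<eta> - 2 * \<delta>) \<and> good L (\<eta> - \<delta>)"
  proof (intro eventually_conj)
    have 1: "((\<lambda>\<delta>. \<eta> - 2 * \<delta>) \<longlongrightarrow> \<eta> - 2 * 0) (at_right 0)" by (intro tendsto_intros)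
    have 2: "((\<lambda>\<delta>. \<eta> - \<delta>) \<longlongrightarrow> \<eta> - 0) (at_right 0)" by (intro tendsto_intros)
    show "\<forall>\<^sub>F \<delta> in at_right 0. good L (\<eta> - 2 * \<delta>)" "\<forall>\<^sub>F \<delta> in at_right 0. good L (\<eta> - \<delta>)"
      using good_eventually[OF _ 1] good_eventually[OF _ 2] g1 by auto
  qed
  then have "\<forall>\<^sub>F \<delta> in at_right 0. 0 < \<delta> \<and> good L (\<eta> - 2 * \<delta>) \<and> good L (\<eta> - \<delta>)"
    using eventually_at_right_less by (rule eventually_conj[rotated])
  then obtain \<delta> where \<delta>: "0 < \<delta>" "good L (\<eta> - 2 * \<delta>)" "good L (\<eta> - \<delta>)"
    using eventually_happens'[of "at_right (0::real)"] by (metis (no_types, lifting) trivial_limit_at_right_real)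
  \<comment> \<open>For constant weights superadditivity with surplus \<delta> means
    \<open>\<eta> - 2 * \<delta> + \<delta> \<le> 0\<close> and
    \<open>\<eta> - \<delta> + \<delta> \<le> 0\<close>, that is, \<eta> \<le> 0 suffices.\<close>
  define p q :: "nat \<Rightarrow> real" where "p j = \<eta> - 2 * \<delta>" and "q j = \<eta> - \<delta>" for j
  have "smooth_LP S Pp \<alpha> \<beta> K p q \<delta> L \<delta> k vsol (Dg D)"
  proof (rule smooth_LP_vsol[OF D k _ _ \<delta>(1) \<delta>(1)])
    show "weight p \<delta>" "weight q \<delta>" using \<delta>(1) False by unfold_locales (auto simp: p_def q_def)
    show "locally_bounded_derivs k D" by (rule locally_bounded_derivs_decay[OF \<delta>(3)]) (use \<delta>(1) False in auto)
  qed (use \<delta> in \<open>auto simp: p_def q_def\<close>)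
  then show ?thesis by (rule smooth_LP.stable_graph_Ck)
qed

end

end

subsection \<open>Measurability\<close>

lemma infdist_range_dense:
  fixes f :: "'a::topological_space \<Rightarrow> 'b::metric_space"
  assumes f: "continuous_on UNIV f" and A: "\<And>X. open X \<Longrightarrow> X \<noteq> {} \<Longrightarrow> \<exists>a\<in>A. a \<in> X"
  shows "infdist x (range f) = (INF a\<in>A. dist x (f a))"
proof -
  have ne: "A \<noteq> {}" using A[of UNIV] by auto
  have bdd: "bdd_below ((\<lambda>a. dist x (f a)) ` A)" by (rule bdd_belowI[of _ 0]) auto
  have "(INF a\<in>A. dist x (f a)) \<le> dist x (f b)" for b
  proof (rule field_le_epsilon)
    fix e :: real assume e: "0 < e"
    have "open (f -` ball (f b) e)" using f by (simp add: open_vimage)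
    moreover have "b \<in> f -` ball (f b) e" using e by simp
    then have "f -` ball (f b) e \<noteq> {}" by blast
    ultimately have "\<exists>a\<in>A. a \<in> f -` ball (f b) e" by (rule A)
    then obtain a where a: "a \<in> A" "dist (f b) (f a) < e" by auto
    have "(INF a\<in>A. dist x (f a)) \<le> dist x (f a)" by (rule cINF_lower[OF bdd a(1)])
    also have "\<dots> \<le> dist x (f b) + e" using dist_triangle[of x "f a" "f b"] a(2) by simp
    finally show "(INF a\<in>A. dist x (f a)) \<le> dist x (f b) + e" .
  qed
  then have 1: "(INF a\<in>A. dist x (f a)) \<le> infdist x (range f)"
    unfolding infdist_def by (auto intro!: cINF_greatest)
  have "infdist x (range f) \<le> dist x (f a)" for a by (rule infdist_le) auto
  then have "infdist x (range f) \<le> (INF a\<in>A. dist x (f a))" using ne by (intro cINF_greatest) auto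
  with 1 show ?thesis by simp
qed

context dichotomy
begin

text \<open>Joint measurability in noise and time is what the induction can carry, since the next
  iterate integrates the previous one over time. The indicators discard negative times, where
  nothing is assumed.\<close>

lemma picard_measurable:
  assumes G: "(\<lambda>(w, s, X). indicator {0..} s *\<^sub>R G w s X) \<in> borel_measurable (N \<Otimes>\<^sub>M (borel \<Otimes>\<^sub>M borel))"
    and \<xi>: "\<xi> \<in> V"
  shows "(\<lambda>(w, t). indicator {0..} t *\<^sub>R picard (\<lambda>t. S t \<xi>) (G w) n t) \<in> borel_measurable (N \<Otimes>\<^sub>M borel)"
proof (induction n)
  case (Suc n)
  let ?P = "\<lambda>w t. indicator {0..} t *\<^sub>R picard (\<lambda>t. S t \<xi>) (G w) n t"
  have P: "(\<lambda>z. ?P (fst (fst z)) (snd z)) \<in> borel_measurable ((N \<Otimes>\<^sub>M borel) \<Otimes>\<^sub>M lborel)"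
  proof -
    have "(\<lambda>z. (fst (fst z), snd z)) \<in> (N \<Otimes>\<^sub>M borel) \<Otimes>\<^sub>M lborel \<rightarrow>\<^sub>M N \<Otimes>\<^sub>M borel" by measurable
    from measurable_compose[OF this Suc] show ?thesis by simp
  qed
  have Gm: "(\<lambda>z. indicator {0..} (snd z) *\<^sub>R G (fst (fst z)) (snd z) (?P (fst (fst z)) (snd z))) \<in> borel_measurable ((N \<Otimes>\<^sub>M borel) \<Otimes>\<^sub>M lborel)"
  proof -
    have "(\<lambda>z. (fst (fst z), snd z, ?P (fst (fst z)) (snd z))) \<in> (N \<Otimes>\<^sub>M borel) \<Otimes>\<^sub>M lborel \<rightarrow>\<^sub>M N \<Otimes>\<^sub>M (borel \<Otimes>\<^sub>M borel)"
      using P by (intro measurable_Pair) (auto intro: measurable_compose[OF measurable_fst])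
    from measurable_compose[OF this G] show ?thesis by simp
  qed
  have "(\<lambda>z. Gr (snd (fst z)) (snd z) (indicator {0..} (snd z) *\<^sub>R G (fst (fst z)) (snd z) (?P (fst (fst z)) (snd z))))
      \<in> borel_measurable ((N \<Otimes>\<^sub>M borel) \<Otimes>\<^sub>M lborel)"
    by (rule Gr_measurable[OF _ _ Gm]) measurable
  then have "(\<lambda>z. LINT s|lborel. Gr (snd z) s (indicator {0..} s *\<^sub>R G (fst z) s (?P (fst z) s))) \<in> borel_measurable (N \<Otimes>\<^sub>M borel)"
    by (intro lborel.borel_measurable_lebesgue_integral) (simp add: split_beta)
  moreover have "(LINT s|lborel. Gr t s (indicator {0..} s *\<^sub>R G w s (?P w s))) = LP (\<lambda>s. G w s (picard (\<lambda>t. S t \<xi>) (G w) n s)) t" for w t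
    unfolding LP_def by (rule Bochner_Integration.integral_cong) (auto simp: indicator_def)
  ultimately have LPm: "(\<lambda>z. LP (\<lambda>s. G (fst z) s (picard (\<lambda>t. S t \<xi>) (G (fst z)) n s)) (snd z)) \<in> borel_measurable (N \<Otimes>\<^sub>M borel)"
    by simp
  have SQm: "(\<lambda>t. SQ t \<xi>) \<in> borel_measurable borel" by (rule borel_measurable_continuous_onI[OF SQ_cont])
  have "(\<lambda>z. indicator {0..} (snd z) *\<^sub>R (SQ (snd z) \<xi> + LP (\<lambda>s. G (fst z) s (picard (\<lambda>t. S t \<xi>) (G (fst z)) n s)) (snd z)))
      \<in> borel_measurable (N \<Otimes>\<^sub>M borel)"
    using LPm measurable_compose[OF measurable_snd SQm] by (intro borel_measurable_scaleR borel_measurable_add) measurable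
  moreover have "(\<lambda>(w, t). indicator {0..} t *\<^sub>R picard (\<lambda>t. S t \<xi>) (G w) (Suc n) t) =
      (\<lambda>z. indicator {0..} (snd z) *\<^sub>R (SQ (snd z) \<xi> + LP (\<lambda>s. G (fst z) s (picard (\<lambda>t. S t \<xi>) (G (fst z)) n s)) (snd z)))"
    by (auto simp: fun_eq_iff indicator_def S_V[OF _ \<xi>])
  ultimately show ?case by simp
qed simp

end

subsection \<open>The noise\<close>

lemma C0_borel_space: "space C0_borel = C0_paths"
  and C0_borel_sets: "openin compact_open_topology U \<Longrightarrow> U \<in> sets C0_borel"
proof -
  have "U \<subseteq> C0_paths" if "openin compact_open_topology U" for U
    using openin_subset[OF that] by (auto simp: compact_open_topology_def)
  then have "{U. openin compact_open_topology U} \<subseteq> Pow C0_paths" by blast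
  then show "space C0_borel = C0_paths" "openin compact_open_topology U \<Longrightarrow> U \<in> sets C0_borel"
    by (auto simp: C0_borel_def space_measure_of sets_measure_of)
qed

lemma evaluation_measurable: "(\<lambda>\<omega>. \<omega> t) \<in> borel_measurable C0_borel"
proof (rule borel_measurableI)
  fix U :: "real set" assume "open U"
  then have "{\<omega>\<in>C0_paths. \<omega> ` {t} \<subseteq> U} \<in> {{\<omega>\<in>C0_paths. \<omega> ` C \<subseteq> U} | C U. compact C \<and> open U}"
    by (intro CollectI exI[of _ "{t}"] exI[of _ U]) simp
  then have "openin compact_open_topology {\<omega>\<in>C0_paths. \<omega> ` {t} \<subseteq> U}"
    unfolding compact_open_topology_def by (rule topology_generated_by_Basis)
  moreover have "{\<omega>\<in>C0_paths. \<omega> ` {t} \<subseteq> U} = (\<lambda>\<omega>. \<omega> t) -` U \<inter> space C0_borel"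
    by (auto simp: C0_borel_space)
  ultimately show "(\<lambda>\<omega>. \<omega> t) -` U \<inter> space C0_borel \<in> sets C0_borel" using C0_borel_sets by metis
qed

lemma wshift_wshift: "wshift s (wshift t \<omega>) = wshift (s + t) \<omega>"
  by (auto simp: wshift_def algebra_simps)

locale noise =
  fixes W :: "(real \<Rightarrow> real) measure" and Om :: "(real \<Rightarrow> real) set"
  assumes W: "space W = C0_paths" "sets W = sets C0_borel" and Om: "noise_set W Om"
begin

abbreviation N where "N \<equiv> restrict_space W Om"

lemma Om_sets: "Om \<in> sets W"
  using Om by (simp add: noise_set_def)

lemma Om_paths: "Om \<subseteq> C0_paths"
  using sets.sets_into_space[OF Om_sets] W by simp

lemma space_N: "space N = Om"
  using Om_paths W by (simp add: space_restrict_space inf.absorb1)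

lemma wshift_Om: "\<omega> \<in> Om \<Longrightarrow> wshift t \<omega> \<in> Om"
  using Om by (auto simp: noise_set_def)

text \<open>Continuity of the paths upgrades measurability at fixed times: the time is rounded down
  to a multiple of \<open>1 / Suc n\<close>, which takes countably many values.\<close>

lemma path_measurable: "(\<lambda>z. (snd z) (fst z)) \<in> borel_measurable (borel \<Otimes>\<^sub>M N)"
proof (rule borel_measurable_LIMSEQ_metric)
  let ?f = "\<lambda>n z. (snd z) (of_int \<lfloor>real (Suc n) * fst z\<rfloor> / real (Suc n))"
  have ev: "(\<lambda>\<omega>. \<omega> t) \<in> borel_measurable N" for t
    using evaluation_measurable[of t] W(2) by (intro measurable_restrict_space1) (simp cong: measurable_cong_sets)
  show "?f n \<in> borel_measurable (borel \<Otimes>\<^sub>M N)" for n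
  proof (rule measurable_compose_countable[where f = "\<lambda>i z. (snd z) (of_int i / real (Suc n))" and g = "\<lambda>z. \<lfloor>real (Suc n) * fst z\<rfloor>"])
    show "(\<lambda>z. (snd z) (of_int i / real (Suc n))) \<in> borel_measurable (borel \<Otimes>\<^sub>M N)" for i :: int
      by (rule measurable_compose[OF measurable_snd ev])
    show "(\<lambda>z. \<lfloor>real (Suc n) * fst z\<rfloor>) \<in> borel \<Otimes>\<^sub>M N \<rightarrow>\<^sub>M count_space UNIV" by measurable
  qed
  fix z assume "z \<in> space ((borel :: real measure) \<Otimes>\<^sub>M N)"
  then have "snd z \<in> C0_paths" using Om_paths by (auto simp: space_pair_measure space_N)
  then have "isCont (snd z) (fst z)" by (simp add: C0_paths_def continuous_on_eq_continuous_at)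
  moreover have "(\<lambda>n. of_int \<lfloor>real (Suc n) * fst z\<rfloor> / real (Suc n)) \<longlonglongrightarrow> fst z"
  proof (rule LIMSEQ_I)
    fix r :: real assume "0 < r"
    then obtain m where m: "1 / real (Suc m) < r" using nat_approx_posE by blast
    have "norm (of_int \<lfloor>real (Suc n) * fst z\<rfloor> / real (Suc n) - fst z) < r" if "m \<le> n" for n
    proof -
      have "of_int \<lfloor>real (Suc n) * fst z\<rfloor> / real (Suc n) - fst z = (of_int \<lfloor>real (Suc n) * fst z\<rfloor> - real (Suc n) * fst z) / real (Suc n)"
        by (simp add: diff_divide_distrib)
      then have "norm (of_int \<lfloor>real (Suc n) * fst z\<rfloor> / real (Suc n) - fst z) = \<bar>of_int \<lfloor>real (Suc n) * fst z\<rfloor> - real (Suc n) * fst z\<bar> / real (Suc n)"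
        by (simp del: of_nat_Suc)
      also have "\<dots> \<le> 1 / real (Suc n)"
      proof (rule divide_right_mono)
        show "\<bar>of_int \<lfloor>real (Suc n) * fst z\<rfloor> - real (Suc n) * fst z\<bar> \<le> 1" by linarith
      qed simp
      also have "\<dots> \<le> 1 / real (Suc m)" using that by (intro divide_left_mono) auto
      finally show ?thesis using m by linarith
    qed
    then show "\<exists>no. \<forall>n\<ge>no. norm (of_int \<lfloor>real (Suc n) * fst z\<rfloor> / real (Suc n) - fst z) < r" by blast
  qed
  ultimately show "(\<lambda>n. ?f n z) \<longlonglongrightarrow> (snd z) (fst z)" by (rule isCont_tendsto_compose)
qed

lemma ou_wshift_measurable: "(\<lambda>z. ou (wshift (fst z) (snd z))) \<in> borel_measurable (borel \<Otimes>\<^sub>M N)"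
proof -
  have 1: "(\<lambda>x. (snd (fst x)) (snd x + fst (fst x))) \<in> borel_measurable ((borel \<Otimes>\<^sub>M N) \<Otimes>\<^sub>M lborel)"
    using measurable_compose[where f = "\<lambda>x. (snd x + fst (fst x), snd (fst x))" and g = "\<lambda>z. (snd z) (fst z)", OF _ path_measurable]
    by simp
  have 2: "(\<lambda>x. (snd (fst x)) (fst (fst x))) \<in> borel_measurable ((borel \<Otimes>\<^sub>M N) \<Otimes>\<^sub>M lborel)"
    by (rule measurable_compose[OF measurable_fst path_measurable])
  have "(\<lambda>x. indicator {..0} (snd x) *\<^sub>R (exp (snd x) * ((snd (fst x)) (snd x + fst (fst x)) - (snd (fst x)) (fst (fst x)))))
      \<in> borel_measurable ((borel \<Otimes>\<^sub>M N) \<Otimes>\<^sub>M lborel)"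
    using 1 2 by measurable
  then have "(\<lambda>z. LINT \<tau>|lborel. indicator {..0} \<tau> *\<^sub>R (exp \<tau> * ((snd z) (\<tau> + fst z) - (snd z) (fst z)))) \<in> borel_measurable (borel \<Otimes>\<^sub>M N)"
    by (intro lborel.borel_measurable_lebesgue_integral) (simp add: split_beta)
  then show ?thesis unfolding ou_def wshift_def set_lebesgue_integral_def by measurable
qed

lemma ou_measurable: "ou \<in> borel_measurable N"
proof -
  have "(\<lambda>\<omega>. ou (wshift (fst (0, \<omega>)) (snd (0::real, \<omega>)))) \<in> borel_measurable N"
    by (rule measurable_compose[OF _ ou_wshift_measurable]) measurable
  moreover have "ou (wshift (fst (0, \<omega>)) (snd (0::real, \<omega>))) = ou \<omega>" if "\<omega> \<in> space N" for \<omega>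
  proof -
    have "\<omega> 0 = 0" using that Om_paths by (auto simp: space_N C0_paths_def)
    then show ?thesis by (simp add: wshift_def)
  qed
  ultimately show ?thesis by (rule measurable_cong[THEN iffD1, rotated])
qed

text \<open>\<open>noise_factor \<omega> t = exp (\<integral>\<^sub>0\<^sup>t z(\<theta>\<^sub>\<tau>\<omega>) d\<tau> + z(\<theta>\<^sub>t\<omega>) - z(\<omega>))\<close>: with this factor \<open>c\<close> a trajectory of the stochastic
  equation is \<open>c(t) v(t)\<close>, where \<open>v\<close> solves the equation with nonlinearity \<open>F(c v) / c\<close>.\<close>

definition noise_factor :: "(real \<Rightarrow> real) \<Rightarrow> real \<Rightarrow> real" where
  "noise_factor \<omega> t = exp ((LBINT \<tau>:{0..t}. ou (wshift \<tau> \<omega>)) + ou (wshift t \<omega>) - ou \<omega>)"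

lemma noise_factor_measurable: "(\<lambda>z. noise_factor (fst z) (snd z)) \<in> borel_measurable (N \<Otimes>\<^sub>M borel)"
proof -
  have sw: "(\<lambda>z. ou (wshift (snd z) (fst z))) \<in> borel_measurable (N \<Otimes>\<^sub>M borel)"
    using measurable_compose[where f = "\<lambda>z. (snd z, fst z)", OF _ ou_wshift_measurable] by simp
  have 1: "(\<lambda>x. ou (wshift (snd x) (fst (fst x)))) \<in> borel_measurable ((N \<Otimes>\<^sub>M borel) \<Otimes>\<^sub>M lborel)"
  proof -
    have "(\<lambda>x. (snd x, fst (fst x))) \<in> (N \<Otimes>\<^sub>M borel) \<Otimes>\<^sub>M lborel \<rightarrow>\<^sub>M borel \<Otimes>\<^sub>M N" by measurable
    from measurable_compose[OF this ou_wshift_measurable] show ?thesis by simp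
  qed
  have "(\<lambda>x. indicator {0..snd (fst x)} (snd x) *\<^sub>R ou (wshift (snd x) (fst (fst x)))) \<in> borel_measurable ((N \<Otimes>\<^sub>M borel) \<Otimes>\<^sub>M lborel)"
  proof -
    have "(\<lambda>x. if 0 \<le> snd x \<and> snd x \<le> snd (fst x) then ou (wshift (snd x) (fst (fst x))) else 0) \<in> borel_measurable ((N \<Otimes>\<^sub>M borel) \<Otimes>\<^sub>M lborel)"
      by (rule measurable_If[OF 1]) measurable
    then show ?thesis by (rule measurable_cong[THEN iffD1, rotated]) (simp add: indicator_def)
  qed
  then have "(\<lambda>z. LINT \<tau>|lborel. indicator {0..snd z} \<tau> *\<^sub>R ou (wshift \<tau> (fst z))) \<in> borel_measurable (N \<Otimes>\<^sub>M borel)"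
    by (intro lborel.borel_measurable_lebesgue_integral) (simp add: split_beta)
  then show ?thesis
    unfolding noise_factor_def set_lebesgue_integral_def using sw measurable_compose[OF measurable_fst ou_measurable] by measurable
qed

text \<open>The integral \<open>int_ou \<omega> 0 t\<close> in gauge form, for which additivity and
  continuity in the end point are immediate; \<open>int_ou_eq\<close> connects the two.\<close>

definition I :: "(real \<Rightarrow> real) \<Rightarrow> real \<Rightarrow> real" where
  "I \<omega> t = integral {0..t} (\<lambda>\<tau>. ou (wshift \<tau> \<omega>))"

context
  fixes \<omega> assumes \<omega>: "\<omega> \<in> Om"
begin

lemma ou_cont: "continuous_on A (\<lambda>t. ou (wshift t \<omega>))"
  using Om \<omega> by (auto simp: noise_set_def intro: continuous_on_subset)

lemma wshift_0: "wshift 0 \<omega> = \<omega>"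
  using \<omega> Om_paths by (auto simp: wshift_def C0_paths_def)

lemma ou_set_integrable: "set_integrable lborel {a..b} (\<lambda>\<tau>. ou (wshift \<tau> \<omega>))"
  unfolding set_integrable_def by (rule borel_integrable_compact[OF compact_Icc ou_cont])

lemma int_ou_eq: "0 \<le> s \<Longrightarrow> s \<le> t \<Longrightarrow> int_ou \<omega> s t = I \<omega> t - I \<omega> s"
  unfolding int_ou_def I_def
  using interval_integral_eq_integral[OF _ ou_set_integrable, of s t]
    Henstock_Kurzweil_Integration.integral_combine[of 0 s t "\<lambda>\<tau>. ou (wshift \<tau> \<omega>)"] integrable_continuous_interval[OF ou_cont]
  by simp

lemma I_0 [simp]: "I \<omega> 0 = 0" by (simp add: I_def)

lemma I_cont: "continuous_on {0..} (I \<omega>)"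
proof -
  have "continuous_on {0..T} (I \<omega>)" for T
    unfolding I_def by (intro indefinite_integral_continuous_1 integrable_continuous_interval ou_cont)
  then have "isCont (I \<omega>) t" if "0 < t" for t
    using continuous_on_interior[of "{0..t + 1}" "I \<omega>" t] that by simp
  show ?thesis
    unfolding continuous_on_def
  proof
    fix t :: real assume t: "t \<in> {0..}"
    have "(I \<omega> \<longlongrightarrow> I \<omega> t) (at t within {0..t + 1})"
      using \<open>\<And>T. continuous_on {0..T} (I \<omega>)\<close>[of "t + 1"] t by (simp add: continuous_on_def)
    moreover have "at t within {0..} = at t within {0..t + 1}"
      using t by (intro at_within_nhd[of _ "{..<t + 1}"]) auto
    ultimately show "(I \<omega> \<longlongrightarrow> I \<omega> t) (at t within {0..})" by simp
  qed
qed

lemma noise_factor_eq: "0 \<le> t \<Longrightarrow> noise_factor \<omega> t = exp (I \<omega> t + ou (wshift t \<omega>) - ou \<omega>)"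
  using set_borel_integral_eq_integral(2)[OF ou_set_integrable[of 0 t]] by (simp add: noise_factor_def I_def)

lemma noise_factor_cont: "continuous_on {0..} (noise_factor \<omega>)"
  by (rule continuous_on_eq[of _ "\<lambda>t. exp (I \<omega> t + ou (wshift t \<omega>) - ou \<omega>)"])
    (auto intro!: continuous_intros I_cont ou_cont simp: noise_factor_eq)

lemma noise_factor_pos: "0 < noise_factor \<omega> t"
  by (simp add: noise_factor_def)

text \<open>The time average of \<open>z\<close> and the quotient of \<open>z\<close> by the time
  both tend to 0, so the exponent is below \<open>\<sigma> * t\<close> up to a constant for large
  times. Earlier times form a compact interval.\<close>

lemma noise_factor_subexp:
  assumes "0 < \<sigma>" shows "\<exists>C. \<forall>s\<ge>0. noise_factor \<omega> s \<le> C * exp (\<sigma> * s)"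
proof -
  have "((\<lambda>t. (1 / t) * int_ou \<omega> 0 t + \<bar>ou (wshift t \<omega>)\<bar> / \<bar>t\<bar>) \<longlongrightarrow> 0 + 0) at_top"
    using Om \<omega> by (intro tendsto_add) (auto simp: noise_set_def)
  then have "\<forall>\<^sub>F t in at_top. (1 / t) * int_ou \<omega> 0 t + \<bar>ou (wshift t \<omega>)\<bar> / \<bar>t\<bar> < \<sigma>"
    using assms by (intro order_tendstoD(2)) auto
  then obtain T0 where T0: "\<And>t. T0 \<le> t \<Longrightarrow> (1 / t) * int_ou \<omega> 0 t + \<bar>ou (wshift t \<omega>)\<bar> / \<bar>t\<bar> < \<sigma>"
    by (auto simp: eventually_at_top_linorder)
  define T where "T = max 1 T0"
  have "compact (noise_factor \<omega> ` {0..T})"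
    by (intro compact_continuous_image continuous_on_subset[OF noise_factor_cont]) auto
  then obtain C0 where C0: "\<And>s. 0 \<le> s \<Longrightarrow> s \<le> T \<Longrightarrow> noise_factor \<omega> s \<le> C0"
    using bounded_imp_bdd_above[OF compact_imp_bounded] unfolding bdd_above_def by fastforce
  have "noise_factor \<omega> s \<le> max C0 (exp (- ou \<omega>)) * exp (\<sigma> * s)" if s: "0 \<le> s" for s
  proof (cases "s \<le> T")
    case True
    have "1 \<le> exp (\<sigma> * s)" using s assms by simp
    moreover have "0 \<le> max C0 (exp (- ou \<omega>))" by (simp add: le_max_iff_disj)
    ultimately have "max C0 (exp (- ou \<omega>)) * 1 \<le> max C0 (exp (- ou \<omega>)) * exp (\<sigma> * s)" by (intro mult_left_mono)
    then show ?thesis using C0[OF s True] by simp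
  next
    case False
    then have sT: "T0 \<le> s" "0 < s" by (auto simp: T_def)
    have "(1 / s) * int_ou \<omega> 0 s + \<bar>ou (wshift s \<omega>)\<bar> / \<bar>s\<bar> = (int_ou \<omega> 0 s + \<bar>ou (wshift s \<omega>)\<bar>) / s"
      using sT by (simp add: add_divide_distrib)
    then have "int_ou \<omega> 0 s + \<bar>ou (wshift s \<omega>)\<bar> < \<sigma> * s" using T0[OF sT(1)] sT(2) by (simp add: divide_less_eq)
    then have "I \<omega> s + ou (wshift s \<omega>) - ou \<omega> \<le> \<sigma> * s - ou \<omega>" using int_ou_eq[of 0 s] s by simp
    then have "noise_factor \<omega> s \<le> exp (\<sigma> * s - ou \<omega>)" using s by (simp add: noise_factor_eq)
    also have "\<dots> = exp (- ou \<omega>) * exp (\<sigma> * s)" by (simp flip: exp_add)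
    also have "\<dots> \<le> max C0 (exp (- ou \<omega>)) * exp (\<sigma> * s)" by (intro mult_right_mono) auto
    finally show ?thesis .
  qed
  then show ?thesis by blast
qed

lemma I_wshift: "0 \<le> s \<Longrightarrow> 0 \<le> t \<Longrightarrow> I \<omega> (t + s) = I \<omega> t + I (wshift t \<omega>) s"
proof -
  assume st: "0 \<le> s" "0 \<le> t"
  have "I (wshift t \<omega>) s = integral {0..s} ((\<lambda>\<tau>. ou (wshift \<tau> \<omega>)) \<circ> (\<lambda>\<tau>. \<tau> + t))"
    by (simp add: I_def wshift_wshift o_def)
  also have "\<dots> = integral {t..t + s} (\<lambda>\<tau>. ou (wshift \<tau> \<omega>))"
    using integral_shift[of 0 t s "\<lambda>\<tau>. ou (wshift \<tau> \<omega>)"] ou_cont by (simp add: add.commute)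
  finally show ?thesis
    using Henstock_Kurzweil_Integration.integral_combine[of 0 t "t + s" "\<lambda>\<tau>. ou (wshift \<tau> \<omega>)"] st integrable_continuous_interval[OF ou_cont]
    by (simp add: I_def)
qed

end

end

subsection \<open>The stable manifold of the stochastic equation\<close>

locale stochastic_equation = dichotomy S Pp \<alpha> \<beta> K + noise W Om
  for S :: "real \<Rightarrow> 'h::{real_inner,banach,second_countable_topology} \<Rightarrow> 'h" and Pp \<alpha> \<beta> K W Om +
  fixes F :: "'h \<Rightarrow> 'h" and L :: real and u :: "real \<Rightarrow> (real \<Rightarrow> real) \<Rightarrow> 'h \<Rightarrow> 'h"
  assumes F_zero: "F 0 = 0" and L: "0 \<le> L"
    and F_lip_P: "\<And>x y. norm (Pp (F x - F y)) \<le> L * norm (x - y)"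
    and F_lip_Q: "\<And>x y. norm (Q (F x - F y)) \<le> L * norm (x - y)"
    and u_mild: "\<And>\<omega> u0. \<omega> \<in> Om \<Longrightarrow> mild_solution S F \<omega> u0 (\<lambda>t. u t \<omega> u0)"
    and u_rds: "random_dynamical_system W Om u"
begin

lemma scaled: "\<omega> \<in> Om \<Longrightarrow> scaled_equation S Pp \<alpha> \<beta> K F (noise_factor \<omega>) L"
  by unfold_locales
    (auto simp: F_zero L F_lip_P F_lip_Q noise_factor_cont noise_factor_pos noise_factor_subexp)

definition M :: "real \<Rightarrow> (real \<Rightarrow> real) \<Rightarrow> 'h set" where
  "M \<eta> \<omega> = Ttrans_inv \<omega> ` Ms \<eta> u \<omega>"

lemma in_M: "x \<in> M \<eta> \<omega> \<longleftrightarrow> Ttrans \<omega> x \<in> Ms \<eta> u \<omega>"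
proof
  assume "Ttrans \<omega> x \<in> Ms \<eta> u \<omega>"
  moreover have "x = Ttrans_inv \<omega> (Ttrans \<omega> x)" by (simp add: Ttrans_def Ttrans_inv_def flip: exp_add)
  ultimately show "x \<in> M \<eta> \<omega>" unfolding M_def by blast
qed (auto simp: M_def Ttrans_def Ttrans_inv_def simp flip: exp_add)

definition h :: "'h \<Rightarrow> (real \<Rightarrow> real) \<Rightarrow> 'h" where
  "h \<xi> \<omega> = Pp (scaled_equation.vsol S Pp F (noise_factor \<omega>) \<xi> 0)"

lemma u_cont: "\<omega> \<in> Om \<Longrightarrow> continuous_on {0..} (\<lambda>t. u t \<omega> x)"
  using u_mild by (simp add: mild_solution_def)

context
  fixes \<omega> assumes \<omega>: "\<omega> \<in> Om"
begin

interpretation sc: scaled_equation S Pp \<alpha> \<beta> K F "noise_factor \<omega>" L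
  by (rule scaled[OF \<omega>])

text \<open>The factor \<open>exp (- I \<omega> t)\<close> removes the term \<open>z u\<close> from
  the linear part, which leaves the semigroup alone; \<open>exp (ou \<omega>)\<close> restores the
  initial value \<open>x\<close>.\<close>

lemma transformed_mild:
  "sc.mild x (\<lambda>t. exp (ou \<omega> - I \<omega> t) *\<^sub>R u t \<omega> (Ttrans \<omega> x))"
  unfolding sc.mild_def
proof (intro conjI allI impI)
  let ?v = "\<lambda>t. exp (ou \<omega> - I \<omega> t) *\<^sub>R u t \<omega> (Ttrans \<omega> x)"
  show "continuous_on {0..} ?v" by (intro continuous_intros I_cont[OF \<omega>] u_cont[OF \<omega>])
  fix t :: real assume t: "0 \<le> t"
  let ?f = "\<lambda>s. exp (int_ou \<omega> s t) *\<^sub>R S (t - s) (rand_nonlin F (wshift s \<omega>) (u s \<omega> (Ttrans \<omega> x)))"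
  have "u t \<omega> (Ttrans \<omega> x) = exp (I \<omega> t) *\<^sub>R S t (Ttrans \<omega> x) + (LINT s|lborel. indicator {0..t} s *\<^sub>R ?f s)"
    using u_mild[OF \<omega>, of "Ttrans \<omega> x"] t int_ou_eq[OF \<omega>, of 0 t] I_0[OF \<omega>]
    by (simp add: mild_solution_def interval_integral_Icc[OF t] set_lebesgue_integral_def)
  then have "?v t = exp (ou \<omega> - I \<omega> t) *\<^sub>R exp (I \<omega> t) *\<^sub>R S t (Ttrans \<omega> x) + (LINT s|lborel. exp (ou \<omega> - I \<omega> t) *\<^sub>R indicator {0..t} s *\<^sub>R ?f s)"
    by (simp only: scaleR_add_right integral_scaleR_right)
  also have "exp (ou \<omega> - I \<omega> t) *\<^sub>R exp (I \<omega> t) *\<^sub>R S t (Ttrans \<omega> x) = S t x"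
    using t by (simp add: Ttrans_def linear_cmul[OF S_linear] flip: exp_add)
  also have "(LINT s|lborel. exp (ou \<omega> - I \<omega> t) *\<^sub>R indicator {0..t} s *\<^sub>R ?f s) = conv (\<lambda>s. sc.g s (?v s)) t"
    unfolding conv_def
  proof (rule Bochner_Integration.integral_cong[OF refl])
    fix s
    show "exp (ou \<omega> - I \<omega> t) *\<^sub>R indicator {0..t} s *\<^sub>R ?f s = indicator {0..t} s *\<^sub>R S (t - s) (sc.g s (?v s))"
    proof (cases "s \<in> {0..t}")
      case True
      then have s: "0 \<le> s" "s \<le> t" by auto
      let ?z = "ou (wshift s \<omega>)"
      \<comment> \<open>The integrals of \<open>z\<close> and the value \<open>ou \<omega>\<close>
        cancel, so the argument and the prefactor of \<open>F\<close> become those of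
        \<open>rand_nonlin\<close> at the shifted path.\<close>
      have e: "noise_factor \<omega> s * exp (ou \<omega> - I \<omega> s) = exp ?z" "1 / noise_factor \<omega> s = exp (ou \<omega> - I \<omega> s) * exp (- ?z)"
        using s by (simp_all add: noise_factor_eq[OF \<omega>] flip: exp_add exp_minus add: inverse_eq_divide[symmetric])
      have "sc.g s (?v s) = (exp (ou \<omega> - I \<omega> s) * exp (- ?z)) *\<^sub>R F (exp ?z *\<^sub>R u s \<omega> (Ttrans \<omega> x))"
        by (simp add: sc.g_def e)
      moreover have "exp (ou \<omega> - I \<omega> t) * exp (int_ou \<omega> s t) = exp (ou \<omega> - I \<omega> s)"
        using int_ou_eq[OF \<omega> s] by (simp flip: exp_add)
      ultimately show ?thesis
        using True s by (simp add: rand_nonlin_def linear_cmul[OF S_linear] mult.assoc[symmetric])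
    qed simp
  qed
  finally show "?v t = S t x + conv (\<lambda>s. sc.g s (?v s)) t" .
qed

text \<open>The random part of the weight of \<open>C_eta_plus\<close> is exactly the factor of the
  transformation, so a deterministic exponential weight remains.\<close>

lemma in_M_iff:
  "x \<in> M \<eta> \<omega> \<longleftrightarrow> (\<exists>C. expbd \<eta> C (\<lambda>t. exp (ou \<omega> - I \<omega> t) *\<^sub>R u t \<omega> (Ttrans \<omega> x)))"
proof -
  let ?U = "\<lambda>t. norm (u t \<omega> (Ttrans \<omega> x))"
  have *: "exp (- \<eta> * t - int_ou \<omega> 0 t) * ?U t \<le> C \<longleftrightarrow> exp (ou \<omega> - I \<omega> t) * ?U t \<le> (exp (ou \<omega>) * C) * exp (\<eta> * t)"
    if "0 \<le> t" for t C
  proof -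
    have "exp (ou \<omega> - I \<omega> t) * ?U t = (exp (ou \<omega>) * exp (\<eta> * t)) * (exp (- \<eta> * t - int_ou \<omega> 0 t) * ?U t)"
      using that int_ou_eq[OF \<omega> order.refl that] I_0[OF \<omega>] by (simp add: mult.assoc[symmetric] flip: exp_add)
    then have "exp (ou \<omega> - I \<omega> t) * ?U t \<le> (exp (ou \<omega>) * exp (\<eta> * t)) * C \<longleftrightarrow> exp (- \<eta> * t - int_ou \<omega> 0 t) * ?U t \<le> C"
      by (simp only: mult_le_cancel_left_pos[OF mult_pos_pos[OF exp_gt_zero exp_gt_zero]])
    then show ?thesis by (simp only: mult_ac)
  qed
  have "x \<in> M \<eta> \<omega> \<longleftrightarrow> (\<exists>C. \<forall>t\<ge>0. exp (- \<eta> * t - int_ou \<omega> 0 t) * ?U t \<le> C)"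
    unfolding in_M Ms_def C_eta_plus_def using u_cont[OF \<omega>] by (auto simp: bdd_above_def)
  also have "\<dots> \<longleftrightarrow> (\<exists>C. \<forall>t\<ge>0. exp (ou \<omega> - I \<omega> t) * ?U t \<le> (exp (ou \<omega>) * C) * exp (\<eta> * t))"
    using * by blast
  also have "\<dots> \<longleftrightarrow> (\<exists>C. \<forall>t\<ge>0. exp (ou \<omega> - I \<omega> t) * ?U t \<le> C * exp (\<eta> * t))"
  proof
    assume "\<exists>C. \<forall>t\<ge>0. exp (ou \<omega> - I \<omega> t) * ?U t \<le> C * exp (\<eta> * t)"
    then obtain C where C: "\<forall>t\<ge>0. exp (ou \<omega> - I \<omega> t) * ?U t \<le> C * exp (\<eta> * t)" by blast
    have *: "exp (ou \<omega>) * (exp (- ou \<omega>) * C) = C" by (simp add: mult.assoc[symmetric] flip: exp_add)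
    then show "\<exists>C. \<forall>t\<ge>0. exp (ou \<omega> - I \<omega> t) * ?U t \<le> (exp (ou \<omega>) * C) * exp (\<eta> * t)"
      using C by (intro exI[of _ "exp (- ou \<omega>) * C"]) (simp only: *)
  qed blast
  finally show ?thesis by (simp add: expbd_def)
qed

lemma M_graph:
  assumes gd: "good L \<eta>"
  shows "M \<eta> \<omega> = {\<xi> + h \<xi> \<omega> | \<xi>. \<xi> \<in> V}"
proof -
  have "x \<in> M \<eta> \<omega> \<longleftrightarrow> (\<exists>w C. sc.mild x w \<and> expbd \<eta> C w)" for x
  proof
    assume "x \<in> M \<eta> \<omega>"
    then show "\<exists>w C. sc.mild x w \<and> expbd \<eta> C w" using transformed_mild[of x] in_M_iff by blast
  next
    assume "\<exists>w C. sc.mild x w \<and> expbd \<eta> C w"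
    then obtain w C where w: "sc.mild x w" "expbd \<eta> C w" by blast
    have "expbd \<eta> C (\<lambda>t. exp (ou \<omega> - I \<omega> t) *\<^sub>R u t \<omega> (Ttrans \<omega> x))"
      using w(2) sc.mild_unique'[OF transformed_mild w(1)] unfolding expbd_def by metis
    then show "x \<in> M \<eta> \<omega>" using in_M_iff by blast
  qed
  then show ?thesis unfolding sc.stable_set_graph[OF gd] h_def by blast
qed

text \<open>Composing with \<open>Q\<close> makes the whole space the parameter space, as needed for
  the reduction to a countable dense set of parameters.\<close>

lemma h_cont: "good L \<eta> \<Longrightarrow> continuous_on UNIV (\<lambda>d. Q d + h (Q d) \<omega>)"
proof -
  assume gd: "good L \<eta>"
  define l where "l = K / (1 - K * L * kap \<eta>)"
  have l: "0 \<le> l" using gd K_nonneg by (simp add: l_def good_def)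
  have "l-lipschitz_on V (\<lambda>\<xi>. sc.vsol \<xi> 0)"
  proof (rule lipschitz_onI[OF _ l])
    fix x y assume "x \<in> V" "y \<in> V"
    from expbd_at_0[OF sc.vsol_lipschitz[OF gd this(2,1)]]
    show "dist (sc.vsol x 0) (sc.vsol y 0) \<le> l * dist x y" by (simp add: l_def dist_norm)
  qed
  then have "continuous_on V (\<lambda>\<xi>. sc.vsol \<xi> 0)" by (rule lipschitz_on_continuous_on)
  then have "continuous_on UNIV (\<lambda>d. sc.vsol (Q d) 0)"
    by (rule continuous_on_compose2) (auto simp: V_def intro: linear_continuous_on[OF Q_bl])
  then show ?thesis unfolding h_def
    by (intro continuous_on_add linear_continuous_on[OF Q_bl] continuous_on_compose2[OF linear_continuous_on[OF Pp_bl]]) auto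
qed

text \<open>The graph is the fixed point set of the continuous map that sends \<open>x\<close> to
  \<open>Q x + h (Q x) \<omega>\<close>.\<close>

lemma M_closed:
  assumes gd: "good L \<eta>" shows "closed (M \<eta> \<omega>)" "M \<eta> \<omega> \<noteq> {}"
proof -
  have PpV: "Pp \<xi> = 0" if "\<xi> \<in> V" for \<xi> using that Pp_Q[of \<xi>] by (simp add: in_V)
  have "x \<in> M \<eta> \<omega> \<longleftrightarrow> Q x + h (Q x) \<omega> = x" for x
  proof
    assume "x \<in> M \<eta> \<omega>"
    then obtain \<xi> where "\<xi> \<in> V" "x = \<xi> + h \<xi> \<omega>" unfolding M_graph[OF gd] by blast
    moreover then have "Q x = \<xi>" by (simp add: h_def linear_add[OF Q_linear] in_V)
    ultimately show "Q x + h (Q x) \<omega> = x" by simp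
  next
    assume "Q x + h (Q x) \<omega> = x"
    moreover have "Q x \<in> V" by (simp add: in_V)
    ultimately show "x \<in> M \<eta> \<omega>" unfolding M_graph[OF gd] by force
  qed
  then have "M \<eta> \<omega> = {x. Q x + h (Q x) \<omega> = x}" by blast
  then show "closed (M \<eta> \<omega>)" using closed_Collect_eq[OF h_cont[OF gd] continuous_on_id] by simp
  have "0 \<in> V" using V_subspace by (rule subspace_0)
  then show "M \<eta> \<omega> \<noteq> {}" unfolding M_graph[OF gd] by blast
qed

end

lemma h_measurable:
  assumes gd: "good L \<eta>" and \<xi>: "\<xi> \<in> V"
  shows "(\<lambda>\<omega>. h \<xi> \<omega>) \<in> borel_measurable N"
proof -
  let ?g = "\<lambda>\<omega>. scaled_equation.g F (noise_factor \<omega>)"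
  have g_eq: "?g \<omega> s X = (1 / noise_factor \<omega> s) *\<^sub>R F (noise_factor \<omega> s *\<^sub>R X)" if "\<omega> \<in> Om" for \<omega> s X
    using scaled_equation.g_def[OF scaled[OF that]] .
  have Fm: "F \<in> borel_measurable borel"
  proof -
    have "norm (F x - F y) \<le> (2 * L) * norm (x - y)" for x y
      using F_lip_P[of x y] F_lip_Q[of x y] norm_triangle_ineq[of "Pp (F x - F y)" "Q (F x - F y)"]
      by (simp add: Pp_plus_Q)
    then have "(2 * L)-lipschitz_on UNIV F" using L by (intro lipschitz_onI) (auto simp: dist_norm)
    then show ?thesis by (intro borel_measurable_continuous_onI lipschitz_on_continuous_on)
  qed
  have c: "(\<lambda>z. noise_factor (fst z) (fst (snd z))) \<in> borel_measurable (N \<Otimes>\<^sub>M ((borel :: real measure) \<Otimes>\<^sub>M (borel :: 'h measure)))"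
  proof -
    have "(\<lambda>z. (fst z, fst (snd z))) \<in> N \<Otimes>\<^sub>M ((borel :: real measure) \<Otimes>\<^sub>M (borel :: 'h measure)) \<rightarrow>\<^sub>M N \<Otimes>\<^sub>M borel" by measurable
    from measurable_compose[OF this noise_factor_measurable] show ?thesis by simp
  qed
  have "(\<lambda>z. indicator {0..} (fst (snd z)) *\<^sub>R ((1 / noise_factor (fst z) (fst (snd z))) *\<^sub>R F (noise_factor (fst z) (fst (snd z)) *\<^sub>R snd (snd z))))
      \<in> borel_measurable (N \<Otimes>\<^sub>M (borel \<Otimes>\<^sub>M borel))"
    using c Fm by measurable
  then have "(\<lambda>(\<omega>, s, X). indicator {0..} s *\<^sub>R ?g \<omega> s X) \<in> borel_measurable (N \<Otimes>\<^sub>M (borel \<Otimes>\<^sub>M borel))"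
    by (rule measurable_cong[THEN iffD1, rotated]) (auto simp: space_pair_measure space_N g_eq)
  note pm = picard_measurable[OF this \<xi>]
  have "(\<lambda>\<omega>. picard (\<lambda>t. S t \<xi>) (?g \<omega>) n 0) \<in> borel_measurable N" for n
  proof -
    have "(\<lambda>\<omega>. (\<omega>, 0::real)) \<in> N \<rightarrow>\<^sub>M N \<Otimes>\<^sub>M borel" by measurable
    from measurable_compose[OF this pm] show ?thesis by simp
  qed
  then have "(\<lambda>\<omega>. scaled_equation.vsol S Pp F (noise_factor \<omega>) \<xi> 0) \<in> borel_measurable N"
    by (rule borel_measurable_LIMSEQ_metric) (auto simp: space_N intro: scaled_equation.vsol_lim[OF scaled gd \<xi>])
  from measurable_compose[OF this borel_measurable_continuous_onI[OF linear_continuous_on[OF Pp_bl]]]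
  show ?thesis by (simp add: h_def)
qed

lemma M_random_set:
  assumes gd: "good L \<eta>" shows "random_set W Om (M \<eta>)"
  unfolding random_set_def
proof (intro conjI ballI allI)
  show "M \<eta> \<omega> \<noteq> {}" "closed (M \<eta> \<omega>)" if "\<omega> \<in> Om" for \<omega> using M_closed[OF that gd] by auto
  fix x
  obtain A :: "'h set" where A: "countable A" "\<forall>X. open X \<longrightarrow> X \<noteq> {} \<longrightarrow> (\<exists>d\<in>A. d \<in> X)"
    using countable_dense_exists by blast
  have eq: "infdist x (M \<eta> \<omega>) = (INF a\<in>A. dist x (Q a + h (Q a) \<omega>))" if "\<omega> \<in> space N" for \<omega>
  proof -
    have \<omega>: "\<omega> \<in> Om" using that by (simp add: space_N)
    have "M \<eta> \<omega> = range (\<lambda>d. Q d + h (Q d) \<omega>)"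
      unfolding M_graph[OF \<omega> gd] V_def by auto
    then show ?thesis using infdist_range_dense[OF h_cont[OF \<omega> gd] A(2)[rule_format]] by simp
  qed
  have "(\<lambda>\<omega>. INF a\<in>A. dist x (Q a + h (Q a) \<omega>)) \<in> borel_measurable N"
  proof (rule borel_measurable_cINF[OF A(1)])
    fix a
    have "Q a \<in> V" by (simp add: in_V)
    from h_measurable[OF gd this] show "(\<lambda>\<omega>. dist x (Q a + h (Q a) \<omega>)) \<in> borel_measurable N" by measurable
  qed (auto intro!: bdd_belowI[of _ 0])
  then show "(\<lambda>\<omega>. infdist x (M \<eta> \<omega>)) \<in> borel_measurable N"
    by (rule measurable_cong[THEN iffD2, rotated]) (rule eq)
qed

lemma spde_random_dynamical_system: "random_dynamical_system W Om (spde_rds u)"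
proof -
  let ?R = "restrict_space borel {0..} :: real measure"
  let ?B = "borel :: 'h measure"
  have um: "(\<lambda>(t, \<omega>, x). u t \<omega> x) \<in> borel_measurable (?R \<Otimes>\<^sub>M (N \<Otimes>\<^sub>M ?B))"
    and u0: "\<And>\<omega> x. \<omega> \<in> Om \<Longrightarrow> u 0 \<omega> x = x"
    and u_add: "\<And>t1 t2 \<omega> x. 0 \<le> t1 \<Longrightarrow> 0 \<le> t2 \<Longrightarrow> \<omega> \<in> Om \<Longrightarrow> u (t1 + t2) \<omega> x = u t2 (wshift t1 \<omega>) (u t1 \<omega> x)"
    using u_rds by (auto simp: random_dynamical_system_def)
  have zm: "(\<lambda>z. ou (wshift (fst z) (fst (snd z)))) \<in> borel_measurable (?R \<Otimes>\<^sub>M (N \<Otimes>\<^sub>M ?B))"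
  proof -
    have "(\<lambda>t. t) \<in> ?R \<rightarrow>\<^sub>M borel" by (intro measurable_restrict_space1) simp
    then have "(\<lambda>z. (fst z, fst (snd z))) \<in> ?R \<Otimes>\<^sub>M (N \<Otimes>\<^sub>M ?B) \<rightarrow>\<^sub>M borel \<Otimes>\<^sub>M N"
      by (intro measurable_Pair) (auto intro: measurable_compose[OF measurable_fst] measurable_compose[OF measurable_snd])
    from measurable_compose[OF this ou_wshift_measurable] show ?thesis by simp
  qed
  have z0: "(\<lambda>z. ou (fst (snd z))) \<in> borel_measurable (?R \<Otimes>\<^sub>M (N \<Otimes>\<^sub>M ?B))"
    by (intro measurable_compose[OF _ ou_measurable]) measurable
  then have "(\<lambda>z. (fst z, fst (snd z), exp (- ou (fst (snd z))) *\<^sub>R snd (snd z))) \<in> ?R \<Otimes>\<^sub>M (N \<Otimes>\<^sub>M ?B) \<rightarrow>\<^sub>M ?R \<Otimes>\<^sub>M (N \<Otimes>\<^sub>M ?B)"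
    by measurable
  from measurable_compose[OF this um]
  have "(\<lambda>z. u (fst z) (fst (snd z)) (exp (- ou (fst (snd z))) *\<^sub>R snd (snd z))) \<in> borel_measurable (?R \<Otimes>\<^sub>M (N \<Otimes>\<^sub>M ?B))"
    by simp
  then have "(\<lambda>z. exp (ou (wshift (fst z) (fst (snd z)))) *\<^sub>R u (fst z) (fst (snd z)) (exp (- ou (fst (snd z))) *\<^sub>R snd (snd z)))
      \<in> borel_measurable (?R \<Otimes>\<^sub>M (N \<Otimes>\<^sub>M ?B))"
    using zm by measurable
  moreover have "spde_rds u 0 \<omega> x = x" if "\<omega> \<in> Om" for \<omega> x
    using that by (simp add: spde_rds_def Ttrans_def Ttrans_inv_def u0 wshift_0 flip: exp_add)
  moreover have "spde_rds u (t1 + t2) \<omega> x = spde_rds u t2 (wshift t1 \<omega>) (spde_rds u t1 \<omega> x)"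
    if "0 \<le> t1" "0 \<le> t2" "\<omega> \<in> Om" for t1 t2 \<omega> x
    using that by (simp add: spde_rds_def Ttrans_def Ttrans_inv_def u_add wshift_wshift add.commute flip: exp_add)
  ultimately show ?thesis
    by (simp add: random_dynamical_system_def spde_rds_def Ttrans_def Ttrans_inv_def split_beta')
qed

text \<open>The growth condition concerns the future of a trajectory, so it survives a shift of
  time. By the cocycle properties of \<open>u\<close> and of \<open>I\<close>, only the constant
  changes.\<close>

lemma M_invariant:
  assumes \<omega>: "\<omega> \<in> Om" and t: "0 \<le> t"
  shows "spde_rds u t \<omega> ` M \<eta> \<omega> \<subseteq> M \<eta> (wshift t \<omega>)"
proof
  fix y assume "y \<in> spde_rds u t \<omega> ` M \<eta> \<omega>"
  then obtain x where x: "x \<in> M \<eta> \<omega>" "y = spde_rds u t \<omega> x" by blast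
  let ?\<omega>' = "wshift t \<omega>"
  have \<omega>': "?\<omega>' \<in> Om" by (rule wshift_Om[OF \<omega>])
  obtain C where C: "expbd \<eta> C (\<lambda>t. exp (ou \<omega> - I \<omega> t) *\<^sub>R u t \<omega> (Ttrans \<omega> x))"
    using x(1) in_M_iff[OF \<omega>] by blast
  have T: "Ttrans ?\<omega>' y = u t \<omega> (Ttrans \<omega> x)"
    by (simp add: x(2) spde_rds_def Ttrans_def Ttrans_inv_def flip: exp_add)
  \<comment> \<open>The ratio of the transformation factors of the shifted path at time
    \<open>s\<close> and of the original path at time \<open>t + s\<close>.\<close>
  define a where "a = exp (ou ?\<omega>' - ou \<omega> + I \<omega> t)"
  have "expbd \<eta> (a * C * exp (\<eta> * t)) (\<lambda>s. exp (ou ?\<omega>' - I ?\<omega>' s) *\<^sub>R u s ?\<omega>' (Ttrans ?\<omega>' y))"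
    unfolding expbd_def
  proof (intro allI impI)
    fix s :: real assume s: "0 \<le> s"
    have "u s ?\<omega>' (Ttrans ?\<omega>' y) = u (t + s) \<omega> (Ttrans \<omega> x)"
      unfolding T using u_rds s t \<omega> by (simp add: random_dynamical_system_def)
    moreover have "exp (ou ?\<omega>' - I ?\<omega>' s) = a * exp (ou \<omega> - I \<omega> (t + s))"
      using I_wshift[OF \<omega> s t] by (simp add: a_def flip: exp_add)
    ultimately have "norm (exp (ou ?\<omega>' - I ?\<omega>' s) *\<^sub>R u s ?\<omega>' (Ttrans ?\<omega>' y)) =
        a * norm (exp (ou \<omega> - I \<omega> (t + s)) *\<^sub>R u (t + s) \<omega> (Ttrans \<omega> x))"
      by (simp add: a_def abs_mult)
    also have "\<dots> \<le> a * (C * exp (\<eta> * (t + s)))"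
      using C s t by (intro mult_left_mono) (auto simp: expbd_def a_def)
    also have "\<dots> = a * C * exp (\<eta> * t) * exp (\<eta> * s)" by (simp add: distrib_left exp_add)
    finally show "norm (exp (ou ?\<omega>' - I ?\<omega>' s) *\<^sub>R u s ?\<omega>' (Ttrans ?\<omega>' y)) \<le> a * C * exp (\<eta> * t) * exp (\<eta> * s)" .
  qed
  then show "y \<in> M \<eta> ?\<omega>'" using in_M_iff[OF \<omega>'] by blast
qed

end

theorem theorem4p2:
  fixes DA :: "'h::{real_inner,banach,second_countable_topology} set"
    and A :: "'h \<Rightarrow> 'h"
    and S :: "real \<Rightarrow> 'h \<Rightarrow> 'h"
    and Pp :: "'h \<Rightarrow> 'h"
    and F :: "'h \<Rightarrow> 'h"
    and W :: "(real \<Rightarrow> real) measure"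
    and Om :: "(real \<Rightarrow> real) set"
    and u :: "real \<Rightarrow> (real \<Rightarrow> real) \<Rightarrow> 'h \<Rightarrow> 'h"
    and \<alpha> \<beta> \<eta> K L :: real
    and k :: nat
  assumes infinite_dim: "\<not> (\<exists>B::'h set. finite B \<and> span B = UNIV)"
    and generator: "generates_semigroup DA A S"
    and dichotomy: "exponential_dichotomy S Pp \<alpha> \<beta> K"
    and F_zero: "F 0 = 0"
    and L_pos: "0 < L"
    and F_lip_plus: "\<And>x y. norm (Pp (F x - F y)) \<le> L * norm (x - y)"
    and F_lip_minus: "\<And>x y. norm (minus_proj Pp (F x - F y)) \<le> L * norm (x - y)"
    and wiener: "wiener_measure W"
    and noise: "noise_set W Om"
    and u_mild: "\<And>\<omega> u0. \<omega> \<in> Om \<Longrightarrow> mild_solution S F \<omega> u0 (\<lambda>t. u t \<omega> u0)"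
    and u_rds: "random_dynamical_system W Om u"
    and k_ge: "1 \<le> k"
    and \<eta>_bounds: "\<beta> < \<eta>" "\<eta> < \<alpha>"
    and F_smooth: "Ck_on k UNIV F"
    and F_bounded_derivs: "0 < \<eta> \<Longrightarrow> bounded_higher_derivs k F"
    and k\<eta>_bounds: "\<beta> < real k * \<eta>" "real k * \<eta> < \<alpha>"
    and gap: "\<And>i. 1 \<le> i \<Longrightarrow> i \<le> k \<Longrightarrow>
                K * L * (1 / (real i * \<eta> - \<beta>) + 1 / (\<alpha> - real i * \<eta>)) < 1"
  shows "Ck_stable_manifold k W Om Pp (spde_rds u) (\<lambda>\<omega>. Ttrans_inv \<omega> ` Ms \<eta> u \<omega>)"
proof -
  \<comment> \<open>The dichotomy estimate at time 0, applied to a nonzero vector, decides the sign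
    of \<open>K\<close>.\<close>
  have K: "0 \<le> K"
  proof -
    obtain x :: 'h where x: "x \<noteq> 0"
      using infinite_dim by (metis finite.emptyI span_empty UNIV_eq_I singletonI)
    have "norm (unstable_flow S Pp 0 (Pp x)) \<le> K * exp (\<alpha> * 0) * norm x"
      using dichotomy unfolding exponential_dichotomy_def by blast
    from order.trans[OF norm_ge_zero this] have "0 \<le> K * norm x" by simp
    then show ?thesis using x by (simp add: zero_le_mult_iff)
  qed
  interpret stochastic_equation S Pp \<alpha> \<beta> K W Om F L u
    using generator dichotomy K wiener noise F_zero L_pos F_lip_plus F_lip_minus u_mild u_rds
    by unfold_locales (auto simp: generates_semigroup_def wiener_measure_def)
  have gd: "good L (real j * \<eta>)" if j: "1 \<le> j" "j \<le> k" for j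
  proof -
    have r: "1 \<le> real j" "real j \<le> real k" using j by auto
    \<comment> \<open>For either sign of \<eta> the multiple lies between \<eta> and
      \<open>real k * \<eta>\<close>, so the bounds on these two place it between \<beta> and
      \<alpha>.\<close>
    have "\<eta> \<le> real j * \<eta> \<and> real j * \<eta> \<le> real k * \<eta> \<or> real k * \<eta> \<le> real j * \<eta> \<and> real j * \<eta> \<le> \<eta>"
    proof (cases "0 \<le> \<eta>")
      case True
      then show ?thesis using mult_right_mono[OF r(1) True] mult_right_mono[OF r(2) True] by simp
    next
      case False
      then have "\<eta> \<le> 0" by simp
      then show ?thesis using mult_right_mono_neg[OF r(1)] mult_right_mono_neg[OF r(2)] by fastforce
    qed
    then show ?thesis unfolding good_def kap_def using gap[OF j] \<eta>_bounds k\<eta>_bounds by auto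
  qed
  have g1: "good L \<eta>" using gd[OF order.refl k_ge] by simp
  obtain D where D: "frechet_derivs_upto k UNIV F D" using F_smooth by (auto simp: Ck_on_def)
  have "Ck_on k (range Q) (\<lambda>\<xi>. h \<xi> \<omega>)" if "\<omega> \<in> Om" for \<omega>
    unfolding h_def V_def[symmetric]
  proof (rule scaled_equation.vsol_Ck[OF scaled[OF that] D k_ge gd])
    fix j assume "0 < \<eta>" "j \<in> {2..k}"
    then show "\<exists>C. \<forall>x vs. length vs = j \<longrightarrow> norm (D j x vs) \<le> C * norms vs"
      using F_bounded_derivs D unfolding bounded_higher_derivs_def by blast
  qed
  moreover have "h \<xi> \<omega> \<in> range Pp" for \<xi> \<omega> by (simp add: h_def)
  moreover have "invariant_random_set W Om (spde_rds u) (M \<eta>)"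
    unfolding invariant_random_set_def
    using spde_random_dynamical_system M_random_set[OF g1] M_invariant by blast
  ultimately have "Ck_stable_manifold k W Om Pp (spde_rds u) (M \<eta>)"
    unfolding Ck_stable_manifold_def using M_graph[OF _ g1, unfolded V_def] by blast
  then show ?thesis by (simp only: M_def[abs_def])
qed

end
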